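(* Let $(M,g,K)$ be a three-dimensional vacuum initial data set which is AF-RT, with ADM mass $m\neq0$. Let $\{D_k\}_{k=1}^\infty$ be closed subsets of $M$ such that the sets $S_k=\partial D_k$ are connected two-dimensional $C^1$ surfaces without boundary which satisfy: (1) $r_k=\inf\{|x|:x\in S_k\}\to\infty$ as $k\to\infty$; (2) $r_k^{-2}\,\mathrm{area}(S_k)$ is bounded as $k\to\infty$; (3) $\mathrm{vol}(D_k\setminus D_k^-)=O(r_k^{3^-})$, where $D_k^-=D_k\cap\{-D_k\}$ and $3^-$ is a number less than $3$. Then the center of mass defined by $$C_I^\alpha=\frac1{16\pi m}\lim_{k\to\infty}\int_{S_k}\Big(R_{ij}-\tfrac12R_gg_{ij}\Big)Y^i_{(\alpha)}\nu_g^j\,d\sigma_g,\qquad\alpha=1,2,3,$$ is independent of the sequence $\{S_k\}$ (i.e. the limit exists and is the same for every such sequence).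
   Context: Repeated indices are summed. $M$ is a $3$-manifold, $g$ a Riemannian metric, $K$ a symmetric two-tensor. $(M,g,K)$ is a vacuum initial data set if $R_g-|K|_g^2+H^2=0$ and $\mathrm{div}_g(K)-dH=0$, where $R_g$ is the scalar curvature and $H=\mathrm{Tr}_gK$. AF: a vacuum initial data set is asymptotically flat (AF) if there are coordinates $\{x\}$ outside a compact set $B_{R_0}$ (identifying $M\setminus B_{R_0}$ with the exterior of a ball in $\mathbb{R}^3$) such that for some $\delta\in(1/2,1]$, $g_{ij}-\delta_{ij}=O(|x|^{-\delta})$, $g_{ij,k}=O(|x|^{-1-\delta})$, $g_{ij,kl}=O(|x|^{-2-\delta})$, $K_{ij}=O(|x|^{-1-\delta})$, $K_{ij,k}=O(|x|^{-2-\delta})$, $K_{ij,kl}=O(|x|^{-3-\delta})$, and similarly for higher derivatives, up to third derivatives of $g$ and second derivatives of $K$. AF-RT: with $f^{odd}(x)=f(x)-f(-x)$, $f^{even}(x)=f(x)+f(-x)$ on $M\setminus B_{R_0}$, $(M,g,K)$ is AF-RT if it is AF and $g^{odd}_{ij}=O(|x|^{-1-\delta})$, $(g^{odd}_{ij})_{,k}=O(|x|^{-2-\delta})$, $K^{even}_{ij}=O(|x|^{-2-\delta})$, $(K^{even}_{ij})_{,k}=O(|x|^{-3-\delta})$, and correspondingly for higher derivatives. The ADM mass is $m=\frac1{16\pi}\lim_{r\to\infty}\int_{|x|=r}(g_{ij,i}-g_{ii,j})\nu_g^jd\sigma_g$. $R_{ij}$ is the Ricci curvature, $Y_{(\alpha)}=(|x|^2\delta^{\alpha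 i}-2x^\alpha x^i)\frac{\partial}{\partial x^i}$, and $\nu_g$, $d\sigma_g$ are the outward unit normal and area form of the surface with respect to $g$. $D_k$ is the (bounded) region enclosed by $S_k$, containing $B_{R_0}$ for large $k$; $-D_k$ is the image of $D_k$ under the antipodal map $x\mapsto-x$ of the coordinate region, with $B_{R_0}$ regarded as symmetric.
   Formalization: In condition (3) the exponent "3^-" is taken to be a number less than 1+2δ (every number less than 3 when δ=1), because for δ<1 the claim fails for exponents between 1+2δ and 3, e.g. for suitably off-centre round balls. *)

theory Defs
  imports "HOL-Analysis.Analysis" "HOL-Library.Landau_Symbols"
begin

section \<open>Calculus on open subsets of Euclidean space\<close>

text \<open>Only meant for open \<open>U\<close>: the derivative is the one at interior points.\<close>

primrec Ck_on ::
  "nat \<Rightarrow> ('a::euclidean_space \<Rightarrow> 'b::real_normed_vector) \<Rightarrow> 'a set \<Rightarrow> bool"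
where
  "Ck_on 0 f U \<longleftrightarrow> continuous_on U f"
| "Ck_on (Suc n) f U \<longleftrightarrow>
     (\<forall>x\<in>U. f differentiable (at x)) \<and>
     (\<forall>v\<in>Basis. Ck_on n (\<lambda>x. frechet_derivative f (at x) v) U)"

definition smooth_on ::
  "('a::euclidean_space \<Rightarrow> 'b::real_normed_vector) \<Rightarrow> 'a set \<Rightarrow> bool"
where "smooth_on f U \<longleftrightarrow> (\<forall>n. Ck_on n f U)"

definition pd :: "'n::finite \<Rightarrow> (real^'n \<Rightarrow> 'b::real_normed_vector) \<Rightarrow> real^'n \<Rightarrow> 'b"
where "pd i f x = frechet_derivative f (at x) (axis i 1)"

primrec pds :: "'n::finite list \<Rightarrow> (real^'n \<Rightarrow> 'b::real_normed_vector) \<Rightarrow> real^'n \<Rightarrow> 'b"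
where
  "pds [] f = f"
| "pds (i # is) f = pd i (pds is f)"


section \<open>Smooth 3-manifolds and tensor fields\<close>

text \<open>The underlying set of the manifold is the whole type \<open>'m\<close>, with its class topology.
  A chart is a pair of its domain and its coordinate map; only the values of the map on the
  domain matter.\<close>

type_synonym 'm chart = "'m set \<times> ('m \<Rightarrow> real^3)"

abbreviation cdom :: "'m chart \<Rightarrow> 'm set" where "cdom c \<equiv> fst c"
abbreviation cmap :: "'m chart \<Rightarrow> 'm \<Rightarrow> real^3" where "cmap c \<equiv> snd c"
abbreviation cimg :: "'m chart \<Rightarrow> (real^3) set" where "cimg c \<equiv> cmap c ` cdom c"
abbreviation cinv :: "'m chart \<Rightarrow> real^3 \<Rightarrow> 'm" where "cinv c \<equiv> inv_into (cdom c) (cmap c)"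

definition is_chart :: "'m::topological_space chart \<Rightarrow> bool"
where "is_chart c \<longleftrightarrow>
  open (cdom c) \<and> open (cimg c) \<and> homeomorphism (cdom c) (cimg c) (cmap c) (cinv c)"

definition transition :: "'m chart \<Rightarrow> 'm chart \<Rightarrow> real^3 \<Rightarrow> real^3"
where "transition c d = cmap d \<circ> cinv c"

text \<open>\<open>A\<close> need not be maximal. The topology on \<open>'m\<close> is Hausdorff and second countable, and
  manifolds are connected.\<close>

definition smooth_3_manifold ::
  "'m::{t2_space, second_countable_topology} chart set \<Rightarrow> bool"
where "smooth_3_manifold A \<longleftrightarrow>
  connected (UNIV :: 'm set) \<and>
  (\<Union>c\<in>A. cdom c) = UNIV \<and>
  (\<forall>c\<in>A. is_chart c) \<and>
  (\<forall>c\<in>A. \<forall>d\<in>A. smooth_on (transition c d) (cmap c ` (cdom c \<inter> cdom d)))"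

text \<open>A covariant two-tensor field is given by its component matrices: \<open>T c x $ i $ j\<close> is the
  \<open>ij\<close> component in the chart \<open>c\<close> at the point with coordinates \<open>x\<close>.\<close>

type_synonym 'm tensor2 = "'m chart \<Rightarrow> real^3 \<Rightarrow> real^3^3"

definition tensor_field :: "'m chart set \<Rightarrow> 'm tensor2 \<Rightarrow> bool"
where "tensor_field A T \<longleftrightarrow>
  (\<forall>c\<in>A. \<forall>d\<in>A. \<forall>x \<in> cmap c ` (cdom c \<inter> cdom d). \<forall>i j.
     T c x $ i $ j =
       (\<Sum>k\<in>UNIV. \<Sum>l\<in>UNIV.
          pd i (transition c d) x $ k * pd j (transition c d) x $ l *
          T d (transition c d x) $ k $ l))"

definition symmetric_two_tensor :: "nat \<Rightarrow> 'm chart set \<Rightarrow> 'm tensor2 \<Rightarrow> bool"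
where "symmetric_two_tensor n A T \<longleftrightarrow>
  tensor_field A T \<and>
  (\<forall>c\<in>A. Ck_on n (T c) (cimg c) \<and> (\<forall>x\<in>cimg c. transpose (T c x) = T c x))"

definition riemannian_metric :: "nat \<Rightarrow> 'm chart set \<Rightarrow> 'm tensor2 \<Rightarrow> bool"
where "riemannian_metric n A g \<longleftrightarrow>
  symmetric_two_tensor n A g \<and>
  (\<forall>c\<in>A. \<forall>x\<in>cimg c. \<forall>v. v \<noteq> 0 \<longrightarrow> v \<bullet> (g c x *v v) > 0)"


section \<open>Curvature and the vacuum constraints in coordinates\<close>

type_synonym field2 = "real^3 \<Rightarrow> real^3^3"

definition ginv :: "field2 \<Rightarrow> field2"
where "ginv G x = matrix_inv (G x)"

text \<open>\<open>christoffel G k i j\<close> is $\Gamma^k_{ij}$.\<close>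

definition christoffel :: "field2 \<Rightarrow> 3 \<Rightarrow> 3 \<Rightarrow> 3 \<Rightarrow> real^3 \<Rightarrow> real"
where "christoffel G k i j x =
  (\<Sum>l\<in>UNIV. ginv G x $ k $ l *
     (pd i (\<lambda>y. G y $ j $ l) x + pd j (\<lambda>y. G y $ i $ l) x - pd l (\<lambda>y. G y $ i $ j) x)) / 2"

definition ricci :: "field2 \<Rightarrow> 3 \<Rightarrow> 3 \<Rightarrow> real^3 \<Rightarrow> real"
where "ricci G i j x =
  (\<Sum>k\<in>UNIV. pd k (christoffel G k i j) x) - (\<Sum>k\<in>UNIV. pd j (christoffel G k i k) x) +
  (\<Sum>k\<in>UNIV. \<Sum>l\<in>UNIV. christoffel G k k l x * christoffel G l i j x) -
  (\<Sum>k\<in>UNIV. \<Sum>l\<in>UNIV. christoffel G k j l x * christoffel G l i k x)"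

definition scalar_curvature :: "field2 \<Rightarrow> real^3 \<Rightarrow> real"
where "scalar_curvature G x = (\<Sum>i\<in>UNIV. \<Sum>j\<in>UNIV. ginv G x $ i $ j * ricci G i j x)"

definition trace_wrt :: "field2 \<Rightarrow> field2 \<Rightarrow> real^3 \<Rightarrow> real"
where "trace_wrt G P x = (\<Sum>i\<in>UNIV. \<Sum>j\<in>UNIV. ginv G x $ i $ j * P x $ i $ j)"

definition normsq_wrt :: "field2 \<Rightarrow> field2 \<Rightarrow> real^3 \<Rightarrow> real"
where "normsq_wrt G P x =
  (\<Sum>i\<in>UNIV. \<Sum>j\<in>UNIV. \<Sum>k\<in>UNIV. \<Sum>l\<in>UNIV.
     ginv G x $ i $ k * ginv G x $ j $ l * P x $ i $ j * P x $ k $ l)"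

text \<open>\<open>cov_deriv G P k i j\<close> is $\nabla_k P_{ij}$.\<close>

definition cov_deriv :: "field2 \<Rightarrow> field2 \<Rightarrow> 3 \<Rightarrow> 3 \<Rightarrow> 3 \<Rightarrow> real^3 \<Rightarrow> real"
where "cov_deriv G P k i j x =
  pd k (\<lambda>y. P y $ i $ j) x
  - (\<Sum>l\<in>UNIV. christoffel G l k i x * P x $ l $ j)
  - (\<Sum>l\<in>UNIV. christoffel G l k j x * P x $ i $ l)"

definition divergence_wrt :: "field2 \<Rightarrow> field2 \<Rightarrow> 3 \<Rightarrow> real^3 \<Rightarrow> real"
where "divergence_wrt G P i x =
  (\<Sum>j\<in>UNIV. \<Sum>k\<in>UNIV. ginv G x $ j $ k * cov_deriv G P j k i x)"

text \<open>The regularity \<open>C\<^sup>3\<close> of the metric and \<open>C\<^sup>2\<close> of the second fundamental form is what the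
  asymptotic conditions below refer to.\<close>

definition vacuum_initial_data ::
  "'m::{t2_space, second_countable_topology} chart set \<Rightarrow> 'm tensor2 \<Rightarrow> 'm tensor2 \<Rightarrow> bool"
where "vacuum_initial_data A g K \<longleftrightarrow>
  smooth_3_manifold A \<and> riemannian_metric 3 A g \<and> symmetric_two_tensor 2 A K \<and>
  (\<forall>c\<in>A. \<forall>x\<in>cimg c.
     scalar_curvature (g c) x - normsq_wrt (g c) (K c) x + (trace_wrt (g c) (K c) x)\<^sup>2 = 0 \<and>
     (\<forall>i. divergence_wrt (g c) (K c) i x - pd i (trace_wrt (g c) (K c)) x = 0))"


section \<open>Asymptotic conditions\<close>

text \<open>The chart \<open>c\<close> is defined outside a compact set, the complement of its domain. That set
  plays the role of a ball, so it is nonempty: otherwise the exterior of a ball in \<open>\<real>\<^sup>3\<close> itself,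
  with a hole, would qualify.\<close>

definition end_chart ::
  "'m::topological_space chart set \<Rightarrow> 'm chart \<Rightarrow> real \<Rightarrow> bool"
where "end_chart A c R0 \<longleftrightarrow>
  c \<in> A \<and> compact (- cdom c) \<and> - cdom c \<noteq> {} \<and> R0 > 0 \<and> cimg c = {x. norm x > R0}"

definition AF_decay :: "real \<Rightarrow> field2 \<Rightarrow> field2 \<Rightarrow> bool"
where "AF_decay \<delta> G P \<longleftrightarrow>
  (\<forall>i j. \<forall>is. length is \<le> 3 \<longrightarrow>
     pds is (\<lambda>x. G x $ i $ j - (if i = j then 1 else 0))
       \<in> O[at_infinity](\<lambda>x. norm x powr (- \<delta> - real (length is)))) \<and>
  (\<forall>i j. \<forall>is. length is \<le> 2 \<longrightarrow>
     pds is (\<lambda>x. P x $ i $ j)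
       \<in> O[at_infinity](\<lambda>x. norm x powr (- 1 - \<delta> - real (length is))))"

definition odd_part :: "(real^3 \<Rightarrow> real) \<Rightarrow> real^3 \<Rightarrow> real"
where "odd_part f x = f x - f (- x)"

definition even_part :: "(real^3 \<Rightarrow> real) \<Rightarrow> real^3 \<Rightarrow> real"
where "even_part f x = f x + f (- x)"

definition RT_decay :: "real \<Rightarrow> field2 \<Rightarrow> field2 \<Rightarrow> bool"
where "RT_decay \<delta> G P \<longleftrightarrow>
  (\<forall>i j. \<forall>is. length is \<le> 3 \<longrightarrow>
     pds is (odd_part (\<lambda>x. G x $ i $ j))
       \<in> O[at_infinity](\<lambda>x. norm x powr (- 1 - \<delta> - real (length is)))) \<and>
  (\<forall>i j. \<forall>is. length is \<le> 2 \<longrightarrow>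
     pds is (even_part (\<lambda>x. P x $ i $ j))
       \<in> O[at_infinity](\<lambda>x. norm x powr (- 2 - \<delta> - real (length is))))"

definition AF ::
  "'m::topological_space chart set \<Rightarrow> 'm chart \<Rightarrow> real \<Rightarrow> real \<Rightarrow> 'm tensor2 \<Rightarrow> 'm tensor2 \<Rightarrow> bool"
where "AF A c R0 \<delta> g K \<longleftrightarrow>
  end_chart A c R0 \<and> 1/2 < \<delta> \<and> \<delta> \<le> 1 \<and> AF_decay \<delta> (g c) (K c)"

definition AF_RT ::
  "'m::topological_space chart set \<Rightarrow> 'm chart \<Rightarrow> real \<Rightarrow> real \<Rightarrow> 'm tensor2 \<Rightarrow> 'm tensor2 \<Rightarrow> bool"
where "AF_RT A c R0 \<delta> g K \<longleftrightarrow> AF A c R0 \<delta> g K \<and> RT_decay \<delta> (g c) (K c)"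


section \<open>Surfaces, area and normals in the asymptotic coordinates\<close>

definition C1_patch :: "(real^3) set \<Rightarrow> (real^2) set \<Rightarrow> (real^2 \<Rightarrow> real^3) \<Rightarrow> bool"
where "C1_patch S U \<phi> \<longleftrightarrow>
  open U \<and> Ck_on 1 \<phi> U \<and> (\<forall>u\<in>U. inj (frechet_derivative \<phi> (at u))) \<and>
  openin (top_of_set S) (\<phi> ` U) \<and> (\<exists>\<psi>. homeomorphism U (\<phi> ` U) \<phi> \<psi>)"

definition C1_surface :: "(real^3) set \<Rightarrow> bool"
where "C1_surface S \<longleftrightarrow> (\<forall>x\<in>S. \<exists>U \<phi>. C1_patch S U \<phi> \<and> x \<in> \<phi> ` U)"

text \<open>Square root of the determinant of the first fundamental form.\<close>

definition area_density :: "field2 \<Rightarrow> (real^2 \<Rightarrow> real^3) \<Rightarrow> real^2 \<Rightarrow> real"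
where "area_density G \<phi> u =
  sqrt (det (\<chi> a b. pd a \<phi> u \<bullet> (G (\<phi> u) *v pd b \<phi> u) :: real^2^2))"

text \<open>The measure $d\sigma_g$ on a closed \<open>C\<^sup>1\<close> surface \<open>S\<close>, extended by zero to a Borel measure
  on \<open>\<real>\<^sup>3\<close>: the unique one given in every local parametrization by the area density.\<close>

definition area_measure :: "field2 \<Rightarrow> (real^3) set \<Rightarrow> (real^3) measure"
where "area_measure G S = (THE \<mu>.
  sets \<mu> = sets borel \<and> emeasure \<mu> (- S) = 0 \<and>
  (\<forall>U \<phi>. C1_patch S U \<phi> \<longrightarrow>
     (\<forall>E\<in>sets borel. emeasure \<mu> (E \<inter> \<phi> ` U) =
        (\<integral>\<^sup>+u\<in>U. indicator E (\<phi> u) * ennreal (area_density G \<phi> u) \<partial>lborel))))"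

definition area :: "field2 \<Rightarrow> (real^3) set \<Rightarrow> real"
where "area G S = measure (area_measure G S) S"

definition surface_integral :: "field2 \<Rightarrow> (real^3) set \<Rightarrow> (real^3 \<Rightarrow> real) \<Rightarrow> real"
where "surface_integral G S f = (LINT x:S|area_measure G S. f x)"

definition tangent_space :: "(real^3) set \<Rightarrow> real^3 \<Rightarrow> (real^3) set"
where "tangent_space S x =
  {frechet_derivative \<phi> (at u) v | U \<phi> u v. C1_patch S U \<phi> \<and> u \<in> U \<and> \<phi> u = x}"

text \<open>The unit normal along \<open>S\<close> with respect to \<open>G\<close> that points out of the region \<open>W\<close>
  bounded by \<open>S\<close>.\<close>

definition outward_normal :: "field2 \<Rightarrow> (real^3) set \<Rightarrow> (real^3) set \<Rightarrow> real^3 \<Rightarrow> real^3"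
where "outward_normal G W S x = (THE \<nu>.
  \<nu> \<bullet> (G x *v \<nu>) = 1 \<and>
  (\<forall>w\<in>tangent_space S x. w \<bullet> (G x *v \<nu>) = 0) \<and>
  (\<exists>\<epsilon>>0. \<forall>t. 0 < t \<and> t < \<epsilon> \<longrightarrow> x + t *\<^sub>R \<nu> \<notin> W))"


section \<open>ADM mass and center of mass\<close>

definition adm_mass :: "field2 \<Rightarrow> real"
where "adm_mass G = 1 / (16 * pi) *
  Lim at_top (\<lambda>r. surface_integral G (sphere 0 r)
    (\<lambda>x. \<Sum>i\<in>UNIV. \<Sum>j\<in>UNIV.
       (pd i (\<lambda>y. G y $ i $ j) x - pd j (\<lambda>y. G y $ i $ i) x) *
       outward_normal G (cball 0 r) (sphere 0 r) x $ j))"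

text \<open>$Y_{(\alpha)}^i = |x|^2\delta^{\alpha i} - 2x^\alpha x^i$.\<close>

definition Y_field :: "3 \<Rightarrow> real^3 \<Rightarrow> real^3"
where "Y_field \<alpha> x = (\<chi> i. (norm x)\<^sup>2 * (if \<alpha> = i then 1 else 0) - 2 * x $ \<alpha> * x $ i)"

definition center_flux :: "field2 \<Rightarrow> (real^3) set \<Rightarrow> (real^3) set \<Rightarrow> 3 \<Rightarrow> real"
where "center_flux G W S \<alpha> = surface_integral G S
  (\<lambda>x. \<Sum>i\<in>UNIV. \<Sum>j\<in>UNIV.
     (ricci G i j x - 1/2 * scalar_curvature G x * G x $ i $ j) *
     Y_field \<alpha> x $ i * outward_normal G W S x $ j)"


section \<open>Admissible exhaustions\<close>

text \<open>Image of \<open>D\<close> under the antipodal map of the end, the compact core being regarded as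
  symmetric (pointwise fixed).\<close>

definition antipodal_image :: "'m chart \<Rightarrow> 'm set \<Rightarrow> 'm set"
where "antipodal_image c D =
  (D - cdom c) \<union> {p \<in> cdom c. \<exists>q \<in> D \<inter> cdom c. cmap c p = - cmap c q}"

text \<open>Riemannian volume of subsets of the end.\<close>

definition end_volume :: "'m chart \<Rightarrow> field2 \<Rightarrow> 'm set \<Rightarrow> real"
where "end_volume c G E = (LINT x : cmap c ` (E \<inter> cdom c) | lborel. sqrt (det (G x)))"

definition coord_region :: "'m chart \<Rightarrow> 'm set \<Rightarrow> (real^3) set"
where "coord_region c D = cmap c ` (D \<inter> cdom c)"

definition coord_boundary :: "'m::topological_space chart \<Rightarrow> 'm set \<Rightarrow> (real^3) set"
where "coord_boundary c D = cmap c ` frontier D"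

definition inner_radius :: "'m::topological_space chart \<Rightarrow> 'm set \<Rightarrow> real"
where "inner_radius c D = (INF x \<in> coord_boundary c D. norm x)"

text \<open>In the last condition \<open>q\<close> is the exponent $3^-$. Since \<open>\<delta> \<le> 1\<close> it is less than 3, and for
  \<open>\<delta> = 1\<close> every number less than 3 is allowed. For \<open>\<delta> < 1\<close> the integrand in the divergence
  theorem is only $O(|x|^{-1-2\delta})$, and a defect of symmetry with exponent above
  $1 + 2\delta$ (for instance, round balls of radius \<open>r\<close> with center at distance
  $r^{1-\epsilon}$, $\epsilon < 2 - 2\delta$, from the origin) can make the flux diverge.\<close>

definition admissible_sequence ::
  "'m::topological_space chart \<Rightarrow> real \<Rightarrow> field2 \<Rightarrow> (nat \<Rightarrow> 'm set) \<Rightarrow> bool"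
where "admissible_sequence c \<delta> G D \<longleftrightarrow>
  (\<forall>k. compact (D k) \<and> frontier (D k) \<subseteq> cdom c \<and>
       connected (frontier (D k)) \<and> C1_surface (coord_boundary c (D k))) \<and>
  (\<forall>\<^sub>F k in sequentially. - cdom c \<subseteq> D k) \<and>
  filterlim (\<lambda>k. inner_radius c (D k)) at_top sequentially \<and>
  Bseq (\<lambda>k. area G (coord_boundary c (D k)) / (inner_radius c (D k))\<^sup>2) \<and>
  (\<exists>q < 1 + 2 * \<delta>.
     (\<lambda>k. end_volume c G (D k - (D k \<inter> antipodal_image c (D k))))
       \<in> O(\<lambda>k. inner_radius c (D k) powr q))"

end

theory Submission
  imports Defs "HOL-Analysis.Analysis"
begin

text \<open>Write $E = \mathrm{Ric} - \frac12 R g$ for the Einstein tensor. The vector density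
$Z^j = \sqrt{\det g}\, g^{jk} E_{ik} Y^i$ turns the flux of $E(Y,\cdot)$ with respect to $g$ into a
Euclidean flux, so that everything rests on the Euclidean divergence of \<open>Z\<close>. To leading order
$Z^j$ is $L_{ij} Y^i$, with \<open>L\<close> the Einstein tensor linearized at the flat metric. Third partial
derivatives commute, hence \<open>L\<close> is divergence free; and \<open>Y\<close> is a conformal Killing field of the flat
metric, so that contracting \<open>L\<close> with the gradient of \<open>Y\<close> only sees the trace of \<open>L\<close>, that is, the
linearized scalar curvature. The Hamiltonian constraint makes the scalar curvature quadratic in the
decaying quantities. Therefore $\mathrm{div}\, Z = O(|x|^{-1-2\delta})$, and the parity conditions
make it odd up to $O(|x|^{-2-2\delta})$ (\<open>flux_div_decay\<close>).

The region enclosed by $S_k$ becomes, after the compact core has been replaced by a ball, a compact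
region $\Omega_k$ of Euclidean space with boundary $S_k$ (\<open>region_structure\<close>); cutting \<open>Z\<close> off near
that ball gives a global \<open>C\<^sup>1\<close> field \<open>X\<close>. By the divergence theorem (\<open>divergence_theorem\<close>) the flux
is the integral of $f = \mathrm{div}\, X$ over $\Omega_k$. On $\Omega_k \cap -\Omega_k$ only the even
part of \<open>f\<close> counts. It is integrable, because $2 + 2\delta > 3$, so that these integrals converge to
$\frac12 \int (f(x) + f(-x))\, dx$. The rest of $\Omega_k$ lies outside the ball of radius $r_k$
and has volume $O(r_k^q)$ with $q < 1 + 2\delta$; its contribution is
$O(r_k^{q - 1 - 2\delta})$ and tends to zero (\<open>symmetric_exhaustion_limit\<close>). The limit does not
mention the surfaces.

The divergence theorem is needed for boundaries that are only \<open>C\<^sup>1\<close> and are given by local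
parametrizations. Near a boundary point the surface stays outside a double cone around its normal.
For every direction \<open>b\<close> in that cone the region is locally a flow box of \<open>b\<close> cut off by the surface,
and the fundamental theorem of calculus along \<open>b\<close> gives the boundary integral; the coordinate
directions are differences of such directions. The same double cone decides on which side the region
lies, identifies the outward normal, and makes transition maps differentiable, which is what the
existence of the area measure requires.\<close>

section \<open>Partial derivatives, decay and parity at infinity\<close>

lemma pd_eqI: "(f has_derivative f') (at x) \<Longrightarrow> pd i f x = f' (axis i 1)"
  unfolding pd_def using frechet_derivative_at by metis

lemma has_derivative_cong_open:
  assumes "open U" "x \<in> U" "\<And>y. y \<in> U \<Longrightarrow> f y = g y"
  shows "(f has_derivative D) (at x) \<longleftrightarrow> (g has_derivative D) (at x)"
  using assms by (metis has_derivative_transform_within_open)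

lemma pd_cong_open:
  assumes "open U" "x \<in> U" "\<And>y. y \<in> U \<Longrightarrow> f y = g y"
  shows "pd i f x = pd i g x"
proof -
  have "(f has_derivative D) (at x) \<longleftrightarrow> (g has_derivative D) (at x)" for D
    by (rule has_derivative_cong_open) (use assms in auto)
  then show ?thesis unfolding pd_def frechet_derivative_def by simp
qed

lemma differentiable_cong_open:
  assumes "open U" "x \<in> U" "\<And>y. y \<in> U \<Longrightarrow> f y = g y"
  shows "f differentiable (at x) \<longleftrightarrow> g differentiable (at x)"
proof -
  have "(f has_derivative D) (at x) \<longleftrightarrow> (g has_derivative D) (at x)" for D
    by (rule has_derivative_cong_open) (use assms in auto)
  then show ?thesis unfolding differentiable_def by simp
qed

text \<open>Partial derivatives determine the derivative, so that calculus can be done on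
components only.\<close>

lemma has_derivative_pd:
  fixes f :: "real^'n \<Rightarrow> real"
  assumes "f differentiable (at x)"
  shows "(f has_derivative (\<lambda>h. \<Sum>i\<in>UNIV. h $ i * pd i f x)) (at x)"
proof -
  from assms obtain D where D: "(f has_derivative D) (at x)"
    unfolding differentiable_def by auto
  interpret D: bounded_linear D using D by (rule has_derivative_bounded_linear)
  have "D = (\<lambda>h. \<Sum>i\<in>UNIV. h $ i * pd i f x)"
  proof
    fix h :: "real^'n"
    have "D h = D (\<Sum>i\<in>UNIV. h $ i *\<^sub>R axis i 1)"
      using basis_expansion[of h] by (simp add: scalar_mult_eq_scaleR)
    also have "\<dots> = (\<Sum>i\<in>UNIV. h $ i * D (axis i 1))"
      by (simp add: D.sum D.scaleR)
    finally show "D h = (\<Sum>i\<in>UNIV. h $ i * pd i f x)" by (simp add: pd_eqI[OF D])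
  qed
  with D show ?thesis by simp
qed

lemma pd_add: "f differentiable at x \<Longrightarrow> g differentiable at x \<Longrightarrow> pd i (\<lambda>x. f x + g x) x = pd i f x + pd i g x"
  unfolding pd_def by (subst frechet_derivative_at[symmetric, OF has_derivative_add])
    (auto simp: frechet_derivative_works[symmetric])

lemma pd_mult:
  fixes f g :: "real^'n \<Rightarrow> real"
  shows "f differentiable at x \<Longrightarrow> g differentiable at x \<Longrightarrow>
    pd i (\<lambda>x. f x * g x) x = f x * pd i g x + pd i f x * g x"
  unfolding pd_def by (subst frechet_derivative_at[symmetric, OF has_derivative_mult])
    (auto simp: frechet_derivative_works[symmetric])

lemma pd_const: "pd i (\<lambda>x. c) x = 0"
  by (rule pd_eqI[where f'="\<lambda>_. 0", THEN trans]) auto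

lemma pd_cmult:
  fixes f :: "real^'n \<Rightarrow> real"
  shows "f differentiable at x \<Longrightarrow> pd i (\<lambda>x. c * f x) x = c * pd i f x"
  by (subst pd_mult) (auto simp: pd_const)

lemma pd_diff:
  fixes f g :: "real^'n \<Rightarrow> real"
  shows "f differentiable at x \<Longrightarrow> g differentiable at x \<Longrightarrow> pd i (\<lambda>x. f x - g x) x = pd i f x - pd i g x"
  unfolding pd_def by (subst frechet_derivative_at[symmetric, OF has_derivative_diff])
    (auto simp: frechet_derivative_works[symmetric])

lemma differentiable_finite_sum:
  "finite A \<Longrightarrow> (\<And>a. a \<in> A \<Longrightarrow> f a differentiable at x) \<Longrightarrow> (\<lambda>x. \<Sum>a\<in>A. f a x) differentiable at x"
  by (induction A rule: finite_induct) auto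

lemma pd_sum:
  fixes f :: "'a \<Rightarrow> real^'n \<Rightarrow> real"
  shows "finite A \<Longrightarrow> (\<And>a. a \<in> A \<Longrightarrow> f a differentiable at x) \<Longrightarrow>
    pd i (\<lambda>x. \<Sum>a\<in>A. f a x) x = (\<Sum>a\<in>A. pd i (f a) x)"
  by (induction A rule: finite_induct) (auto simp: pd_const pd_add differentiable_finite_sum)

lemma pd_coord: "pd i (\<lambda>x. x $ j) x = (if i = j then 1 else 0 :: real)"
  using pd_eqI[OF bounded_linear_imp_has_derivative[OF bounded_linear_vec_nth[of j]], of i x]
  by (simp add: axis_def)

lemma pd_reflect:
  fixes f :: "real^'n \<Rightarrow> real"
  assumes "f differentiable at (-x)"
  shows "(\<lambda>x. f (-x)) differentiable at x" "pd i (\<lambda>x. f (-x)) x = - pd i f (-x)"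
proof -
  have "((\<lambda>x. f (-x)) has_derivative (\<lambda>h. \<Sum>i\<in>UNIV. (-h) $ i * pd i f (-x))) (at x)"
    by (rule has_derivative_compose[OF has_derivative_minus[OF has_derivative_ident] has_derivative_pd[OF assms], unfolded o_def])
  then show "(\<lambda>x. f (-x)) differentiable at x" "pd i (\<lambda>x. f (-x)) x = - pd i f (-x)"
    by (auto simp: differentiable_def pd_eqI axis_def if_distrib[of "\<lambda>x. x * _"] cong: if_cong)
       (simp add: sum_negf)
qed

definition exterior :: "real \<Rightarrow> (real^3) set" where "exterior R = {x. norm x > R}"

lemma open_exterior: "open (exterior R)" unfolding exterior_def by (intro open_Collect_less continuous_intros)
lemma minus_exterior [simp]: "-x \<in> exterior R \<longleftrightarrow> x \<in> exterior R" by (simp add: exterior_def)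

lemma eventually_exterior: "eventually (\<lambda>x. x \<in> exterior R) at_infinity"
  unfolding eventually_at_infinity exterior_def by (rule exI[of _ "R+1"]) auto

text \<open>Decay of order at least \<open>a\<close>; negative \<open>a\<close> allows growth.\<close>

definition bounded_order :: "real \<Rightarrow> (real^3 \<Rightarrow> real) \<Rightarrow> bool" where
  "bounded_order a f \<longleftrightarrow> f \<in> O[at_infinity](\<lambda>x. norm x powr (- a))"

lemma bounded_order_add: "bounded_order a f \<Longrightarrow> bounded_order a g \<Longrightarrow> bounded_order a (\<lambda>x. f x + g x)"
  unfolding bounded_order_def by (rule sum_in_bigo)

lemma bounded_order_cmult: "bounded_order a f \<Longrightarrow> bounded_order a (\<lambda>x. c * f x)"
  unfolding bounded_order_def by simp

lemma bounded_order_mult: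
  assumes "bounded_order a f" "bounded_order b g" shows "bounded_order (a + b) (\<lambda>x. f x * g x)"
proof -
  have "(\<lambda>x. f x * g x) \<in> O[at_infinity](\<lambda>x. norm x powr (- a) * norm x powr (- b))"
    using assms unfolding bounded_order_def by (rule landau_o.big_mult)
  then show ?thesis by (simp add: bounded_order_def powr_add[symmetric])
qed

lemma bounded_order_mono:
  assumes "bounded_order a f" "b \<le> a" shows "bounded_order b f"
proof -
  have "(\<lambda>x. norm (x::real^3) powr (- a)) \<in> O[at_infinity](\<lambda>x. norm x powr (- b))"
  proof (rule bigoI[where c=1])
    have "\<forall>\<^sub>F x in at_infinity. norm (x::real^3) \<ge> 1"
      unfolding eventually_at_infinity by blast
    then show "\<forall>\<^sub>F x in at_infinity. norm (norm (x::real^3) powr - a) \<le> 1 * norm (norm x powr - b)"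
      by eventually_elim (use assms in \<open>auto intro: powr_mono\<close>)
  qed
  with assms(1) show ?thesis unfolding bounded_order_def by (rule landau_o.big_trans)
qed

lemma bounded_order_reflect: assumes "bounded_order a f" shows "bounded_order a (\<lambda>x. f (-x))"
proof -
  have "filterlim uminus at_infinity (at_infinity :: (real^3) filter)"
    by (simp add: filterlim_at_infinity_conv_norm_at_top filterlim_norm_at_top)
  with assms show ?thesis unfolding bounded_order_def
    using landau_o.big.compose[of f at_infinity "\<lambda>x. norm x powr - a" uminus at_infinity] by simp
qed

lemma bounded_order_cong: "(\<And>x. x \<in> exterior R \<Longrightarrow> f x = g x) \<Longrightarrow> bounded_order a f \<longleftrightarrow> bounded_order a g"
  unfolding bounded_order_def by (rule landau_o.big.in_cong[OF eventually_mono[OF eventually_exterior[of R]]])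

lemma bounded_order_0 [simp]: "bounded_order a (\<lambda>x. 0)" by (simp add: bounded_order_def)

text \<open>\<open>s = 1\<close> stands for even and \<open>s = -1\<close> for odd functions: the part of the wrong parity
decays one order faster.\<close>

definition decay0 :: "real \<Rightarrow> real \<Rightarrow> real \<Rightarrow> (real^3 \<Rightarrow> real) \<Rightarrow> bool" where
  "decay0 R a s f \<longleftrightarrow> continuous_on (exterior R) f \<and> bounded_order a f \<and> bounded_order (a + 1) (\<lambda>x. f x - s * f (- x))"

text \<open>The class \<open>decay R n a s\<close> of \<open>C\<^sup>n\<close> functions outside the ball of radius \<open>R\<close> is
graded: products add the orders and multiply the parities, and a derivative raises the order by one
and flips the parity. All asymptotic estimates for curvature reduce to these rules.\<close>

primrec decay :: "real \<Rightarrow> nat \<Rightarrow> real \<Rightarrow> real \<Rightarrow> (real^3 \<Rightarrow> real) \<Rightarrow> bool" where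
  "decay R 0 a s f \<longleftrightarrow> decay0 R a s f"
| "decay R (Suc n) a s f \<longleftrightarrow> decay0 R a s f \<and> (\<forall>x\<in>exterior R. f differentiable at x) \<and>
     (\<forall>i. decay R n (a + 1) (- s) (pd i f))"

lemma decay_0_iff:
  "decay R 0 a s f \<longleftrightarrow> continuous_on (exterior R) f \<and> bounded_order a f \<and> bounded_order (a + 1) (\<lambda>x. f x - s * f (- x))"
  by (simp add: decay0_def)

lemma decay_Suc_iff:
  "decay R (Suc n) a s f \<longleftrightarrow> decay R 0 a s f \<and> (\<forall>x\<in>exterior R. f differentiable at x) \<and>
     (\<forall>i. decay R n (a + 1) (- s) (pd i f))"
  by simp

declare decay.simps [simp del]
lemmas decay_iffs = decay_0_iff decay_Suc_iff

lemma decay_0I: "decay R n a s f \<Longrightarrow> decay R 0 a s f"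
  by (cases n) (auto simp: decay_iffs)

lemma decay_le: "m \<le> n \<Longrightarrow> decay R n a s f \<Longrightarrow> decay R m a s f"
proof (induction n arbitrary: m a s f)
  case (Suc n)
  show ?case
  proof (cases m)
    case 0 then show ?thesis using Suc.prems decay_0I by blast
  next
    case (Suc m')
    then show ?thesis using Suc.prems Suc.IH by (auto simp: decay_Suc_iff)
  qed
qed simp

lemma decay_differentiable: "decay R (Suc n) a s f \<Longrightarrow> x \<in> exterior R \<Longrightarrow> f differentiable at x"
  by (simp add: decay_iffs)

lemma decay_pd: "decay R (Suc n) a s f \<Longrightarrow> b = a + 1 \<Longrightarrow> t = - s \<Longrightarrow> decay R n b t (pd i f)"
  by (simp add: decay_iffs)

lemma decay_bounded_order: "decay R n a s f \<Longrightarrow> bounded_order a f"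
  using decay_0I decay_0_iff by blast

lemma decay_cong: "(\<And>x. x \<in> exterior R \<Longrightarrow> f x = g x) \<Longrightarrow> decay R n a s f \<longleftrightarrow> decay R n a s g"
proof (induction n arbitrary: a s f g)
  case 0
  have "continuous_on (exterior R) f \<longleftrightarrow> continuous_on (exterior R) g"
    by (rule continuous_on_cong) (auto simp: 0)
  moreover have "bounded_order a f \<longleftrightarrow> bounded_order a g" by (rule bounded_order_cong[where R=R]) (auto simp: 0)
  moreover have "bounded_order (a + 1) (\<lambda>x. f x - s * f (- x)) \<longleftrightarrow> bounded_order (a + 1) (\<lambda>x. g x - s * g (- x))"
    by (rule bounded_order_cong[where R=R]) (auto simp: 0)
  ultimately show ?case by (simp add: decay_iffs)
next
  case (Suc n)
  have *: "decay R 0 a s f = decay R 0 a s g"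
  proof -
    have "continuous_on (exterior R) f \<longleftrightarrow> continuous_on (exterior R) g"
      by (rule continuous_on_cong) (auto simp: Suc)
    moreover have "bounded_order a f \<longleftrightarrow> bounded_order a g" by (rule bounded_order_cong[where R=R]) (auto simp: Suc)
    moreover have "bounded_order (a + 1) (\<lambda>x. f x - s * f (- x)) \<longleftrightarrow> bounded_order (a + 1) (\<lambda>x. g x - s * g (- x))"
      by (rule bounded_order_cong[where R=R]) (auto simp: Suc)
    ultimately show ?thesis by (simp add: decay_iffs)
  qed
  have "(f differentiable at x) = (g differentiable at x)" if "x \<in> exterior R" for x
    by (rule differentiable_cong_open[OF open_exterior that Suc.prems])
  moreover have "decay R n (a + 1) (- s) (pd i f) = decay R n (a + 1) (- s) (pd i g)" for i
    by (rule Suc.IH) (rule pd_cong_open[OF open_exterior _ Suc.prems])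
  ultimately show ?case using * by (simp add: decay_Suc_iff)
qed

lemma decay0_mono: "decay R 0 a s f \<Longrightarrow> b \<le> a \<Longrightarrow> decay R 0 b s f"
  unfolding decay_0_iff by (auto intro: bounded_order_mono[of a] bounded_order_mono[of "a+1"])

lemma decay_mono: "decay R n a s f \<Longrightarrow> b \<le> a \<Longrightarrow> decay R n b s f"
proof (induction n arbitrary: a b s f)
  case 0 then show ?case by (rule decay0_mono)
next
  case (Suc n)
  have "decay R n (b + 1) (- s) (pd i f)" for i
    by (rule Suc.IH[of "a+1"]) (use Suc.prems in \<open>auto simp: decay_Suc_iff\<close>)
  then show ?case using Suc.prems decay0_mono[of R a s f b] by (simp add: decay_Suc_iff)
qed

lemma decay0_add: "decay R 0 a s f \<Longrightarrow> decay R 0 a s g \<Longrightarrow> decay R 0 a s (\<lambda>x. f x + g x)"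
  using bounded_order_add[of "a+1" "\<lambda>x. f x - s * f (-x)" "\<lambda>x. g x - s * g (-x)"]
  by (auto simp: decay_iffs algebra_simps intro!: continuous_intros bounded_order_add)

lemma decay_add: "decay R n a s f \<Longrightarrow> decay R n a s g \<Longrightarrow> decay R n a s (\<lambda>x. f x + g x)"
proof (induction n arbitrary: a s f g)
  case 0 then show ?case by (rule decay0_add)
next
  case (Suc n)
  have "decay R n (a + 1) (- s) (pd i (\<lambda>x. f x + g x))" for i
    by (rule decay_cong[THEN iffD2, OF pd_add Suc.IH]) (use Suc.prems in \<open>auto simp: decay_iffs\<close>)
  then show ?case using Suc.prems decay0_add by (auto simp: decay_Suc_iff)
qed

lemma decay0_cmult: "decay R 0 a s f \<Longrightarrow> decay R 0 a s (\<lambda>x. c * f x)"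
  using bounded_order_cmult[of "a+1" "\<lambda>x. f x - s * f (-x)" c]
  by (auto simp: decay_iffs algebra_simps intro!: continuous_intros bounded_order_cmult)

lemma decay_cmult: "decay R n a s f \<Longrightarrow> decay R n a s (\<lambda>x. c * f x)"
proof (induction n arbitrary: a s f)
  case 0 then show ?case by (rule decay0_cmult)
next
  case (Suc n)
  have "decay R n (a + 1) (- s) (pd i (\<lambda>x. c * f x))" for i
    by (rule decay_cong[THEN iffD2, OF pd_cmult Suc.IH]) (use Suc.prems in \<open>auto simp: decay_iffs\<close>)
  then show ?case using Suc.prems decay0_cmult by (auto simp: decay_Suc_iff intro!: derivative_intros)
qed

lemma decay_diff: "decay R n a s f \<Longrightarrow> decay R n a s g \<Longrightarrow> decay R n a s (\<lambda>x. f x - g x)"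
  using decay_add[OF _ decay_cmult[of R n a s g "-1"]] by simp

lemma decay_uminus: "decay R n a s f \<Longrightarrow> decay R n a s (\<lambda>x. - f x)"
  using decay_cmult[of R n a s f "-1"] by simp

lemma decay_zero: "decay R n a s (\<lambda>x. 0)"
  by (induction n arbitrary: a s) (auto simp: decay_iffs pd_const[abs_def])

lemma decay_sum: "(\<And>i. i \<in> A \<Longrightarrow> decay R n a s (f i)) \<Longrightarrow> decay R n a s (\<lambda>x. \<Sum>i\<in>A. f i x)"
  by (induction A rule: infinite_finite_induct) (auto intro: decay_zero decay_add)

text \<open>The defect of parity of a product is
$fg - st\, f^- g^- = (f - s f^-) g + s f^- (g - t g^-)$, where $f^-(x) = f(-x)$.\<close>

lemma decay0_mult:
  assumes "decay R 0 a s f" "decay R 0 b t g"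
  shows "decay R 0 (a + b) (s * t) (\<lambda>x. f x * g x)"
proof -
  have "bounded_order (a + 1 + b) (\<lambda>x. (f x - s * f (-x)) * g x)"
    using assms by (intro bounded_order_mult) (auto simp: decay_iffs)
  moreover have "bounded_order (a + (b + 1)) (\<lambda>x. s * (f (-x) * (g x - t * g (-x))))"
    using assms by (intro bounded_order_cmult bounded_order_mult bounded_order_reflect) (auto simp: decay_iffs)
  ultimately have "bounded_order (a + b + 1) (\<lambda>x. (f x - s * f (-x)) * g x + s * (f (-x) * (g x - t * g (-x))))"
    by (intro bounded_order_add) (simp_all add: add_ac)
  then have "bounded_order (a + b + 1) (\<lambda>x. f x * g x - s * t * (f (- x) * g (- x)))" by (simp add: algebra_simps)
  then show ?thesis using assms by (auto simp: decay_iffs intro!: continuous_intros bounded_order_mult)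
qed

text \<open>Induction with the Leibniz rule, both of whose summands lie in the class expected for a
derivative of the product.\<close>

lemma decay_mult':
  "decay R n a s f \<Longrightarrow> decay R n b t g \<Longrightarrow> decay R n (a + b) (s * t) (\<lambda>x. f x * g x)"
proof (induction n arbitrary: a s f b t g)
  case 0 then show ?case by (rule decay0_mult)
next
  case (Suc n)
  have f: "decay R n a s f" and g: "decay R n b t g" using Suc.prems decay_le[of n "Suc n"] by auto
  have "decay R n (a + b + 1) (- (s * t)) (pd i (\<lambda>x. f x * g x))" for i
  proof (rule decay_cong[THEN iffD2, OF pd_mult decay_add])
    have "decay R n (a + (b + 1)) (s * - t) (\<lambda>x. f x * pd i g x)"
      by (rule Suc.IH) (use f Suc.prems in \<open>auto simp: decay_iffs\<close>)
    then show "decay R n (a + b + 1) (- (s * t)) (\<lambda>x. f x * pd i g x)" by (simp add: add_ac)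
    have "decay R n (a + 1 + b) (- s * t) (\<lambda>x. pd i f x * g x)"
      by (rule Suc.IH) (use g Suc.prems in \<open>auto simp: decay_iffs\<close>)
    then show "decay R n (a + b + 1) (- (s * t)) (\<lambda>x. pd i f x * g x)" by (simp add: add_ac)
  qed (use Suc.prems in \<open>auto simp: decay_iffs\<close>)
  then show ?case using Suc.prems decay0_mult by (auto simp: decay_Suc_iff intro!: derivative_intros)
qed

lemma decay_mult:
  "decay R n a s f \<Longrightarrow> decay R n b t g \<Longrightarrow> c = a + b \<Longrightarrow> p = s * t \<Longrightarrow> decay R n c p (\<lambda>x. f x * g x)"
  using decay_mult' by blast

lemma decay_const: "decay R n 0 1 (\<lambda>x. c)"
proof (cases n)
  case 0
  have "bounded_order 0 (\<lambda>x. c)" by (auto simp: bounded_order_def intro!: bigoI[where c="\<bar>c\<bar>"] eventually_mono[OF eventually_exterior[of 0]] simp: exterior_def)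
  with 0 show ?thesis by (auto simp: decay_iffs)
next
  case (Suc m)
  have "bounded_order 0 (\<lambda>x. c)" by (auto simp: bounded_order_def intro!: bigoI[where c="\<bar>c\<bar>"] eventually_mono[OF eventually_exterior[of 0]] simp: exterior_def)
  with Suc show ?thesis by (auto simp: decay_iffs pd_const[abs_def] decay_zero)
qed

lemma decay_coord: "decay R n (-1) (-1) (\<lambda>x. x $ j)"
proof -
  have "bounded_order (-1) (\<lambda>x. x $ j)"
    unfolding bounded_order_def by (rule bigoI[where c=1]) (auto intro!: always_eventually component_le_norm_cart)
  then have 0: "decay R 0 (-1) (-1) (\<lambda>x. x $ j)" by (auto simp: decay_iffs intro!: continuous_intros)
  have "decay R m 0 1 (pd i (\<lambda>x. x $ j))" for m i
    unfolding pd_coord[abs_def] by (rule decay_const)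
  with 0 show ?thesis
    by (cases n) (auto simp: decay_Suc_iff intro!: bounded_linear_imp_differentiable bounded_linear_vec_nth)
qed

lemma bounded_order_tendsto_0: assumes "bounded_order a f" "a > 0" shows "(f \<longlongrightarrow> 0) at_infinity"
proof -
  have 0: "((\<lambda>x::real^3. norm x powr (-a)) \<longlongrightarrow> 0) at_infinity"
    using assms(2) by (intro tendsto_neg_powr filterlim_norm_at_top) auto
  obtain c where "\<forall>\<^sub>F x in at_infinity. norm (f x) \<le> c * norm (norm x powr (-a))"
    using assms(1) unfolding bounded_order_def by (auto elim: landau_o.bigE)
  then show ?thesis
    by (rule Lim_null_comparison) (use tendsto_mult_right_zero[OF 0, of c] in simp)
qed

section \<open>Quotients, square roots and the symmetry of second derivatives\<close>

lemma bounded_order_le: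
  assumes "\<forall>\<^sub>F x in at_infinity. \<bar>f x\<bar> \<le> c * \<bar>g x\<bar>" "bounded_order a g" shows "bounded_order a f"
proof -
  have "f \<in> O[at_infinity](g)" by (rule bigoI[where c=c]) (use assms(1) in simp)
  then show ?thesis using assms(2) unfolding bounded_order_def by (rule landau_o.big_trans)
qed

text \<open>The derivative of $1/v$ is $- v^{-2} \partial v$, a product of a derivative of \<open>v\<close> with
functions that the induction hypothesis covers.\<close>

lemma decay_inverse:
  assumes "decay R n 0 1 v" "\<And>x. x \<in> exterior R \<Longrightarrow> v x \<noteq> 0" "bounded_order 0 (\<lambda>x. 1 / v x)"
  shows "decay R n 0 1 (\<lambda>x. 1 / v x)"
  using assms(1)
proof (induction n)
  case 0
  have *: "bounded_order (0 + 1 + 0 + 0) (\<lambda>x. (-1) * (v x - 1 * v (-x)) * (1 / v x) * (1 / v (-x)))"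
    using 0 assms(3) by (intro bounded_order_mult bounded_order_cmult) (auto simp: decay_0_iff intro: bounded_order_reflect[of 0 "\<lambda>x. 1 / v x"])
  have "bounded_order 1 (\<lambda>x. 1 / v x - 1 * (1 / v (-x)))"
    by (rule bounded_order_cong[where R=R, THEN iffD1, OF _ *[simplified]]) (use assms(2) in \<open>auto simp: field_simps\<close>)
  with 0 assms show ?case by (auto simp: decay_0_iff intro!: continuous_on_divide continuous_on_const)
next
  case (Suc n)
  have IH: "decay R n 0 1 (\<lambda>x. 1 / v x)" using Suc decay_le[of n "Suc n"] by auto
  have d0: "decay R 0 0 1 (\<lambda>x. 1 / v x)" using IH decay_0I by blast
  have diff: "v differentiable at x" if "x \<in> exterior R" for x
    using decay_differentiable[OF Suc.prems that] .
  have hd: "((\<lambda>x. 1 / v x) has_derivative (\<lambda>h. - (\<Sum>i\<in>UNIV. h $ i * pd i v x) / (v x * v x))) (at x)" if "x \<in> exterior R" for x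
  proof -
    have "((\<lambda>x. 1 / v x) has_derivative (\<lambda>h. - 1 * (inverse (v x) * (\<Sum>i\<in>UNIV. h $ i * pd i v x) * inverse (v x)) + 0 / v x)) (at x)"
      by (rule has_derivative_divide[OF has_derivative_const has_derivative_pd[OF diff[OF that]] assms(2)[OF that]])
    then show ?thesis by (simp add: field_simps)
  qed
  have pdv: "pd i (\<lambda>x. 1 / v x) x = (-1) * (pd i v x * ((1 / v x) * (1 / v x)))" if "x \<in> exterior R" for i x
    unfolding pd_eqI[OF hd[OF that]] using assms(2)[OF that]
    by (simp add: axis_def if_distrib[of "\<lambda>x. x * _"] cong: if_cong)
  have "decay R n (0 + 1) (- 1) (pd i (\<lambda>x. 1 / v x))" for i
    by (rule decay_cong[THEN iffD2, OF pdv], assumption, rule decay_cmult, rule decay_mult[OF decay_pd[OF Suc.prems] decay_mult[OF IH IH]]) auto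
  then show ?case using d0 hd by (auto simp: decay_Suc_iff differentiable_def)
qed

text \<open>As for quotients, using $\partial \sqrt v = \frac12 \partial v \, v^{-1} \sqrt v$, which
contains no function other than \<open>v\<close>, its inverse and its root.\<close>

lemma decay_sqrt:
  assumes "decay R n 0 1 v" "\<And>x. x \<in> exterior R \<Longrightarrow> v x > 0" "bounded_order 0 (\<lambda>x. 1 / v x)"
  shows "decay R n 0 1 (\<lambda>x. sqrt (v x))"
  using assms(1)
proof (induction n)
  case 0
  have ev: "\<forall>\<^sub>F x in at_infinity. v x > 0 \<and> v (-x) > 0"
    using eventually_exterior[of R] by eventually_elim (auto intro: assms(2))
  have le: "sqrt y \<le> 1 + y" if "y > 0" for y :: real
    by (rule real_le_lsqrt) (use that in \<open>auto simp: power2_eq_square algebra_simps\<close>)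
  have b: "bounded_order 0 v" using 0 by (simp add: decay_0_iff)
  have one: "bounded_order 0 (\<lambda>x. 1)" using decay_bounded_order[OF decay_const[of R 0 1]] .
  have "bounded_order 0 (\<lambda>x. sqrt (v x))"
    by (rule bounded_order_le[where c=1, OF _ bounded_order_add[OF one b]], rule eventually_mono[OF ev]) (use le in auto)
  moreover have isq: "bounded_order 0 (\<lambda>x. 1 / sqrt (v x))"
  proof (rule bounded_order_le[where c=1, OF _ bounded_order_add[OF one assms(3)]], rule eventually_mono[OF ev], elim conjE)
    fix x assume "v x > 0"
    then show "\<bar>1 / sqrt (v x)\<bar> \<le> 1 * \<bar>1 + 1 / v x\<bar>" using le[of "1 / v x"] by (simp add: real_sqrt_divide)
  qed
  moreover have "bounded_order 1 (\<lambda>x. sqrt (v x) - 1 * sqrt (v (-x)))"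
  proof (rule bounded_order_le[where c=1])
    show "bounded_order 1 (\<lambda>x. (v x - 1 * v (-x)) * (1 / sqrt (v x)))"
      using bounded_order_mult[of 1 "\<lambda>x. v x - 1 * v (-x)" 0, OF _ isq] 0 by (simp add: decay_0_iff)
    show "\<forall>\<^sub>F x in at_infinity. \<bar>sqrt (v x) - 1 * sqrt (v (- x))\<bar> \<le> 1 * \<bar>(v x - 1 * v (- x)) * (1 / sqrt (v x))\<bar>"
      using ev
    proof eventually_elim
      case (elim x)
      let ?p = "sqrt (v x)" and ?q = "sqrt (v (-x))"
      have "v x - v (-x) = (?p - ?q) * (?p + ?q)" using elim by (simp add: algebra_simps)
      moreover have "?p > 0" "?q > 0" using elim by auto
      ultimately have "\<bar>v x - v (-x)\<bar> = \<bar>?p - ?q\<bar> * (?p + ?q)" by (simp add: abs_mult)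
      moreover have "\<bar>?p - ?q\<bar> * ?p \<le> \<bar>?p - ?q\<bar> * (?p + ?q)"
        using \<open>?q > 0\<close> by (intro mult_left_mono) auto
      ultimately show ?case using \<open>?p > 0\<close> by (simp add: abs_mult field_simps)
    qed
  qed
  ultimately show ?case using 0 assms(2) by (auto simp: decay_0_iff intro!: continuous_on_real_sqrt)
next
  case (Suc n)
  have IH: "decay R n 0 1 (\<lambda>x. sqrt (v x))" and vn: "decay R n 0 1 v" using Suc decay_le[of n "Suc n"] by auto
  have inv: "decay R n 0 1 (\<lambda>x. 1 / v x)" by (rule decay_inverse[OF vn _ assms(3)]) (use assms(2) in force)
  have d0: "decay R 0 0 1 (\<lambda>x. sqrt (v x))" using IH decay_0I by blast
  have diff: "v differentiable at x" if "x \<in> exterior R" for x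
    using decay_differentiable[OF Suc.prems that] .
  have hd: "((\<lambda>x. sqrt (v x)) has_derivative (\<lambda>h. (\<Sum>i\<in>UNIV. h $ i * pd i v x) * (inverse (sqrt (v x)) / 2))) (at x)" if "x \<in> exterior R" for x
    using DERIV_real_sqrt[OF assms(2)[OF that]] has_derivative_pd[OF diff[OF that]]
    by (rule DERIV_compose_FDERIV)
  have pdv: "pd i (\<lambda>x. sqrt (v x)) x = (1/2) * (pd i v x * ((1 / v x) * sqrt (v x)))" if "x \<in> exterior R" for i x
  proof -
    have "inverse (sqrt (v x)) = (1 / v x) * sqrt (v x)" using assms(2)[OF that]
      by (simp add: field_simps)
    then show ?thesis
    unfolding pd_eqI[OF hd[OF that]]
    by (simp add: axis_def if_distrib[of "\<lambda>x. x * _"] cong: if_cong)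
  qed
  have "decay R n (0 + 1) (- 1) (pd i (\<lambda>x. sqrt (v x)))" for i
    by (rule decay_cong[THEN iffD2, OF pdv], assumption, rule decay_cmult, rule decay_mult[OF decay_pd[OF Suc.prems] decay_mult[OF inv IH]]) auto
  then show ?case using d0 hd by (auto simp: decay_Suc_iff differentiable_def)
qed

lemma pds_append: "pds (is @ js) f = pds is (pds js f)"
  by (induction "is") auto

lemma pds_cong_open:
  assumes "open U" "\<And>y. y \<in> U \<Longrightarrow> f y = g y" "x \<in> U"
  shows "pds is f x = pds is g x"
  using assms(3)
proof (induction "is" arbitrary: x)
  case Nil then show ?case using assms(2) by simp
next
  case (Cons i "is")
  show ?case unfolding pds.simps by (rule pd_cong_open[OF assms(1) Cons.prems Cons.IH])
qed

lemma Ck_on_cong_open: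
  "open U \<Longrightarrow> (\<And>x. x \<in> U \<Longrightarrow> f x = g x) \<Longrightarrow> Ck_on n f U \<longleftrightarrow> Ck_on n g U"
proof (induction n arbitrary: f g)
  case 0 then show ?case by (auto intro: continuous_on_cong[THEN iffD1])
next
  case (Suc n)
  have hd: "(f has_derivative D) (at x) \<longleftrightarrow> (g has_derivative D) (at x)" if "x \<in> U" for x D
    by (rule has_derivative_cong_open) (use Suc that in auto)
  have "Ck_on n (\<lambda>x. frechet_derivative f (at x) v) U \<longleftrightarrow> Ck_on n (\<lambda>x. frechet_derivative g (at x) v) U" for v
    by (rule Suc.IH) (use Suc.prems hd in \<open>auto simp: frechet_derivative_def\<close>)
  then show ?case using hd by (auto simp: differentiable_def)
qed

lemma Ck_on_linear:
  "open U \<Longrightarrow> bounded_linear L \<Longrightarrow> Ck_on n f U \<Longrightarrow> Ck_on n (\<lambda>x. L (f x)) U"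
proof (induction n arbitrary: f)
  case 0 then show ?case by (auto intro: bounded_linear.continuous_on)
next
  case (Suc n)
  have hd: "((\<lambda>x. L (f x)) has_derivative (\<lambda>h. L (frechet_derivative f (at x) h))) (at x)" if "x \<in> U" for x
    using Suc.prems that by (intro bounded_linear.has_derivative[OF Suc.prems(2)]) (auto simp: frechet_derivative_works[symmetric])
  have "Ck_on n (\<lambda>x. L (frechet_derivative f (at x) v)) U" if "v \<in> Basis" for v
    using Suc that by auto
  moreover have "Ck_on n (\<lambda>x. L (frechet_derivative f (at x) v)) U \<longleftrightarrow>
     Ck_on n (\<lambda>x. frechet_derivative (\<lambda>x. L (f x)) (at x) v) U" for v
    by (rule Ck_on_cong_open[OF Suc.prems(1)]) (use frechet_derivative_at[OF hd] in metis)
  ultimately show ?case using hd by (auto simp: differentiable_def)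
qed

lemma Ck_on_continuous: "Ck_on n f U \<Longrightarrow> continuous_on U f"
  by (cases n) (auto intro!: continuous_at_imp_continuous_on differentiable_imp_continuous_within)

text \<open>Brings the asymptotic conditions, which are stated for iterated partial derivatives of a
function and of its odd or even part, into the recursive form of \<open>decay\<close>.\<close>

lemma decay_from_pds:
  fixes a :: real
  assumes "Ck_on n f (exterior R)"
    "\<And>is. length is \<le> n \<Longrightarrow> bounded_order (a + length is) (pds is f)"
    "\<And>is. length is \<le> n \<Longrightarrow> bounded_order (a + 1 + length is) (pds is (\<lambda>x. f x - s * f (-x)))"
  shows "decay R n a s f"
  using assms
proof (induction n arbitrary: a s f)
  case 0
  then show ?case using 0(2)[of "[]"] 0(3)[of "[]"] by (auto simp: decay_0_iff)
next
  case (Suc n)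
  have d0: "decay R 0 a s f" using Suc.prems(2)[of "[]"] Suc.prems(3)[of "[]"] Ck_on_continuous[OF Suc.prems(1)]
    by (auto simp: decay_0_iff)
  have diff: "f differentiable at x" if "x \<in> exterior R" for x using Suc.prems(1) that by auto
  have "decay R n (a + 1) (- s) (pd i f)" for i
  proof (rule Suc.IH)
    show "Ck_on n (pd i f) (exterior R)" using Suc.prems(1) unfolding pd_def[abs_def] by simp
    fix "is" :: "3 list" assume l: "length is \<le> n"
    show "bounded_order (a + 1 + length is) (pds is (pd i f))"
      using Suc.prems(2)[of "is @ [i]"] l by (simp add: pds_append add_ac)
    have *: "pd i (\<lambda>x. f x - s * f (-x)) x = pd i f x - - s * pd i f (-x)" if "x \<in> exterior R" for x
      using diff[OF that] diff[of "-x"] that pd_reflect[of f x]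
      by (subst pd_diff) (auto simp: pd_cmult)
    have "pds is (pd i (\<lambda>x. f x - s * f (-x))) x = pds is (\<lambda>x. pd i f x - - s * pd i f (-x)) x" if "x \<in> exterior R" for x
      by (rule pds_cong_open[OF open_exterior * that])
    then have "bounded_order (a + 1 + 1 + length is) (pds is (pd i (\<lambda>x. f x - s * f (-x)))) \<longleftrightarrow>
       bounded_order (a + 1 + 1 + length is) (pds is (\<lambda>x. pd i f x - - s * pd i f (-x)))"
      by (rule bounded_order_cong)
    then show "bounded_order (a + 1 + 1 + length is) (pds is (\<lambda>x. pd i f x - - s * pd i f (-x)))"
      using Suc.prems(3)[of "is @ [i]"] l by (simp add: pds_append add_ac)
  qed
  then show ?case using d0 diff by (simp add: decay_Suc_iff)
qed

lemma pd_line: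
  fixes f :: "real^'n \<Rightarrow> real"
  assumes "f differentiable at (x + t *\<^sub>R axis i 1)"
  shows "((\<lambda>t. f (x + t *\<^sub>R axis i 1)) has_real_derivative pd i f (x + t *\<^sub>R axis i 1)) (at t)"
proof -
  have "((\<lambda>t. x + t *\<^sub>R axis i 1) has_derivative (\<lambda>h. h *\<^sub>R axis i 1)) (at t)"
    by (auto intro!: derivative_eq_intros)
  from has_derivative_compose[OF this has_derivative_pd[OF assms]]
  have "((\<lambda>t. f (x + t *\<^sub>R axis i 1)) has_derivative (\<lambda>h. h * pd i f (x + t *\<^sub>R axis i 1))) (at t)"
    by (simp add: axis_def if_distrib[of "\<lambda>x. _ * x"] if_distrib[of "\<lambda>x. x * _"] cong: if_cong)
  then show ?thesis by (simp add: has_field_derivative_def mult_commute_abs)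
qed

text \<open>The mean value theorem, applied first in direction \<open>i\<close> and then in direction \<open>j\<close>.\<close>

lemma second_difference_mvt:
  fixes f :: "real^'n \<Rightarrow> real"
  assumes "h > 0" "cball x (2*h) \<subseteq> U"
    "\<And>y. y \<in> U \<Longrightarrow> f differentiable at y" "\<And>y. y \<in> U \<Longrightarrow> pd i f differentiable at y"
  shows "\<exists>y \<in> cball x (2*h). f (x + h *\<^sub>R axis i 1 + h *\<^sub>R axis j 1) - f (x + h *\<^sub>R axis i 1)
     - f (x + h *\<^sub>R axis j 1) + f x = h * h * pd j (pd i f) y"
proof -
  have inb: "x + s *\<^sub>R axis i 1 + t *\<^sub>R axis j 1 \<in> cball x (2*h)" if "0 \<le> s" "s \<le> h" "0 \<le> t" "t \<le> h" for s t
  proof -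
    have "norm (s *\<^sub>R axis i 1 + t *\<^sub>R axis j (1::real)) \<le> s + t"
      using norm_triangle_ineq[of "s *\<^sub>R axis i (1::real)" "t *\<^sub>R axis j 1"] that by simp
    moreover have "s + t \<le> 2 * h" using that by simp
    moreover have "x + s *\<^sub>R axis i 1 + t *\<^sub>R axis j 1 - x = s *\<^sub>R axis i 1 + t *\<^sub>R axis j (1::real)" by simp
    ultimately show ?thesis by (metis mem_cball dist_commute dist_norm order_trans)
  qed
  define p where "p s = f ((x + h *\<^sub>R axis j 1) + s *\<^sub>R axis i 1) - f (x + s *\<^sub>R axis i 1)" for s
  have "(p has_real_derivative pd i f ((x + h *\<^sub>R axis j 1) + s *\<^sub>R axis i 1) - pd i f (x + s *\<^sub>R axis i 1)) (at s)"
    if "0 \<le> s" "s \<le> h" for s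
    unfolding p_def
    by (rule DERIV_diff; intro pd_line assms(3) subsetD[OF assms(2)])
      (use inb[of s h] inb[of s 0] that assms(1) in \<open>auto simp: add_ac\<close>)
  from MVT2[OF assms(1) this] obtain s where s: "0 < s" "s < h" and ps:
    "p h - p 0 = h * (pd i f ((x + h *\<^sub>R axis j 1) + s *\<^sub>R axis i 1) - pd i f (x + s *\<^sub>R axis i 1))"
    by auto
  define q where "q t = pd i f ((x + s *\<^sub>R axis i 1) + t *\<^sub>R axis j 1)" for t
  have "(q has_real_derivative pd j (pd i f) ((x + s *\<^sub>R axis i 1) + t *\<^sub>R axis j 1)) (at t)"
    if "0 \<le> t" "t \<le> h" for t
    unfolding q_def
    by (intro pd_line assms(4) subsetD[OF assms(2)])
      (use inb[of s t] s that in auto)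
  from MVT2[OF assms(1) this] obtain t where t: "0 < t" "t < h" and qt:
    "q h - q 0 = h * pd j (pd i f) ((x + s *\<^sub>R axis i 1) + t *\<^sub>R axis j 1)"
    by auto
  have "p h - p 0 = h * h * pd j (pd i f) ((x + s *\<^sub>R axis i 1) + t *\<^sub>R axis j 1)"
    unfolding ps using qt by (simp add: q_def add_ac mult.assoc)
  moreover have "p h - p 0 = f (x + h *\<^sub>R axis i 1 + h *\<^sub>R axis j 1) - f (x + h *\<^sub>R axis i 1)
     - f (x + h *\<^sub>R axis j 1) + f x" by (simp add: p_def add_ac)
  ultimately show ?thesis using inb[of s t] s t by auto
qed

text \<open>Both mixed derivatives are limits of the same second difference quotient, by
\<open>second_difference_mvt\<close> for the two orders of the directions.\<close>

lemma pd_commute: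
  fixes f :: "real^'n \<Rightarrow> real"
  assumes "open U" "x \<in> U" "\<And>y. y \<in> U \<Longrightarrow> f differentiable at y"
    "\<And>y k. y \<in> U \<Longrightarrow> pd k f differentiable at y"
    "\<And>k l. continuous_on U (pd k (pd l f))"
  shows "pd i (pd j f) x = pd j (pd i f) x"
proof (rule ccontr)
  assume ne: "\<not> ?thesis"
  define e where "e = \<bar>pd i (pd j f) x - pd j (pd i f) x\<bar> / 2"
  have e: "e > 0" using ne by (simp add: e_def)
  have "isCont (pd i (pd j f)) x" "isCont (pd j (pd i f)) x"
    using assms(1,2,5) by (auto simp: continuous_on_eq_continuous_at)
  then obtain d1 d2 where d: "d1 > 0" "d2 > 0" "\<forall>y. dist y x < d1 \<longrightarrow> dist (pd i (pd j f) y) (pd i (pd j f) x) < e"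
      "\<forall>y. dist y x < d2 \<longrightarrow> dist (pd j (pd i f) y) (pd j (pd i f) x) < e"
    using e unfolding continuous_at_eps_delta by blast
  obtain d3 where d3: "d3 > 0" "cball x d3 \<subseteq> U" using assms(1,2) open_contains_cball by blast
  \<comment> \<open>Small enough for both second differences to lie in the neighborhoods on which the mixed derivatives vary by less than half of their gap.\<close>
  define h where "h = min d3 (min d1 d2) / 4"
  have h: "h > 0" "2 * h < d1" "2 * h < d2" "2 * h \<le> d3" using d d3 by (auto simp: h_def)
  have U: "cball x (2*h) \<subseteq> U" using d3 h by (meson subset_cball order_trans)
  obtain y where y: "y \<in> cball x (2*h)" "f (x + h *\<^sub>R axis i 1 + h *\<^sub>R axis j 1) - f (x + h *\<^sub>R axis i 1)
     - f (x + h *\<^sub>R axis j 1) + f x = h * h * pd j (pd i f) y"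
    using second_difference_mvt[OF h(1) U assms(3,4)] by blast
  obtain z where z: "z \<in> cball x (2*h)" "f (x + h *\<^sub>R axis j 1 + h *\<^sub>R axis i 1) - f (x + h *\<^sub>R axis j 1)
     - f (x + h *\<^sub>R axis i 1) + f x = h * h * pd i (pd j f) z"
    using second_difference_mvt[OF h(1) U assms(3,4)] by blast
  have "h * h * pd j (pd i f) y = h * h * pd i (pd j f) z"
    unfolding y(2)[symmetric] z(2)[symmetric] by (simp add: algebra_simps)
  then have "pd j (pd i f) y = pd i (pd j f) z" using h by simp
  moreover have "dist (pd i (pd j f) z) (pd i (pd j f) x) < e" "dist (pd j (pd i f) y) (pd j (pd i f) x) < e"
    using d(3)[rule_format, of z] d(4)[rule_format, of y] y(1) z(1) h by (auto simp: dist_commute)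
  ultimately have "dist (pd i (pd j f) x) (pd j (pd i f) x) < e + e"
    by (metis dist_commute dist_triangle_less_add)
  then show False by (simp add: e_def dist_real_def)
qed

section \<open>Curvature near infinity\<close>

text \<open>Even functions that approach a constant with order \<open>a\<close>, like the components of the
metric.\<close>

definition near :: "real \<Rightarrow> nat \<Rightarrow> real \<Rightarrow> real \<Rightarrow> (real^3 \<Rightarrow> real) \<Rightarrow> bool" where
  "near R n a c f \<longleftrightarrow> decay R n a 1 (\<lambda>x. f x - c)"

lemma near_decay: "near R n a c f \<Longrightarrow> a \<ge> 0 \<Longrightarrow> decay R n 0 1 f"
  using decay_add[OF decay_mono[of R n a 1 "\<lambda>x. f x - c" 0] decay_const[of R n c]]
  by (auto simp: near_def)

lemma near_add: "near R n a c f \<Longrightarrow> near R n a d g \<Longrightarrow> near R n a (c + d) (\<lambda>x. f x + g x)"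
  using decay_add[of R n a 1 "\<lambda>x. f x - c" "\<lambda>x. g x - d"] by (simp add: near_def algebra_simps)

lemma near_diff: "near R n a c f \<Longrightarrow> near R n a d g \<Longrightarrow> near R n a (c - d) (\<lambda>x. f x - g x)"
  using decay_diff[of R n a 1 "\<lambda>x. f x - c" "\<lambda>x. g x - d"] by (simp add: near_def algebra_simps)

lemma near_mult:
  assumes "near R n a c f" "near R n a d g" "a \<ge> 0"
  shows "near R n a (c * d) (\<lambda>x. f x * g x)"
proof -
  have "decay R n a 1 (\<lambda>x. (f x - c) * g x)"
    by (rule decay_mult[of R n a 1 _ 0 1]) (use assms near_decay in \<open>auto simp: near_def\<close>)
  then have "decay R n a 1 (\<lambda>x. (f x - c) * g x + c * (g x - d))"
    using assms by (intro decay_add decay_cmult) (auto simp: near_def)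
  then show ?thesis by (simp add: near_def algebra_simps)
qed

lemma near_tendsto: "near R n a c f \<Longrightarrow> a > 0 \<Longrightarrow> (f \<longlongrightarrow> c) at_infinity"
  using bounded_order_tendsto_0[OF decay_bounded_order, of R n a 1 "\<lambda>x. f x - c"] tendsto_add[OF _ tendsto_const[of c], of "\<lambda>x. f x - c" 0 at_infinity]
  by (simp add: near_def)

lemma tendsto_bounded_order_0:
  assumes "(f \<longlongrightarrow> c) at_infinity" shows "bounded_order 0 f"
proof (rule bounded_order_le[OF _ decay_bounded_order[OF decay_const[of 0 0 1]]])
  have "\<forall>\<^sub>F x in at_infinity. dist (f x) c < 1" using assms by (rule tendstoD) simp
  then show "\<forall>\<^sub>F x in at_infinity. \<bar>f x\<bar> \<le> (1 + \<bar>c\<bar>) * \<bar>1\<bar>"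
    by eventually_elim (auto simp: dist_real_def)
qed

lemma near_bounded_order_inverse:
  assumes "near R n a c f" "a > 0" "c > 0"
  shows "bounded_order 0 (\<lambda>x. 1 / f x)"
proof -
  have "((\<lambda>x. 1 / f x) \<longlongrightarrow> 1 / c) at_infinity"
    using near_tendsto[OF assms(1,2)] assms(3) by (intro tendsto_intros) auto
  then show ?thesis by (rule tendsto_bounded_order_0)
qed

lemma near_inverse:
  assumes "near R n a 1 f" "a > 0" "\<And>x. x \<in> exterior R \<Longrightarrow> f x > 0"
  shows "near R n a 1 (\<lambda>x. 1 / f x)"
proof -
  have i: "decay R n 0 1 (\<lambda>x. 1 / f x)"
    using assms by (intro decay_inverse near_decay[OF assms(1)] near_bounded_order_inverse[OF assms(1,2)]) (auto simp: less_imp_neq[symmetric])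
  have "decay R n a 1 (\<lambda>x. - ((f x - 1) * (1 / f x)))"
    by (rule decay_uminus, rule decay_mult[OF _ i]) (use assms(1) in \<open>auto simp: near_def\<close>)
  then show ?thesis unfolding near_def
    by (rule decay_cong[THEN iffD1, rotated]) (use assms(3) in \<open>force simp: field_simps\<close>)
qed

lemma near_sqrt:
  assumes "near R n a 1 f" "a > 0" "\<And>x. x \<in> exterior R \<Longrightarrow> f x > 0"
  shows "near R n a 1 (\<lambda>x. sqrt (f x))"
proof -
  have s: "decay R n 0 1 (\<lambda>x. sqrt (f x))"
    using assms by (intro decay_sqrt near_decay[OF assms(1)] near_bounded_order_inverse[OF assms(1,2)]) auto
  have "((\<lambda>x. 1 / (sqrt (f x) + 1)) \<longlongrightarrow> 1 / (sqrt 1 + 1)) at_infinity"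
    using near_tendsto[OF assms(1,2)] by (intro tendsto_intros) auto
  then have "bounded_order 0 (\<lambda>x. 1 / (sqrt (f x) + 1))" by (rule tendsto_bounded_order_0)
  moreover have pos: "sqrt (f x) + 1 > 0" if "x \<in> exterior R" for x
    using assms(3)[OF that] by (simp add: add_pos_pos)
  ultimately have "decay R n 0 1 (\<lambda>x. 1 / (sqrt (f x) + 1))"
    by (intro decay_inverse decay_add[OF s decay_const]) (auto simp: less_imp_neq[symmetric])
  then have "decay R n a 1 (\<lambda>x. (f x - 1) * (1 / (sqrt (f x) + 1)))"
    by (rule decay_mult[rotated]) (use assms(1) in \<open>auto simp: near_def\<close>)
  moreover have "(f x - 1) * (1 / (sqrt (f x) + 1)) = sqrt (f x) - 1" if "x \<in> exterior R" for x
    using pos[OF that] assms(3)[OF that] by (simp add: field_simps)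
  ultimately show ?thesis unfolding near_def
    by (rule decay_cong[THEN iffD1, rotated])
qed

definition adjugate3 :: "real^3^3 \<Rightarrow> real^3^3" where
  "adjugate3 A = (\<chi> i j. A $ (j + 1) $ (i + 1) * A $ (j + 2) $ (i + 2) - A $ (j + 1) $ (i + 2) * A $ (j + 2) $ (i + 1))"

lemma add_index3: "(1::3) + 1 = 2" "(2::3) + 1 = 3" "(3::3) + 1 = 1" "(1::3) + 2 = 3" "(2::3) + 2 = 1" "(3::3) + 2 = 2"
  by simp_all

lemma adjugate3_mult: "A ** adjugate3 A = det A *\<^sub>R mat 1" "adjugate3 A ** A = det A *\<^sub>R mat 1"
  unfolding vec_eq_iff forall_3 matrix_matrix_mult_def mat_def adjugate3_def
  by (simp_all only: vec_lambda_beta sum_3 add_index3 vector_scaleR_component det_3) (simp_all add: algebra_simps)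

lemma matrix_inv_eqI:
  fixes A B :: "real^'n^'n"
  assumes "A ** B = mat 1" shows "matrix_inv A = B"
proof -
  have BA: "B ** A = mat 1" using assms by (simp add: matrix_left_right_inverse)
  have "\<exists>A'. A ** A' = mat 1 \<and> A' ** A = mat 1" using assms BA by blast
  then have "A ** matrix_inv A = mat 1 \<and> matrix_inv A ** A = mat 1"
    unfolding matrix_inv_def by (rule someI_ex)
  then show ?thesis using BA by (metis matrix_mul_assoc matrix_mul_lid matrix_mul_rid)
qed

lemma matrix_mult_scaleR_right: "A ** (c *\<^sub>R B) = c *\<^sub>R (A ** B :: real^'k^'n)"
  by (simp add: matrix_matrix_mult_def vec_eq_iff sum_distrib_left mult_ac)

text \<open>The adjugate makes the inverse metric a rational function of the metric, to which the decay
calculus applies.\<close>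

lemma matrix_inv_adjugate3: "det A \<noteq> 0 \<Longrightarrow> matrix_inv A = (1 / det A) *\<^sub>R adjugate3 A"
  by (rule matrix_inv_eqI) (simp add: adjugate3_mult matrix_mult_scaleR_right)

lemma positive_definite_det_nonzero:
  fixes A :: "real^'n^'n"
  assumes "\<And>v. v \<noteq> 0 \<Longrightarrow> v \<bullet> (A *v v) > 0"
  shows "det A \<noteq> 0"
proof -
  have "v = 0" if "A *v v = 0" for v using assms[of v] that by fastforce
  then show ?thesis
    using matrix_left_invertible_ker[of A] invertible_left_inverse invertible_det_nz by blast
qed

text \<open>The determinant cannot change sign on the segment from the identity matrix to \<open>A\<close>, which
consists of positive definite matrices.\<close>

lemma positive_definite_det_pos:
  fixes A :: "real^'n^'n"
  assumes pos: "\<And>v. v \<noteq> 0 \<Longrightarrow> v \<bullet> (A *v v) > 0"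
  shows "det A > 0"
proof (rule ccontr)
  assume "\<not> det A > 0"
  define p where "p t = det ((1 - t) *\<^sub>R mat 1 + t *\<^sub>R A)" for t :: real
  have "continuous_on {0..1} p" unfolding p_def det_def
    by (auto intro!: continuous_intros)
  moreover have "p 1 \<le> 0" "0 \<le> p 0" using \<open>\<not> det A > 0\<close> by (auto simp: p_def)
  ultimately obtain t where t: "0 \<le> t" "t \<le> 1" "p t = 0" using IVT2'[of p 1 0 0] by auto
  have "v \<bullet> (((1 - t) *\<^sub>R mat 1 + t *\<^sub>R A) *v v) > 0" if "v \<noteq> 0" for v
  proof -
    have eq: "v \<bullet> (((1 - t) *\<^sub>R mat 1 + t *\<^sub>R A) *v v) = (1 - t) * (v \<bullet> v) + t * (v \<bullet> (A *v v))"
      by (simp add: matrix_vector_mult_add_rdistrib scaleR_matrix_vector_assoc[symmetric] inner_add_right)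
    have "v \<bullet> v > 0" "v \<bullet> (A *v v) > 0" using that pos by auto
    then show ?thesis unfolding eq using t by (cases "t = 0") (auto intro: add_nonneg_pos)
  qed
  then show False using positive_definite_det_nonzero t(3) unfolding p_def by blast
qed

text \<open>An initial data set in the coordinates of the end: a metric that is even and a second
fundamental form that is odd to leading order, related by the Hamiltonian constraint.\<close>

locale asymptotic_data =
  fixes G P :: field2 and R \<delta> :: real
  assumes delta: "\<delta> > 1/2"
    and G_sym: "x \<in> exterior R \<Longrightarrow> G x $ i $ j = G x $ j $ i"
    and G_pos: "x \<in> exterior R \<Longrightarrow> v \<noteq> 0 \<Longrightarrow> v \<bullet> (G x *v v) > 0"
    and G_near: "near R 3 \<delta> (if i = j then 1 else 0) (\<lambda>x. G x $ i $ j)"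
    and P_decay: "decay R 0 (1 + \<delta>) (-1) (\<lambda>x. P x $ i $ j)"
    and hamiltonian: "x \<in> exterior R \<Longrightarrow> scalar_curvature G x - normsq_wrt G P x + (trace_wrt G P x)\<^sup>2 = 0"
begin

text \<open>Separate forms for diagonal and off-diagonal entries, to be used as rules.\<close>

lemma G_near': "i = j \<Longrightarrow> near R 3 \<delta> 1 (\<lambda>x. G x $ i $ j)" "i \<noteq> j \<Longrightarrow> near R 3 \<delta> 0 (\<lambda>x. G x $ i $ j)"
  using G_near[of i j] by simp_all

lemma det_near: "near R 3 \<delta> 1 (\<lambda>x. det (G x))"
proof -
  have "near R 3 \<delta> (1 * 1 * 1 + 0 * 0 * 0 + 0 * 0 * 0 - 1 * 0 * 0 - 0 * 0 * 1 - 0 * 1 * 0) (\<lambda>x. det (G x))"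
    unfolding det_3 by (intro near_add near_diff near_mult G_near') (use delta in auto)
  then show ?thesis by simp
qed

lemma adjugate_near: "near R 3 \<delta> (if i = j then 1 else 0) (\<lambda>x. adjugate3 (G x) $ i $ j)"
proof -
  let ?d = "\<lambda>i j::3. if i = j then 1 else 0 :: real"
  have "near R 3 \<delta> (?d (j+1) (i+1) * ?d (j+2) (i+2) - ?d (j+1) (i+2) * ?d (j+2) (i+1)) (\<lambda>x. adjugate3 (G x) $ i $ j)"
    unfolding adjugate3_def vec_lambda_beta by (intro near_diff near_mult G_near) (use delta in auto)
  moreover have "(?d (j+1) (i+1) * ?d (j+2) (i+2) - ?d (j+1) (i+2) * ?d (j+2) (i+1)) = ?d i j"
    using exhaust_3[of i] exhaust_3[of j] by auto
  ultimately show ?thesis by simp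
qed

lemma det_pos: "x \<in> exterior R \<Longrightarrow> det (G x) > 0"
  using positive_definite_det_pos G_pos by blast

lemma ginv_near: "near R 3 \<delta> (if i = j then 1 else 0) (\<lambda>x. ginv G x $ i $ j)"
proof -
  have "near R 3 \<delta> (1 * (if i = j then 1 else 0)) (\<lambda>x. 1 / det (G x) * adjugate3 (G x) $ i $ j)"
    by (intro near_mult adjugate_near near_inverse det_near det_pos) (use delta in auto)
  moreover have "1 / det (G x) * adjugate3 (G x) $ i $ j = ginv G x $ i $ j" if "x \<in> exterior R" for x
    using det_pos[OF that] by (simp add: ginv_def matrix_inv_adjugate3)
  ultimately show ?thesis unfolding near_def by (subst decay_cong[where g="\<lambda>x. 1 / det (G x) * adjugate3 (G x) $ i $ j - (if i = j then 1 else 0)"]) auto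
qed

lemma ginv_decay: "decay R 3 0 1 (\<lambda>x. ginv G x $ i $ j)"
  using near_decay[OF ginv_near] delta by auto

lemma G_decay: "decay R 3 0 1 (\<lambda>x. G x $ i $ j)"
  using near_decay[OF G_near] delta by auto

lemma volume_density_near: "near R 3 \<delta> 1 (\<lambda>x. sqrt (det (G x)))"
  by (intro near_sqrt det_near det_pos) (use delta in auto)

abbreviation "dG i j l \<equiv> pd i (\<lambda>y. G y $ j $ l)"

lemma dG_decay: "decay R 2 (1 + \<delta>) (-1) (dG i j l)"
proof -
  let ?c = "if j = l then 1 else 0 :: real"
  have d: "decay R (Suc 2) \<delta> 1 (\<lambda>x. G x $ j $ l - ?c)"
    using G_near[of j l] by (simp add: near_def eval_nat_numeral)
  have "decay R 2 (1 + \<delta>) (-1) (pd i (\<lambda>x. G x $ j $ l - ?c))"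
    by (rule decay_pd[OF d]) auto
  moreover have "pd i (\<lambda>x. G x $ j $ l - ?c) x = dG i j l x" if "x \<in> exterior R" for x
  proof -
    have "(\<lambda>x. G x $ j $ l) differentiable at x"
      using decay_differentiable[of R 2 0 1] G_decay[of j l] that by (simp add: eval_nat_numeral)
    then show ?thesis by (simp add: pd_diff pd_const)
  qed
  ultimately show ?thesis by (rule decay_cong[THEN iffD1, rotated])
qed

definition "lin_christoffel k i j x = (1/2) * (dG i j k x + dG j i k x - dG k i j x)"

lemma lin_christoffel_decay: "decay R 2 (1 + \<delta>) (-1) (lin_christoffel k i j)"
  unfolding lin_christoffel_def[abs_def] by (intro decay_cmult decay_add decay_diff dG_decay)

text \<open>The error of linearization is quadratic: the inverse metric differs from the identity by
order \<open>\<delta>\<close>, and it multiplies first derivatives of order $1 + \delta$.\<close>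

lemma christoffel_decay_diff: "decay R 2 (1 + 2 * \<delta>) (-1) (\<lambda>x. christoffel G k i j x - lin_christoffel k i j x)"
proof -
  have "decay R 2 (1 + 2 * \<delta>) (-1) (\<lambda>x. \<Sum>l\<in>UNIV. (ginv G x $ k $ l - (if k = l then 1 else 0)) * lin_christoffel l i j x)"
    by (intro decay_sum decay_mult[OF decay_le[OF _ ginv_near[unfolded near_def]] lin_christoffel_decay]) auto
  moreover have "christoffel G k i j x = (\<Sum>l\<in>UNIV. ginv G x $ k $ l * lin_christoffel l i j x)" for x
    by (simp add: christoffel_def lin_christoffel_def sum_divide_distrib)
  ultimately show ?thesis
    by (simp add: left_diff_distrib sum_subtractf if_distrib[of "\<lambda>x. x * _"] cong: if_cong)
qed

definition "lin_ricci i j x = (\<Sum>k\<in>UNIV. pd k (lin_christoffel k i j) x) - (\<Sum>k\<in>UNIV. pd j (lin_christoffel k i k) x)"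

definition "lin_scalar x = (\<Sum>i\<in>UNIV. lin_ricci i i x)"

lemma lin_christoffel_pd: "decay R 1 (2 + \<delta>) 1 (pd l (lin_christoffel k i j))"
  by (rule decay_pd[of R 1 "1 + \<delta>" "-1"]) (use lin_christoffel_decay in \<open>auto simp: eval_nat_numeral\<close>)

lemma lin_ricci_decay: "decay R 1 (2 + \<delta>) 1 (lin_ricci i j)"
  unfolding lin_ricci_def[abs_def] by (intro decay_diff decay_sum lin_christoffel_pd)

lemma lin_scalar_decay: "decay R 1 (2 + \<delta>) 1 lin_scalar"
  unfolding lin_scalar_def[abs_def] by (intro decay_sum lin_ricci_decay)

lemma christoffel_decay: "decay R 2 (1 + \<delta>) (-1) (christoffel G k i j)"
  using decay_add[OF decay_mono[OF christoffel_decay_diff[of k i j], of "1 + \<delta>"] lin_christoffel_decay[of k i j]] delta by simp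

lemma pd_christoffel_diff:
  "decay R 1 (2 + 2 * \<delta>) 1 (\<lambda>x. pd l (christoffel G k i j) x - pd l (lin_christoffel k i j) x)"
proof -
  have "decay R 1 (2 + 2 * \<delta>) 1 (pd l (\<lambda>x. christoffel G k i j x - lin_christoffel k i j x))"
    by (rule decay_pd[of R 1 "1 + 2 * \<delta>" "-1"]) (use christoffel_decay_diff[of k i j] in \<open>auto simp: eval_nat_numeral\<close>)
  moreover have "pd l (\<lambda>x. christoffel G k i j x - lin_christoffel k i j x) x =
     pd l (christoffel G k i j) x - pd l (lin_christoffel k i j) x" if "x \<in> exterior R" for x
    using decay_differentiable[of R 1] christoffel_decay[of k i j] lin_christoffel_decay[of k i j] that
    by (intro pd_diff) (auto simp: eval_nat_numeral)
  ultimately show ?thesis by (rule decay_cong[THEN iffD1, rotated])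
qed

text \<open>Besides the derivatives of the errors of the Christoffel symbols only their quadratic
terms remain; these have order $2 + 2\delta$ as well, and a product of two odd functions is even.\<close>

lemma ricci_decay_diff: "decay R 1 (2 + 2 * \<delta>) 1 (\<lambda>x. ricci G i j x - lin_ricci i j x)"
proof -
  have c: "decay R 1 (1 + \<delta>) (-1) (christoffel G k i j)" for k i j
    using decay_le[OF _ christoffel_decay] by simp
  have "decay R 1 (2 + 2 * \<delta>) 1 (\<lambda>x.
     (\<Sum>k\<in>UNIV. pd k (christoffel G k i j) x - pd k (lin_christoffel k i j) x) -
     (\<Sum>k\<in>UNIV. pd j (christoffel G k i k) x - pd j (lin_christoffel k i k) x) +
     (\<Sum>k\<in>UNIV. \<Sum>l\<in>UNIV. christoffel G k k l x * christoffel G l i j x) -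
     (\<Sum>k\<in>UNIV. \<Sum>l\<in>UNIV. christoffel G k j l x * christoffel G l i k x))"
    by (intro decay_add decay_diff decay_sum pd_christoffel_diff decay_mult[OF c c]) auto
  then show ?thesis unfolding ricci_def lin_ricci_def sum_subtractf by (simp add: algebra_simps)
qed

lemma ricci_decay: "decay R 1 (2 + \<delta>) 1 (ricci G i j)"
  using decay_add[OF decay_mono[OF ricci_decay_diff[of i j], of "2 + \<delta>"] lin_ricci_decay[of i j]] delta by simp

lemma scalar_decay_diff: "decay R 1 (2 + 2 * \<delta>) 1 (\<lambda>x. scalar_curvature G x - lin_scalar x)"
proof -
  have "decay R 1 (2 + 2 * \<delta>) 1 (\<lambda>x.
     (\<Sum>i\<in>UNIV. \<Sum>j\<in>UNIV. (ginv G x $ i $ j - (if i = j then 1 else 0)) * ricci G i j x)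
     + (\<Sum>i\<in>UNIV. ricci G i i x - lin_ricci i i x))"
    by (intro decay_add decay_sum decay_mult[OF decay_le[OF _ ginv_near[unfolded near_def]] ricci_decay] ricci_decay_diff) auto
  then show ?thesis unfolding scalar_curvature_def lin_scalar_def left_diff_distrib sum_subtractf
    by (simp add: if_distrib[of "\<lambda>x. x * _"] cong: if_cong)
qed

definition "einstein i j x = ricci G i j x - 1/2 * scalar_curvature G x * G x $ i $ j"
definition "lin_einstein i j x = lin_ricci i j x - 1/2 * lin_scalar x * (if i = j then 1 else 0)"

lemma lin_einstein_decay: "decay R 1 (2 + \<delta>) 1 (lin_einstein i j)"
  unfolding lin_einstein_def[abs_def]
  by (intro decay_diff lin_ricci_decay decay_mult[OF decay_cmult[OF lin_scalar_decay] decay_const]) auto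

lemma einstein_decay_diff: "decay R 1 (2 + 2 * \<delta>) 1 (\<lambda>x. einstein i j x - lin_einstein i j x)"
proof -
  have "decay R 1 (2 + 2 * \<delta>) 1 (\<lambda>x. (ricci G i j x - lin_ricci i j x)
     - (1/2) * ((scalar_curvature G x - lin_scalar x) * G x $ i $ j)
     - (1/2) * (lin_scalar x * (G x $ i $ j - (if i = j then 1 else 0))))"
    by (intro decay_diff decay_cmult ricci_decay_diff decay_mult[OF scalar_decay_diff decay_le[OF _ G_decay]]
       decay_mult[OF lin_scalar_decay decay_le[OF _ G_near[unfolded near_def]]]) auto
  then show ?thesis unfolding einstein_def lin_einstein_def by (simp add: algebra_simps)
qed

lemma einstein_decay: "decay R 1 (2 + \<delta>) 1 (einstein i j)"
  using decay_add[OF decay_mono[OF einstein_decay_diff[of i j], of "2 + \<delta>"] lin_einstein_decay[of i j]] delta by simp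

text \<open>The Hamiltonian constraint expresses the scalar curvature by squares of the second
fundamental form, which improves the order from $2 + \delta$ to $2 + 2\delta$.\<close>

lemma scalar_decay: "decay R 0 (2 + 2 * \<delta>) 1 (scalar_curvature G)"
proof -
  have g: "decay R 0 0 1 (\<lambda>x. ginv G x $ i $ j)" for i j using decay_le[OF _ ginv_decay] by simp
  have gg: "decay R 0 0 1 (\<lambda>x. ginv G x $ i $ j * ginv G x $ k $ l)" for i j k l by (rule decay_mult[OF g g]) auto
  have tr: "decay R 0 (1 + \<delta>) (-1) (trace_wrt G P)"
    unfolding trace_wrt_def[abs_def] by (intro decay_sum decay_mult[OF g P_decay]) auto
  have "decay R 0 (2 + 2 * \<delta>) 1 (\<lambda>x. normsq_wrt G P x - trace_wrt G P x * trace_wrt G P x)"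
    unfolding normsq_wrt_def by (intro decay_diff decay_mult[OF tr tr] decay_sum decay_mult[OF decay_mult[OF gg P_decay] P_decay]) auto
  moreover have "normsq_wrt G P x - trace_wrt G P x * trace_wrt G P x = scalar_curvature G x" if "x \<in> exterior R" for x
    using hamiltonian[OF that] by (simp add: power2_eq_square)
  ultimately show ?thesis by (rule decay_cong[THEN iffD1, rotated])
qed

abbreviation "ddG a i j l \<equiv> pd a (dG i j l)"

lemma G_diff: "x \<in> exterior R \<Longrightarrow> (\<lambda>x. G x $ i $ j) differentiable at x"
  using decay_differentiable[of R 2 0 1] G_decay[of i j] by (simp add: eval_nat_numeral)

lemma dG_diff: "x \<in> exterior R \<Longrightarrow> dG i j l differentiable at x"
  using decay_differentiable[of R 1] dG_decay[of i j l] by (simp add: eval_nat_numeral)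

lemma ddG_decay: "decay R 1 (2 + \<delta>) 1 (ddG a i j l)"
  by (rule decay_pd[of R 1 "1 + \<delta>" "-1"]) (use dG_decay in \<open>auto simp: eval_nat_numeral\<close>)

lemma ddG_diff: "x \<in> exterior R \<Longrightarrow> ddG a i j l differentiable at x"
  using decay_differentiable[of R 0] ddG_decay[of a i j l] by simp

lemma dG_swap: "x \<in> exterior R \<Longrightarrow> dG i j l x = dG i l j x"
  by (rule pd_cong_open[OF open_exterior]) (auto intro: G_sym)

lemma ddG_swap: "x \<in> exterior R \<Longrightarrow> ddG a i j l x = ddG a i l j x"
  by (rule pd_cong_open[OF open_exterior]) (auto intro: dG_swap)

lemma ddG_continuous: "continuous_on (exterior R) (ddG a i j l)"
  using decay_0I[OF ddG_decay] decay_0_iff by blast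

lemma dddG_decay: "decay R 0 (3 + \<delta>) (-1) (pd b (ddG a i j l))"
  by (rule decay_pd[of R 0 "2 + \<delta>" 1]) (use ddG_decay in auto)

lemma dddG_continuous: "continuous_on (exterior R) (pd b (ddG a i j l))"
  using dddG_decay decay_0_iff by blast

lemma ddG_commute: "x \<in> exterior R \<Longrightarrow> ddG a i j l x = ddG i a j l x"
  by (rule pd_commute[OF open_exterior _ G_diff dG_diff ddG_continuous])

lemma dddG_commute: "x \<in> exterior R \<Longrightarrow> pd b (ddG a i j l) x = pd a (ddG b i j l) x"
  by (rule pd_commute[OF open_exterior _ dG_diff ddG_diff dddG_continuous])

lemma dddG_commute': "x \<in> exterior R \<Longrightarrow> pd b (ddG a i j l) x = pd b (ddG i a j l) x"
  by (rule pd_cong_open[OF open_exterior]) (auto intro: ddG_commute)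

lemma pd_lin_christoffel: "x \<in> exterior R \<Longrightarrow>
   pd l (lin_christoffel k i j) x = (1/2) * (ddG l i j k x + ddG l j i k x - ddG l k i j x)"
  unfolding lin_christoffel_def[abs_def]
  by (subst pd_cmult, (intro differentiable_diff differentiable_add dG_diff; assumption),
      subst pd_diff, (intro differentiable_add dG_diff; assumption), (rule dG_diff; assumption),
      subst pd_add, (rule dG_diff; assumption), (rule dG_diff; assumption), rule refl)

lemma lin_ricci_eq:
  assumes x: "x \<in> exterior R"
  shows "lin_ricci i j x =
   (\<Sum>k\<in>UNIV. (1/2) * (ddG k i j k x + ddG k j i k x - ddG k k i j x - ddG j i k k x))"
  unfolding lin_ricci_def pd_lin_christoffel[OF x] sum_subtractf[symmetric]
proof (rule sum.cong[OF refl])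
  fix k :: 3
  show "1 / 2 * (ddG k i j k x + ddG k j i k x - ddG k k i j x) - 1 / 2 * (ddG j i k k x + ddG j k i k x - ddG j k i k x) =
    1 / 2 * (ddG k i j k x + ddG k j i k x - ddG k k i j x - ddG j i k k x)"
    by (simp add: algebra_simps)
qed

lemma lin_ricci_sym: "x \<in> exterior R \<Longrightarrow> lin_ricci i j x = lin_ricci j i x"
  unfolding lin_ricci_eq using ddG_swap[of x _ _ i j] ddG_commute[of x i j] by (simp add: add_ac)

lemma pd_lin_ricci:
  assumes x: "x \<in> exterior R"
  shows "pd l (lin_ricci i j) x =
   (\<Sum>k\<in>UNIV. (1/2) * (pd l (ddG k i j k) x + pd l (ddG k j i k) x - pd l (ddG k k i j) x - pd l (ddG j i k k) x))"
proof -
  have d: "ddG a i j l differentiable at x" for a i j l using ddG_diff x .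
  have "pd l (lin_ricci i j) x = pd l (\<lambda>x. \<Sum>k\<in>UNIV. (1/2) * (ddG k i j k x + ddG k j i k x - ddG k k i j x - ddG j i k k x)) x"
    by (rule pd_cong_open[OF open_exterior x lin_ricci_eq])
  also have "\<dots> = (\<Sum>k\<in>UNIV. pd l (\<lambda>x. (1/2) * (ddG k i j k x + ddG k j i k x - ddG k k i j x - ddG j i k k x)) x)"
    by (intro pd_sum differentiable_mult differentiable_const differentiable_diff differentiable_add d) auto
  also have "\<dots> = (\<Sum>k\<in>UNIV. (1/2) * (pd l (ddG k i j k) x + pd l (ddG k j i k) x - pd l (ddG k k i j) x - pd l (ddG j i k k) x))"
    by (intro sum.cong refl, subst pd_cmult, (intro differentiable_diff differentiable_add d),
        subst pd_diff, (intro differentiable_diff differentiable_add d)+,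
        subst pd_diff, (intro differentiable_diff differentiable_add d)+,
        subst pd_add, (intro d)+, rule refl)
  finally show ?thesis .
qed

lemma lin_ricci_diff: "x \<in> exterior R \<Longrightarrow> lin_ricci i j differentiable at x"
  using decay_differentiable[of R 0] lin_ricci_decay[of i j] by simp

lemma lin_scalar_diff: "x \<in> exterior R \<Longrightarrow> lin_scalar differentiable at x"
  using decay_differentiable[of R 0] lin_scalar_decay by simp

lemma lin_einstein_diff: "x \<in> exterior R \<Longrightarrow> lin_einstein i j differentiable at x"
  using decay_differentiable[of R 0] lin_einstein_decay[of i j] by simp

text \<open>The linearized contracted Bianchi identity. Both sides are sums of third derivatives of the
metric, which agree after commuting derivatives and renaming indices.\<close>

lemma lin_einstein_divergence_free:
  assumes x: "x \<in> exterior R" shows "(\<Sum>j\<in>UNIV. pd j (lin_einstein i j) x) = 0"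
proof -
  let ?T = "\<lambda>a b c j l. pd a (ddG b c j l) x"
  have "pd j (lin_einstein i j) x = pd j (lin_ricci i j) x - (if i = j then 1/2 * pd j lin_scalar x else 0)" for j
  proof -
    have "pd j (lin_einstein i j) x = pd j (lin_ricci i j) x - pd j (\<lambda>x. ((if i = j then 1 else 0) / 2) * lin_scalar x) x"
      unfolding lin_einstein_def[abs_def]
      by (subst pd_diff, (intro lin_ricci_diff differentiable_mult differentiable_const lin_scalar_diff x)+)
        (simp add: mult.commute)
    also have "pd j (\<lambda>x. ((if i = j then 1 else 0) / 2) * lin_scalar x) x = ((if i = j then 1 else 0) / 2) * pd j lin_scalar x"
      by (rule pd_cmult[OF lin_scalar_diff[OF x]])
    finally show ?thesis by simp
  qed
  then have "(\<Sum>j\<in>UNIV. pd j (lin_einstein i j) x) = (\<Sum>j\<in>UNIV. pd j (lin_ricci i j) x) - 1/2 * pd i lin_scalar x"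
    by (simp add: sum_subtractf)
  also have "pd i lin_scalar x = (\<Sum>j\<in>UNIV. pd i (lin_ricci j j) x)"
    unfolding lin_scalar_def[abs_def] by (rule pd_sum) (auto intro: lin_ricci_diff x)
  also have "\<dots> = (\<Sum>j\<in>UNIV. \<Sum>k\<in>UNIV. 1/2 * (2 * ?T i k j j k - ?T i k k j j - ?T i j j k k))"
    unfolding pd_lin_ricci[OF x] by simp
  also have "\<dots> = (\<Sum>j\<in>UNIV. \<Sum>k\<in>UNIV. ?T i k j j k) - 1/2 * (\<Sum>j\<in>UNIV. \<Sum>k\<in>UNIV. ?T i k k j j) - 1/2 * (\<Sum>j\<in>UNIV. \<Sum>k\<in>UNIV. ?T i j j k k)"
    by (simp add: sum_subtractf sum_distrib_left right_diff_distrib)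
  also have "(\<Sum>j\<in>UNIV. \<Sum>k\<in>UNIV. ?T i k k j j) = (\<Sum>j\<in>UNIV. \<Sum>k\<in>UNIV. ?T i j j k k)"
    by (rule sum.swap)
  finally have L: "(\<Sum>j\<in>UNIV. pd j (lin_einstein i j) x) = (\<Sum>j\<in>UNIV. pd j (lin_ricci i j) x)
     - 1/2 * ((\<Sum>j\<in>UNIV. \<Sum>k\<in>UNIV. ?T i k j j k) - (\<Sum>j\<in>UNIV. \<Sum>k\<in>UNIV. ?T i j j k k))" by (simp add: algebra_simps)
  have "(\<Sum>j\<in>UNIV. pd j (lin_ricci i j) x) = (\<Sum>j\<in>UNIV. \<Sum>k\<in>UNIV. 1/2 * (?T j k i j k + ?T j k j i k - ?T j k k i j - ?T j j i k k))"
    unfolding pd_lin_ricci[OF x] ..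
  also have "\<dots> = 1/2 * ((\<Sum>j\<in>UNIV. \<Sum>k\<in>UNIV. ?T j k i j k) + (\<Sum>j\<in>UNIV. \<Sum>k\<in>UNIV. ?T j k j i k) - (\<Sum>j\<in>UNIV. \<Sum>k\<in>UNIV. ?T j k k i j) - (\<Sum>j\<in>UNIV. \<Sum>k\<in>UNIV. ?T j j i k k))"
    by (simp add: sum_subtractf sum.distrib sum_distrib_left right_diff_distrib distrib_left)
  also have "(\<Sum>j\<in>UNIV. \<Sum>k\<in>UNIV. ?T j k j i k) = (\<Sum>j\<in>UNIV. \<Sum>k\<in>UNIV. ?T j k k i j)"
    by (subst sum.swap) (simp add: dddG_commute[OF x])
  also have "(\<Sum>j\<in>UNIV. \<Sum>k\<in>UNIV. ?T j k i j k) = (\<Sum>j\<in>UNIV. \<Sum>k\<in>UNIV. ?T i k j j k)"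
    by (intro sum.cong refl) (metis dddG_commute[OF x] dddG_commute'[OF x])
  also have "(\<Sum>j\<in>UNIV. \<Sum>k\<in>UNIV. ?T j j i k k) = (\<Sum>j\<in>UNIV. \<Sum>k\<in>UNIV. ?T i j j k k)"
    by (intro sum.cong refl) (metis dddG_commute[OF x] dddG_commute'[OF x])
  finally show ?thesis unfolding L by simp
qed

lemma lin_einstein_sym: "x \<in> exterior R \<Longrightarrow> lin_einstein i j x = lin_einstein j i x"
  by (simp add: lin_einstein_def lin_ricci_sym[of x i j])

text \<open>The dimension enters here: the trace of the identity is \<open>3\<close>, and $1 - 3/2 = -1/2$.\<close>

lemma lin_einstein_trace: "(\<Sum>i\<in>UNIV. lin_einstein i i x) = - 1/2 * lin_scalar x"
  by (simp add: lin_einstein_def sum_subtractf lin_scalar_def[symmetric])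

end

section \<open>The flux field and its divergence\<close>

lemma Y_field_eq: "Y_field \<alpha> x $ i = (\<Sum>k\<in>UNIV. x $ k * x $ k) * (if \<alpha> = i then 1 else 0) - 2 * (x $ \<alpha> * x $ i)"
  by (simp add: Y_field_def power2_norm_eq_inner inner_vec_def)

lemma Y_decay: "decay R n (-2) 1 (\<lambda>x. Y_field \<alpha> x $ i)"
  unfolding Y_field_eq
  by (intro decay_diff decay_cmult decay_mult[OF decay_sum[OF decay_mult[OF decay_coord decay_coord refl refl]] decay_const] decay_mult[OF decay_coord decay_coord]) auto

lemma coord_diff: "(\<lambda>x::real^3. x $ i) differentiable at x"
  by (rule bounded_linear_imp_differentiable[OF bounded_linear_vec_nth])

lemma pd_Y: "pd j (\<lambda>x. Y_field \<alpha> x $ i) x = 2 * x $ j * (if \<alpha> = i then 1 else 0)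
   - 2 * (if j = \<alpha> then 1 else 0) * x $ i - 2 * x $ \<alpha> * (if i = j then 1 else 0)"
proof -
  have m: "(\<lambda>x::real^3. x $ a * x $ b) differentiable at x" for a b x
    by (intro differentiable_mult coord_diff)
  have "pd j (\<lambda>x. Y_field \<alpha> x $ i) x = pd j (\<lambda>x. (if \<alpha> = i then 1 else 0) * (\<Sum>k\<in>UNIV. x $ k * x $ k) - 2 * (x $ \<alpha> * x $ i)) x"
    unfolding Y_field_eq by (simp add: mult.commute)
  also have "\<dots> = (if \<alpha> = i then 1 else 0) * (\<Sum>k\<in>UNIV. x $ k * (if j = k then 1 else 0) + (if j = k then 1 else 0) * x $ k)
     - 2 * (x $ \<alpha> * (if j = i then 1 else 0) + (if j = \<alpha> then 1 else 0) * x $ i)"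
    by (subst pd_diff, (intro differentiable_mult differentiable_const differentiable_finite_sum m finite coord_diff)+,
        subst pd_cmult, (intro differentiable_finite_sum m finite)+,
        subst pd_cmult, rule m, subst pd_sum, (intro finite m)+)
       (simp only: pd_mult[OF coord_diff coord_diff] pd_coord)
  finally show ?thesis by (auto simp: if_distrib[of "\<lambda>x. _ * x"] if_distrib[of "\<lambda>x. x * _"] sum.distrib cong: if_cong)
qed

context asymptotic_data begin

definition "flux_field \<alpha> x = (\<chi> j. sqrt (det (G x)) * (\<Sum>k\<in>UNIV. ginv G x $ j $ k * (\<Sum>i\<in>UNIV. einstein i k x * Y_field \<alpha> x $ i)))"

definition "flux_div \<alpha> x = (\<Sum>j\<in>UNIV. pd j (\<lambda>x. flux_field \<alpha> x $ j) x)"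

definition "lin_flux \<alpha> k x = (\<Sum>i\<in>UNIV. lin_einstein i k x * Y_field \<alpha> x $ i)"

lemma lin_flux_decay: "decay R 1 \<delta> 1 (lin_flux \<alpha> k)"
  unfolding lin_flux_def[abs_def] by (intro decay_sum decay_mult[OF lin_einstein_decay Y_decay]) auto

lemma EY_decay: "decay R 1 \<delta> 1 (\<lambda>x. \<Sum>i\<in>UNIV. einstein i k x * Y_field \<alpha> x $ i)"
  by (intro decay_sum decay_mult[OF einstein_decay Y_decay]) auto

text \<open>Replacing $\sqrt{\det g}$, $g^{jk}$ and the Einstein tensor by their leading parts costs a
factor of order \<open>\<delta>\<close> each time.\<close>

lemma flux_rest_decay: "decay R 1 (2 * \<delta>) 1 (\<lambda>x. flux_field \<alpha> x $ j - lin_flux \<alpha> j x)"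
proof -
  let ?V = "\<lambda>k x. \<Sum>i\<in>UNIV. einstein i k x * Y_field \<alpha> x $ i"
  let ?w = "\<lambda>x. sqrt (det (G x))"
  let ?d = "\<lambda>k. if j = k then 1 else 0 :: real"
  have w: "decay R 1 0 1 ?w" by (rule decay_le[OF _ near_decay[OF volume_density_near]]) (use delta in auto)
  have w1: "decay R 1 \<delta> 1 (\<lambda>x. ?w x - 1)"
    using decay_le[OF _ volume_density_near[unfolded near_def], of 1] by simp
  have gi: "decay R 1 \<delta> 1 (\<lambda>x. ginv G x $ j $ k - ?d k)" for k
    using decay_le[OF _ ginv_near[unfolded near_def], of 1] by simp
  have "decay R 1 (2 * \<delta>) 1 (\<lambda>x. ?w x * (\<Sum>k\<in>UNIV. (ginv G x $ j $ k - ?d k) * ?V k x) + (?w x - 1) * ?V j x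
     + (\<Sum>i\<in>UNIV. (einstein i j x - lin_einstein i j x) * Y_field \<alpha> x $ i))"
    by (intro decay_add decay_mult[OF w decay_sum[OF decay_mult[OF gi EY_decay refl refl]]] decay_mult[OF w1 EY_decay]
       decay_sum[OF decay_mult[OF einstein_decay_diff Y_decay]]) auto
  moreover have "?w x * (\<Sum>k\<in>UNIV. (ginv G x $ j $ k - ?d k) * ?V k x) + (?w x - 1) * ?V j x
     + (\<Sum>i\<in>UNIV. (einstein i j x - lin_einstein i j x) * Y_field \<alpha> x $ i) = flux_field \<alpha> x $ j - lin_flux \<alpha> j x" for x
  proof -
    have "(\<Sum>k\<in>UNIV. (ginv G x $ j $ k - ?d k) * ?V k x) = (\<Sum>k\<in>UNIV. ginv G x $ j $ k * ?V k x) - ?V j x"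
      by (simp add: left_diff_distrib sum_subtractf if_distrib[of "\<lambda>x. x * _"] cong: if_cong)
    moreover have "(\<Sum>i\<in>UNIV. (einstein i j x - lin_einstein i j x) * Y_field \<alpha> x $ i) = ?V j x - lin_flux \<alpha> j x"
      by (simp add: left_diff_distrib sum_subtractf lin_flux_def)
    ultimately show ?thesis by (simp only: flux_field_def vec_lambda_beta) (simp add: algebra_simps)
  qed
  ultimately show ?thesis by simp
qed

lemma flux_field_decay: "decay R 1 \<delta> 1 (\<lambda>x. flux_field \<alpha> x $ j)"
  using decay_add[OF decay_mono[OF flux_rest_decay, of \<delta> \<alpha> j] lin_flux_decay[of \<alpha> j]] delta by simp

text \<open>The conformal Killing equation
$\partial_j Y^i + \partial_i Y^j = -4 x^\alpha \delta_{ij}$ leaves only the trace of the symmetric and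
divergence free tensor \<open>lin_einstein\<close>.\<close>

lemma lin_flux_div:
  assumes x: "x \<in> exterior R"
  shows "(\<Sum>j\<in>UNIV. pd j (lin_flux \<alpha> j) x) = x $ \<alpha> * lin_scalar x"
proof -
  have Yd: "(\<lambda>x. Y_field \<alpha> x $ i) differentiable at x" for i
    by (rule decay_differentiable[OF Y_decay x])
  have "pd j (lin_flux \<alpha> j) x = (\<Sum>i\<in>UNIV. lin_einstein i j x * pd j (\<lambda>x. Y_field \<alpha> x $ i) x + pd j (lin_einstein i j) x * Y_field \<alpha> x $ i)" for j
    unfolding lin_flux_def[abs_def]
    by (subst pd_sum, (intro finite differentiable_mult lin_einstein_diff x Yd)+)
       (simp add: pd_mult lin_einstein_diff x Yd)
  then have "(\<Sum>j\<in>UNIV. pd j (lin_flux \<alpha> j) x) = (\<Sum>j\<in>UNIV. \<Sum>i\<in>UNIV. lin_einstein i j x * pd j (\<lambda>x. Y_field \<alpha> x $ i) x)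
     + (\<Sum>j\<in>UNIV. \<Sum>i\<in>UNIV. pd j (lin_einstein i j) x * Y_field \<alpha> x $ i)"
    by (simp add: sum.distrib)
  also have "(\<Sum>j\<in>UNIV. \<Sum>i\<in>UNIV. pd j (lin_einstein i j) x * Y_field \<alpha> x $ i) = 0"
    by (subst sum.swap) (simp add: lin_einstein_divergence_free[OF x] flip: sum_distrib_right)
  also have "(\<Sum>j\<in>UNIV. \<Sum>i\<in>UNIV. lin_einstein i j x * pd j (\<lambda>x. Y_field \<alpha> x $ i) x)
    = 2 * (\<Sum>j\<in>UNIV. lin_einstein \<alpha> j x * x $ j) - 2 * (\<Sum>i\<in>UNIV. lin_einstein i \<alpha> x * x $ i) - 2 * x $ \<alpha> * (\<Sum>i\<in>UNIV. lin_einstein i i x)"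
  proof -
    have "(\<Sum>j\<in>UNIV. \<Sum>i\<in>UNIV. lin_einstein i j x * pd j (\<lambda>x. Y_field \<alpha> x $ i) x) =
      (\<Sum>j\<in>UNIV. \<Sum>i\<in>UNIV. if \<alpha> = i then 2 * (lin_einstein i j x * x $ j) else 0)
      - (\<Sum>j\<in>UNIV. \<Sum>i\<in>UNIV. if j = \<alpha> then 2 * (lin_einstein i j x * x $ i) else 0)
      - (\<Sum>j\<in>UNIV. \<Sum>i\<in>UNIV. if i = j then 2 * x $ \<alpha> * lin_einstein i j x else 0)"
      unfolding sum_subtractf[symmetric] pd_Y by (intro sum.cong refl) (simp add: algebra_simps)
    moreover have "(\<Sum>j\<in>UNIV. \<Sum>i\<in>UNIV. if j = \<alpha> then 2 * (lin_einstein i j x * x $ i) else 0) = 2 * (\<Sum>i\<in>UNIV. lin_einstein i \<alpha> x * x $ i)"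
      by (subst sum.swap) (simp add: sum_distrib_left)
    ultimately show ?thesis by (simp add: sum_distrib_left)
  qed
  also have "(\<Sum>i\<in>UNIV. lin_einstein i \<alpha> x * x $ i) = (\<Sum>j\<in>UNIV. lin_einstein \<alpha> j x * x $ j)"
    by (simp add: lin_einstein_sym[OF x, of _ \<alpha>])
  finally show ?thesis by (simp add: lin_einstein_trace)
qed

text \<open>The divergence of the leading part is $x^\alpha$ times the linearized scalar curvature,
hence of order $1 + 2\delta$ by \<open>scalar_decay\<close>; the remainder of the field has order $2\delta$, and
its divergence one order more.\<close>

lemma flux_div_decay: "decay R 0 (1 + 2 * \<delta>) (-1) (flux_div \<alpha>)"
proof -
  let ?r = "\<lambda>j x. flux_field \<alpha> x $ j - lin_flux \<alpha> j x"
  have s: "decay R 0 (2 + 2 * \<delta>) 1 lin_scalar"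
    using decay_diff[OF scalar_decay decay_le[OF _ scalar_decay_diff, of 0]] by simp
  have "decay R 0 (1 + 2 * \<delta>) (-1) (\<lambda>x. x $ \<alpha> * lin_scalar x + (\<Sum>j\<in>UNIV. pd j (?r j) x))"
    by (intro decay_add decay_mult[OF decay_coord s] decay_sum decay_pd[of R 0 "2 * \<delta>" 1])
      (use flux_rest_decay in auto)
  moreover have "x $ \<alpha> * lin_scalar x + (\<Sum>j\<in>UNIV. pd j (?r j) x) = flux_div \<alpha> x" if x: "x \<in> exterior R" for x
  proof -
    have "pd j (?r j) x = pd j (\<lambda>x. flux_field \<alpha> x $ j) x - pd j (lin_flux \<alpha> j) x" for j
      using decay_differentiable[of R 0] flux_field_decay[of \<alpha> j] lin_flux_decay[of \<alpha> j] x
      by (intro pd_diff) auto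
    then show ?thesis by (simp add: sum_subtractf lin_flux_div[OF x] flux_div_def)
  qed
  ultimately show ?thesis by (rule decay_cong[THEN iffD1, rotated])
qed

end

section \<open>Local geometry of a surface patch\<close>

text \<open>The Euclidean normal of the parametrized surface, whose length is the Euclidean area
density.\<close>

definition patch_normal :: "(real^2 \<Rightarrow> real^3) \<Rightarrow> real^2 \<Rightarrow> real^3" where
  "patch_normal \<phi> u = cross3 (pd 1 \<phi> u) (pd 2 \<phi> u)"

lemma Basis_vec_axis: "(Basis :: (real^'n) set) = (\<lambda>i. axis i 1) ` UNIV"
  by (auto simp: Basis_vec_def)

context
  fixes S U \<phi>
  assumes patch: "C1_patch S U \<phi>"
begin

lemma patch_open: "open U" and patch_sub: "\<phi> ` U \<subseteq> S"
proof -
  show "open U" using patch by (simp add: C1_patch_def)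
  have "openin (top_of_set S) (\<phi> ` U)" using patch by (simp add: C1_patch_def)
  then show "\<phi> ` U \<subseteq> S" by (rule openin_imp_subset)
qed

lemma patch_derivative_raw: "u \<in> U \<Longrightarrow> (\<phi> has_derivative frechet_derivative \<phi> (at u)) (at u)"
  using patch by (auto simp: C1_patch_def frechet_derivative_works[symmetric])

lemma patch_derivative_eq:
  assumes "u \<in> U"
  shows "frechet_derivative \<phi> (at u) h = h $ 1 *\<^sub>R pd 1 \<phi> u + h $ 2 *\<^sub>R pd 2 \<phi> u"
proof -
  interpret D: bounded_linear "frechet_derivative \<phi> (at u)"
    using patch_derivative_raw[OF assms] by (rule has_derivative_bounded_linear)
  have "h = h $ 1 *\<^sub>R axis 1 1 + h $ 2 *\<^sub>R axis 2 1"
    by (auto simp: vec_eq_iff forall_2 axis_def)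
  then have "frechet_derivative \<phi> (at u) h = frechet_derivative \<phi> (at u) (h $ 1 *\<^sub>R axis 1 1 + h $ 2 *\<^sub>R axis 2 1)"
    by (rule arg_cong)
  then show ?thesis by (simp add: pd_def D.add D.scaleR)
qed

lemma patch_derivative:
  assumes "u \<in> U"
  shows "(\<phi> has_derivative (\<lambda>h. h $ 1 *\<^sub>R pd 1 \<phi> u + h $ 2 *\<^sub>R pd 2 \<phi> u)) (at u)"
proof -
  have "frechet_derivative \<phi> (at u) = (\<lambda>h. h $ 1 *\<^sub>R pd 1 \<phi> u + h $ 2 *\<^sub>R pd 2 \<phi> u)"
    by (rule ext) (rule patch_derivative_eq[OF assms])
  then show ?thesis using patch_derivative_raw[OF assms] by simp
qed

lemma patch_pd_continuous: "continuous_on U (pd i \<phi>)"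
proof -
  have "\<forall>v\<in>Basis. continuous_on U (\<lambda>u. frechet_derivative \<phi> (at u) v)"
    using patch by (simp add: C1_patch_def)
  then show ?thesis unfolding pd_def[abs_def] by (simp add: Basis_vec_axis)
qed

lemma patch_continuous: "continuous_on U \<phi>"
  using patch_derivative by (meson continuous_at_imp_continuous_on has_derivative_continuous)

lemma patch_inj: "inj_on \<phi> U"
proof -
  obtain \<psi> where "homeomorphism U (\<phi> ` U) \<phi> \<psi>" using patch by (auto simp: C1_patch_def)
  then show ?thesis by (intro inj_on_inverseI[of U \<psi>]) (auto simp: homeomorphism_def)
qed

lemma patch_openin: assumes "open V" "V \<subseteq> U" shows "openin (top_of_set S) (\<phi> ` V)"
proof -
  obtain \<psi> where h: "homeomorphism U (\<phi> ` U) \<phi> \<psi>" using patch by (auto simp: C1_patch_def)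
  have "openin (top_of_set U) V" using assms by (simp add: open_subset)
  then have "openin (top_of_set (\<phi> ` U)) (\<phi> ` V)"
    using homeomorphism_imp_open_map[OF h] by blast
  then show ?thesis using patch by (auto simp: C1_patch_def intro: openin_trans)
qed

lemma patch_normal_nonzero: assumes "u \<in> U" shows "patch_normal \<phi> u \<noteq> 0"
proof
  assume "patch_normal \<phi> u = 0"
  then have "collinear {0, pd 1 \<phi> u, pd 2 \<phi> u}" by (simp add: patch_normal_def cross_eq_0)
  then consider "pd 1 \<phi> u = 0" | "pd 2 \<phi> u = 0" | c where "pd 2 \<phi> u = c *\<^sub>R pd 1 \<phi> u"
    unfolding collinear_lemma by blast
  then obtain h :: "real^2" where "h \<noteq> 0" "h $ 1 *\<^sub>R pd 1 \<phi> u + h $ 2 *\<^sub>R pd 2 \<phi> u = 0"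
  proof cases
    case 1 then show ?thesis by (intro that[of "axis 1 1"]) (simp_all add: axis_eq_0_iff, simp add: axis_def)
  next
    case 2 then show ?thesis by (intro that[of "axis 2 1"]) (simp_all add: axis_eq_0_iff, simp add: axis_def)
  next
    case (3 c) then show ?thesis
      by (intro that[of "vector [- c, 1]"]) (auto simp: vec_eq_iff forall_2 vector_2)
  qed
  then have "frechet_derivative \<phi> (at u) h = frechet_derivative \<phi> (at u) 0" "h \<noteq> 0"
    by (simp_all add: patch_derivative_eq[OF assms])
  then show False using patch assms by (auto simp: C1_patch_def dest: injD)
qed

lemma patch_normal_continuous: "continuous_on U (patch_normal \<phi>)"
  unfolding patch_normal_def[abs_def] by (intro continuous_on_cross patch_pd_continuous)

end

definition cone :: "real^3 \<Rightarrow> real \<Rightarrow> (real^3) set" where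
  "cone n \<eta> = {c. c \<bullet> n > \<eta> * norm n * norm c}"

text \<open>Convexity makes the sets of points that are reached from a patch along small vectors of the
cone connected.\<close>

lemma convex_cone_ball: "\<eta> > 0 \<Longrightarrow> convex (cone n \<eta> \<inter> ball 0 \<epsilon>)"
proof (rule convex_Int[OF _ convex_ball], unfold convex_def, intro ballI allI impI)
  fix c d and u v :: real assume \<eta>: "\<eta> > 0" and c: "c \<in> cone n \<eta>" "d \<in> cone n \<eta>" and uv: "0 \<le> u" "0 \<le> v" "u + v = 1"
  have "\<eta> * norm n * norm (u *\<^sub>R c + v *\<^sub>R d) \<le> \<eta> * norm n * (u * norm c + v * norm d)"
    using norm_triangle_ineq[of "u *\<^sub>R c" "v *\<^sub>R d"] uv \<eta> by (intro mult_left_mono) auto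
  also have "\<dots> = u * (\<eta> * norm n * norm c) + v * (\<eta> * norm n * norm d)" by (simp add: algebra_simps)
  also have "\<dots> < u * (c \<bullet> n) + v * (d \<bullet> n)"
  proof (cases "u = 0")
    case True then show ?thesis using c uv by (simp add: cone_def)
  next
    case False
    then have "u * (\<eta> * norm n * norm c) < u * (c \<bullet> n)" using c uv by (simp add: cone_def)
    moreover have "v * (\<eta> * norm n * norm d) \<le> v * (d \<bullet> n)" using c uv by (intro mult_left_mono) (auto simp: cone_def)
    ultimately show ?thesis by linarith
  qed
  finally show "u *\<^sub>R c + v *\<^sub>R d \<in> cone n \<eta>" by (simp add: cone_def inner_add_left)
qed

lemma cone_scale: "t > 0 \<Longrightarrow> c \<in> cone n \<eta> \<Longrightarrow> t *\<^sub>R c \<in> cone n \<eta>"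
  by (auto simp: cone_def mult.left_commute)

lemma open_cone: "open (cone n \<eta>)"
  unfolding cone_def by (intro open_Collect_less continuous_intros)

text \<open>A neighborhood of a point of the patch on which everything is controlled by the normal \<open>n\<close>
at that point: secants are nearly tangential, normals have positive product with the cone around \<open>n\<close>,
and short vectors of the cone, forwards and backwards, lead off the surface.\<close>

definition adapted :: "(real^3) set \<Rightarrow> (real^2) set \<Rightarrow> (real^2 \<Rightarrow> real^3) \<Rightarrow> real^2 \<Rightarrow> real^3 \<Rightarrow> real \<Rightarrow> real \<Rightarrow> real \<Rightarrow> bool" where
  "adapted S U \<phi> u0 n \<eta> r \<epsilon> \<longleftrightarrow> r > 0 \<and> \<epsilon> > 0 \<and> cball u0 r \<subseteq> U \<and>
     (\<forall>u\<in>ball u0 r. \<forall>v\<in>ball u0 r. \<bar>(\<phi> v - \<phi> u) \<bullet> n\<bar> \<le> \<eta> * norm n * norm (\<phi> v - \<phi> u)) \<and>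
     (\<forall>u\<in>ball u0 r. \<forall>c\<in>cone n \<eta>. patch_normal \<phi> u \<bullet> c > 0) \<and>
     (\<forall>u\<in>ball u0 r. \<forall>c\<in>cone n \<eta>. norm c < \<epsilon> \<longrightarrow> \<phi> u + c \<notin> S \<and> \<phi> u - c \<notin> S)"

text \<open>Near the center the parametrization differs from its derivative there by a map with small
Lipschitz constant, so that secants are almost tangential. A short vector of the cone that led
from the surface to the surface would be such a secant; this uses that the surface has, near the
point, no other part than the patch.\<close>

lemma adapted_exists:
  assumes patch: "C1_patch S U \<phi>" and u0: "u0 \<in> U" and \<eta>: "\<eta> > 0"
  shows "\<exists>r \<epsilon>. adapted S U \<phi> u0 (patch_normal \<phi> u0) \<eta> r \<epsilon>"
proof -
  note P = patch
  let ?N = "patch_normal \<phi>"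
  let ?n = "?N u0"
  define L where "L h = h $ 1 *\<^sub>R pd 1 \<phi> u0 + h $ 2 *\<^sub>R pd 2 \<phi> u0" for h :: "real^2"
  have Leq: "L = frechet_derivative \<phi> (at u0)"
    by (rule ext) (simp add: L_def patch_derivative_eq[OF P u0])
  have Lbl: "bounded_linear L" unfolding Leq using patch_derivative_raw[OF P u0] by (rule has_derivative_bounded_linear)
  have "inj L" unfolding Leq using P u0 by (auto simp: C1_patch_def)
  then obtain B where B: "B > 0" "\<And>h. B * norm h \<le> norm (L h)"
    using linear_inj_bounded_below_pos[OF bounded_linear.linear[OF Lbl]] by blast
  have Ln: "L h \<bullet> ?n = 0" for h
    by (simp add: L_def patch_normal_def inner_add_left dot_cross_self)
  have n0: "norm ?n > 0" using patch_normal_nonzero[OF P u0] by simp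
  \<comment> \<open>The Lipschitz constant of the error: a secant of parameter length \<open>h\<close> is at least $(B - \kappa) h$ long, and its normal component at most $\kappa h$ times the length of the normal; the choice gives $\kappa = \eta (B - \kappa)$.\<close>
  define \<kappa> where "\<kappa> = \<eta> * B / (1 + \<eta>)"
  have \<kappa>: "\<kappa> > 0" "\<kappa> * (1 + \<eta>) = \<eta> * B" using B \<eta> by (auto simp: \<kappa>_def)
  obtain r0 where r0: "r0 > 0" "cball u0 r0 \<subseteq> U" using patch_open[OF P] u0 open_contains_cball by blast
  have close: "\<exists>d>0. \<forall>u. dist u u0 < d \<longrightarrow> dist (F u) (F u0) < e" if "continuous_on U F" "e > 0" for F :: "real^2 \<Rightarrow> real^3" and e
  proof -
    have "isCont F u0" using that(1) patch_open[OF P] u0 by (simp add: continuous_on_eq_continuous_at)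
    then show ?thesis using that(2) by (auto simp: continuous_at_eps_delta)
  qed
  obtain d1 where d1: "d1 > 0" "\<And>u. dist u u0 < d1 \<Longrightarrow> dist (pd 1 \<phi> u) (pd 1 \<phi> u0) < \<kappa> / 2"
    using close[OF patch_pd_continuous[OF P], of "\<kappa>/2"] \<kappa>(1) by auto
  obtain d2 where d2: "d2 > 0" "\<And>u. dist u u0 < d2 \<Longrightarrow> dist (pd 2 \<phi> u) (pd 2 \<phi> u0) < \<kappa> / 2"
    using close[OF patch_pd_continuous[OF P], of "\<kappa>/2"] \<kappa>(1) by auto
  obtain d3 where d3: "d3 > 0" "\<And>u. dist u u0 < d3 \<Longrightarrow> dist (?N u) ?n < \<eta> * norm ?n"
    using close[OF patch_normal_continuous[OF P], of "\<eta> * norm ?n"] mult_pos_pos[OF \<eta> n0] by auto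
  define r1 where "r1 = min r0 (min d1 (min d2 d3))"
  have r1: "r1 > 0" "r1 \<le> r0" "r1 \<le> d1" "r1 \<le> d2" "r1 \<le> d3" using r0 d1 d2 d3 by (auto simp: r1_def)
  have inU: "ball u0 r1 \<subseteq> U" using r0 r1 by (meson ball_subset_cball order_trans subset_cball)
  have est: "norm (\<phi> v - \<phi> u - L (v - u)) \<le> \<kappa> * norm (v - u)" if "u \<in> ball u0 r1" "v \<in> ball u0 r1" for u v
  proof -
    have "norm ((\<phi> v - L v) - (\<phi> u - L u)) \<le> \<kappa> * norm (v - u)"
    proof (rule differentiable_bound[OF convex_ball[of u0 r1]])
      fix x assume x: "x \<in> ball u0 r1"
      show "((\<lambda>x. \<phi> x - L x) has_derivative (\<lambda>h. (h $ 1 *\<^sub>R pd 1 \<phi> x + h $ 2 *\<^sub>R pd 2 \<phi> x) - L h)) (at x within ball u0 r1)"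
        using x inU by (intro has_derivative_diff[OF has_derivative_at_withinI[OF patch_derivative[OF P]] bounded_linear_imp_has_derivative[OF Lbl]]) auto
      show "onorm (\<lambda>h. (h $ 1 *\<^sub>R pd 1 \<phi> x + h $ 2 *\<^sub>R pd 2 \<phi> x) - L h) \<le> \<kappa>"
      proof (rule onorm_le)
        fix h :: "real^2"
        have x': "dist x u0 < d1" "dist x u0 < d2" using x r1 by (auto simp: dist_commute)
        have "norm ((h $ 1 *\<^sub>R pd 1 \<phi> x + h $ 2 *\<^sub>R pd 2 \<phi> x) - L h) =
          norm (h $ 1 *\<^sub>R (pd 1 \<phi> x - pd 1 \<phi> u0) + h $ 2 *\<^sub>R (pd 2 \<phi> x - pd 2 \<phi> u0))"
          by (simp add: L_def algebra_simps)
        also have "\<dots> \<le> \<bar>h $ 1\<bar> * norm (pd 1 \<phi> x - pd 1 \<phi> u0) + \<bar>h $ 2\<bar> * norm (pd 2 \<phi> x - pd 2 \<phi> u0)"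
          by (rule norm_triangle_le) simp
        also have "\<dots> \<le> norm h * (\<kappa>/2) + norm h * (\<kappa>/2)"
          using d1(2)[OF x'(1)] d2(2)[OF x'(2)]
          by (intro add_mono mult_mono component_le_norm_cart) (auto simp: dist_norm)
        finally show "norm ((h $ 1 *\<^sub>R pd 1 \<phi> x + h $ 2 *\<^sub>R pd 2 \<phi> x) - L h) \<le> \<kappa> * norm h"
          by (simp add: algebra_simps)
      qed
    qed (use that in auto)
    moreover have "(\<phi> v - L v) - (\<phi> u - L u) = \<phi> v - \<phi> u - L (v - u)"
      using linear_diff[OF bounded_linear.linear[OF Lbl], of v u] by simp
    ultimately show ?thesis by simp
  qed
  have flat: "\<bar>(\<phi> v - \<phi> u) \<bullet> ?n\<bar> \<le> \<eta> * norm ?n * norm (\<phi> v - \<phi> u)" if uv: "u \<in> ball u0 r1" "v \<in> ball u0 r1" for u v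
  proof -
    define e where "e = \<phi> v - \<phi> u - L (v - u)"
    have e: "norm e \<le> \<kappa> * norm (v - u)" using est[OF uv] by (simp add: e_def)
    have eq: "\<phi> v - \<phi> u = L (v - u) + e" by (simp add: e_def)
    have "\<bar>(\<phi> v - \<phi> u) \<bullet> ?n\<bar> = \<bar>e \<bullet> ?n\<bar>" unfolding eq by (simp add: inner_add_left Ln)
    also have "\<dots> \<le> norm e * norm ?n" by (rule Cauchy_Schwarz_ineq2)
    also have "\<dots> \<le> \<kappa> * norm (v - u) * norm ?n" using e by (intro mult_right_mono) auto
    also have "\<dots> \<le> \<eta> * norm (\<phi> v - \<phi> u) * norm ?n"
    proof (intro mult_right_mono)
      have "B * norm (v - u) \<le> norm (\<phi> v - \<phi> u) + norm e"
        using B(2)[of "v - u"] norm_triangle_ineq4[of "\<phi> v - \<phi> u" e] by (simp add: eq)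
      then have "\<eta> * (B * norm (v - u)) \<le> \<eta> * (norm (\<phi> v - \<phi> u) + \<kappa> * norm (v - u))"
        using e \<eta> by (intro mult_left_mono) auto
      moreover have "\<eta> * (B * norm (v - u)) = \<kappa> * (1 + \<eta>) * norm (v - u)"
        unfolding \<kappa>(2) by (simp add: mult.assoc)
      ultimately show "\<kappa> * norm (v - u) \<le> \<eta> * norm (\<phi> v - \<phi> u)" by (simp add: algebra_simps)
    qed simp
    finally show ?thesis by (simp add: mult_ac)
  qed
  have Npos: "?N u \<bullet> c > 0" if u: "u \<in> ball u0 r1" and c: "c \<in> cone ?n \<eta>" for u c
  proof -
    have "dist u u0 < d3" using u r1 by (simp add: dist_commute)
    then have "norm (?N u - ?n) < \<eta> * norm ?n" using d3(2) by (metis dist_norm)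
    moreover have "\<bar>(?N u - ?n) \<bullet> c\<bar> \<le> norm (?N u - ?n) * norm c" by (rule Cauchy_Schwarz_ineq2)
    ultimately have "\<bar>(?N u - ?n) \<bullet> c\<bar> \<le> \<eta> * norm ?n * norm c"
      by (meson less_imp_le mult_right_mono norm_ge_zero order_trans)
    moreover have "?N u \<bullet> c = c \<bullet> ?n + (?N u - ?n) \<bullet> c" by (simp add: inner_diff_left inner_diff_right inner_commute)
    moreover have "c \<bullet> ?n > \<eta> * norm ?n * norm c" using c by (simp add: cone_def)
    ultimately show ?thesis by linarith
  qed
  obtain T where T: "open T" "\<phi> ` ball u0 r1 = S \<inter> T"
    using patch_openin[OF P open_ball inU] by (auto simp: openin_open)
  have "\<phi> u0 \<in> T" using T(2) r1(1) by (metis IntD2 centre_in_ball imageI)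
  then obtain \<rho> where \<rho>: "\<rho> > 0" "ball (\<phi> u0) \<rho> \<subseteq> T" using T(1) open_contains_ball by blast
  obtain d4 where d4: "d4 > 0" "\<And>u. dist u u0 < d4 \<Longrightarrow> dist (\<phi> u) (\<phi> u0) < \<rho> / 2"
    using close[OF patch_continuous[OF P], of "\<rho>/2"] \<rho>(1) by auto
  define r where "r = min r1 d4"
  have r: "r > 0" "r \<le> r1" "r \<le> d4" using r1 d4 by (auto simp: r_def)
  have avoid: "\<phi> u + s *\<^sub>R c \<notin> S" if u: "u \<in> ball u0 r" and c: "c \<in> cone ?n \<eta>" "norm c < \<rho> / 2" and s: "\<bar>s\<bar> = 1" for u c and s :: real
  proof
    assume inS: "\<phi> u + s *\<^sub>R c \<in> S"
    have "dist (\<phi> u) (\<phi> u0) < \<rho>/2" using d4(2)[of u] u r by (auto simp: dist_commute)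
    moreover have "dist (\<phi> u + s *\<^sub>R c) (\<phi> u) < \<rho>/2" using c s by (simp add: dist_norm)
    ultimately have "dist (\<phi> u + s *\<^sub>R c) (\<phi> u0) < \<rho>/2 + \<rho>/2" by (metis add.commute dist_triangle_less_add dist_commute)
    then have "\<phi> u + s *\<^sub>R c \<in> ball (\<phi> u0) \<rho>" by (simp add: dist_commute)
    then have "\<phi> u + s *\<^sub>R c \<in> \<phi> ` ball u0 r1" using \<rho>(2) T(2) inS by blast
    then obtain v where v: "v \<in> ball u0 r1" "\<phi> v - \<phi> u = s *\<^sub>R c" by (metis add_diff_cancel_left' imageE)
    have "\<bar>s *\<^sub>R c \<bullet> ?n\<bar> \<le> \<eta> * norm ?n * norm c" using flat[of u v] v u r s by auto
    then show False using c s by (simp add: cone_def abs_mult)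
  qed
  have "adapted S U \<phi> u0 ?n \<eta> r (\<rho>/2)"
    unfolding adapted_def
  proof (intro conjI ballI impI)
    show "cball u0 r \<subseteq> U" using r r1 r0 by (meson order_trans subset_cball)
  qed (use r \<rho> flat Npos avoid[of _ _ 1] avoid[of _ _ "-1"] in auto)
  then show ?thesis by blast
qed

lemma patch_nbhd:
  assumes "C1_patch S U \<phi>" "u0 \<in> U" "r > 0"
  shows "\<exists>\<rho>>0. \<forall>x. x \<in> S \<and> dist x (\<phi> u0) < \<rho> \<longrightarrow> x \<in> \<phi> ` (U \<inter> ball u0 r)"
proof -
  have "openin (top_of_set S) (\<phi> ` (U \<inter> ball u0 r))"
    by (rule patch_openin[OF assms(1)]) (use patch_open[OF assms(1)] in auto)
  then obtain T where T: "open T" "\<phi> ` (U \<inter> ball u0 r) = S \<inter> T" by (auto simp: openin_open)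
  have "\<phi> u0 \<in> T" using T(2) assms by (metis IntD2 IntI centre_in_ball imageI)
  then obtain \<rho> where "\<rho> > 0" "ball (\<phi> u0) \<rho> \<subseteq> T" using T(1) open_contains_ball by blast
  then show ?thesis using T(2) by (intro exI[of _ \<rho>]) (auto simp: dist_commute)
qed

text \<open>The curve on the surface with a tangent vector that is not orthogonal to the normal would
run into the cone, which is disjoint from the surface.\<close>

lemma patch_tangent_orthogonal:
  assumes "C1_patch S U \<phi>" "u \<in> U" "C1_patch S V \<psi>" "v \<in> V" "\<psi> v = \<phi> u"
  shows "frechet_derivative \<psi> (at v) w \<bullet> patch_normal \<phi> u = 0"
proof (rule ccontr)
  let ?n = "patch_normal \<phi> u"
  assume ne: "\<not> ?thesis"
  define D where "D = frechet_derivative \<psi> (at v)"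
  interpret D: bounded_linear D unfolding D_def using patch_derivative_raw[OF assms(3,4)] by (rule has_derivative_bounded_linear)
  define w' where "w' = (if D w \<bullet> ?n > 0 then w else - w)"
  have pos: "D w' \<bullet> ?n > 0" using ne by (auto simp: w'_def linear_neg[OF D.linear] D_def[symmetric])
  have nn: "norm ?n > 0" using patch_normal_nonzero[OF assms(1,2)] by simp
  have Dw: "norm (D w') > 0" using pos by auto
  \<comment> \<open>Half of the cosine of the angle between the tangent vector and the normal, so that the vector lies in the open cone.\<close>
  define \<eta> where "\<eta> = D w' \<bullet> ?n / (2 * norm ?n * norm (D w'))"
  have \<eta>: "\<eta> > 0" unfolding \<eta>_def using pos nn Dw by simp
  have "D w' \<in> cone ?n \<eta>" using pos nn Dw by (simp add: cone_def \<eta>_def field_simps)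
  obtain r \<epsilon> where ad: "adapted S U \<phi> u ?n \<eta> r \<epsilon>" using adapted_exists[OF assms(1,2) \<eta>] by blast
  have l1: "((\<lambda>t. v + t *\<^sub>R w') has_derivative (\<lambda>t. t *\<^sub>R w')) (at 0)"
    by (auto intro!: derivative_eq_intros)
  have l2: "(\<psi> has_derivative D) (at (v + 0 *\<^sub>R w'))"
    using patch_derivative_raw[OF assms(3,4)] by (simp add: D_def)
  have "((\<lambda>t. \<psi> (v + t *\<^sub>R w')) has_derivative (\<lambda>t. D (t *\<^sub>R w'))) (at 0)"
    by (rule has_derivative_compose[OF l1 l2])
  then have "((\<lambda>t. (\<psi> (v + t *\<^sub>R w') - \<psi> v - t *\<^sub>R D w') /\<^sub>R \<bar>t\<bar>) \<longlongrightarrow> 0) (at 0)"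
    by (simp add: has_derivative_at_within has_derivative_def D.scaleR)
  then have "((\<lambda>t. (\<psi> (v + t *\<^sub>R w') - \<psi> v - t *\<^sub>R D w') /\<^sub>R \<bar>t\<bar> + D w') \<longlongrightarrow> 0 + D w') (at_right 0)"
    by (intro tendsto_intros) (rule filterlim_mono[OF _ order_refl at_le], auto)
  moreover have "\<forall>\<^sub>F t in at_right 0. (\<psi> (v + t *\<^sub>R w') - \<psi> v - t *\<^sub>R D w') /\<^sub>R \<bar>t\<bar> + D w' = (\<psi> (v + t *\<^sub>R w') - \<psi> v) /\<^sub>R t"
    using eventually_at_right_less[of "0::real"] by eventually_elim (simp add: scaleR_diff_right)
  ultimately have lim: "((\<lambda>t. (\<psi> (v + t *\<^sub>R w') - \<psi> v) /\<^sub>R t) \<longlongrightarrow> D w') (at_right 0)"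
    by (simp add: filterlim_cong[OF refl refl])
  have e1: "\<forall>\<^sub>F t in at_right 0. (\<psi> (v + t *\<^sub>R w') - \<psi> v) /\<^sub>R t \<in> cone ?n \<eta>"
    by (rule topological_tendstoD[OF lim open_cone \<open>D w' \<in> cone ?n \<eta>\<close>])
  have tl: "((\<lambda>t. v + t *\<^sub>R w') \<longlongrightarrow> v + 0 *\<^sub>R w') (at_right 0)" by (intro tendsto_intros)
  have e2: "\<forall>\<^sub>F t in at_right 0. v + t *\<^sub>R w' \<in> V"
    using topological_tendstoD[OF tl patch_open[OF assms(3)]] assms(4) by simp
  have cont: "isCont \<psi> v" by (rule has_derivative_continuous[OF patch_derivative_raw[OF assms(3,4)]])
  have "((\<lambda>t. \<psi> (v + t *\<^sub>R w')) \<longlongrightarrow> \<psi> v) (at_right 0)"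
    by (rule isCont_tendsto_compose[OF cont]) (use tl in simp)
  then have e3: "\<forall>\<^sub>F t in at_right 0. dist (\<psi> (v + t *\<^sub>R w')) (\<psi> v) < \<epsilon>"
    by (rule tendstoD) (use ad in \<open>simp add: adapted_def\<close>)
  have "\<forall>\<^sub>F t in at_right (0::real). False"
    using e1 e2 e3 eventually_at_right_less[of "0::real"]
  proof eventually_elim
    case (elim t)
    define c where "c = \<psi> (v + t *\<^sub>R w') - \<psi> v"
    have "t *\<^sub>R ((\<psi> (v + t *\<^sub>R w') - \<psi> v) /\<^sub>R t) \<in> cone ?n \<eta>" by (rule cone_scale[OF elim(4,1)])
    then have "c \<in> cone ?n \<eta>" using elim(4) by (simp add: c_def)
    moreover have "norm c < \<epsilon>" using elim(3) by (simp add: c_def dist_norm)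
    moreover have "u \<in> ball u r" using ad by (simp add: adapted_def)
    ultimately have "\<phi> u + c \<notin> S" using ad unfolding adapted_def by blast
    moreover have "\<phi> u + c = \<psi> (v + t *\<^sub>R w')" by (simp add: c_def assms(5))
    ultimately show False using patch_sub[OF assms(3)] elim(2) by auto
  qed
  then show False by simp
qed

section \<open>Flow boxes and transition maps\<close>

definition pr :: "real^3 \<Rightarrow> real^2" where "pr y = vector [y $ 1, y $ 2]"
definition up :: "real^2 \<Rightarrow> real \<Rightarrow> real^3" where "up u t = vector [u $ 1, u $ 2, t]"

lemma pr_nth [simp]: "pr y $ 1 = y $ 1" "pr y $ 2 = y $ 2" by (simp_all add: pr_def)
lemma up_nth [simp]: "up u t $ 1 = u $ 1" "up u t $ 2 = u $ 2" "up u t $ 3 = t" by (simp_all add: up_def)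
lemma pr_up [simp]: "pr (up u t) = u" by (simp add: vec_eq_iff forall_2)
lemma up_pr: "up (pr y) (y $ 3) = y" by (simp add: vec_eq_iff forall_3)

lemma bounded_linear_pr: "bounded_linear pr"
  by (rule linear_conv_bounded_linear[THEN iffD1]) (auto intro!: linearI simp: vec_eq_iff forall_2)

text \<open>The first two coordinates parametrize the surface, and the third is the time of the flow in
the constant direction \<open>b\<close>.\<close>

definition flow :: "(real^2 \<Rightarrow> real^3) \<Rightarrow> real^3 \<Rightarrow> real^3 \<Rightarrow> real^3" where
  "flow \<phi> b y = \<phi> (pr y) + y $ 3 *\<^sub>R b"

definition flow_deriv :: "(real^2 \<Rightarrow> real^3) \<Rightarrow> real^3 \<Rightarrow> real^3 \<Rightarrow> real^3 \<Rightarrow> real^3" where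
  "flow_deriv \<phi> b y h = h $ 1 *\<^sub>R pd 1 \<phi> (pr y) + h $ 2 *\<^sub>R pd 2 \<phi> (pr y) + h $ 3 *\<^sub>R b"

definition C1_map :: "(real^2) set \<Rightarrow> (real^2 \<Rightarrow> real^3) \<Rightarrow> bool" where
  "C1_map U \<phi> \<longleftrightarrow> (\<forall>u\<in>U. (\<phi> has_derivative (\<lambda>h. h $ 1 *\<^sub>R pd 1 \<phi> u + h $ 2 *\<^sub>R pd 2 \<phi> u)) (at u)) \<and>
     (\<forall>i. continuous_on U (pd i \<phi>))"

lemma C1_patch_map: "C1_patch S U \<phi> \<Longrightarrow> C1_map U \<phi>"
  using patch_derivative patch_pd_continuous by (auto simp: C1_map_def)

lemma flow_has_derivative:
  assumes "C1_map U \<phi>" "pr y \<in> U"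
  shows "(flow \<phi> b has_derivative flow_deriv \<phi> b y) (at y)"
proof -
  have 1: "(pr has_derivative pr) (at y)" by (rule bounded_linear_imp_has_derivative[OF bounded_linear_pr])
  have 0: "(\<phi> has_derivative (\<lambda>h. h $ 1 *\<^sub>R pd 1 \<phi> (pr y) + h $ 2 *\<^sub>R pd 2 \<phi> (pr y))) (at (pr y))"
    using assms by (auto simp: C1_map_def)
  have 2: "((\<lambda>y. \<phi> (pr y)) has_derivative (\<lambda>h. pr h $ 1 *\<^sub>R pd 1 \<phi> (pr y) + pr h $ 2 *\<^sub>R pd 2 \<phi> (pr y))) (at y)"
    by (rule has_derivative_compose[OF 1 0])
  have 3: "((\<lambda>y. y $ 3 *\<^sub>R b) has_derivative (\<lambda>h. h $ 3 *\<^sub>R b)) (at y)"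
    by (intro bounded_linear_imp_has_derivative bounded_linear_compose[OF bounded_linear_scaleR_left bounded_linear_vec_nth])
  show ?thesis using has_derivative_add[OF 2 3] by (simp add: flow_def[abs_def] flow_deriv_def[abs_def])
qed

lemma flow_det: "det (matrix (flow_deriv \<phi> b y)) = patch_normal \<phi> (pr y) \<bullet> b"
  unfolding det_3 matrix_def flow_deriv_def patch_normal_def cross3_def inner_vec_def
  by (simp add: axis_def sum_3 algebra_simps)

text \<open>Two surface points on one line of direction \<open>b\<close> would have a secant in the cone.\<close>

lemma flow_inj:
  assumes "adapted S U \<phi> u0 n \<eta> r \<epsilon>" "inj_on \<phi> U" "b \<in> cone n \<eta>" "\<eta> > 0"
  shows "inj_on (flow \<phi> b) {y. pr y \<in> ball u0 r}"
proof (rule inj_onI, simp only: mem_Collect_eq)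
  fix x y assume xy: "pr x \<in> ball u0 r" "pr y \<in> ball u0 r" and eq: "flow \<phi> b x = flow \<phi> b y"
  let ?s = "y $ 3 - x $ 3"
  have d: "\<phi> (pr x) - \<phi> (pr y) = ?s *\<^sub>R b" using eq by (simp add: flow_def algebra_simps)
  have "\<bar>(\<phi> (pr x) - \<phi> (pr y)) \<bullet> n\<bar> \<le> \<eta> * norm n * norm (\<phi> (pr x) - \<phi> (pr y))"
    using assms(1) xy by (simp add: adapted_def)
  then have le: "\<bar>?s\<bar> * \<bar>b \<bullet> n\<bar> \<le> \<bar>?s\<bar> * (\<eta> * norm n * norm b)"
    unfolding d by (simp add: abs_mult mult_ac)
  have "\<bar>b \<bullet> n\<bar> > \<eta> * norm n * norm b" using assms(3) by (simp add: cone_def)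
  then have "?s = 0" using le by (meson abs_le_zero_iff linorder_not_le mult_le_cancel_left_pos not_less_iff_gr_or_eq abs_not_less_zero)
  then have "\<phi> (pr x) = \<phi> (pr y)" using d by simp
  moreover have "pr x \<in> U" "pr y \<in> U" using xy assms(1) by (auto simp: adapted_def)
  ultimately have "pr x = pr y" using assms(2) by (auto dest: inj_onD)
  then show "x = y" using \<open>?s = 0\<close> up_pr[of x] up_pr[of y] by simp
qed

lemma open_flow_dom: "open {y. pr y \<in> ball u0 r}"
proof -
  have "continuous_on UNIV pr" by (rule linear_continuous_on[OF bounded_linear_pr])
  then have "open (pr -` ball u0 r)" by (rule open_vimage[OF open_ball])
  then show ?thesis by (simp add: vimage_def)
qed

lemma normal_in_cone: "n \<noteq> 0 \<Longrightarrow> \<eta> < 1 \<Longrightarrow> n \<in> cone n \<eta>"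
proof -
  assume "n \<noteq> 0" "\<eta> < 1"
  then have "\<eta> * (norm n)^2 < 1 * (norm n)^2" by (intro mult_strict_right_mono) auto
  then show ?thesis by (simp add: cone_def power2_norm_eq_inner[symmetric] power2_eq_square mult.assoc)
qed

definition transit :: "(real^2) set \<Rightarrow> (real^2 \<Rightarrow> real^3) \<Rightarrow> (real^2 \<Rightarrow> real^3) \<Rightarrow> real^2 \<Rightarrow> real^2" where
  "transit V \<psi> \<phi> u = inv_into V \<psi> (\<phi> u)"

text \<open>The flow along the normal is a local diffeomorphism of three-space. Its inverse, composed
with the projection that forgets the time, extends the inverse of \<open>\<psi>\<close> to a differentiable map on a
neighborhood in three-space.\<close>

lemma transit_differentiable:
  assumes P: "C1_patch S U \<phi>" and Q: "C1_patch S V \<psi>" and u: "u \<in> U" "\<phi> u \<in> \<psi> ` V"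
  shows "\<exists>D. (transit V \<psi> \<phi> has_derivative D) (at u)"
proof -
  obtain v where v: "v \<in> V" "\<phi> u = \<psi> v" using u by blast
  let ?n = "patch_normal \<psi> v"
  have n0: "?n \<noteq> 0" by (rule patch_normal_nonzero[OF Q v(1)])
  obtain r \<epsilon> where ad: "adapted S V \<psi> v ?n (1/2) r \<epsilon>" using adapted_exists[OF Q v(1), of "1/2"] by auto
  let ?D = "{y. pr y \<in> ball v r}"
  have sub: "ball v r \<subseteq> V" using ad ball_subset_cball unfolding adapted_def by blast
  have nc: "?n \<in> cone ?n (1/2)" by (rule normal_in_cone[OF n0]) simp
  have inj: "inj_on (flow \<psi> ?n) ?D" by (rule flow_inj[OF ad patch_inj[OF Q] nc]) simp
  define H where "H = inv_into ?D (flow \<psi> ?n)"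
  define y0 where "y0 = up v 0"
  have y0: "y0 \<in> ?D" using ad by (simp add: y0_def adapted_def)
  let ?L = "flow_deriv \<psi> ?n y0"
  have Ld: "(flow \<psi> ?n has_derivative flow_deriv \<psi> ?n y) (at y)" if "y \<in> ?D" for y
    by (rule flow_has_derivative[OF C1_patch_map[OF Q]]) (use that sub in auto)
  have lin: "linear ?L" using Ld[OF y0] by (rule has_derivative_linear)
  have "det (matrix ?L) \<noteq> 0" using n0 by (simp add: flow_det y0_def)
  then have "invertible (matrix ?L)" by (simp add: invertible_det_nz)
  then obtain g where g: "?L \<circ> g = id" using matrix_invertible[OF lin] by blast
  have Hf: "H (flow \<psi> ?n y) = y" if "y \<in> ?D" for y
    unfolding H_def by (rule inv_into_f_f[OF inj that])
  have "(H has_derivative g) (at (flow \<psi> ?n y0))"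
    by (rule has_derivative_inverse_on[OF open_flow_dom Ld Hf g y0])
  moreover have fy0: "flow \<psi> ?n y0 = \<phi> u" by (simp add: flow_def y0_def v)
  ultimately have "(H has_derivative g) (at (\<phi> u))" by simp
  then have "((\<lambda>x. H (\<phi> x)) has_derivative (\<lambda>h. g (frechet_derivative \<phi> (at u) h))) (at u)"
    by (rule has_derivative_compose[OF patch_derivative_raw[OF P u(1)]])
  then have d: "((\<lambda>x. pr (H (\<phi> x))) has_derivative (\<lambda>h. pr (g (frechet_derivative \<phi> (at u) h)))) (at u)"
    by (rule bounded_linear.has_derivative[OF bounded_linear_pr])
  have "r > 0" using ad by (simp add: adapted_def)
  then obtain \<rho> where \<rho>: "\<rho> > 0" "\<And>x. x \<in> S \<Longrightarrow> dist x (\<psi> v) < \<rho> \<Longrightarrow> x \<in> \<psi> ` (V \<inter> ball v r)"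
    using patch_nbhd[OF Q v(1)] by blast
  have "isCont \<phi> u" by (rule has_derivative_continuous[OF patch_derivative_raw[OF P u(1)]])
  then obtain d1 where d1: "d1 > 0" "\<And>x. dist x u < d1 \<Longrightarrow> dist (\<phi> x) (\<phi> u) < \<rho>"
    using \<rho>(1) unfolding continuous_at_eps_delta by blast
  obtain d2 where d2: "d2 > 0" "ball u d2 \<subseteq> U" using patch_open[OF P] u(1) open_contains_ball by blast
  have eq: "pr (H (\<phi> x)) = transit V \<psi> \<phi> x" if "x \<in> ball u (min d1 d2)" for x
  proof -
    have "x \<in> U" "dist x u < d1" using that d2 by (auto simp: dist_commute)
    then have "\<phi> x \<in> \<psi> ` (V \<inter> ball v r)" using patch_sub[OF P] d1(2) v(2) by (intro \<rho>(2)) auto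
    then obtain w where w: "w \<in> V" "w \<in> ball v r" "\<phi> x = \<psi> w" by blast
    have "H (flow \<psi> ?n (up w 0)) = up w 0" unfolding H_def by (rule inv_into_f_f[OF inj]) (use w in simp)
    then have "H (\<phi> x) = up w 0" using w by (simp add: flow_def)
    moreover have "transit V \<psi> \<phi> x = w" unfolding transit_def w(3) by (rule inv_into_f_f[OF patch_inj[OF Q] w(1)])
    ultimately show ?thesis by simp
  qed
  have "(transit V \<psi> \<phi> has_derivative (\<lambda>h. pr (g (frechet_derivative \<phi> (at u) h)))) (at u)"
    by (rule has_derivative_transform_within_open[OF d, of "ball u (min d1 d2)"]) (use d1 d2 eq in auto)
  then show ?thesis by blast
qed

text \<open>The first fundamental forms of the two parametrizations are congruent by the derivative of
the transition map.\<close>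

lemma area_density_transit:
  assumes P: "C1_patch S U \<phi>" and Q: "C1_patch S V \<psi>" and u: "u \<in> U" "\<phi> u \<in> \<psi> ` V"
    and D: "(transit V \<psi> \<phi> has_derivative D) (at u)"
  shows "area_density G \<phi> u = \<bar>det (matrix D)\<bar> * area_density G \<psi> (transit V \<psi> \<phi> u)"
proof -
  let ?v = "transit V \<psi> \<phi> u"
  have v: "?v \<in> V" "\<psi> ?v = \<phi> u" using u(2) by (auto simp: transit_def inv_into_into f_inv_into_f)
  have "((\<lambda>x. \<psi> (transit V \<psi> \<phi> x)) has_derivative (\<lambda>h. D h $ 1 *\<^sub>R pd 1 \<psi> ?v + D h $ 2 *\<^sub>R pd 2 \<psi> ?v)) (at u)"
    by (rule has_derivative_compose[OF D patch_derivative[OF Q v(1)]])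
  moreover obtain T where T: "open T" "\<psi> ` V = S \<inter> T"
    using patch_openin[OF Q patch_open[OF Q] order_refl] by (auto simp: openin_open)
  have "open (U \<inter> \<phi> -` T)" using continuous_open_preimage[OF patch_continuous[OF P] patch_open[OF P] T(1)] by (simp add: Int_commute)
  moreover have "u \<in> U \<inter> \<phi> -` T" using u T(2) by auto
  moreover have "\<psi> (transit V \<psi> \<phi> x) = \<phi> x" if "x \<in> U \<inter> \<phi> -` T" for x
    unfolding transit_def by (rule f_inv_into_f) (use that T(2) patch_sub[OF P] in auto)
  ultimately have "(\<phi> has_derivative (\<lambda>h. D h $ 1 *\<^sub>R pd 1 \<psi> ?v + D h $ 2 *\<^sub>R pd 2 \<psi> ?v)) (at u)"
    by (rule has_derivative_transform_within_open)
  then have pe: "pd a \<phi> u = D (axis a 1) $ 1 *\<^sub>R pd 1 \<psi> ?v + D (axis a 1) $ 2 *\<^sub>R pd 2 \<psi> ?v" for a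
    by (rule pd_eqI)
  let ?X = "\<lambda>a b. pd a \<psi> ?v \<bullet> (G (\<psi> ?v) *v pd b \<psi> ?v)"
  let ?m = "\<lambda>k a. D (axis a 1) $ k"
  have "pd a \<phi> u \<bullet> (G (\<phi> u) *v pd b \<phi> u) = ?m 1 a * ?m 1 b * ?X 1 1 + ?m 1 a * ?m 2 b * ?X 1 2 + ?m 2 a * ?m 1 b * ?X 2 1 + ?m 2 a * ?m 2 b * ?X 2 2" for a b
    unfolding pe v(2) by (simp add: inner_add_left inner_add_right matrix_vector_right_distrib matrix_vector_mult_scaleR algebra_simps)
  then have "det (\<chi> a b. pd a \<phi> u \<bullet> (G (\<phi> u) *v pd b \<phi> u) :: real^2^2) = (det (matrix D))\<^sup>2 * det (\<chi> a b. ?X a b :: real^2^2)"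
    unfolding det_2 matrix_def by (simp only: vec_lambda_beta) (simp add: power2_eq_square algebra_simps)
  then show ?thesis unfolding area_density_def by (simp add: real_sqrt_mult)
qed

section \<open>The area measure of a compact surface\<close>

lemma nn_integral_abs_integrable:
  fixes F :: "'a::euclidean_space \<Rightarrow> real"
  assumes "(\<lambda>x. indicator A x *\<^sub>R F x) \<in> borel_measurable borel" "\<And>x. F x \<ge> 0"
  shows "(\<integral>\<^sup>+x\<in>A. ennreal (F x) \<partial>lborel) = (if F absolutely_integrable_on A then ennreal (integral A F) else \<infinity>)"
proof -
  let ?f = "\<lambda>x. indicator A x *\<^sub>R F x"
  have m: "?f \<in> borel_measurable lborel" using assms(1) by simp
  have nn: "(\<integral>\<^sup>+x\<in>A. ennreal (F x) \<partial>lborel) = (\<integral>\<^sup>+x. ennreal (?f x) \<partial>lborel)"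
    by (intro nn_integral_cong) (auto simp: indicator_def)
  have iff: "F absolutely_integrable_on A \<longleftrightarrow> integrable lborel ?f"
    unfolding set_integrable_def by (rule integrable_completion[OF m])
  show ?thesis
  proof (cases "F absolutely_integrable_on A")
    case True
    then have "(\<integral>\<^sup>+x. ennreal (?f x) \<partial>lborel) = ennreal (integral\<^sup>L lborel ?f)"
      using iff assms(2) by (intro nn_integral_eq_integral) auto
    also have "integral\<^sup>L lborel ?f = integral\<^sup>L lebesgue ?f" by (rule integral_completion[OF m, symmetric])
    also have "\<dots> = integral A F" using set_lebesgue_integral_eq_integral(2)[OF True] by (simp add: set_lebesgue_integral_def)
    finally show ?thesis using True nn by simp
  next
    case False
    have "(\<integral>\<^sup>+x. ennreal (?f x) \<partial>lborel) = \<infinity>"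
    proof (rule ccontr)
      assume "\<not> ?thesis"
      then have "(\<integral>\<^sup>+x. ennreal (?f x) \<partial>lborel) < \<infinity>" by (simp add: less_top)
      then have "integrable lborel ?f" using m assms(2) by (intro integrableI_nonneg) auto
      then show False using False iff by simp
    qed
    then show ?thesis using False nn by simp
  qed
qed

text \<open>Scalar form of the change of variables formula, which is stated for vector-valued
functions.\<close>

lemma change_of_variables_scalar:
  fixes f :: "real^'m::{finite,wellorder} \<Rightarrow> real" and g :: "real^'m::_ \<Rightarrow> real^'m::_"
  assumes "S \<in> sets lebesgue"
    and "\<And>x. x \<in> S \<Longrightarrow> (g has_derivative g' x) (at x within S)"
    and "inj_on g S"
  shows "(\<lambda>x. \<bar>det (matrix (g' x))\<bar> * f (g x)) absolutely_integrable_on S \<and>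
           integral S (\<lambda>x. \<bar>det (matrix (g' x))\<bar> * f (g x)) = b
     \<longleftrightarrow> f absolutely_integrable_on (g ` S) \<and> integral (g ` S) f = b"
proof -
  let ?v = "vec :: real \<Rightarrow> real^1"
  have i: "h absolutely_integrable_on A \<and> integral A h = b \<longleftrightarrow>
      (\<lambda>x. ?v (h x)) absolutely_integrable_on A \<and> integral A (\<lambda>x. ?v (h x)) = ?v b" for h :: "real^'m::{finite,wellorder} \<Rightarrow> real" and A
    unfolding absolutely_integrable_on_1_iff integral_on_1_eq by simp
  show ?thesis unfolding i
    using has_absolute_integral_change_of_variables[OF assms, of "\<lambda>x. ?v (f x)" "?v b"]
    by (simp add: vec_cmul scalar_mult_eq_scaleR)
qed

lemma continuous_on_area_density:
  assumes P: "C1_patch S U \<phi>" and G: "continuous_on S G"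
  shows "continuous_on U (area_density G \<phi>)"
proof -
  have "continuous_on U (\<lambda>u. G (\<phi> u))"
    by (rule continuous_on_compose2[OF G patch_continuous[OF P] patch_sub[OF P]])
  then show ?thesis unfolding area_density_def[abs_def] det_2 vec_lambda_beta inner_vec_def matrix_vector_mult_def
    by (auto intro!: continuous_intros patch_pd_continuous[OF P])
qed

lemma indicator_measurable_open:
  fixes f :: "'a::euclidean_space \<Rightarrow> 'b::euclidean_space"
  assumes "open U" "continuous_on U f" "E \<in> sets borel"
  shows "{u \<in> U. f u \<in> E} \<in> sets borel"
proof -
  have "f \<in> borel_measurable (restrict_space borel U)"
    by (rule borel_measurable_continuous_on_restrict[OF assms(2)])
  then have "f -` E \<inter> U \<in> sets (restrict_space borel U)" using assms(3)
    by (auto dest: measurable_sets simp: space_restrict_space)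
  then have "f -` E \<inter> U \<in> sets borel" using assms(1) by (simp add: sets_restrict_space_iff)
  moreover have "f -` E \<inter> U = {u \<in> U. f u \<in> E}" by auto
  ultimately show ?thesis by simp
qed

lemma density_on_measurable:
  fixes f :: "'a::euclidean_space \<Rightarrow> real"
  assumes "open U" "continuous_on U f" "A \<in> sets borel" "A \<subseteq> U"
  shows "(\<lambda>x. indicator A x *\<^sub>R f x) \<in> borel_measurable borel"
proof -
  have "(\<lambda>x. indicator U x *\<^sub>R f x) \<in> borel_measurable borel"
    by (rule borel_measurable_continuous_on_indicator) (use assms in auto)
  then have "(\<lambda>x. indicator A x *\<^sub>R (indicator U x *\<^sub>R f x)) \<in> borel_measurable borel"
    using assms(3) by measurable
  moreover have "indicator A x *\<^sub>R (indicator U x *\<^sub>R f x) = indicator A x *\<^sub>R f x" for x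
    using assms(4) by (auto simp: indicator_def)
  ultimately show ?thesis by (simp only:)
qed

abbreviation patch_content :: "field2 \<Rightarrow> (real^2) set \<Rightarrow> (real^2 \<Rightarrow> real^3) \<Rightarrow> (real^3) set \<Rightarrow> ennreal" where
  "patch_content G U \<phi> E \<equiv> \<integral>\<^sup>+u\<in>U. indicator E (\<phi> u) * ennreal (area_density G \<phi> u) \<partial>lborel"

lemma patch_content_eq: "patch_content G U \<phi> E = (\<integral>\<^sup>+u\<in>{u\<in>U. \<phi> u \<in> E}. ennreal (max 0 (area_density G \<phi> u)) \<partial>lborel)"
  by (rule nn_integral_cong) (auto simp: indicator_def max_def ennreal_neg)

text \<open>Change of variables by the transition map: on the overlap of two patches both
parametrizations define the same area.\<close>

lemma patch_content_compatible:
  assumes P: "C1_patch S U \<phi>" and Q: "C1_patch S V \<psi>" and G: "continuous_on S G" and E: "E \<in> sets borel"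
  shows "patch_content G U \<phi> (E \<inter> \<psi> ` V) = patch_content G V \<psi> (E \<inter> \<phi> ` U)"
proof -
  obtain T where T: "open T" "\<psi> ` V = S \<inter> T"
    using patch_openin[OF Q patch_open[OF Q] order_refl] by (auto simp: openin_open)
  obtain T' where T': "open T'" "\<phi> ` U = S \<inter> T'"
    using patch_openin[OF P patch_open[OF P] order_refl] by (auto simp: openin_open)
  define A where "A = {u \<in> U. \<phi> u \<in> E \<inter> \<psi> ` V}"
  define B where "B = {v \<in> V. \<psi> v \<in> E \<inter> \<phi> ` U}"
  let ?T = "transit V \<psi> \<phi>"
  have Aeq: "A = {u \<in> U. \<phi> u \<in> E \<inter> T}" unfolding A_def T(2) using patch_sub[OF P] by auto
  have Beq: "B = {v \<in> V. \<psi> v \<in> E \<inter> T'}" unfolding B_def T'(2) using patch_sub[OF Q] by auto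
  have A: "A \<in> sets borel" unfolding Aeq
    by (rule indicator_measurable_open[OF patch_open[OF P] patch_continuous[OF P]]) (use E T in auto)
  have B: "B \<in> sets borel" unfolding Beq
    by (rule indicator_measurable_open[OF patch_open[OF Q] patch_continuous[OF Q]]) (use E T' in auto)
  have TT: "?T u \<in> V" "\<psi> (?T u) = \<phi> u" if "u \<in> A" for u
    using that by (auto simp: A_def transit_def inv_into_into f_inv_into_f)
  have TA: "?T ` A = B"
  proof
    show "?T ` A \<subseteq> B" using TT by (auto simp: A_def B_def)
    show "B \<subseteq> ?T ` A"
    proof
      fix v assume "v \<in> B"
      then obtain u where u: "u \<in> U" "\<psi> v = \<phi> u" "v \<in> V" "\<psi> v \<in> E" by (auto simp: B_def)
      then have "u \<in> A" by (force simp: A_def)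
      moreover have "?T u = v" unfolding transit_def u(2)[symmetric] by (rule inv_into_f_f[OF patch_inj[OF Q] u(3)])
      ultimately show "v \<in> ?T ` A" by blast
    qed
  qed
  have inj: "inj_on ?T A"
  proof (rule inj_onI)
    fix x y assume "x \<in> A" "y \<in> A" "?T x = ?T y"
    then have "\<phi> x = \<phi> y" using TT by metis
    then show "x = y" using \<open>x \<in> A\<close> \<open>y \<in> A\<close> patch_inj[OF P] by (auto simp: A_def dest: inj_onD)
  qed
  have "\<forall>u\<in>A. \<exists>D. (?T has_derivative D) (at u)"
    using transit_differentiable[OF P Q] by (auto simp: A_def)
  then obtain D where D: "\<And>u. u \<in> A \<Longrightarrow> (?T has_derivative D u) (at u)" by metis
  let ?f = "\<lambda>u. max 0 (area_density G \<phi> u)" and ?h = "\<lambda>v. max 0 (area_density G \<psi> v)"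
  have fh: "?f u = \<bar>det (matrix (D u))\<bar> * ?h (?T u)" if "u \<in> A" for u
  proof -
    have "area_density G \<phi> u = \<bar>det (matrix (D u))\<bar> * area_density G \<psi> (?T u)"
      by (rule area_density_transit[OF P Q _ _ D[OF that]]) (use that in \<open>auto simp: A_def\<close>)
    then show ?thesis by (simp add: max_mult_distrib_left max_def zero_le_mult_iff mult_le_0_iff)
  qed
  have cv: "(\<lambda>x. \<bar>det (matrix (D x))\<bar> * ?h (?T x)) absolutely_integrable_on A \<and>
           integral A (\<lambda>x. \<bar>det (matrix (D x))\<bar> * ?h (?T x)) = b
     \<longleftrightarrow> ?h absolutely_integrable_on (?T ` A) \<and> integral (?T ` A) ?h = b" for b
    by (rule change_of_variables_scalar[OF _ has_derivative_at_withinI[OF D] inj])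
      (use A sets_completionI_sets in auto)
  have i1: "(\<lambda>x. \<bar>det (matrix (D x))\<bar> * ?h (?T x)) absolutely_integrable_on A \<longleftrightarrow> ?f absolutely_integrable_on A"
    by (rule set_integrable_cong) (auto simp: fh)
  have i2: "integral A (\<lambda>x. \<bar>det (matrix (D x))\<bar> * ?h (?T x)) = integral A ?f"
    by (rule integral_cong) (auto simp: fh)
  have "(\<integral>\<^sup>+u\<in>A. ennreal (?f u) \<partial>lborel) = (if ?f absolutely_integrable_on A then ennreal (integral A ?f) else \<infinity>)"
    by (rule nn_integral_abs_integrable, rule density_on_measurable[OF patch_open[OF P]])
       (use A continuous_on_area_density[OF P G] in \<open>auto simp: A_def intro!: continuous_intros\<close>)
  also have "\<dots> = (if ?h absolutely_integrable_on B then ennreal (integral B ?h) else \<infinity>)"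
    using cv unfolding i1 i2 TA by (metis (full_types))
  also have "\<dots> = (\<integral>\<^sup>+v\<in>B. ennreal (?h v) \<partial>lborel)"
    by (rule nn_integral_abs_integrable[symmetric], rule density_on_measurable[OF patch_open[OF Q]])
       (use B continuous_on_area_density[OF Q G] in \<open>auto simp: B_def intro!: continuous_intros\<close>)
  finally show ?thesis unfolding patch_content_eq A_def B_def .
qed

text \<open>The default value \<open>0\<close> outside of \<open>U\<close> carries no mass, since the density vanishes
there.\<close>

definition patch_measure :: "field2 \<Rightarrow> (real^2) set \<Rightarrow> (real^2 \<Rightarrow> real^3) \<Rightarrow> (real^3) measure" where
  "patch_measure G U \<phi> = distr (density lborel (\<lambda>u. ennreal (indicator U u *\<^sub>R area_density G \<phi> u))) borel (\<lambda>u. if u \<in> U then \<phi> u else 0)"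

lemma emeasure_patch_measure:
  assumes P: "C1_patch S U \<phi>" and G: "continuous_on S G" and E: "E \<in> sets borel"
  shows "emeasure (patch_measure G U \<phi>) E = patch_content G U \<phi> E"
proof -
  have U: "U \<in> sets borel" using patch_open[OF P] by simp
  have m1: "(\<lambda>u. if u \<in> U then \<phi> u else 0) \<in> borel_measurable borel"
    by (rule borel_measurable_continuous_on_if[OF U patch_continuous[OF P]]) simp
  have m2: "(\<lambda>u. indicator U u *\<^sub>R area_density G \<phi> u) \<in> borel_measurable borel"
    by (rule density_on_measurable[OF patch_open[OF P] continuous_on_area_density[OF P G] U]) simp
  have m3: "(\<lambda>u. if u \<in> U then \<phi> u else 0) -` E \<in> sets borel"
    using measurable_sets[OF m1 E] by simp
  have "emeasure (patch_measure G U \<phi>) E = (\<integral>\<^sup>+u. ennreal (indicator U u *\<^sub>R area_density G \<phi> u) * indicator ((\<lambda>u. if u \<in> U then \<phi> u else 0) -` E) u \<partial>lborel)"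
    unfolding patch_measure_def using m1 m2 m3 E
    by (subst emeasure_distr) (auto simp: emeasure_density)
  also have "\<dots> = patch_content G U \<phi> E"
    by (intro nn_integral_cong) (auto simp: indicator_def)
  finally show ?thesis .
qed

lemma sets_patch_measure [simp]: "sets (patch_measure G U \<phi>) = sets borel"
  by (simp add: patch_measure_def)

text \<open>The property whose unique solution \<open>area_measure\<close> is by definition.\<close>

definition is_area_measure :: "field2 \<Rightarrow> (real^3) set \<Rightarrow> (real^3) measure \<Rightarrow> bool" where
  "is_area_measure G S \<mu> \<longleftrightarrow> sets \<mu> = sets borel \<and> emeasure \<mu> (- S) = 0 \<and>
  (\<forall>U \<phi>. C1_patch S U \<phi> \<longrightarrow> (\<forall>E\<in>sets borel. emeasure \<mu> (E \<inter> \<phi> ` U) = patch_content G U \<phi> E))"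

lemma patch_image_borel:
  assumes "C1_patch S U \<phi>" "closed S" shows "\<phi> ` U \<in> sets borel"
proof -
  obtain T where "open T" "\<phi> ` U = S \<inter> T"
    using patch_openin[OF assms(1) patch_open[OF assms(1)] order_refl] by (auto simp: openin_open)
  then show ?thesis using assms(2) by auto
qed

lemma finite_patch_cover:
  assumes "C1_surface S" "compact S"
    and R: "\<And>x U \<phi>. C1_patch S U \<phi> \<Longrightarrow> x \<in> \<phi> ` U \<Longrightarrow> \<exists>V \<psi>. C1_patch S V \<psi> \<and> x \<in> \<psi> ` V \<and> R V \<psi>"
  shows "\<exists>(n::nat) U \<phi>. (\<forall>i<n. C1_patch S (U i) (\<phi> i) \<and> R (U i) (\<phi> i)) \<and> S = (\<Union>i<n. \<phi> i ` U i)"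
proof -
  have "\<forall>x\<in>S. \<exists>p. C1_patch S (fst p) (snd p) \<and> x \<in> snd p ` fst p \<and> R (fst p) (snd p)"
    using assms(1) R unfolding C1_surface_def by (metis fst_conv snd_conv)
  then obtain p where p: "\<And>x. x \<in> S \<Longrightarrow> C1_patch S (fst (p x)) (snd (p x)) \<and> x \<in> snd (p x) ` fst (p x) \<and> R (fst (p x)) (snd (p x))"
    by metis
  have "\<exists>T. open T \<and> snd (p x) ` fst (p x) = S \<inter> T" if "x \<in> S" for x
  proof -
    have P: "C1_patch S (fst (p x)) (snd (p x))" using p[OF that] by simp
    show ?thesis using patch_openin[OF P patch_open[OF P] order_refl] by (auto simp: openin_open)
  qed
  then obtain T where T: "\<And>x. x \<in> S \<Longrightarrow> open (T x) \<and> snd (p x) ` fst (p x) = S \<inter> T x" by metis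
  have "S \<subseteq> (\<Union>x\<in>S. T x)" using p T by blast
  then obtain C where C: "C \<subseteq> S" "finite C" "S \<subseteq> (\<Union>x\<in>C. T x)"
    using compactE_image[OF assms(2), of S T] T by blast
  obtain f where f: "C = f ` {i::nat. i < card C}" using C(2) finite_imp_nat_seg_image_inj_on[OF C(2)] by (metis card_Collect_less_nat card_image)
  have "S = (\<Union>i<card C. snd (p (f i)) ` fst (p (f i)))"
  proof
    show "S \<subseteq> (\<Union>i<card C. snd (p (f i)) ` fst (p (f i)))"
    proof
      fix y assume y: "y \<in> S"
      then obtain x where x: "x \<in> C" "y \<in> T x" using C(3) by blast
      then obtain i where "i < card C" "x = f i" using f by auto
      moreover have "y \<in> snd (p x) ` fst (p x)" using T[of x] x y C(1) by auto
      ultimately show "y \<in> (\<Union>i<card C. snd (p (f i)) ` fst (p (f i)))" by auto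
    qed
    show "(\<Union>i<card C. snd (p (f i)) ` fst (p (f i))) \<subseteq> S"
      using T C(1) f by auto
  qed
  moreover have "\<forall>i<card C. C1_patch S (fst (p (f i))) (snd (p (f i))) \<and> R (fst (p (f i))) (snd (p (f i)))"
    using p C(1) f by blast
  ultimately show ?thesis by (intro exI[of _ "card C"] exI[of _ "\<lambda>i. fst (p (f i))"] exI[of _ "\<lambda>i. snd (p (f i))"]) auto
qed

text \<open>Finitely many patches cover the surface; making their images disjoint gives Borel pieces
on each of which one parametrization suffices.\<close>

lemma patch_partition:
  assumes S: "C1_surface S" "compact S"
  shows "\<exists>(n::nat) U \<phi> C. (\<forall>i<n. C1_patch S (U i) (\<phi> i) \<and> C i \<in> sets borel \<and> C i \<subseteq> \<phi> i ` U i) \<and>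
     disjoint_family C \<and> S = (\<Union>i<n. C i)"
proof -
  obtain n :: nat and U \<phi> where P: "\<And>i. i < n \<Longrightarrow> C1_patch S (U i) (\<phi> i)" and Seq: "S = (\<Union>i<n. \<phi> i ` U i)"
    using finite_patch_cover[OF S, of "\<lambda>_ _. True"] by blast
  define A where "A i = (if i < n then \<phi> i ` U i else {})" for i
  have cl: "closed S" using S(2) by (rule compact_imp_closed)
  have A: "A i \<in> sets borel" for i unfolding A_def using patch_image_borel[OF P cl] by auto
  have C: "disjointed A i \<in> sets borel" for i unfolding disjointed_def using A by (intro sets.Diff sets.finite_UN) auto
  have sub: "disjointed A i \<subseteq> A i" for i by (rule disjointed_subset)
  have "S = (\<Union>i. A i)" unfolding Seq A_def by (auto split: if_splits)
  also have "\<dots> = (\<Union>i. disjointed A i)" by (rule UN_disjointed_eq[symmetric])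
  also have "\<dots> = (\<Union>i<n. disjointed A i)"
  proof -
    have "disjointed A i = {}" if "\<not> i < n" for i using sub[of i] that by (simp add: A_def)
    then show ?thesis by blast
  qed
  finally have "S = (\<Union>i<n. disjointed A i)" .
  then show ?thesis using P C sub disjoint_family_disjointed[of A]
    by (intro exI[of _ n] exI[of _ U] exI[of _ \<phi>] exI[of _ "disjointed A"]) (fastforce simp: A_def)
qed

text \<open>A measure of this kind is determined on the pieces of \<open>patch_partition\<close>.\<close>

lemma is_area_measure_unique:
  assumes S: "C1_surface S" "compact S" and \<mu>: "is_area_measure G S \<mu>" "is_area_measure G S \<nu>"
  shows "\<mu> = \<nu>"
proof -
  obtain n :: nat and U \<phi> C where P: "\<And>i. i < n \<Longrightarrow> C1_patch S (U i) (\<phi> i)"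
    and C: "\<And>i. i < n \<Longrightarrow> C i \<in> sets borel" "\<And>i. i < n \<Longrightarrow> C i \<subseteq> \<phi> i ` U i"
    and disj: "disjoint_family C" and Seq: "S = (\<Union>i<n. C i)"
    using patch_partition[OF S] by blast
  have eq: "emeasure \<mu> E = (\<Sum>i<n. patch_content G (U i) (\<phi> i) (E \<inter> C i))"
    if \<mu>: "is_area_measure G S \<mu>" and E: "E \<in> sets borel" for \<mu> E
  proof -
    have sets: "sets \<mu> = sets borel" and 0: "emeasure \<mu> (- S) = 0"
      and pm: "\<And>U \<phi> E. C1_patch S U \<phi> \<Longrightarrow> E \<in> sets borel \<Longrightarrow> emeasure \<mu> (E \<inter> \<phi> ` U) = patch_content G U \<phi> E"
      using \<mu> by (auto simp: is_area_measure_def)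
    have dj: "disjoint_family_on (\<lambda>i. E \<inter> C i) {..<n}"
      using disj unfolding disjoint_family_on_def by blast
    have "closed S" using S(2) by (rule compact_imp_closed)
    then have Sb: "S \<in> sets \<mu>" "- S \<in> sets \<mu>" using sets by auto
    have "emeasure \<mu> E = emeasure \<mu> (E \<inter> S) + emeasure \<mu> (E \<inter> - S)"
      using E Sb sets by (subst plus_emeasure) (auto intro!: arg_cong[where f="emeasure \<mu>"])
    also have "emeasure \<mu> (E \<inter> - S) = 0"
      using emeasure_mono[of "E \<inter> - S" "- S" \<mu>] Sb 0 by simp
    also have "E \<inter> S = (\<Union>i<n. E \<inter> C i)" using Seq by auto
    also have "emeasure \<mu> (\<Union>i<n. E \<inter> C i) = (\<Sum>i<n. emeasure \<mu> (E \<inter> C i))"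
      using C(1) E sets by (intro sum_emeasure[symmetric] dj) auto
    also have "\<dots> = (\<Sum>i<n. patch_content G (U i) (\<phi> i) (E \<inter> C i))"
    proof (rule sum.cong[OF refl])
      fix i assume "i \<in> {..<n}"
      then have i: "i < n" by simp
      have "E \<inter> C i = (E \<inter> C i) \<inter> \<phi> i ` U i" using C(2)[OF i] by auto
      then show "emeasure \<mu> (E \<inter> C i) = patch_content G (U i) (\<phi> i) (E \<inter> C i)"
        using pm[OF P[OF i], of "E \<inter> C i"] E C(1)[OF i] by auto
    qed
    finally show ?thesis by simp
  qed
  show ?thesis
    by (rule measure_eqI) (use \<mu> in \<open>auto simp: is_area_measure_def eq[OF \<mu>(1)] eq[OF \<mu>(2)]\<close>)
qed

text \<open>The sum of the measures of the pieces of \<open>patch_partition\<close>. It has the right value on the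
image of every patch because of \<open>patch_content_compatible\<close>.\<close>

lemma area_measure_exists:
  assumes S: "C1_surface S" "compact S" and G: "continuous_on S G"
  shows "\<exists>\<mu>. is_area_measure G S \<mu>"
proof -
  obtain n :: nat and U \<phi> C where P: "\<And>i. i < n \<Longrightarrow> C1_patch S (U i) (\<phi> i)"
    and C: "\<And>i. i < n \<Longrightarrow> C i \<in> sets borel" "\<And>i. i < n \<Longrightarrow> C i \<subseteq> \<phi> i ` U i"
    and disj: "disjoint_family C" and Seq: "S = (\<Union>i<n. C i)"
    using patch_partition[OF S] by blast
  define m where "m E = (\<Sum>i<n. patch_content G (U i) (\<phi> i) (E \<inter> C i))" for E
  define \<mu> where "\<mu> = measure_of UNIV (sets borel) m"
  have m_eq: "m E = (\<Sum>i<n. emeasure (patch_measure G (U i) (\<phi> i)) (E \<inter> C i))" if "E \<in> sets borel" for E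
    unfolding m_def using C that by (intro sum.cong refl) (simp add: emeasure_patch_measure[OF P G])
  have ca: "countably_additive (sets borel) m"
    unfolding countably_additive_def
  proof (intro allI impI)
    fix F :: "nat \<Rightarrow> (real^3) set" assume F: "range F \<subseteq> sets borel" "disjoint_family F" "\<Union> (range F) \<in> sets borel"
    have "(\<Sum>k. m (F k)) = (\<Sum>k. \<Sum>i<n. emeasure (patch_measure G (U i) (\<phi> i)) (F k \<inter> C i))"
      using F(1) by (intro suminf_cong m_eq) auto
    also have "\<dots> = (\<Sum>i<n. \<Sum>k. emeasure (patch_measure G (U i) (\<phi> i)) (F k \<inter> C i))"
      by (rule suminf_sum) simp
    also have "\<dots> = (\<Sum>i<n. emeasure (patch_measure G (U i) (\<phi> i)) (\<Union>k. F k \<inter> C i))"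
      using F C(1) by (intro sum.cong refl suminf_emeasure) (auto simp: disjoint_family_on_def)
    also have "\<dots> = m (\<Union> (range F))" using m_eq[OF F(3)] by simp
    finally show "(\<Sum>k. m (F k)) = m (\<Union> (range F))" .
  qed
  have em: "emeasure \<mu> E = m E" if "E \<in> sets borel" for E
    unfolding \<mu>_def by (rule emeasure_measure_of_sigma[OF _ _ ca that])
      (auto simp: positive_def m_def sets.sigma_algebra_axioms[of borel, simplified])
  have sets: "sets \<mu> = sets borel" unfolding \<mu>_def
    by (simp add: sets.sigma_sets_eq[of borel, simplified] sets_measure_of_conv)
  have cl: "closed S" using S(2) by (rule compact_imp_closed)
  have "is_area_measure G S \<mu>" unfolding is_area_measure_def
  proof (intro conjI allI impI ballI sets)
    have CS: "- S \<inter> C i = {}" if "i < n" for i using Seq that by auto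
    have "m (- S) = 0" unfolding m_def using CS by (auto intro!: sum.neutral)
    then show "emeasure \<mu> (- S) = 0" using em[of "- S"] cl by simp
    fix V \<psi> and E :: "(real^3) set" assume Q: "C1_patch S V \<psi>" and E: "E \<in> sets borel"
    have dj: "disjoint_family_on (\<lambda>i. E \<inter> C i) {..<n}"
      using disj unfolding disjoint_family_on_def by blast
    have VE: "E \<inter> \<psi> ` V \<in> sets borel" using E patch_image_borel[OF Q cl] by auto
    have "emeasure \<mu> (E \<inter> \<psi> ` V) = (\<Sum>i<n. patch_content G (U i) (\<phi> i) ((E \<inter> C i) \<inter> \<psi> ` V))"
      unfolding em[OF VE] m_def by (intro sum.cong refl) (simp add: Int_ac)
    also have "\<dots> = (\<Sum>i<n. patch_content G V \<psi> ((E \<inter> C i) \<inter> \<phi> i ` U i))"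
      by (intro sum.cong refl patch_content_compatible[OF P Q G]) (use E C(1) in auto)
    also have "\<dots> = (\<Sum>i<n. patch_content G V \<psi> (E \<inter> C i))"
    proof (intro sum.cong refl)
      fix i assume "i \<in> {..<n}"
      then have "(E \<inter> C i) \<inter> \<phi> i ` U i = E \<inter> C i" using C(2) by auto
      then show "patch_content G V \<psi> ((E \<inter> C i) \<inter> \<phi> i ` U i) = patch_content G V \<psi> (E \<inter> C i)" by simp
    qed
    also have "\<dots> = (\<Sum>i<n. emeasure (patch_measure G V \<psi>) (E \<inter> C i))"
      using E C(1) by (intro sum.cong refl) (simp add: emeasure_patch_measure[OF Q G])
    also have "\<dots> = emeasure (patch_measure G V \<psi>) (\<Union>i<n. E \<inter> C i)"
      using C(1) E by (intro sum_emeasure dj) auto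
    also have "(\<Union>i<n. E \<inter> C i) = E \<inter> S" using Seq by auto
    also have "emeasure (patch_measure G V \<psi>) (E \<inter> S) = patch_content G V \<psi> (E \<inter> S)"
      using E cl by (intro emeasure_patch_measure[OF Q G]) auto
    also have "\<dots> = patch_content G V \<psi> E"
      using patch_sub[OF Q] by (intro nn_integral_cong) (auto simp: indicator_def)
    finally show "emeasure \<mu> (E \<inter> \<psi> ` V) = patch_content G V \<psi> E" .
  qed
  then show ?thesis by blast
qed

lemma area_measure_is_area_measure:
  assumes S: "C1_surface S" "compact S" and G: "continuous_on S G"
  shows "is_area_measure G S (area_measure G S)"
proof -
  have "\<exists>!\<mu>. is_area_measure G S \<mu>"
    using area_measure_exists[OF assms] is_area_measure_unique[OF S] by blast
  then have "is_area_measure G S (THE \<mu>. is_area_measure G S \<mu>)" by (rule theI')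
  then show ?thesis unfolding area_measure_def is_area_measure_def .
qed

lemma C1_patch_restrict:
  assumes P: "C1_patch S U \<phi>" and V: "open V" "V \<subseteq> U"
  shows "C1_patch S V \<phi>"
proof -
  obtain \<psi> where h: "homeomorphism U (\<phi> ` U) \<phi> \<psi>" using P by (auto simp: C1_patch_def)
  have "homeomorphism V (\<phi> ` V) \<phi> \<psi>"
    using h V(2) by (intro homeomorphism_of_subsets[OF h]) auto
  moreover have "Ck_on 1 \<phi> V" using P V(2) by (auto simp: C1_patch_def intro: continuous_on_subset)
  moreover have "\<forall>u\<in>V. inj (frechet_derivative \<phi> (at u))" using P V(2) by (auto simp: C1_patch_def)
  ultimately show ?thesis using V(1) patch_openin[OF P V] unfolding C1_patch_def by blast
qed

text \<open>Every point lies in a patch on which the area density is bounded; finitely many of them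
cover.\<close>

lemma area_measure_finite:
  assumes S: "C1_surface S" "compact S" and G: "continuous_on S G"
  shows "emeasure (area_measure G S) UNIV < \<infinity>"
proof -
  let ?\<mu> = "area_measure G S"
  have sets: "sets ?\<mu> = sets borel" and 0: "emeasure ?\<mu> (- S) = 0"
    and pm: "\<And>U \<phi> E. C1_patch S U \<phi> \<Longrightarrow> E \<in> sets borel \<Longrightarrow> emeasure ?\<mu> (E \<inter> \<phi> ` U) = patch_content G U \<phi> E"
    using area_measure_is_area_measure[OF assms] by (auto simp: is_area_measure_def)
  have cl: "closed S" using S(2) by (rule compact_imp_closed)
  have "\<exists>(n::nat) U \<phi>. (\<forall>i<n. C1_patch S (U i) (\<phi> i) \<and> patch_content G (U i) (\<phi> i) UNIV < \<infinity>) \<and> S = (\<Union>i<n. \<phi> i ` U i)"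
  proof (rule finite_patch_cover[OF S])
    fix x U \<phi> assume P: "C1_patch S U \<phi>" and "x \<in> \<phi> ` U"
    then obtain u where u: "u \<in> U" "x = \<phi> u" by blast
    obtain r where r: "r > 0" "cball u r \<subseteq> U" using patch_open[OF P] u(1) open_contains_cball by blast
    have bU: "ball u r \<subseteq> U" using r by (meson ball_subset_cball order_trans)
    have "compact (area_density G \<phi> ` cball u r)"
      by (intro compact_continuous_image continuous_on_subset[OF continuous_on_area_density[OF P G] r(2)] compact_cball)
    then obtain B where B: "\<forall>y\<in>area_density G \<phi> ` cball u r. norm y \<le> B"
      using compact_imp_bounded bounded_iff by metis
    have B': "ennreal (area_density G \<phi> v) \<le> ennreal B" if "v \<in> ball u r" for v
    proof (rule ennreal_leI)
      have "norm (area_density G \<phi> v) \<le> B" by (rule B[rule_format, OF imageI]) (use that in auto)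
      then show "area_density G \<phi> v \<le> B" by simp
    qed
    have "patch_content G (ball u r) \<phi> UNIV \<le> (\<integral>\<^sup>+v. ennreal B * indicator (ball u r) v \<partial>lborel)"
      using B' by (intro nn_integral_mono) (auto simp: indicator_def)
    also have "\<dots> = ennreal B * emeasure lborel (ball u r)" by (rule nn_integral_cmult_indicator) simp
    also have "\<dots> < \<infinity>" using emeasure_bounded_finite[OF bounded_ball, of u r] by (simp add: ennreal_mult_less_top)
    finally show "\<exists>V \<psi>. C1_patch S V \<psi> \<and> x \<in> \<psi> ` V \<and> patch_content G V \<psi> UNIV < \<infinity>"
      using C1_patch_restrict[OF P open_ball bU] r(1) u by (intro exI[of _ "ball u r"] exI[of _ \<phi>]) auto
  qed
  then obtain n :: nat and U \<phi> where P: "\<And>i. i < n \<Longrightarrow> C1_patch S (U i) (\<phi> i)"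
    and fin: "\<And>i. i < n \<Longrightarrow> patch_content G (U i) (\<phi> i) UNIV < \<infinity>" and Seq: "S = (\<Union>i<n. \<phi> i ` U i)" by blast
  have im: "\<phi> i ` U i \<in> sets ?\<mu>" if "i < n" for i using patch_image_borel[OF P[OF that] cl] sets by simp
  have "emeasure ?\<mu> UNIV \<le> emeasure ?\<mu> S + emeasure ?\<mu> (- S)"
    using emeasure_subadditive[of S ?\<mu> "- S"] cl sets by simp
  also have "emeasure ?\<mu> (- S) = 0" by (rule 0)
  also have "emeasure ?\<mu> S \<le> (\<Sum>i<n. emeasure ?\<mu> (\<phi> i ` U i))"
    unfolding Seq by (rule emeasure_subadditive_finite) (use im in \<open>auto simp flip: Seq\<close>)
  also have "\<dots> = (\<Sum>i<n. patch_content G (U i) (\<phi> i) UNIV)"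
    using pm[OF P, of _ UNIV] by (intro sum.cong refl) auto
  also have "\<dots> < \<infinity>" using fin by (simp add: ennreal_sum_less_top)
  finally show ?thesis by simp
qed

section \<open>Integrating a directional derivative over a flow box\<close>

definition C1_fun :: "(real^3 \<Rightarrow> real) \<Rightarrow> bool" where
  "C1_fun f \<longleftrightarrow> (\<forall>x. f differentiable at x) \<and> (\<forall>i. continuous_on UNIV (pd i f))"

definition dir_deriv :: "real^3 \<Rightarrow> (real^3 \<Rightarrow> real) \<Rightarrow> real^3 \<Rightarrow> real" where
  "dir_deriv b f x = (\<Sum>i\<in>UNIV. b $ i * pd i f x)"

lemma dir_deriv_continuous: "C1_fun f \<Longrightarrow> continuous_on UNIV (dir_deriv b f)"
  unfolding dir_deriv_def[abs_def] C1_fun_def by (intro continuous_on_sum continuous_on_mult_left) auto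

lemma C1_fun_continuous: "C1_fun f \<Longrightarrow> continuous_on UNIV f"
  unfolding C1_fun_def by (intro continuous_at_imp_continuous_on ballI differentiable_imp_continuous_within) auto

lemma dir_deriv_line:
  assumes "C1_fun f"
  shows "((\<lambda>t. f (x + t *\<^sub>R b)) has_real_derivative dir_deriv b f (x + t *\<^sub>R b)) (at t)"
proof -
  have 1: "((\<lambda>t. x + t *\<^sub>R b) has_derivative (\<lambda>h. h *\<^sub>R b)) (at t)"
    by (auto intro!: derivative_eq_intros)
  have 2: "(f has_derivative (\<lambda>h. \<Sum>i\<in>UNIV. h $ i * pd i f (x + t *\<^sub>R b))) (at (x + t *\<^sub>R b))"
    by (rule has_derivative_pd) (use assms in \<open>auto simp: C1_fun_def\<close>)
  have "((\<lambda>t. f (x + t *\<^sub>R b)) has_derivative (\<lambda>h. h * dir_deriv b f (x + t *\<^sub>R b))) (at t)"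
    using has_derivative_compose[OF 1 2] by (simp add: dir_deriv_def sum_distrib_left mult.assoc)
  then show ?thesis by (simp add: has_field_derivative_def mult_commute_abs)
qed

lemma continuous_on_up: "continuous_on UNIV (\<lambda>p. up (fst p) (snd p))"
proof -
  have eq: "up u t = (\<chi> i. if i = 1 then u $ 1 else if i = 2 then u $ 2 else t)" for u t
    by (simp add: vec_eq_iff forall_3)
  have "continuous_on UNIV (\<lambda>p. if i = 1 then fst p $ 1 else if i = 2 then fst p $ 2 else snd p)" for i :: 3
  proof (cases "i = 1 \<or> i = 2")
    case True
    then show ?thesis by (elim disjE) (simp_all add: continuous_on_component continuous_on_fst continuous_on_id)
  qed (simp add: continuous_on_snd continuous_on_id)
  then show ?thesis unfolding eq by (rule continuous_on_vec_lambda)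
qed

lemma up_measurable: "(\<lambda>(u, t). up u t) \<in> borel_measurable (lborel \<Otimes>\<^sub>M lborel)"
proof -
  have "(\<lambda>p. up (fst p) (snd p)) \<in> borel_measurable borel"
    by (rule borel_measurable_continuous_onI[OF continuous_on_up])
  then show ?thesis unfolding lborel_prod by (simp add: case_prod_beta')
qed

lemma prod_Basis_vec: "(\<Prod>b\<in>(Basis::(real^'n) set). f b) = (\<Prod>i\<in>UNIV. f (axis i 1))"
  unfolding Basis_vec_axis by (subst prod.reindex) (auto simp: inj_on_def axis_eq_axis)

lemma prod_3: "prod f (UNIV :: 3 set) = f 1 * f 2 * f 3"
  unfolding UNIV_3 by (simp add: ac_simps)

text \<open>Fubini's theorem for the splitting of three-space into a plane and a line.\<close>

lemma lborel_up: "lborel = distr (lborel \<Otimes>\<^sub>M lborel) borel (\<lambda>(u, t). up u t)"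
proof (rule lborel_eqI)
  fix l u :: "real^3" assume le: "\<And>b. b \<in> Basis \<Longrightarrow> l \<bullet> b \<le> u \<bullet> b"
  then have le': "l $ i \<le> u $ i" for i using le[of "axis i 1"] by (simp add: Basis_vec_axis inner_axis)
  have pre: "(\<lambda>(u, t). up u t) -` box l u = box (pr l) (pr u) \<times> box (l $ 3) (u $ 3)"
    by (auto simp: mem_box_cart forall_3 forall_2)
  have "emeasure (distr (lborel \<Otimes>\<^sub>M lborel) borel (\<lambda>(u, t). up u t)) (box l u) = emeasure (lborel \<Otimes>\<^sub>M lborel) (box (pr l) (pr u) \<times> box (l $ 3) (u $ 3))"
    using up_measurable by (subst emeasure_distr) (auto simp: pre space_pair_measure)
  also have "\<dots> = emeasure lborel (box (pr l) (pr u)) * emeasure lborel (box (l $ 3) (u $ 3))"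
    by (rule lborel.emeasure_pair_measure_Times) auto
  also have "emeasure lborel (box (l $ 3) (u $ 3)) = ennreal (u $ 3 - l $ 3)" using le' by simp
  also have "emeasure lborel (box (pr l) (pr u)) = ennreal (\<Prod>b\<in>Basis. (pr u - pr l) \<bullet> b)"
  proof (rule emeasure_lborel_box)
    fix b :: "real^2" assume "b \<in> Basis"
    then obtain i where "b = axis i 1" by (auto simp: Basis_vec_axis)
    then show "pr l \<bullet> b \<le> pr u \<bullet> b" using le' exhaust_2[of i] by (auto simp: inner_axis)
  qed
  also have "(\<Prod>b\<in>Basis. (pr u - pr l) \<bullet> b) = (u $ 1 - l $ 1) * (u $ 2 - l $ 2)"
    by (simp add: prod_Basis_vec inner_axis UNIV_2)
  also have "ennreal ((u $ 1 - l $ 1) * (u $ 2 - l $ 2)) * ennreal (u $ 3 - l $ 3) = ennreal ((u $ 1 - l $ 1) * (u $ 2 - l $ 2) * (u $ 3 - l $ 3))"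
    using le'[of 1] le'[of 2] le'[of 3] by (intro ennreal_mult[symmetric]) simp_all
  also have "(u $ 1 - l $ 1) * (u $ 2 - l $ 2) * (u $ 3 - l $ 3) = (\<Prod>b\<in>Basis. (u - l) \<bullet> b)"
    by (simp only: prod_Basis_vec prod_3 inner_axis vector_minus_component inner_real_def mult_1_right)
  finally show "emeasure (distr (lborel \<Otimes>\<^sub>M lborel) borel (\<lambda>(u, t). up u t)) (box l u) = (\<Prod>b\<in>Basis. (u - l) \<bullet> b)" .
qed simp

lemma set_integral_lborel:
  fixes f :: "'a::euclidean_space \<Rightarrow> real"
  assumes "f absolutely_integrable_on A" "(\<lambda>x. indicator A x *\<^sub>R f x) \<in> borel_measurable borel"
  shows "set_integrable lborel A f" "(LINT x:A|lborel. f x) = integral A f"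
proof -
  show 1: "set_integrable lborel A f"
    using assms integrable_completion[of "\<lambda>x. indicator A x *\<^sub>R f x" lborel] by (simp add: set_integrable_def)
  show "(LINT x:A|lborel. f x) = integral A f" by (rule set_borel_integral_eq_integral(2)[OF 1])
qed

lemma continuous_on_pr: "continuous_on A pr"
  by (rule linear_continuous_on[OF bounded_linear_pr])

text \<open>In the coordinates of the flow the directional derivative is the derivative with respect to
time, and the Jacobian is the product of the normal with \<open>b\<close>, which does not depend on time. The time
integral is then evaluated by the fundamental theorem of calculus.\<close>

lemma flow_box_integral:
  assumes U: "open U" "C1_map U \<phi>" "cball u0 r \<subseteq> U" and r: "r > 0"
    and inj: "inj_on (flow \<phi> b) {y. pr y \<in> ball u0 r}"
    and pos: "\<And>u. u \<in> ball u0 r \<Longrightarrow> patch_normal \<phi> u \<bullet> b > 0"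
    and f: "C1_fun f" and \<alpha>\<beta>: "\<alpha> < \<beta>"
  shows "open (flow \<phi> b ` {y. pr y \<in> ball u0 r \<and> \<alpha> < y $ 3 \<and> y $ 3 < \<beta>})" (is "open (_ ` ?Q)")
    and "(LINT x:flow \<phi> b ` {y. pr y \<in> ball u0 r \<and> \<alpha> < y $ 3 \<and> y $ 3 < \<beta>}|lborel. dir_deriv b f x) =
      (LINT u:ball u0 r|lborel. (patch_normal \<phi> u \<bullet> b) * (f (\<phi> u + \<beta> *\<^sub>R b) - f (\<phi> u + \<alpha> *\<^sub>R b)))"
proof -
  let ?\<Phi> = "flow \<phi> b" and ?N = "patch_normal \<phi>"
  have bU: "ball u0 r \<subseteq> U" using U(3) ball_subset_cball by blast
  have Qeq: "?Q = {y. pr y \<in> ball u0 r} \<inter> {y. \<alpha> < y $ 3 \<and> y $ 3 < \<beta>}" by auto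
  have "continuous_on UNIV (\<lambda>y::real^3. y $ 3)" by (rule continuous_on_component[OF continuous_on_id])
  then have "open ((\<lambda>y::real^3. y $ 3) -` {\<alpha><..<\<beta>})" by (rule open_vimage[OF open_greaterThanLessThan])
  then have oQ: "open ?Q" unfolding Qeq by (intro open_Int[OF open_flow_dom]) (simp add: vimage_def)
  have der: "(?\<Phi> has_derivative flow_deriv \<phi> b y) (at y)" if "pr y \<in> U" for y
    by (rule flow_has_derivative[OF U(2) that])
  have cont: "continuous_on {y. pr y \<in> U} ?\<Phi>"
    by (rule continuous_at_imp_continuous_on) (use has_derivative_continuous[OF der] in simp)
  have injQ: "inj_on ?\<Phi> ?Q" by (rule inj_on_subset[OF inj]) auto
  have contQ: "continuous_on ?Q ?\<Phi>" by (rule continuous_on_subset[OF cont]) (use bU in auto)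
  show oim: "open (?\<Phi> ` ?Q)" by (rule invariance_of_domain[OF contQ oQ injQ])
  have Ncont: "continuous_on U ?N" unfolding patch_normal_def[abs_def]
    using U(2) by (intro continuous_on_cross) (auto simp: C1_map_def)
  define F where "F y = (?N (pr y) \<bullet> b) * dir_deriv b f (?\<Phi> y)" for y
  have c1: "continuous_on {y. pr y \<in> U} (\<lambda>y. ?N (pr y))"
    by (rule continuous_on_compose2[OF Ncont continuous_on_pr]) auto
  have c2: "continuous_on {y. pr y \<in> U} (\<lambda>y. dir_deriv b f (?\<Phi> y))"
    by (rule continuous_on_compose2[OF dir_deriv_continuous[OF f] cont]) auto
  have Fcont: "continuous_on {y. pr y \<in> U} F" unfolding F_def
    by (rule continuous_on_mult[OF continuous_on_inner[OF c1 continuous_on_const] c2])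
  define K where "K = (\<lambda>p. up (fst p) (snd p)) ` (cball u0 r \<times> {\<alpha>..\<beta>})"
  have K: "compact K" unfolding K_def
    by (intro compact_continuous_image continuous_on_subset[OF continuous_on_up] compact_Times) auto
  have QK: "?Q \<subseteq> K"
  proof
    fix y assume "y \<in> ?Q"
    then show "y \<in> K" unfolding K_def by (intro image_eqI[of _ _ "(pr y, y $ 3)"]) (auto simp: up_pr)
  qed
  have KU: "K \<subseteq> {y. pr y \<in> U}" using U(3) by (auto simp: K_def)
  have "integrable lborel (\<lambda>y. indicator K y *\<^sub>R F y)"
    by (rule borel_integrable_compact[OF K continuous_on_subset[OF Fcont KU]])
  then have FQ: "set_integrable lborel ?Q F"
    using oQ QK by (intro set_integrable_subset[of lborel K F ?Q]) (auto simp: set_integrable_def)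
  have FQ': "F absolutely_integrable_on ?Q"
    using FQ integrable_completion[of "\<lambda>x. indicator ?Q x *\<^sub>R F x" lborel] borel_measurable_integrable
    unfolding set_integrable_def by blast
  have cv: "(\<lambda>y. \<bar>det (matrix (flow_deriv \<phi> b y))\<bar> * dir_deriv b f (?\<Phi> y)) absolutely_integrable_on ?Q \<and>
           integral ?Q (\<lambda>y. \<bar>det (matrix (flow_deriv \<phi> b y))\<bar> * dir_deriv b f (?\<Phi> y)) = integral ?Q F
     \<longleftrightarrow> dir_deriv b f absolutely_integrable_on (?\<Phi> ` ?Q) \<and> integral (?\<Phi> ` ?Q) (dir_deriv b f) = integral ?Q F"
    by (rule change_of_variables_scalar[OF _ has_derivative_at_withinI[OF der] injQ])
      (use oQ bU in \<open>auto intro: sets_completionI_sets\<close>)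
  have Feq: "\<bar>det (matrix (flow_deriv \<phi> b y))\<bar> * dir_deriv b f (?\<Phi> y) = F y" if "y \<in> ?Q" for y
    using pos[of "pr y"] that by (simp add: F_def flow_det)
  have i1: "(\<lambda>y. \<bar>det (matrix (flow_deriv \<phi> b y))\<bar> * dir_deriv b f (?\<Phi> y)) absolutely_integrable_on ?Q \<longleftrightarrow> F absolutely_integrable_on ?Q"
    by (rule set_integrable_cong) (simp_all only: Feq)
  have i2: "integral ?Q (\<lambda>y. \<bar>det (matrix (flow_deriv \<phi> b y))\<bar> * dir_deriv b f (?\<Phi> y)) = integral ?Q F"
    by (rule integral_cong) (simp only: Feq)
  have im: "dir_deriv b f absolutely_integrable_on (?\<Phi> ` ?Q)" "integral (?\<Phi> ` ?Q) (dir_deriv b f) = integral ?Q F"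
    using cv[unfolded i1 i2] FQ' by blast+
  have "(LINT x:?\<Phi> ` ?Q|lborel. dir_deriv b f x) = integral (?\<Phi> ` ?Q) (dir_deriv b f)"
    by (rule set_integral_lborel(2)[OF im(1) density_on_measurable[OF open_UNIV dir_deriv_continuous[OF f]]]) (use oim in auto)
  also have "\<dots> = (LINT y:?Q|lborel. F y)"
    unfolding im(2) by (rule set_borel_integral_eq_integral(2)[OF FQ, symmetric])
  also have "\<dots> = (\<integral>u. \<integral>t. indicator ?Q (up u t) *\<^sub>R F (up u t) \<partial>lborel \<partial>lborel)"
  proof -
    define q where "q y = indicator ?Q y *\<^sub>R F y" for y
    have qi: "integrable lborel q" using FQ by (simp add: set_integrable_def q_def[abs_def])
    then have qm: "q \<in> borel_measurable borel" using borel_measurable_integrable by auto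
    have e: "(\<lambda>p. q (case p of (u, t) \<Rightarrow> up u t)) = (\<lambda>p. q (up (fst p) (snd p)))"
      by (simp add: case_prod_beta')
    have "integrable (lborel \<Otimes>\<^sub>M lborel) (\<lambda>p. q (case p of (u, t) \<Rightarrow> up u t))"
      using qi by (subst integrable_distr_eq[OF up_measurable qm, symmetric]) (simp flip: lborel_up)
    then have int: "integrable (lborel \<Otimes>\<^sub>M lborel) (\<lambda>p. q (up (fst p) (snd p)))" unfolding e .
    have "(LINT y:?Q|lborel. F y) = integral\<^sup>L lborel q"
      by (simp add: set_lebesgue_integral_def q_def[abs_def])
    also have "\<dots> = integral\<^sup>L (distr (lborel \<Otimes>\<^sub>M lborel) borel (\<lambda>(u, t). up u t)) q"
      by (simp flip: lborel_up)
    also have "\<dots> = integral\<^sup>L (lborel \<Otimes>\<^sub>M lborel) (\<lambda>p. q (up (fst p) (snd p)))"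
      unfolding e[symmetric] by (rule integral_distr[OF up_measurable qm])
    also have "\<dots> = (\<integral>u. \<integral>t. q (up u t) \<partial>lborel \<partial>lborel)"
      using lborel_pair.integral_fst'[OF int] by simp
    finally show ?thesis by (simp add: q_def)
  qed
  also have "\<dots> = (LINT u:ball u0 r|lborel. (?N u \<bullet> b) * (f (\<phi> u + \<beta> *\<^sub>R b) - f (\<phi> u + \<alpha> *\<^sub>R b)))"
    unfolding set_lebesgue_integral_def
  proof (rule Bochner_Integration.integral_cong[OF refl])
    fix u
    have "indicator ?Q (up u t) *\<^sub>R F (up u t) = (indicator (ball u0 r) u * (?N u \<bullet> b)) * (indicator {\<alpha><..<\<beta>} t *\<^sub>R dir_deriv b f (\<phi> u + t *\<^sub>R b))" for t
      by (simp add: indicator_def F_def flow_def)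
    then have "(\<integral>t. indicator ?Q (up u t) *\<^sub>R F (up u t) \<partial>lborel) =
       (indicator (ball u0 r) u * (?N u \<bullet> b)) * (\<integral>t. indicator {\<alpha><..<\<beta>} t *\<^sub>R dir_deriv b f (\<phi> u + t *\<^sub>R b) \<partial>lborel)"
      by (simp only: integral_mult_right_zero)
    also have "(\<integral>t. indicator {\<alpha><..<\<beta>} t *\<^sub>R dir_deriv b f (\<phi> u + t *\<^sub>R b) \<partial>lborel) = (LBINT t=\<alpha>..\<beta>. dir_deriv b f (\<phi> u + t *\<^sub>R b))"
      using \<alpha>\<beta> by (simp add: interval_lebesgue_integral_def einterval_eq set_lebesgue_integral_def)
    also have "\<dots> = f (\<phi> u + \<beta> *\<^sub>R b) - f (\<phi> u + \<alpha> *\<^sub>R b)"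
    proof (rule interval_integral_FTC_finite)
      show "continuous_on {min \<alpha> \<beta>..max \<alpha> \<beta>} (\<lambda>t. dir_deriv b f (\<phi> u + t *\<^sub>R b))"
        by (intro continuous_on_compose2[OF dir_deriv_continuous[OF f]] continuous_intros) auto
      fix t show "((\<lambda>t. f (\<phi> u + t *\<^sub>R b)) has_vector_derivative dir_deriv b f (\<phi> u + t *\<^sub>R b)) (at t within {min \<alpha> \<beta>..max \<alpha> \<beta>})"
        by (rule has_vector_derivative_at_within)
          (use dir_deriv_line[OF f, of "\<phi> u" b t] in \<open>simp add: has_real_derivative_iff_has_vector_derivative\<close>)
    qed
    finally show "(\<integral>t. indicator ?Q (up u t) *\<^sub>R F (up u t) \<partial>lborel) = indicator (ball u0 r) u *\<^sub>R ((?N u \<bullet> b) * (f (\<phi> u + \<beta> *\<^sub>R b) - f (\<phi> u + \<alpha> *\<^sub>R b)))" by (simp only: real_scaleR_def mult.assoc)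
  qed
  finally show "(LINT x:?\<Phi> ` ?Q|lborel. dir_deriv b f x) =
      (LINT u:ball u0 r|lborel. (?N u \<bullet> b) * (f (\<phi> u + \<beta> *\<^sub>R b) - f (\<phi> u + \<alpha> *\<^sub>R b)))" .
qed

section \<open>The two sides of the boundary of a region\<close>

lemma connected_in_or_out:
  assumes "closed \<Omega>" "connected T" "T \<inter> frontier \<Omega> = {}"
  shows "T \<subseteq> interior \<Omega> \<or> T \<inter> \<Omega> = {}"
proof (cases "T \<inter> \<Omega> = {}")
  case False
  then have "T - \<Omega> = {}" using connected_Int_frontier[OF assms(2)] assms(3) by blast
  then have "T \<subseteq> interior \<Omega>" using assms(1,3) by (auto simp: frontier_def)
  then show ?thesis ..
qed simp

lemma adaptedD:
  assumes "adapted S U \<phi> u0 n \<eta> r \<epsilon>"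
  shows "r > 0" "\<epsilon> > 0" "cball u0 r \<subseteq> U" "ball u0 r \<subseteq> U" "u0 \<in> ball u0 r"
proof -
  show 1: "r > 0" "\<epsilon> > 0" "cball u0 r \<subseteq> U" using assms by (simp_all add: adapted_def)
  show "ball u0 r \<subseteq> U" by (rule order_trans[OF ball_subset_cball 1(3)])
  show "u0 \<in> ball u0 r" using 1(1) by simp
qed

lemma adapted_normal_pos:
  "adapted S U \<phi> u0 n \<eta> r \<epsilon> \<Longrightarrow> u \<in> ball u0 r \<Longrightarrow> c \<in> cone n \<eta> \<Longrightarrow> patch_normal \<phi> u \<bullet> c > 0"
  by (simp add: adapted_def)

lemma C1_fun_const: "C1_fun (\<lambda>x. c)"
  by (simp add: C1_fun_def pd_const[abs_def])

text \<open>A compact region with connected \<open>C\<^sup>1\<close> boundary \<open>S\<close>, and a metric \<open>G\<close> along the boundary.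
The set \<open>W\<close> agrees with the region only near \<open>S\<close>; it is the part in the coordinate domain, and it
serves to decide what is outward.\<close>

locale smooth_region =
  fixes \<Omega> S W :: "(real^3) set" and G :: field2
  assumes compact_\<Omega>: "compact \<Omega>" and S_def: "S = frontier \<Omega>"
    and S_connected: "connected S" and S_C1: "C1_surface S" and interior_nonempty: "interior \<Omega> \<noteq> {}"
    and W_sub: "W \<subseteq> \<Omega>" and W_near: "\<exists>T. open T \<and> S \<subseteq> T \<and> \<Omega> \<inter> T \<subseteq> W"
    and G_cont: "continuous_on S G"
    and G_symm: "x \<in> S \<Longrightarrow> transpose (G x) = G x"
    and G_posdef: "x \<in> S \<Longrightarrow> v \<noteq> 0 \<Longrightarrow> v \<bullet> (G x *v v) > 0"
begin

lemma closed_\<Omega>: "closed \<Omega>" using compact_\<Omega> by (rule compact_imp_closed)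

lemma S_compact: "compact S" unfolding S_def by (rule compact_frontier[OF compact_\<Omega>])

lemma S_closed: "closed S" using S_compact by (rule compact_imp_closed)

lemma S_sub: "S \<subseteq> \<Omega>" unfolding S_def using closed_\<Omega> by (rule frontier_subset_closed)

lemma S_interior: "S \<inter> interior \<Omega> = {}" unfolding S_def by (auto simp: frontier_def)

lemma \<Omega>_cases: "\<Omega> = interior \<Omega> \<union> S"
  unfolding S_def using closed_\<Omega> interior_subset[of \<Omega>] by (auto simp: frontier_def)

text \<open>The points reached from the patch along short vectors of the cone form a connected set
that avoids the boundary.\<close>

lemma cone_in_or_out:
  assumes P: "C1_patch S U \<phi>" and ad: "adapted S U \<phi> u0 n \<eta> r \<epsilon>" and \<eta>: "\<eta> > 0" and s: "s = 1 \<or> s = -1"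
  shows "(\<forall>u\<in>ball u0 r. \<forall>c\<in>cone n \<eta> \<inter> ball 0 \<epsilon>. \<phi> u + s *\<^sub>R c \<in> interior \<Omega>) \<or>
     (\<forall>u\<in>ball u0 r. \<forall>c\<in>cone n \<eta> \<inter> ball 0 \<epsilon>. \<phi> u + s *\<^sub>R c \<notin> \<Omega>)"
proof -
  define T where "T = (\<lambda>p. \<phi> (fst p) + s *\<^sub>R snd p) ` (ball u0 r \<times> (cone n \<eta> \<inter> ball 0 \<epsilon>))"
  have bU: "ball u0 r \<subseteq> U" by (rule adaptedD(4)[OF ad])
  have c1: "continuous_on (ball u0 r \<times> (cone n \<eta> \<inter> ball 0 \<epsilon>)) (\<lambda>p. \<phi> (fst p))"
    by (rule continuous_on_compose2[OF continuous_on_subset[OF patch_continuous[OF P] bU] continuous_on_fst[OF continuous_on_id]]) auto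
  have "connected T" unfolding T_def
    by (rule connected_continuous_image[OF continuous_on_add[OF c1 continuous_on_scaleR[OF continuous_on_const continuous_on_snd[OF continuous_on_id]]]])
      (intro connected_Times convex_connected convex_ball convex_cone_ball \<eta>)
  moreover have "T \<inter> frontier \<Omega> = {}"
  proof -
    have "\<phi> u + s *\<^sub>R c \<notin> S" if "u \<in> ball u0 r" "c \<in> cone n \<eta> \<inter> ball 0 \<epsilon>" for u c
      using ad that s unfolding adapted_def by fastforce
    then show ?thesis unfolding T_def S_def[symmetric] by auto
  qed
  ultimately have "T \<subseteq> interior \<Omega> \<or> T \<inter> \<Omega> = {}" by (intro connected_in_or_out closed_\<Omega>)
  then show ?thesis
  proof
    assume *: "T \<subseteq> interior \<Omega>"
    show ?thesis
    proof (intro disjI1 ballI)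
      fix u c assume "u \<in> ball u0 r" "c \<in> cone n \<eta> \<inter> ball 0 \<epsilon>"
      then have "\<phi> u + s *\<^sub>R c \<in> T" unfolding T_def by (intro image_eqI[of _ _ "(u, c)"]) auto
      then show "\<phi> u + s *\<^sub>R c \<in> interior \<Omega>" using * by blast
    qed
  next
    assume *: "T \<inter> \<Omega> = {}"
    show ?thesis
    proof (intro disjI2 ballI)
      fix u c assume "u \<in> ball u0 r" "c \<in> cone n \<eta> \<inter> ball 0 \<epsilon>"
      then have "\<phi> u + s *\<^sub>R c \<in> T" unfolding T_def by (intro image_eqI[of _ _ "(u, c)"]) auto
      then show "\<phi> u + s *\<^sub>R c \<notin> \<Omega>" using * by blast
    qed
  qed
qed

text \<open>The sign \<open>\<sigma>\<close> compares the direction out of the region with the normal of the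
parametrization.\<close>

definition sided :: "(real^2 \<Rightarrow> real^3) \<Rightarrow> real^2 \<Rightarrow> real^3 \<Rightarrow> real \<Rightarrow> real \<Rightarrow> real \<Rightarrow> real \<Rightarrow> bool" where
  "sided \<phi> u0 n \<eta> r \<epsilon> \<sigma> \<longleftrightarrow> (\<sigma> = 1 \<or> \<sigma> = -1) \<and>
    (\<forall>u\<in>ball u0 r. \<forall>c\<in>cone n \<eta> \<inter> ball 0 \<epsilon>. \<phi> u + \<sigma> *\<^sub>R c \<notin> \<Omega> \<and> \<phi> u - \<sigma> *\<^sub>R c \<in> interior \<Omega>)"

lemma flow_nbhd:
  assumes P: "C1_patch S U \<phi>" and ad: "adapted S U \<phi> u0 n \<eta> r \<epsilon>" and \<eta>: "\<eta> > 0" and b: "b \<in> cone n \<eta>" and \<tau>: "\<tau> > 0"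
  shows "open (flow \<phi> b ` {y. pr y \<in> ball u0 r \<and> - \<tau> < y $ 3 \<and> y $ 3 < \<tau>})"
    "u \<in> ball u0 r \<Longrightarrow> \<phi> u \<in> flow \<phi> b ` {y. pr y \<in> ball u0 r \<and> - \<tau> < y $ 3 \<and> y $ 3 < \<tau>}"
proof -
  have a: "cball u0 r \<subseteq> U" "r > 0" "\<And>u. u \<in> ball u0 r \<Longrightarrow> patch_normal \<phi> u \<bullet> b > 0"
    using adaptedD[OF ad] adapted_normal_pos[OF ad _ b] by auto
  show "open (flow \<phi> b ` {y. pr y \<in> ball u0 r \<and> - \<tau> < y $ 3 \<and> y $ 3 < \<tau>})"
    by (rule flow_box_integral(1)[OF patch_open[OF P] C1_patch_map[OF P] a(1,2) flow_inj[OF ad patch_inj[OF P] b \<eta>] a(3) C1_fun_const])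
      (use \<tau> in auto)
  show "\<phi> u \<in> flow \<phi> b ` {y. pr y \<in> ball u0 r \<and> - \<tau> < y $ 3 \<and> y $ 3 < \<tau>}" if "u \<in> ball u0 r"
    by (rule image_eqI[of _ _ "up u 0"]) (use that \<tau> in \<open>auto simp: flow_def\<close>)
qed

lemma normal_box_cases:
  assumes P: "C1_patch S U \<phi>" and ad: "adapted S U \<phi> u0 n \<eta> r \<epsilon>" and \<eta>: "0 < \<eta>" "\<eta> < 1" and n: "n \<noteq> 0"
  shows "\<exists>B. open B \<and> \<phi> ` ball u0 r \<subseteq> B \<and> (\<forall>x\<in>B. x \<in> \<phi> ` ball u0 r \<or>
     (\<exists>u\<in>ball u0 r. \<exists>c\<in>cone n \<eta> \<inter> ball 0 \<epsilon>. x = \<phi> u + c \<or> x = \<phi> u - c))"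
proof -
  have nc: "n \<in> cone n \<eta>" by (rule normal_in_cone[OF n \<eta>(2)])
  define \<tau> where "\<tau> = \<epsilon> / norm n"
  have \<tau>: "\<tau> > 0" using ad n by (simp add: \<tau>_def adapted_def)
  have sm: "\<bar>t\<bar> * norm n < \<epsilon>" if "\<bar>t\<bar> < \<tau>" for t using that n by (simp add: \<tau>_def field_simps)
  let ?B = "flow \<phi> n ` {y. pr y \<in> ball u0 r \<and> - \<tau> < y $ 3 \<and> y $ 3 < \<tau>}"
  have "x \<in> \<phi> ` ball u0 r \<or> (\<exists>u\<in>ball u0 r. \<exists>c\<in>cone n \<eta> \<inter> ball 0 \<epsilon>. x = \<phi> u + c \<or> x = \<phi> u - c)" if xB: "x \<in> ?B" for x
  proof -
    obtain y where y': "y \<in> {y. pr y \<in> ball u0 r \<and> - \<tau> < y $ 3 \<and> y $ 3 < \<tau>}" "x = flow \<phi> n y"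
      using xB by blast
    then have y: "pr y \<in> ball u0 r" "- \<tau> < y $ 3" "y $ 3 < \<tau>" "x = \<phi> (pr y) + y $ 3 *\<^sub>R n"
      by (simp_all add: flow_def)
    have c: "t *\<^sub>R n \<in> cone n \<eta> \<inter> ball 0 \<epsilon>" if "0 < t" "t < \<tau>" for t
      using cone_scale[OF that(1) nc] sm[of t] that by simp
    consider "y $ 3 = 0" | "y $ 3 > 0" | "y $ 3 < 0" by linarith
    then show ?thesis
    proof cases
      case 1 then show ?thesis using y by auto
    next
      case 2 then show ?thesis using y c[of "y $ 3"] by blast
    next
      case 3
      have "x = \<phi> (pr y) - (- y $ 3) *\<^sub>R n" using y(4) by simp
      moreover have "(- y $ 3) *\<^sub>R n \<in> cone n \<eta> \<inter> ball 0 \<epsilon>" by (rule c) (use 3 y in auto)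
      ultimately show ?thesis using y(1) by blast
    qed
  qed
  moreover have "open ?B" by (rule flow_nbhd(1)[OF P ad \<eta>(1) nc \<tau>])
  moreover have "\<phi> ` ball u0 r \<subseteq> ?B" using flow_nbhd(2)[OF P ad \<eta>(1) nc \<tau>] by blast
  ultimately show ?thesis by (intro exI[of _ ?B]) blast
qed

lemma cone_nonempty:
  assumes "n \<noteq> 0" "\<eta> < 1" "\<epsilon> > 0" shows "\<exists>c. c \<in> cone n \<eta> \<inter> ball 0 \<epsilon>"
proof -
  have "(\<epsilon> / (2 * norm n)) *\<^sub>R n \<in> cone n \<eta>"
    by (rule cone_scale[OF _ normal_in_cone]) (use assms in auto)
  moreover have "norm ((\<epsilon> / (2 * norm n)) *\<^sub>R n) < \<epsilon>" using assms by simp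
  ultimately show ?thesis by (intro exI[of _ "(\<epsilon> / (2 * norm n)) *\<^sub>R n"]) simp
qed

text \<open>By \<open>cone_in_or_out\<close> each of the two sides is inside or outside. If both were inside, the
patch would consist of interior points. If both are outside, the interior does not accumulate at the
patch.\<close>

lemma sided_or_isolated:
  assumes P: "C1_patch S U \<phi>" and ad: "adapted S U \<phi> u0 n \<eta> r \<epsilon>" and \<eta>: "0 < \<eta>" "\<eta> < 1" and n: "n \<noteq> 0"
  shows "(\<exists>\<sigma>. sided \<phi> u0 n \<eta> r \<epsilon> \<sigma>) \<or> \<phi> ` ball u0 r \<inter> closure (interior \<Omega>) = {}"
proof -
  let ?C = "cone n \<eta> \<inter> ball 0 \<epsilon>"
  from normal_box_cases[OF assms] obtain B where B: "open B" "\<phi> ` ball u0 r \<subseteq> B" and B3: "\<forall>x\<in>B. x \<in> \<phi> ` ball u0 r \<or>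
     (\<exists>u\<in>ball u0 r. \<exists>c\<in>?C. x = \<phi> u + c \<or> x = \<phi> u - c)"
    by (elim exE conjE)
  note Bc = bspec[OF B3]
  have r: "r > 0" "ball u0 r \<subseteq> U" using adaptedD[OF ad] by simp_all
  have im: "\<phi> ` ball u0 r \<subseteq> S" using patch_sub[OF P] r(2) by blast
  have p: "(\<forall>u\<in>ball u0 r. \<forall>c\<in>?C. \<phi> u + c \<in> interior \<Omega>) \<or> (\<forall>u\<in>ball u0 r. \<forall>c\<in>?C. \<phi> u + c \<notin> \<Omega>)"
    using cone_in_or_out[OF P ad \<eta>(1), of 1] by (simp only: scaleR_one simp_thms)
  have m: "(\<forall>u\<in>ball u0 r. \<forall>c\<in>?C. \<phi> u - c \<in> interior \<Omega>) \<or> (\<forall>u\<in>ball u0 r. \<forall>c\<in>?C. \<phi> u - c \<notin> \<Omega>)"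
    using cone_in_or_out[OF P ad \<eta>(1), of "-1"] by (simp only: scaleR_minus1_left add_uminus_conv_diff simp_thms)
  from p m show ?thesis
  proof (elim disjE)
    assume a: "\<forall>u\<in>ball u0 r. \<forall>c\<in>?C. \<phi> u + c \<in> interior \<Omega>" "\<forall>u\<in>ball u0 r. \<forall>c\<in>?C. \<phi> u - c \<in> interior \<Omega>"
    have "B \<subseteq> \<Omega>"
    proof
      fix x assume "x \<in> B"
      from Bc[OF this] show "x \<in> \<Omega>"
      proof
        assume "x \<in> \<phi> ` ball u0 r" then show ?thesis using im S_sub by blast
      next
        assume "\<exists>u\<in>ball u0 r. \<exists>c\<in>?C. x = \<phi> u + c \<or> x = \<phi> u - c"
        then show ?thesis using a interior_subset[of \<Omega>] by blast
      qed
    qed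
    then have "B \<subseteq> interior \<Omega>" using B(1) by (rule interior_maximal)
    moreover have "\<phi> u0 \<in> B" "\<phi> u0 \<in> S" using B(2) im r(1) by auto
    ultimately show ?thesis using S_interior by blast
  next
    assume "\<forall>u\<in>ball u0 r. \<forall>c\<in>?C. \<phi> u + c \<in> interior \<Omega>" "\<forall>u\<in>ball u0 r. \<forall>c\<in>?C. \<phi> u - c \<notin> \<Omega>"
    then have "sided \<phi> u0 n \<eta> r \<epsilon> (-1)" unfolding sided_def by simp
    then show ?thesis by blast
  next
    assume "\<forall>u\<in>ball u0 r. \<forall>c\<in>?C. \<phi> u + c \<notin> \<Omega>" "\<forall>u\<in>ball u0 r. \<forall>c\<in>?C. \<phi> u - c \<in> interior \<Omega>"
    then have "sided \<phi> u0 n \<eta> r \<epsilon> 1" unfolding sided_def by simp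
    then show ?thesis by blast
  next
    assume a: "\<forall>u\<in>ball u0 r. \<forall>c\<in>?C. \<phi> u + c \<notin> \<Omega>" "\<forall>u\<in>ball u0 r. \<forall>c\<in>?C. \<phi> u - c \<notin> \<Omega>"
    have "B \<inter> interior \<Omega> = {}"
    proof (rule ccontr)
      assume "B \<inter> interior \<Omega> \<noteq> {}"
      then obtain x where x: "x \<in> B" "x \<in> interior \<Omega>" by blast
      then have "x \<in> \<Omega>" using interior_subset by blast
      from Bc[OF x(1)] show False
      proof
        assume "x \<in> \<phi> ` ball u0 r" then show ?thesis using im S_interior x(2) by blast
      next
        assume "\<exists>u\<in>ball u0 r. \<exists>c\<in>?C. x = \<phi> u + c \<or> x = \<phi> u - c"
        then show ?thesis using a \<open>x \<in> \<Omega>\<close> by blast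
      qed
    qed
    then have "B \<inter> closure (interior \<Omega>) = {}" using open_Int_closure_eq_empty[OF B(1)] by blast
    then show ?thesis using B(2) by blast
  qed
qed

lemma sided_closure:
  assumes "sided \<phi> u0 n \<eta> r \<epsilon> \<sigma>" "u \<in> ball u0 r" and \<eta>: "\<eta> < 1" and n: "n \<noteq> 0" and \<epsilon>: "\<epsilon> > 0"
  shows "\<phi> u \<in> closure (interior \<Omega>)"
  unfolding closure_approachable
proof (intro allI impI)
  fix e :: real assume e: "e > 0"
  obtain c where c: "c \<in> cone n \<eta> \<inter> ball 0 (min e \<epsilon>)" using cone_nonempty[OF n \<eta>, of "min e \<epsilon>"] e \<epsilon> by auto
  then have "\<phi> u - \<sigma> *\<^sub>R c \<in> interior \<Omega>" using assms(1,2) unfolding sided_def by simp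
  moreover have "dist (\<phi> u - \<sigma> *\<^sub>R c) (\<phi> u) < e" using c assms(1) unfolding sided_def by (auto simp: dist_norm)
  ultimately show "\<exists>y\<in>interior \<Omega>. dist y (\<phi> u) < e" by blast
qed

text \<open>The boundary points at which the interior accumulates form an open and closed subset of the
boundary by \<open>sided_or_isolated\<close>, and there are some of them because a bounded set with nonempty
interior has an interior that is not closed. This is where connectedness of the boundary is
used: a surface floating outside of the closure of the interior has no outward direction.\<close>

lemma S_accessible: "S \<subseteq> closure (interior \<Omega>)"
proof -
  let ?S1 = "S \<inter> closure (interior \<Omega>)"
  have "openin (top_of_set S) ?S1"
    unfolding openin_subopen[of _ ?S1]
  proof
    fix x assume x: "x \<in> ?S1"
    then obtain U \<phi> u0 where P: "C1_patch S U \<phi>" and u0: "u0 \<in> U" "x = \<phi> u0"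
      using S_C1 unfolding C1_surface_def by blast
    let ?n = "patch_normal \<phi> u0"
    have n: "?n \<noteq> 0" by (rule patch_normal_nonzero[OF P u0(1)])
    obtain r \<epsilon> where ad: "adapted S U \<phi> u0 ?n (1/2) r \<epsilon>" using adapted_exists[OF P u0(1), of "1/2"] by auto
    have r: "r > 0" "\<epsilon> > 0" "ball u0 r \<subseteq> U" using adaptedD[OF ad] by simp_all
    have "x \<in> \<phi> ` ball u0 r" using r(1) u0(2) by simp
    then have "\<not> \<phi> ` ball u0 r \<inter> closure (interior \<Omega>) = {}" using x by blast
    then obtain \<sigma> where "sided \<phi> u0 ?n (1/2) r \<epsilon> \<sigma>" using sided_or_isolated[OF P ad _ _ n] by auto
    then have "\<phi> ` ball u0 r \<subseteq> closure (interior \<Omega>)" using sided_closure[OF _ _ _ n r(2)] by auto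
    moreover have "openin (top_of_set S) (\<phi> ` ball u0 r)" by (rule patch_openin[OF P open_ball r(3)])
    moreover have "\<phi> ` ball u0 r \<subseteq> S" using patch_sub[OF P] r(3) by blast
    ultimately show "\<exists>T. openin (top_of_set S) T \<and> x \<in> T \<and> T \<subseteq> ?S1"
      using \<open>x \<in> \<phi> ` ball u0 r\<close> by blast
  qed
  moreover have "closedin (top_of_set S) ?S1" by (rule closedin_closed_Int) simp
  ultimately have "?S1 = {} \<or> ?S1 = S" using S_connected unfolding connected_clopen by blast
  moreover have "?S1 \<noteq> {}"
  proof
    assume "?S1 = {}"
    moreover have "closure (interior \<Omega>) \<subseteq> \<Omega>" using closed_\<Omega> by (simp add: closure_minimal interior_subset)
    ultimately have "closure (interior \<Omega>) \<subseteq> interior \<Omega>" using \<Omega>_cases by blast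
    then have "closed (interior \<Omega>)" by (simp only: closure_subset_eq)
    then have "interior \<Omega> = UNIV" using interior_nonempty clopen[of "interior \<Omega>"] by auto
    then have "\<Omega> = UNIV" using interior_subset[of \<Omega>] by blast
    then show False using compact_imp_bounded[OF compact_\<Omega>] not_bounded_UNIV by simp
  qed
  ultimately show ?thesis by blast
qed

lemma sided_exists:
  assumes P: "C1_patch S U \<phi>" and ad: "adapted S U \<phi> u0 n \<eta> r \<epsilon>" and \<eta>: "0 < \<eta>" "\<eta> < 1" and n: "n \<noteq> 0"
  shows "\<exists>\<sigma>. sided \<phi> u0 n \<eta> r \<epsilon> \<sigma>"
proof -
  have r: "r > 0" "ball u0 r \<subseteq> U" using adaptedD[OF ad] by simp_all
  have "\<phi> u0 \<in> \<phi> ` ball u0 r" using adaptedD(5)[OF ad] by (rule imageI)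
  moreover have "\<phi> u0 \<in> S" using patch_sub[OF P] adaptedD(4,5)[OF ad] by blast
  ultimately have "\<phi> ` ball u0 r \<inter> closure (interior \<Omega>) \<noteq> {}" using S_accessible by blast
  then show ?thesis using sided_or_isolated[OF assms] by argo
qed

text \<open>The line through \<open>p\<close> in direction $\sigma b$ passes from the interior to the outside at
\<open>p\<close>.\<close>

definition leaves :: "real^3 \<Rightarrow> real^3 \<Rightarrow> real \<Rightarrow> bool" where
  "leaves p b \<sigma> \<longleftrightarrow> (\<exists>\<epsilon>>0. \<forall>t. 0 < t \<and> t < \<epsilon> \<longrightarrow> p + (\<sigma> * t) *\<^sub>R b \<notin> \<Omega> \<and> p - (\<sigma> * t) *\<^sub>R b \<in> interior \<Omega>)"

definition point_side :: "(real^2 \<Rightarrow> real^3) \<Rightarrow> real^2 \<Rightarrow> real \<Rightarrow> bool" where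
  "point_side \<phi> u \<sigma> \<longleftrightarrow> (\<sigma> = 1 \<or> \<sigma> = -1) \<and>
    (\<forall>b. patch_normal \<phi> u \<bullet> b > 0 \<longrightarrow> leaves (\<phi> u) b \<sigma>)"

lemma sided_ray:
  assumes "sided \<phi> u0 n \<eta> r \<epsilon> \<sigma>" "u \<in> ball u0 r" "b \<in> cone n \<eta>" "\<epsilon> > 0"
  shows "leaves (\<phi> u) b \<sigma>"
  unfolding leaves_def
proof (intro exI[of _ "\<epsilon> / (norm b + 1)"] conjI allI impI)
  show "\<epsilon> / (norm b + 1) > 0" using assms(4) by (simp add: add_nonneg_pos)
  fix t assume t: "0 < t \<and> t < \<epsilon> / (norm b + 1)"
  have p: "norm b + 1 > 0" by (simp add: add_nonneg_pos)
  have "t * norm b \<le> t * (norm b + 1)" using t by (intro mult_left_mono) auto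
  also have "\<dots> < \<epsilon>" using t p by (simp add: pos_less_divide_eq)
  finally have "t *\<^sub>R b \<in> cone n \<eta> \<inter> ball 0 \<epsilon>" using cone_scale[OF _ assms(3), of t] t by simp
  then have "\<phi> u + \<sigma> *\<^sub>R (t *\<^sub>R b) \<notin> \<Omega> \<and> \<phi> u - \<sigma> *\<^sub>R (t *\<^sub>R b) \<in> interior \<Omega>"
    using assms(1,2) unfolding sided_def by blast
  then show "\<phi> u + (\<sigma> * t) *\<^sub>R b \<notin> \<Omega>" "\<phi> u - (\<sigma> * t) *\<^sub>R b \<in> interior \<Omega>" by simp_all
qed

lemma ray_sign_unique:
  assumes "\<sigma> = 1 \<or> \<sigma> = -1" "\<tau> = 1 \<or> \<tau> = (-1::real)"
    "leaves p b \<sigma>"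
    "leaves p b \<tau>"
  shows "\<sigma> = \<tau>"
proof (rule ccontr)
  assume "\<sigma> \<noteq> \<tau>"
  then have \<tau>: "\<tau> = - \<sigma>" using assms(1,2) by auto
  obtain e1 where e1: "e1 > 0" "\<And>t. 0 < t \<and> t < e1 \<Longrightarrow> p + (\<sigma> * t) *\<^sub>R b \<notin> \<Omega>" using assms(3) unfolding leaves_def by blast
  obtain e2 where e2: "e2 > 0" "\<And>t. 0 < t \<and> t < e2 \<Longrightarrow> p - (\<tau> * t) *\<^sub>R b \<in> interior \<Omega>" using assms(4) unfolding leaves_def by blast
  define t where "t = min e1 e2 / 2"
  have t: "0 < t \<and> t < e1" "0 < t \<and> t < e2" using e1(1) e2(1) by (auto simp: t_def)
  have "p + (\<sigma> * t) *\<^sub>R b \<notin> \<Omega>" by (rule e1(2)[OF t(1)])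
  moreover have "p + (\<sigma> * t) *\<^sub>R b \<in> interior \<Omega>" using e2(2)[OF t(2)] by (simp add: \<tau>)
  ultimately show False using interior_subset by blast
qed

text \<open>The vectors that have positive product with the normal are the union of the cones of all
positive apertures, and the signs for different apertures agree since they agree on the normal
itself.\<close>

lemma point_side_exists:
  assumes P: "C1_patch S U \<phi>" and u: "u \<in> U"
  shows "\<exists>\<sigma>. point_side \<phi> u \<sigma>"
proof -
  let ?n = "patch_normal \<phi> u"
  have n: "?n \<noteq> 0" by (rule patch_normal_nonzero[OF P u])
  have ex: "\<exists>\<sigma>. (\<sigma> = 1 \<or> \<sigma> = -1) \<and> (\<forall>b\<in>cone ?n \<eta>. leaves (\<phi> u) b \<sigma>)"
    if \<eta>: "0 < \<eta>" "\<eta> < 1" for \<eta>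
  proof -
    from adapted_exists[OF P u \<eta>(1)] obtain r \<epsilon> where ad: "adapted S U \<phi> u ?n \<eta> r \<epsilon>" by (elim exE)
    from sided_exists[OF P ad \<eta> n] obtain \<sigma> where s: "sided \<phi> u ?n \<eta> r \<epsilon> \<sigma>" by (elim exE)
    have "u \<in> ball u r" "\<epsilon> > 0" using adaptedD[OF ad] by simp_all
    then have "\<forall>b\<in>cone ?n \<eta>. leaves (\<phi> u) b \<sigma>"
      using sided_ray[OF s] by blast
    moreover have "\<sigma> = 1 \<or> \<sigma> = -1" using s unfolding sided_def by blast
    ultimately show ?thesis by blast
  qed
  obtain \<sigma> where \<sigma>: "\<sigma> = 1 \<or> \<sigma> = -1" and \<sigma>b: "\<forall>b\<in>cone ?n (1/2). leaves (\<phi> u) b \<sigma>"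
    using ex[of "1/2"] by auto
  have nr: "leaves (\<phi> u) ?n \<sigma>"
    using \<sigma>b normal_in_cone[OF n, of "1/2"] by auto
  have "leaves (\<phi> u) b \<sigma>" if b: "?n \<bullet> b > 0" for b
  proof -
    define q where "q = ?n \<bullet> b / (2 * norm ?n * norm b)"
    have b0: "norm b > 0" "norm ?n > 0" using b n by auto
    have q: "q > 0" "q * norm ?n * norm b = ?n \<bullet> b / 2" using b b0 by (auto simp: q_def field_simps)
    define \<eta> where "\<eta> = min (1/2) q"
    have \<eta>: "0 < \<eta>" "\<eta> < 1" using q by (auto simp: \<eta>_def)
    have "\<eta> * norm ?n * norm b \<le> q * norm ?n * norm b" by (intro mult_right_mono) (auto simp: \<eta>_def)
    then have bc: "b \<in> cone ?n \<eta>" using q(2) b unfolding cone_def by (simp add: inner_commute)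
    obtain \<tau> where \<tau>: "\<tau> = 1 \<or> \<tau> = -1" and \<tau>b: "\<forall>b\<in>cone ?n \<eta>. leaves (\<phi> u) b \<tau>"
      using ex[OF \<eta>] by blast
    have "\<sigma> = \<tau>" by (rule ray_sign_unique[OF \<sigma> \<tau> nr]) (use \<tau>b normal_in_cone[OF n \<eta>(2)] in blast)
    then show ?thesis using \<tau>b bc by blast
  qed
  then show ?thesis using \<sigma> unfolding point_side_def by blast
qed

lemma sided_point_side:
  assumes P: "C1_patch S U \<phi>" and ad: "adapted S U \<phi> u0 n \<eta> r \<epsilon>" and \<eta>: "0 < \<eta>" "\<eta> < 1" and n: "n \<noteq> 0"
    and s: "sided \<phi> u0 n \<eta> r \<epsilon> \<sigma>" and u: "u \<in> ball u0 r"
  shows "point_side \<phi> u \<sigma>"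
proof -
  have uU: "u \<in> U" using adaptedD(4)[OF ad] u by blast
  from point_side_exists[OF P uU] obtain \<tau> where \<tau>: "point_side \<phi> u \<tau>" by (elim exE)
  have nc: "n \<in> cone n \<eta>" by (rule normal_in_cone[OF n \<eta>(2)])
  have "patch_normal \<phi> u \<bullet> n > 0" by (rule adapted_normal_pos[OF ad u nc])
  then have 1: "leaves (\<phi> u) n \<tau>"
    using \<tau> unfolding point_side_def by blast
  have 2: "leaves (\<phi> u) n \<sigma>"
    by (rule sided_ray[OF s u nc]) (use ad in \<open>simp add: adapted_def\<close>)
  have "\<sigma> = \<tau>" by (rule ray_sign_unique[OF _ _ 2 1]) (use s \<tau> in \<open>auto simp: sided_def point_side_def\<close>)
  then show ?thesis using \<tau> by simp
qed

end

section \<open>The divergence theorem near a point\<close>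

lemma pd_zero_open:
  assumes "open A" "x \<in> A" "\<And>y. y \<in> A \<Longrightarrow> f y = (0::real)" shows "pd i f x = 0"
  using pd_cong_open[OF assms(1,2), of f "\<lambda>_. 0" i] assms(3) by (simp add: pd_const)

lemma dir_deriv_zero_outside:
  assumes "\<And>x. dist x p > \<rho> \<Longrightarrow> f x = 0" "dist x p > \<rho>" shows "dir_deriv b f x = 0"
proof -
  have "open {x. dist x p > \<rho>}" by (intro open_Collect_less continuous_on_const continuous_on_dist continuous_on_id)
  then have "pd i f x = 0" for i by (rule pd_zero_open) (use assms in auto)
  then show ?thesis by (simp add: dir_deriv_def)
qed

lemma set_integral_eq_indicator:
  assumes "\<And>x. indicator A x * f x = indicator B x * (f x :: real)"
  shows "(LINT x:A|M. f x) = (LINT x:B|M. f x)"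
  unfolding set_lebesgue_integral_def using assms by (intro Bochner_Integration.integral_cong) auto

lemma dir_deriv_add: "dir_deriv (a + b) f x = dir_deriv a f x + dir_deriv b f x"
  by (simp add: dir_deriv_def algebra_simps sum.distrib)

lemma dir_deriv_axis: "dir_deriv (axis i 1) f x = pd i f x"
  by (simp add: dir_deriv_def axis_def if_distrib[of "\<lambda>x. x * _"] cong: if_cong)

lemma dir_deriv_axis_fun: "dir_deriv (axis i 1) f = pd i f"
  by (rule ext) (rule dir_deriv_axis)

definition divergence :: "(real^3 \<Rightarrow> real^3) \<Rightarrow> real^3 \<Rightarrow> real" where
  "divergence X x = (\<Sum>i\<in>UNIV. pd i (\<lambda>y. X y $ i) x)"

definition C1_field :: "(real^3 \<Rightarrow> real^3) \<Rightarrow> bool" where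
  "C1_field X \<longleftrightarrow> (\<forall>i. C1_fun (\<lambda>x. X x $ i))"

lemma set_integrable_bounded_open:
  fixes h :: "'a::euclidean_space \<Rightarrow> real"
  assumes "compact K" "continuous_on K h" "A \<subseteq> K" "A \<in> sets borel"
  shows "set_integrable lborel A h"
proof (rule set_integrable_subset)
  show "set_integrable lborel K h" using borel_integrable_compact[OF assms(1,2)] by (simp add: set_integrable_def)
qed (use assms in auto)

context smooth_region begin

text \<open>Near the point the region is one half of the flow box of \<open>b\<close>. The function vanishes near the
end of this half that lies inside the region, so that only the boundary term on the surface
remains.\<close>

lemma local_dir_flux:
  assumes P: "C1_patch S U \<phi>" and ad: "adapted S U \<phi> u0 n \<eta> r \<epsilon>" and \<eta>: "0 < \<eta>" "\<eta> < 1" and n: "n \<noteq> 0"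
    and s: "sided \<phi> u0 n \<eta> r \<epsilon> \<sigma>" and b: "b \<in> cone n \<eta>"
  shows "\<exists>\<rho>>0. \<forall>f. C1_fun f \<longrightarrow> (\<forall>x. dist x (\<phi> u0) > \<rho> \<longrightarrow> f x = 0) \<longrightarrow>
     (LINT x:interior \<Omega>|lborel. dir_deriv b f x) = \<sigma> * (LINT u:ball u0 r|lborel. f (\<phi> u) * (patch_normal \<phi> u \<bullet> b))"
proof -
  have b0: "norm b > 0" using b by (auto simp: cone_def)
  define \<tau> where "\<tau> = \<epsilon> / norm b"
  have \<tau>: "\<tau> > 0" using adaptedD(2)[OF ad] b0 by (simp add: \<tau>_def)
  let ?D = "{y. pr y \<in> ball u0 r}" and ?\<Phi> = "flow \<phi> b"
  let ?B = "?\<Phi> ` {y. pr y \<in> ball u0 r \<and> - \<tau> < y $ 3 \<and> y $ 3 < \<tau>}"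
  have inj: "inj_on ?\<Phi> ?D" by (rule flow_inj[OF ad patch_inj[OF P] b \<eta>(1)])
  have oB: "open ?B" by (rule flow_nbhd(1)[OF P ad \<eta>(1) b \<tau>])
  have uB: "\<phi> u0 \<in> ?B" by (rule flow_nbhd(2)[OF P ad \<eta>(1) b \<tau> adaptedD(5)[OF ad]])
  from bspec[OF open_contains_cball[THEN iffD1, OF oB] uB]
  obtain \<rho> where \<rho>: "\<rho> > 0" "cball (\<phi> u0) \<rho> \<subseteq> ?B" by (elim exE conjE)
  \<comment> \<open>The half of the flow box that lies inside the region has negative times if \<open>b\<close> points outwards, and positive times otherwise.\<close>
  define \<alpha> where "\<alpha> = (if \<sigma> = 1 then - \<tau> else 0)"
  define \<beta> where "\<beta> = (if \<sigma> = 1 then 0 else \<tau>)"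
  have \<sigma>: "\<sigma> = 1 \<or> \<sigma> = -1" using s by (simp add: sided_def)
  have \<alpha>\<beta>: "\<alpha> < \<beta>" using \<tau> by (simp add: \<alpha>_def \<beta>_def)
  let ?Q = "?\<Phi> ` {y. pr y \<in> ball u0 r \<and> \<alpha> < y $ 3 \<and> y $ 3 < \<beta>}"
  have key: "x \<in> interior \<Omega> \<longleftrightarrow> x \<in> ?Q" if "x \<in> cball (\<phi> u0) \<rho>" for x
  proof -
    have "x \<in> ?B" using that \<rho>(2) by blast
    then obtain y where y': "y \<in> {y. pr y \<in> ball u0 r \<and> - \<tau> < y $ 3 \<and> y $ 3 < \<tau>}" and xy: "x = ?\<Phi> y"
      by blast
    then have y: "pr y \<in> ball u0 r" "- \<tau> < y $ 3" "y $ 3 < \<tau>" by simp_all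
    have Qiff: "x \<in> ?Q \<longleftrightarrow> \<alpha> < y $ 3 \<and> y $ 3 < \<beta>"
    proof
      assume "x \<in> ?Q"
      then obtain z where z: "z \<in> {y. pr y \<in> ball u0 r \<and> \<alpha> < y $ 3 \<and> y $ 3 < \<beta>}" "x = ?\<Phi> z" by blast
      have "z = y" by (rule inj_onD[OF inj]) (use z y xy in simp_all)
      then show "\<alpha> < y $ 3 \<and> y $ 3 < \<beta>" using z by simp
    next
      assume "\<alpha> < y $ 3 \<and> y $ 3 < \<beta>"
      then show "x \<in> ?Q" unfolding xy by (intro imageI) (use y in simp)
    qed
    have c: "\<phi> (pr y) + \<sigma> *\<^sub>R (t *\<^sub>R b) \<notin> \<Omega> \<and> \<phi> (pr y) - \<sigma> *\<^sub>R (t *\<^sub>R b) \<in> interior \<Omega>" if t: "0 < t" "t < \<tau>" for t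
    proof -
      have "t * norm b < \<epsilon>" using t(2) b0 by (simp add: \<tau>_def pos_less_divide_eq)
      then have "t *\<^sub>R b \<in> cone n \<eta> \<inter> ball 0 \<epsilon>" using cone_scale[OF t(1) b] t(1) by simp
      then show ?thesis using s y(1) unfolding sided_def by blast
    qed
    have xe: "x = \<phi> (pr y) + y $ 3 *\<^sub>R b" using xy by (simp add: flow_def)
    have "y $ 3 = 0 \<or> \<sigma> * y $ 3 > 0 \<or> \<sigma> * y $ 3 < 0" using \<sigma> by (elim disjE) auto
    then consider "y $ 3 = 0" | "\<sigma> * y $ 3 > 0" | "\<sigma> * y $ 3 < 0" by argo
    then show ?thesis
    proof cases
      case 1
      have "pr y \<in> U" using y(1) adaptedD(4)[OF ad] by blast
      then have "x \<in> S" using patch_sub[OF P] 1 xe by auto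
      then have "x \<notin> interior \<Omega>" using S_interior by blast
      moreover have "\<not> (\<alpha> < y $ 3 \<and> y $ 3 < \<beta>)" using 1 by (simp add: \<alpha>_def \<beta>_def)
      ultimately show ?thesis using Qiff by blast
    next
      case 2
      have xq: "x = \<phi> (pr y) + \<sigma> *\<^sub>R (\<bar>y $ 3\<bar> *\<^sub>R b)" unfolding xe using 2 \<sigma> by (elim disjE) auto
      have "0 < \<bar>y $ 3\<bar>" "\<bar>y $ 3\<bar> < \<tau>" using 2 y by auto
      from c[OF this] have "x \<notin> \<Omega>" unfolding xq by (rule conjunct1)
      then have "x \<notin> interior \<Omega>" using interior_subset by blast
      moreover have "\<not> (\<alpha> < y $ 3 \<and> y $ 3 < \<beta>)" using 2 \<sigma> by (auto simp: \<alpha>_def \<beta>_def)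
      ultimately show ?thesis using Qiff by blast
    next
      case 3
      have xq: "x = \<phi> (pr y) - \<sigma> *\<^sub>R (\<bar>y $ 3\<bar> *\<^sub>R b)" unfolding xe using 3 \<sigma> by (elim disjE) auto
      have "0 < \<bar>y $ 3\<bar>" "\<bar>y $ 3\<bar> < \<tau>" using 3 y by auto
      from c[OF this] have "x \<in> interior \<Omega>" unfolding xq by (rule conjunct2)
      moreover have "\<alpha> < y $ 3 \<and> y $ 3 < \<beta>" using 3 \<sigma> y by (auto simp: \<alpha>_def \<beta>_def)
      ultimately show ?thesis using Qiff by blast
    qed
  qed
  have far: "\<phi> u + (- \<sigma> * \<tau>) *\<^sub>R b \<notin> cball (\<phi> u0) \<rho>" if u: "u \<in> ball u0 r" for u
  proof
    assume "\<phi> u + (- \<sigma> * \<tau>) *\<^sub>R b \<in> cball (\<phi> u0) \<rho>"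
    then have "\<phi> u + (- \<sigma> * \<tau>) *\<^sub>R b \<in> ?B" using \<rho>(2) by blast
    then obtain y where y: "y \<in> {y. pr y \<in> ball u0 r \<and> - \<tau> < y $ 3 \<and> y $ 3 < \<tau>}" "\<phi> u + (- \<sigma> * \<tau>) *\<^sub>R b = ?\<Phi> y"
      by blast
    have "?\<Phi> y = ?\<Phi> (up u (- \<sigma> * \<tau>))" using y(2) by (simp add: flow_def)
    then have "y = up u (- \<sigma> * \<tau>)" by (rule inj_onD[OF inj]) (use y u in simp_all)
    then show False using y(1) \<sigma> by auto
  qed
  have main: "(LINT x:interior \<Omega>|lborel. dir_deriv b f x) = \<sigma> * (LINT u:ball u0 r|lborel. f (\<phi> u) * (patch_normal \<phi> u \<bullet> b))"
    if f: "C1_fun f" and sup: "\<forall>x. dist x (\<phi> u0) > \<rho> \<longrightarrow> f x = 0" for f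
  proof -
    have "(LINT x:interior \<Omega>|lborel. dir_deriv b f x) = (LINT x:?Q|lborel. dir_deriv b f x)"
    proof (rule set_integral_eq_indicator)
      fix x show "indicator (interior \<Omega>) x * dir_deriv b f x = indicator ?Q x * dir_deriv b f x"
      proof (cases "x \<in> cball (\<phi> u0) \<rho>")
        case True then show ?thesis using key[OF True] by (simp add: indicator_def)
      next
        case False
        then have "dir_deriv b f x = 0" using sup by (intro dir_deriv_zero_outside[of \<rho> "\<phi> u0"]) (auto simp: dist_commute)
        then show ?thesis by simp
      qed
    qed
    also have "\<dots> = (LINT u:ball u0 r|lborel. (patch_normal \<phi> u \<bullet> b) * (f (\<phi> u + \<beta> *\<^sub>R b) - f (\<phi> u + \<alpha> *\<^sub>R b)))"
      by (rule flow_box_integral(2)[OF patch_open[OF P] C1_patch_map[OF P] adaptedD(3)[OF ad] adaptedD(1)[OF ad] inj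
         adapted_normal_pos[OF ad _ b] f \<alpha>\<beta>])
    also have "\<dots> = (LINT u:ball u0 r|lborel. \<sigma> * (f (\<phi> u) * (patch_normal \<phi> u \<bullet> b)))"
    proof (rule set_lebesgue_integral_cong, simp, intro allI impI)
      fix u assume u: "u \<in> ball u0 r"
      have "f (\<phi> u + (- \<sigma> * \<tau>) *\<^sub>R b) = 0" using far[OF u] sup by (auto simp: dist_commute)
      then show "(patch_normal \<phi> u \<bullet> b) * (f (\<phi> u + \<beta> *\<^sub>R b) - f (\<phi> u + \<alpha> *\<^sub>R b)) = \<sigma> * (f (\<phi> u) * (patch_normal \<phi> u \<bullet> b))"
        using \<sigma> by (elim disjE) (simp_all add: \<alpha>_def \<beta>_def)
    qed
    finally show ?thesis by simp
  qed
  show ?thesis by (intro exI[of _ \<rho>] conjI allI impI \<rho>(1)) (rule main; assumption)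
qed

lemma interior_integrable: "continuous_on UNIV h \<Longrightarrow> set_integrable lborel (interior \<Omega>) (h :: real^3 \<Rightarrow> real)"
  by (rule set_integrable_bounded_open[OF compact_\<Omega> continuous_on_subset]) (auto simp: interior_subset)

text \<open>With \<open>u\<close> the unit vector in the direction of \<open>n\<close>, the vector $e_i + 3u$ has length at most
\<open>4\<close> and product at least \<open>2\<close> with \<open>u\<close>, and $2 > 4/3$. Hence $e_i$ is the difference of two
directions in the cone.\<close>

lemma normal_dirs_in_cone:
  assumes n: "n \<noteq> 0"
  shows "(3 / norm n) *\<^sub>R n \<in> cone n (1/3)" "axis i 1 + (3 / norm n) *\<^sub>R n \<in> cone n (1/3)"
proof -
  have nn: "norm n > 0" using n by simp
  have e: "((3 / norm n) *\<^sub>R n) \<bullet> n = 3 * norm n" using nn by (simp add: dot_square_norm power2_eq_square)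
  show "(3 / norm n) *\<^sub>R n \<in> cone n (1/3)" unfolding cone_def using nn e by simp
  have "norm (axis i 1 + (3 / norm n) *\<^sub>R n) \<le> norm (axis i (1::real)) + norm ((3 / norm n) *\<^sub>R n)" by (rule norm_triangle_ineq)
  also have "\<dots> = 4" using nn by simp
  finally have "1/3 * norm n * norm (axis i 1 + (3 / norm n) *\<^sub>R n) \<le> 1/3 * norm n * 4" using nn by (intro mult_left_mono) auto
  moreover have "\<bar>axis i 1 \<bullet> n\<bar> \<le> norm n" using Cauchy_Schwarz_ineq2[of "axis i 1" n] by simp
  ultimately show "axis i 1 + (3 / norm n) *\<^sub>R n \<in> cone n (1/3)"
    unfolding cone_def mem_Collect_eq inner_add_left e using nn by linarith
qed

text \<open>\<open>local_dir_flux\<close> for the directions $e_i + b$ and \<open>b\<close> of \<open>normal_dirs_in_cone\<close>; subtracting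
gives the statement for the coordinate directions.\<close>

lemma local_divergence:
  assumes P: "C1_patch S U \<phi>" and ad: "adapted S U \<phi> u0 n (1/3) r \<epsilon>" and n: "n \<noteq> 0"
    and s: "sided \<phi> u0 n (1/3) r \<epsilon> \<sigma>"
  shows "\<exists>\<rho>>0. \<forall>X. C1_field X \<longrightarrow> (\<forall>x. dist x (\<phi> u0) > \<rho> \<longrightarrow> X x = 0) \<longrightarrow>
     (LINT x:interior \<Omega>|lborel. divergence X x) = \<sigma> * (LINT u:ball u0 r|lborel. X (\<phi> u) \<bullet> patch_normal \<phi> u)"
proof -
  let ?b = "(3 / norm n) *\<^sub>R n" and ?N = "patch_normal \<phi>"
  define good where "good b \<rho> \<longleftrightarrow> (\<forall>f. C1_fun f \<longrightarrow> (\<forall>x. dist x (\<phi> u0) > \<rho> \<longrightarrow> f x = 0) \<longrightarrow>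
     (LINT x:interior \<Omega>|lborel. dir_deriv b f x) = \<sigma> * (LINT u:ball u0 r|lborel. f (\<phi> u) * (?N u \<bullet> b)))" for b \<rho>
  have goodD: "(LINT x:interior \<Omega>|lborel. dir_deriv b f x) = \<sigma> * (LINT u:ball u0 r|lborel. f (\<phi> u) * (?N u \<bullet> b))"
    if "good b \<rho>" "C1_fun f" "\<forall>x. dist x (\<phi> u0) > \<rho> \<longrightarrow> f x = 0" for b \<rho> f
    using that(1)[unfolded good_def, rule_format, OF that(2)] that(3) by blast
  have good_mono: "good b \<rho>'" if "good b \<rho>" "\<rho>' \<le> \<rho>" for b \<rho> \<rho>'
    unfolding good_def by (intro allI impI goodD[OF that(1)]) (use that(2) in auto)
  have ex: "\<exists>\<rho>>0. good b \<rho>" if "b \<in> cone n (1/3)" for b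
    unfolding good_def by (rule local_dir_flux[OF P ad _ _ n s that]) auto
  from ex[OF normal_dirs_in_cone(1)[OF n]] obtain \<rho>0 where \<rho>0: "\<rho>0 > 0" "good ?b \<rho>0" by (elim exE conjE)
  have "\<forall>i. \<exists>\<rho>>0. good (axis i 1 + ?b) \<rho>" by (intro allI ex normal_dirs_in_cone(2)[OF n])
  from choice[OF this] obtain R where RR: "\<forall>i. R i > 0 \<and> good (axis i 1 + ?b) (R i)" by (elim exE)
  then have R: "\<And>i. R i > 0" "\<And>i. good (axis i 1 + ?b) (R i)" by simp_all
  define \<rho> where "\<rho> = min \<rho>0 (min (R 1) (min (R 2) (R 3)))"
  have \<rho>: "\<rho> > 0" "\<rho> \<le> \<rho>0" using \<rho>0(1) R(1) by (auto simp: \<rho>_def)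
  have \<rho>R: "\<rho> \<le> R i" for i using exhaust_3[of i] by (auto simp: \<rho>_def)
  have g0: "good ?b \<rho>" by (rule good_mono[OF \<rho>0(2) \<rho>(2)])
  have gi: "good (axis i 1 + ?b) \<rho>" for i by (rule good_mono[OF R(2) \<rho>R])
  have main: "(LINT x:interior \<Omega>|lborel. divergence X x) = \<sigma> * (LINT u:ball u0 r|lborel. X (\<phi> u) \<bullet> ?N u)"
    if X: "C1_field X" and sup: "\<forall>x. dist x (\<phi> u0) > \<rho> \<longrightarrow> X x = 0" for X
  proof -
    have f: "C1_fun (\<lambda>x. X x $ i)" for i using X by (simp add: C1_field_def)
    have fs: "\<forall>x. dist x (\<phi> u0) > \<rho> \<longrightarrow> X x $ i = 0" for i using sup by simp
    have cont: "continuous_on (cball u0 r) (\<lambda>u. X (\<phi> u) $ i * (?N u \<bullet> b))" for i b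
    proof -
      have "continuous_on (cball u0 r) (\<lambda>u. X (\<phi> u) $ i)"
        by (rule continuous_on_compose2[OF C1_fun_continuous[OF f] continuous_on_subset[OF patch_continuous[OF P] adaptedD(3)[OF ad]]]) simp
      then show ?thesis
        by (rule continuous_on_mult[OF _ continuous_on_inner[OF continuous_on_subset[OF patch_normal_continuous[OF P] adaptedD(3)[OF ad]] continuous_on_const]])
    qed
    have si: "set_integrable lborel (ball u0 r) (\<lambda>u. X (\<phi> u) $ i * (?N u \<bullet> b))" for i b
      by (rule set_integrable_bounded_open[OF compact_cball cont]) auto
    have ii: "set_integrable lborel (interior \<Omega>) (dir_deriv b (\<lambda>x. X x $ i))" for b i
      by (rule interior_integrable[OF dir_deriv_continuous[OF f]])
    have comp: "(LINT x:interior \<Omega>|lborel. pd i (\<lambda>x. X x $ i) x) = \<sigma> * (LINT u:ball u0 r|lborel. X (\<phi> u) $ i * ?N u $ i)" for i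
    proof -
      have "pd i (\<lambda>x. X x $ i) x = dir_deriv (axis i 1 + ?b) (\<lambda>x. X x $ i) x - dir_deriv ?b (\<lambda>x. X x $ i) x" for x
        by (simp add: dir_deriv_add dir_deriv_axis)
      then have "(LINT x:interior \<Omega>|lborel. pd i (\<lambda>x. X x $ i) x) =
        (LINT x:interior \<Omega>|lborel. dir_deriv (axis i 1 + ?b) (\<lambda>x. X x $ i) x) - (LINT x:interior \<Omega>|lborel. dir_deriv ?b (\<lambda>x. X x $ i) x)"
        by (simp only: set_integral_diff(2)[OF ii ii])
      also have "\<dots> = \<sigma> * (LINT u:ball u0 r|lborel. X (\<phi> u) $ i * (?N u \<bullet> (axis i 1 + ?b))) - \<sigma> * (LINT u:ball u0 r|lborel. X (\<phi> u) $ i * (?N u \<bullet> ?b))"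
        unfolding goodD[OF gi f fs] goodD[OF g0 f fs] ..
      also have "\<dots> = \<sigma> * (LINT u:ball u0 r|lborel. X (\<phi> u) $ i * (?N u \<bullet> (axis i 1 + ?b)) - X (\<phi> u) $ i * (?N u \<bullet> ?b))"
        by (simp only: set_integral_diff(2)[OF si si] right_diff_distrib)
      also have "(\<lambda>u. X (\<phi> u) $ i * (?N u \<bullet> (axis i 1 + ?b)) - X (\<phi> u) $ i * (?N u \<bullet> ?b)) = (\<lambda>u. X (\<phi> u) $ i * ?N u $ i)"
        by (simp add: inner_add_right inner_axis distrib_left)
      finally show ?thesis .
    qed
    have si': "set_integrable lborel (ball u0 r) (\<lambda>u. X (\<phi> u) $ i * ?N u $ i)" for i
      using si[of i "axis i 1"] by (simp only: inner_axis inner_real_def mult_1_right)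
    have ii': "set_integrable lborel (interior \<Omega>) (pd i (\<lambda>x. X x $ i))" for i
      using ii[of "axis i 1" i] unfolding dir_deriv_axis_fun .
    have "(LINT x:interior \<Omega>|lborel. divergence X x) = (\<Sum>i\<in>UNIV. LINT x:interior \<Omega>|lborel. pd i (\<lambda>x. X x $ i) x)"
      unfolding divergence_def sum_3
      by (simp only: set_integral_add(2)[OF set_integral_add(1)[OF ii' ii'] ii'] set_integral_add(2)[OF ii' ii'])
    also have "\<dots> = \<sigma> * (\<Sum>i\<in>UNIV. LINT u:ball u0 r|lborel. X (\<phi> u) $ i * ?N u $ i)"
      unfolding comp sum_distrib_left ..
    also have "(\<Sum>i\<in>UNIV. LINT u:ball u0 r|lborel. X (\<phi> u) $ i * ?N u $ i) = (LINT u:ball u0 r|lborel. X (\<phi> u) \<bullet> ?N u)"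
      unfolding inner_vec_def sum_3 inner_real_def
      by (simp only: set_integral_add(2)[OF set_integral_add(1)[OF si' si'] si'] set_integral_add(2)[OF si' si'])
    finally show ?thesis .
  qed
  show ?thesis by (intro exI[of _ \<rho>] conjI allI impI \<rho>(1)) (rule main; assumption)
qed

end

lemma pr_norm_le: "norm (pr x) \<le> norm x"
proof -
  have "(norm (pr x))\<^sup>2 \<le> (norm x)\<^sup>2"
    unfolding power2_norm_eq_inner inner_vec_def sum_2 sum_3 by simp
  then show ?thesis by simp
qed

text \<open>A flow box over a large disc of the coordinate plane contains the support of the function,
which vanishes at both ends of the box. The normalization of \<open>b\<close> makes the Jacobian of the flow one.\<close>

lemma compact_support_dir_deriv_integral:
  assumes f: "C1_fun f" and sup: "\<And>x. norm x > L \<Longrightarrow> f x = 0" and L: "L > 0" and b: "b $ 3 = 1"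
  shows "(LINT x|lborel. dir_deriv b f x) = 0"
proof -
  define \<phi> where "\<phi> u = up u 0" for u
  have hd: "(\<phi> has_derivative (\<lambda>h. up h 0)) (at u)" for u
    unfolding \<phi>_def[abs_def]
    by (rule bounded_linear_imp_has_derivative, rule linear_conv_bounded_linear[THEN iffD1])
      (auto intro!: linearI simp: vec_eq_iff forall_3)
  have pd: "pd 1 \<phi> u = axis 1 1" "pd 2 \<phi> u = axis 2 1" for u
    using pd_eqI[OF hd[of u]] by (auto simp: vec_eq_iff forall_3 axis_def)
  have map: "C1_map UNIV \<phi>" unfolding C1_map_def
  proof (intro conjI ballI allI)
    fix u :: "real^2"
    have "(\<lambda>h. up h 0) = (\<lambda>h. h $ 1 *\<^sub>R pd 1 \<phi> u + h $ 2 *\<^sub>R pd 2 \<phi> u)"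
      unfolding pd by (auto simp: fun_eq_iff vec_eq_iff forall_3 axis_def)
    then show "(\<phi> has_derivative (\<lambda>h. h $ 1 *\<^sub>R pd 1 \<phi> u + h $ 2 *\<^sub>R pd 2 \<phi> u)) (at u)" using hd[of u] by simp
  next
    fix i :: 2
    have "pd i \<phi> = (\<lambda>u. axis (if i = 1 then 1 else 2) 1)" using exhaust_2[of i] pd by (auto simp: fun_eq_iff)
    then show "continuous_on UNIV (pd i \<phi>)" by simp
  qed
  have N: "patch_normal \<phi> u \<bullet> b = 1" for u
    unfolding patch_normal_def pd cross_basis(1) using b by (simp add: inner_axis inner_commute)
  have fl: "flow \<phi> b y $ 3 = y $ 3" for y using b by (simp add: flow_def \<phi>_def)
  have flp: "pr (flow \<phi> b y) = pr y + y $ 3 *\<^sub>R pr b" for y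
    by (simp add: flow_def \<phi>_def vec_eq_iff forall_2)
  define r where "r = 2 * L + 2 * L * norm b + 1"
  have Lb: "L * norm b \<ge> 0" using L by simp
  have r: "r > 0" using L Lb unfolding r_def by (simp only: mult.assoc)
  let ?D = "{y. pr y \<in> ball 0 r}" and ?Q = "flow \<phi> b ` {y. pr y \<in> ball 0 r \<and> - (2 * L) < y $ 3 \<and> y $ 3 < 2 * L}"
  have inj: "inj_on (flow \<phi> b) ?D"
  proof (rule inj_onI)
    fix x y assume e: "flow \<phi> b x = flow \<phi> b y"
    have 3: "x $ 3 = y $ 3" using fl[of x] fl[of y] e by simp
    have "pr x = pr y" using flp[of x] flp[of y] e 3 by simp
    then have "up (pr x) (x $ 3) = up (pr y) (y $ 3)" unfolding 3 by (rule arg_cong[where f="\<lambda>p. up p (y $ 3)"])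
    then show "x = y" by (simp only: up_pr)
  qed
  have cover: "x \<in> ?Q" if x: "norm x \<le> L" for x
  proof (rule image_eqI[of _ _ "up (pr x - x $ 3 *\<^sub>R pr b) (x $ 3)"])
    have x3: "\<bar>x $ 3\<bar> \<le> L" using component_le_norm_cart[of x 3] x by linarith
    have "norm (pr x - x $ 3 *\<^sub>R pr b) \<le> norm (pr x) + \<bar>x $ 3\<bar> * norm (pr b)"
      using norm_triangle_ineq4[of "pr x" "x $ 3 *\<^sub>R pr b"] by simp
    also have "\<dots> \<le> L + L * norm b"
      using x x3 pr_norm_le[of x] pr_norm_le[of b] by (intro add_mono mult_mono) auto
    also have "\<dots> < r" using L Lb unfolding r_def by (simp only: mult.assoc)
    finally show "up (pr x - x $ 3 *\<^sub>R pr b) (x $ 3) \<in> {y. pr y \<in> ball 0 r \<and> - (2 * L) < y $ 3 \<and> y $ 3 < 2 * L}"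
      using x3 L by (auto simp: abs_le_iff)
    show "x = flow \<phi> b (up (pr x - x $ 3 *\<^sub>R pr b) (x $ 3))"
      using b by (simp add: vec_eq_iff forall_3 flow_def \<phi>_def)
  qed
  have zero: "f (\<phi> u + t *\<^sub>R b) = 0" if "\<bar>t\<bar> = 2 * L" for u t
  proof (rule sup)
    have "(\<phi> u + t *\<^sub>R b) $ 3 = t" using b by (simp add: \<phi>_def)
    then have "\<bar>t\<bar> \<le> norm (\<phi> u + t *\<^sub>R b)" using component_le_norm_cart[of "\<phi> u + t *\<^sub>R b" 3] by simp
    then show "norm (\<phi> u + t *\<^sub>R b) > L" using that L by simp
  qed
  have "(LINT x|lborel. dir_deriv b f x) = (LINT x:?Q|lborel. dir_deriv b f x)"
    unfolding set_lebesgue_integral_def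
  proof (rule Bochner_Integration.integral_cong[OF refl])
    fix x show "dir_deriv b f x = indicator ?Q x *\<^sub>R dir_deriv b f x"
    proof (cases "norm x \<le> L")
      case True then show ?thesis using cover[OF True] by (simp add: indicator_def)
    next
      case False
      then have "dir_deriv b f x = 0" using sup by (intro dir_deriv_zero_outside[of L 0]) auto
      then show ?thesis by simp
    qed
  qed
  also have "\<dots> = (LINT u:ball 0 r|lborel. (patch_normal \<phi> u \<bullet> b) * (f (\<phi> u + (2 * L) *\<^sub>R b) - f (\<phi> u + (- (2 * L)) *\<^sub>R b)))"
    by (rule flow_box_integral(2)[OF open_UNIV map _ r inj _ f]) (use N L in auto)
  also have "\<dots> = 0" using zero[of "2 * L"] zero[of "- (2 * L)"] L by (simp add: set_lebesgue_integral_def)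
  finally show ?thesis .
qed

lemma C1_fun_pd_integrable:
  assumes f: "C1_fun f" and sup: "\<And>x. norm x > L \<Longrightarrow> f x = 0"
  shows "integrable lborel (dir_deriv b f)"
proof -
  have "integrable lborel (\<lambda>x. indicator (cball 0 L) x *\<^sub>R dir_deriv b f x)"
    by (rule borel_integrable_compact[OF compact_cball continuous_on_subset[OF dir_deriv_continuous[OF f]]]) simp
  moreover have "(\<lambda>x. indicator (cball 0 L) x *\<^sub>R dir_deriv b f x) = dir_deriv b f"
  proof
    fix x show "indicator (cball 0 L) x *\<^sub>R dir_deriv b f x = dir_deriv b f x"
    proof (cases "norm x > L")
      case True
      then have "dir_deriv b f x = 0" using sup by (intro dir_deriv_zero_outside[of L 0]) auto
      then show ?thesis by simp
    qed (simp add: indicator_def)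
  qed
  ultimately show ?thesis by (simp only:)
qed

text \<open>The third coordinate direction is transversal to the coordinate plane, and the first two
are differences of transversal directions.\<close>

lemma compact_support_divergence_integral:
  assumes X: "C1_field X" and sup: "\<And>x. norm x > L \<Longrightarrow> X x = 0" and L: "L > 0"
  shows "(LINT x|lborel. divergence X x) = 0"
proof -
  have f: "C1_fun (\<lambda>x. X x $ i)" for i using X by (simp add: C1_field_def)
  have fs: "X x $ i = 0" if "norm x > L" for x i using sup[OF that] by simp
  have ax: "axis 3 (1::real) $ (3::3) = 1" by (simp only: axis_def vec_lambda_beta if_True simp_thms refl)
  have int: "integrable lborel (dir_deriv b (\<lambda>x. X x $ i))" for b i
    by (rule C1_fun_pd_integrable[OF f fs])
  have z: "(LINT x|lborel. pd i (\<lambda>x. X x $ i) x) = 0" for i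
  proof (cases "i = 3")
    case True
    have "(LINT x|lborel. dir_deriv (axis 3 1) (\<lambda>x. X x $ i) x) = 0"
      by (rule compact_support_dir_deriv_integral[OF f fs L ax])
    then show ?thesis unfolding dir_deriv_axis_fun True .
  next
    case False
    have 1: "(LINT x|lborel. dir_deriv (axis 3 1) (\<lambda>x. X x $ i) x) = 0"
      by (rule compact_support_dir_deriv_integral[OF f fs L ax])
    have "axis i (1::real) $ 3 = 0" unfolding axis_def vec_lambda_beta using False by auto
    then have ax2: "(axis i (1::real) + axis 3 1) $ 3 = 1" using ax by (simp only: vector_add_component add_0)
    have 2: "(LINT x|lborel. dir_deriv (axis i 1 + axis 3 1) (\<lambda>x. X x $ i) x) = 0"
      by (rule compact_support_dir_deriv_integral[OF f fs L ax2])
    have "(LINT x|lborel. dir_deriv (axis i 1 + axis 3 1) (\<lambda>x. X x $ i) x) =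
      (LINT x|lborel. dir_deriv (axis i 1) (\<lambda>x. X x $ i) x) + (LINT x|lborel. dir_deriv (axis 3 1) (\<lambda>x. X x $ i) x)"
    proof -
      have e: "dir_deriv (axis i 1 + axis 3 1) (\<lambda>x. X x $ i) = (\<lambda>x. dir_deriv (axis i 1) (\<lambda>x. X x $ i) x + dir_deriv (axis 3 1) (\<lambda>x. X x $ i) x)"
        by (rule ext) (rule dir_deriv_add)
      show ?thesis unfolding e
        by (rule Bochner_Integration.integral_add[OF int[of "axis i 1" i] int[of "axis 3 1" i]])
    qed
    then have "(LINT x|lborel. dir_deriv (axis i 1) (\<lambda>x. X x $ i) x) = 0" using 1 2 by linarith
    then show ?thesis unfolding dir_deriv_axis_fun .
  qed
  have int': "integrable lborel (pd i (\<lambda>x. X x $ i))" for i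
    using int[of "axis i 1" i] unfolding dir_deriv_axis_fun .
  have "(LINT x|lborel. divergence X x) = (\<Sum>i\<in>UNIV. LINT x|lborel. pd i (\<lambda>x. X x $ i) x)"
  proof -
    have e: "divergence X = (\<lambda>x. \<Sum>i\<in>UNIV. pd i (\<lambda>x. X x $ i) x)" by (rule ext) (rule divergence_def)
    show ?thesis unfolding e sum_3
      by (simp only: Bochner_Integration.integral_add[OF Bochner_Integration.integrable_add[OF int' int'] int'] Bochner_Integration.integral_add[OF int' int'])
  qed
  then show ?thesis unfolding z by simp
qed

section \<open>Normals and fluxes\<close>

lemma posdef_inverse:
  fixes A :: "real^'n^'n"
  assumes "\<And>v. v \<noteq> 0 \<Longrightarrow> v \<bullet> (A *v v) > 0"
  shows "A ** matrix_inv A = mat 1" "matrix_inv A ** A = mat 1"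
proof -
  have "invertible A" using positive_definite_det_nonzero[OF assms] by (simp add: invertible_det_nz)
  then obtain B where B: "A ** B = mat 1" "B ** A = mat 1" unfolding invertible_def by blast
  then show "A ** matrix_inv A = mat 1" "matrix_inv A ** A = mat 1" by (simp_all add: matrix_inv_eqI[OF B(1)])
qed

lemma inner_sym_matrix: "transpose A = A \<Longrightarrow> (A *v x) \<bullet> y = x \<bullet> ((A :: real^'n^'n) *v y)"
  by (metis dot_lmul_matrix transpose_matrix_vector)

text \<open>The Gram determinant of two vectors in terms of their cross product; for the Euclidean metric
it is Lagrange's identity.\<close>

lemma gram_det_eq:
  fixes A :: "real^3^3"
  assumes "transpose A = A" "H ** A = mat 1"
  shows "(a \<bullet> (A *v a)) * (b \<bullet> (A *v b)) - (a \<bullet> (A *v b)) * (b \<bullet> (A *v a)) = det A * (cross3 a b \<bullet> (H *v cross3 a b))"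
proof -
  have "A *v cross3 (A *v a) (A *v b) = det A *\<^sub>R cross3 a b"
    using cross_matrix_mult[of A a b] assms(1) by simp
  then have "H *v (A *v cross3 (A *v a) (A *v b)) = H *v (det A *\<^sub>R cross3 a b)" by simp
  then have e: "cross3 (A *v a) (A *v b) = det A *\<^sub>R (H *v cross3 a b)"
    by (simp add: matrix_vector_mul_assoc assms(2) matrix_vector_mult_scaleR)
  have "(a \<bullet> (A *v a)) * (b \<bullet> (A *v b)) - (a \<bullet> (A *v b)) * (b \<bullet> (A *v a)) = cross3 a b \<bullet> cross3 (A *v a) (A *v b)"
    by (rule dot_cross[symmetric])
  then show ?thesis unfolding e by simp
qed

lemma orthogonal_to_both:
  assumes "v \<bullet> a = 0" "v \<bullet> b = 0" "cross3 a b \<noteq> 0"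
  shows "\<exists>k. v = k *\<^sub>R cross3 a b"
proof -
  let ?N = "cross3 a b"
  define z where "z = v - ((v \<bullet> ?N) / (?N \<bullet> ?N)) *\<^sub>R ?N"
  have 1: "z \<bullet> ?N = 0" using assms(3) by (simp add: z_def inner_diff_left)
  have "z \<bullet> a = 0" "z \<bullet> b = 0" using assms(1,2) by (simp_all add: z_def inner_diff_left dot_cross_self)
  then have 2: "cross3 z ?N = 0" by (simp add: Lagrange)
  then have "z = 0" using 1 assms(3) norm_and_cross_eq_0[of z ?N] by simp
  then show ?thesis unfolding z_def by (intro exI[of _ "(v \<bullet> ?N) / (?N \<bullet> ?N)"]) simp
qed

context smooth_region begin

definition \<nu> :: "real^3 \<Rightarrow> real^3" where "\<nu> x = outward_normal G W S x"
definition conormal_sq :: "(real^2 \<Rightarrow> real^3) \<Rightarrow> real^2 \<Rightarrow> real" where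
  "conormal_sq \<phi> u = patch_normal \<phi> u \<bullet> (matrix_inv (G (\<phi> u)) *v patch_normal \<phi> u)"

lemma G_inverse: "x \<in> S \<Longrightarrow> G x ** matrix_inv (G x) = mat 1" "x \<in> S \<Longrightarrow> matrix_inv (G x) ** G x = mat 1"
  using posdef_inverse G_posdef by blast+

lemma G_mult_inverse: "x \<in> S \<Longrightarrow> G x *v (matrix_inv (G x) *v v) = v" "x \<in> S \<Longrightarrow> matrix_inv (G x) *v (G x *v v) = v"
  by (simp_all add: matrix_vector_mul_assoc G_inverse)

lemma G_det_pos: "x \<in> S \<Longrightarrow> det (G x) > 0"
  using positive_definite_det_pos G_posdef by blast

lemma patch_in_S: "C1_patch S U \<phi> \<Longrightarrow> u \<in> U \<Longrightarrow> \<phi> u \<in> S"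
  using patch_sub by blast

lemma conormal_sq_pos:
  assumes P: "C1_patch S U \<phi>" and u: "u \<in> U" shows "conormal_sq \<phi> u > 0"
proof -
  let ?x = "\<phi> u" and ?N = "patch_normal \<phi> u"
  have x: "?x \<in> S" by (rule patch_in_S[OF P u])
  let ?y = "matrix_inv (G ?x) *v ?N"
  have N: "G ?x *v ?y = ?N" by (rule G_mult_inverse(1)[OF x])
  have "?y \<noteq> 0" using patch_normal_nonzero[OF P u] N by force
  then have "?y \<bullet> (G ?x *v ?y) > 0" by (rule G_posdef[OF x])
  then show ?thesis unfolding N conormal_sq_def by (simp add: inner_commute)
qed

lemma area_density_eq:
  assumes P: "C1_patch S U \<phi>" and u: "u \<in> U"
  shows "area_density G \<phi> u = sqrt (det (G (\<phi> u)) * conormal_sq \<phi> u)"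
proof -
  have x: "\<phi> u \<in> S" by (rule patch_in_S[OF P u])
  show ?thesis unfolding area_density_def det_2 vec_lambda_beta conormal_sq_def patch_normal_def
    gram_det_eq[OF G_symm[OF x] G_inverse(2)[OF x]] ..
qed

text \<open>The defining conditions leave a positive and a negative multiple of the metric dual of the
patch normal. Only the one on the outer side leaves \<open>W\<close>, because near the boundary \<open>W\<close> is the whole
region.\<close>

lemma normal_eq:
  assumes P: "C1_patch S U \<phi>" and u: "u \<in> U" and s: "point_side \<phi> u \<sigma>"
  shows "\<nu> (\<phi> u) = (\<sigma> / sqrt (conormal_sq \<phi> u)) *\<^sub>R (matrix_inv (G (\<phi> u)) *v patch_normal \<phi> u)"
proof -
  define x where "x = \<phi> u"
  define N where "N = patch_normal \<phi> u"
  define A where "A = G x"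
  define y where "y = matrix_inv A *v N"
  define q where "q = conormal_sq \<phi> u"
  define b where "b = (1 / sqrt q) *\<^sub>R y"
  have x: "x \<in> S" unfolding x_def by (rule patch_in_S[OF P u])
  have \<sigma>: "\<sigma> = 1 \<or> \<sigma> = -1" using s by (simp add: point_side_def)
  have ss: "\<sigma> * \<sigma> = 1" using \<sigma> by auto
  have q: "q > 0" unfolding q_def by (rule conormal_sq_pos[OF P u])
  have qe: "N \<bullet> y = q" by (simp add: q_def conormal_sq_def N_def y_def A_def x_def)
  have Ay: "A *v y = N" unfolding A_def y_def by (rule G_mult_inverse(1)[OF x])
  have HA: "matrix_inv A *v (A *v v) = v" for v unfolding A_def by (rule G_mult_inverse(2)[OF x])
  have Nb: "N \<bullet> b > 0" using q by (simp add: b_def qe)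
  have Ab: "A *v b = (1 / sqrt q) *\<^sub>R N" by (simp add: b_def matrix_vector_mult_scaleR Ay)
  have bAb: "b \<bullet> (A *v b) = 1" unfolding Ab using q by (simp add: b_def inner_commute[of y] qe)
  have lv: "leaves x b \<sigma>" using s Nb unfolding point_side_def x_def N_def by simp
  then obtain e where e: "e > 0" "\<forall>t. 0 < t \<and> t < e \<longrightarrow> x + (\<sigma> * t) *\<^sub>R b \<notin> \<Omega> \<and> x - (\<sigma> * t) *\<^sub>R b \<in> interior \<Omega>"
    unfolding leaves_def by (elim exE conjE)
  have tan: "pd a \<phi> u \<in> tangent_space S x" for a
    unfolding tangent_space_def pd_def x_def using P u by blast
  have "outward_normal G W S x = \<sigma> *\<^sub>R b"
    unfolding outward_normal_def A_def[symmetric]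
  proof (rule the_equality, intro conjI ballI)
    show "(\<sigma> *\<^sub>R b) \<bullet> (A *v (\<sigma> *\<^sub>R b)) = 1"
      by (simp only: matrix_vector_mult_scaleR inner_scaleR_left inner_scaleR_right bAb mult_1_right ss)
    fix w assume "w \<in> tangent_space S x"
    then obtain V \<psi> v h where t: "C1_patch S V \<psi>" "v \<in> V" "\<psi> v = x" "w = frechet_derivative \<psi> (at v) h"
      unfolding tangent_space_def by blast
    have "w \<bullet> N = 0" unfolding t(4) N_def
      by (rule patch_tangent_orthogonal[OF P u t(1,2)]) (simp add: t(3) x_def)
    then show "w \<bullet> (A *v (\<sigma> *\<^sub>R b)) = 0" by (simp add: matrix_vector_mult_scaleR Ab)
  next
    show "\<exists>\<epsilon>>0. \<forall>t. 0 < t \<and> t < \<epsilon> \<longrightarrow> x + t *\<^sub>R (\<sigma> *\<^sub>R b) \<notin> W"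
    proof (intro exI[of _ e] conjI e(1) allI impI)
      fix t assume "0 < t \<and> t < e"
      then have "x + (\<sigma> * t) *\<^sub>R b \<notin> \<Omega>" using e(2) by blast
      then show "x + t *\<^sub>R (\<sigma> *\<^sub>R b) \<notin> W" using W_sub by (auto simp: mult.commute)
    qed
  next
    fix \<mu> assume m: "\<mu> \<bullet> (A *v \<mu>) = 1 \<and> (\<forall>w\<in>tangent_space S x. w \<bullet> (A *v \<mu>) = 0) \<and>
      (\<exists>\<epsilon>>0. \<forall>t. 0 < t \<and> t < \<epsilon> \<longrightarrow> x + t *\<^sub>R \<mu> \<notin> W)"
    have "pd a \<phi> u \<bullet> (A *v \<mu>) = 0" for a using m tan[of a] by blast
    then have "(A *v \<mu>) \<bullet> pd 1 \<phi> u = 0" "(A *v \<mu>) \<bullet> pd 2 \<phi> u = 0" by (simp_all add: inner_commute)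
    from orthogonal_to_both[OF this] patch_normal_nonzero[OF P u]
    obtain k where l: "A *v \<mu> = k *\<^sub>R N" unfolding N_def patch_normal_def by auto
    have "\<mu> = matrix_inv A *v (k *\<^sub>R N)" unfolding l[symmetric] HA ..
    then have my: "\<mu> = k *\<^sub>R y" by (simp add: matrix_vector_mult_scaleR y_def)
    have "k * k * q = 1" using m unfolding l by (simp add: my inner_commute[of y] qe mult.assoc)
    then have "(k * sqrt q)\<^sup>2 = 1" using q by (simp add: power2_eq_square power_mult_distrib mult_ac)
    then have "k * sqrt q = 1 \<or> k * sqrt q = -1" by (simp add: power2_eq_1_iff)
    then have "k = 1 / sqrt q \<or> k = - (1 / sqrt q)" using q by (auto simp: field_simps)
    then have "\<mu> = b \<or> \<mu> = - b" unfolding my b_def by auto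
    then have "\<mu> = \<sigma> *\<^sub>R b \<or> \<mu> = - (\<sigma> *\<^sub>R b)" using \<sigma> by auto
    moreover have "\<mu> \<noteq> - (\<sigma> *\<^sub>R b)"
    proof
      assume mu: "\<mu> = - (\<sigma> *\<^sub>R b)"
      obtain e1 where e1: "e1 > 0" "\<forall>t. 0 < t \<and> t < e1 \<longrightarrow> x + t *\<^sub>R \<mu> \<notin> W" using m by blast
      obtain T where T: "open T" "S \<subseteq> T" "\<Omega> \<inter> T \<subseteq> W" using W_near by blast
      have "x \<in> T" using x T(2) by blast
      then obtain d where d: "d > 0" "ball x d \<subseteq> T" using T(1) open_contains_ball by blast
      define D where "D = d / (norm b + 1)"
      have nb: "norm b + 1 > 0" by (rule add_nonneg_pos) auto
      have D: "D > 0" unfolding D_def using d(1) nb by (rule divide_pos_pos)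
      define t where "t = min (min e e1) D / 2"
      have tp: "t > 0" "t < e" "t < e1" "t < D"
        using e(1) e1(1) D unfolding t_def by auto
      have "t * norm b < d"
      proof -
        have "t * norm b \<le> t * (norm b + 1)" using tp(1) by (intro mult_left_mono) auto
        also have "\<dots> < d" using tp(4) nb by (simp only: D_def pos_less_divide_eq)
        finally show ?thesis .
      qed
      then have "dist x (x - (\<sigma> * t) *\<^sub>R b) < d" using tp(1) \<sigma> by (auto simp: dist_norm)
      then have inT: "x - (\<sigma> * t) *\<^sub>R b \<in> T" using d(2) by auto
      have "x - (\<sigma> * t) *\<^sub>R b \<in> \<Omega>" using e(2) tp(1,2) interior_subset by blast
      then have "x - (\<sigma> * t) *\<^sub>R b \<in> W" using inT T(3) by blast
      moreover have "x + t *\<^sub>R \<mu> = x - (\<sigma> * t) *\<^sub>R b" by (simp add: mu mult.commute)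
      ultimately show False using e1(2) tp(1,3) by auto
    qed
    ultimately show "\<mu> = \<sigma> *\<^sub>R b" by blast
  qed
  then show ?thesis unfolding \<nu>_def x_def[symmetric] N_def[symmetric] q_def[symmetric] A_def[symmetric] y_def[symmetric]
    by (simp add: b_def)
qed

text \<open>The unit normal with lowered index. Along a patch it is parallel to the Euclidean normal,
whatever the metric is.\<close>

definition conormal :: "real^3 \<Rightarrow> real^3" where "conormal x = G x *v \<nu> x"

lemma conormal_eq:
  assumes P: "C1_patch S U \<phi>" and u: "u \<in> U" and s: "point_side \<phi> u \<sigma>"
  shows "conormal (\<phi> u) = (\<sigma> / sqrt (conormal_sq \<phi> u)) *\<^sub>R patch_normal \<phi> u"
  unfolding conormal_def normal_eq[OF assms] matrix_vector_mult_scaleR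
  by (simp only: G_mult_inverse(1)[OF patch_in_S[OF P u]])

lemma G_component_continuous: "continuous_on S (\<lambda>x. G x $ i $ j)"
  by (intro continuous_on_component G_cont)

lemma det_G_continuous: "continuous_on S (\<lambda>x. det (G x))"
  unfolding det_3 by (intro continuous_on_add continuous_on_diff continuous_on_mult G_component_continuous)

lemma ginv_component_continuous: "continuous_on S (\<lambda>x. matrix_inv (G x) $ i $ j)"
proof -
  have "continuous_on S (\<lambda>x. (1 / det (G x)) * adjugate3 (G x) $ i $ j)"
    unfolding adjugate3_def vec_lambda_beta
    by (intro continuous_on_mult continuous_on_diff continuous_on_divide continuous_on_const det_G_continuous G_component_continuous)
       (use G_det_pos in force)
  moreover have "(1 / det (G x)) * adjugate3 (G x) $ i $ j = matrix_inv (G x) $ i $ j" if "x \<in> S" for x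
  proof -
    have "det (G x) \<noteq> 0" using G_det_pos[OF that] by simp
    then show ?thesis by (simp add: matrix_inv_adjugate3)
  qed
  ultimately show ?thesis by (rule continuous_on_eq)
qed

lemma conormal_sq_continuous:
  assumes P: "C1_patch S U \<phi>" shows "continuous_on U (conormal_sq \<phi>)"
proof -
  have H: "continuous_on U (\<lambda>u. matrix_inv (G (\<phi> u)) $ i $ j)" for i j
    by (rule continuous_on_compose2[OF ginv_component_continuous patch_continuous[OF P] patch_sub[OF P]])
  have N: "continuous_on U (\<lambda>u. patch_normal \<phi> u $ i)" for i
    by (rule continuous_on_component[OF patch_normal_continuous[OF P]])
  show ?thesis unfolding conormal_sq_def[abs_def] inner_vec_def matrix_vector_mult_def vec_lambda_beta inner_real_def
    by (intro continuous_on_sum continuous_on_mult H N)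
qed

lemma sided_patch_exists:
  assumes "x \<in> S"
  shows "\<exists>U \<phi> u0 r \<epsilon> \<sigma>. C1_patch S U \<phi> \<and> u0 \<in> U \<and> x = \<phi> u0 \<and> patch_normal \<phi> u0 \<noteq> 0 \<and>
    adapted S U \<phi> u0 (patch_normal \<phi> u0) (1/3) r \<epsilon> \<and> sided \<phi> u0 (patch_normal \<phi> u0) (1/3) r \<epsilon> \<sigma>"
proof -
  from assms S_C1 obtain U \<phi> where P: "C1_patch S U \<phi>" and "x \<in> \<phi> ` U" unfolding C1_surface_def by blast
  then obtain u0 where u0: "u0 \<in> U" "x = \<phi> u0" by blast
  have n: "patch_normal \<phi> u0 \<noteq> 0" by (rule patch_normal_nonzero[OF P u0(1)])
  have "(1/3::real) > 0" by simp
  from adapted_exists[OF P u0(1) this] obtain r \<epsilon> where ad: "adapted S U \<phi> u0 (patch_normal \<phi> u0) (1/3) r \<epsilon>" by (elim exE)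
  from sided_exists[OF P ad _ _ n] obtain \<sigma> where s: "sided \<phi> u0 (patch_normal \<phi> u0) (1/3) r \<epsilon> \<sigma>" by auto
  show ?thesis
    by (rule exI[of _ U], rule exI[of _ \<phi>], rule exI[of _ u0], rule exI[of _ r], rule exI[of _ \<epsilon>], rule exI[of _ \<sigma>])
      (intro conjI P u0 n ad s)
qed

lemma sided_point_side':
  assumes P: "C1_patch S U \<phi>" and ad: "adapted S U \<phi> u0 n (1/3) r \<epsilon>" and n: "n \<noteq> 0"
    and s: "sided \<phi> u0 n (1/3) r \<epsilon> \<sigma>" and u: "u \<in> ball u0 r"
  shows "point_side \<phi> u \<sigma>"
  by (rule sided_point_side[OF P ad _ _ n s u]) simp_all

text \<open>On a whole adapted neighborhood the sign is the same, so that the explicit formula of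
\<open>conormal_eq\<close> applies there.\<close>

lemma conormal_continuous: "continuous_on S conormal"
  unfolding continuous_on_eq_continuous_within
proof
  fix x assume "x \<in> S"
  from sided_patch_exists[OF this] obtain U \<phi> u0 r \<epsilon> \<sigma> where P: "C1_patch S U \<phi>" and u0: "u0 \<in> U" "x = \<phi> u0"
    and n: "patch_normal \<phi> u0 \<noteq> 0" and ad: "adapted S U \<phi> u0 (patch_normal \<phi> u0) (1/3) r \<epsilon>"
    and s: "sided \<phi> u0 (patch_normal \<phi> u0) (1/3) r \<epsilon> \<sigma>" by (elim exE conjE)
  let ?B = "ball u0 r"
  have bU: "?B \<subseteq> U" by (rule adaptedD(4)[OF ad])
  obtain \<psi> where h: "homeomorphism U (\<phi> ` U) \<phi> \<psi>" using P by (auto simp: C1_patch_def)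
  have \<psi>: "\<psi> (\<phi> u) = u" if "u \<in> ?B" for u using h bU that by (auto simp: homeomorphism_def)
  have "continuous_on ?B (\<lambda>u. (\<sigma> / sqrt (conormal_sq \<phi> u)) *\<^sub>R patch_normal \<phi> u)"
    by (intro continuous_on_scaleR continuous_on_divide continuous_on_const continuous_on_real_sqrt
       continuous_on_subset[OF conormal_sq_continuous[OF P] bU] continuous_on_subset[OF patch_normal_continuous[OF P] bU])
       (use conormal_sq_pos[OF P] bU in force)
  then have 1: "continuous_on ?B (\<lambda>u. conormal (\<phi> u))"
    by (rule continuous_on_eq) (use conormal_eq[OF P] sided_point_side'[OF P ad n s] bU in force)
  have "continuous_on (\<phi> ` ?B) \<psi>" using h bU by (meson continuous_on_subset homeomorphism_cont2 image_mono)
  then have "continuous_on (\<phi> ` ?B) (\<lambda>y. conormal (\<phi> (\<psi> y)))"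
    by (rule continuous_on_compose2[OF 1]) (use \<psi> in auto)
  then have c: "continuous_on (\<phi> ` ?B) conormal"
    by (rule continuous_on_eq) (use \<psi> in auto)
  obtain T where T: "open T" "\<phi> ` ?B = S \<inter> T" using patch_openin[OF P open_ball bU] by (auto simp: openin_open)
  have xB: "x \<in> \<phi> ` ?B" unfolding u0(2) by (rule imageI[OF adaptedD(5)[OF ad]])
  have "continuous (at x within \<phi> ` ?B) conormal"
    by (rule bspec[OF c[unfolded continuous_on_eq_continuous_within] xB])
  moreover have "at x within \<phi> ` ?B = at x within S"
    by (rule at_within_nhd[of x T]) (use T xB in auto)
  ultimately show "continuous (at x within S) conormal" by simp
qed

text \<open>For a vector density \<open>X\<close> the field $X / \sqrt{\det G}$ is a vector field, and this is its
normal component with respect to \<open>G\<close>.\<close>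

definition flux_density :: "(real^3 \<Rightarrow> real^3) \<Rightarrow> real^3 \<Rightarrow> real" where
  "flux_density X x = (X x \<bullet> conormal x) / sqrt (det (G x))"

lemma flux_density_continuous:
  assumes "continuous_on S X" shows "continuous_on S (flux_density X)"
  unfolding flux_density_def[abs_def]
  by (intro continuous_on_divide continuous_on_inner assms conormal_continuous continuous_on_real_sqrt det_G_continuous)
     (use G_det_pos in force)

abbreviation \<mu> :: "(real^3) measure" where "\<mu> \<equiv> area_measure G S"

lemma area_measure_props: "sets \<mu> = sets borel" "emeasure \<mu> (- S) = 0"
  "C1_patch S U \<phi> \<Longrightarrow> E \<in> sets borel \<Longrightarrow> emeasure \<mu> (E \<inter> \<phi> ` U) = patch_content G U \<phi> E"
  using area_measure_is_area_measure[OF S_C1 S_compact G_cont] by (simp_all add: is_area_measure_def)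

lemma mu_finite: "finite_measure \<mu>"
proof
  have "space \<mu> = UNIV" using sets_eq_imp_space_eq[OF area_measure_props(1)] by simp
  then show "emeasure \<mu> (space \<mu>) \<noteq> \<infinity>" using area_measure_finite[OF S_C1 S_compact G_cont] by simp
qed

lemma set_integrable_S:
  assumes "continuous_on S (h :: real^3 \<Rightarrow> real)" shows "set_integrable \<mu> S h"
proof -
  have m: "(\<lambda>x. indicator S x *\<^sub>R h x) \<in> borel_measurable borel"
    by (rule borel_measurable_continuous_on_indicator[OF _ assms]) (use S_closed in auto)
  have "bounded (h ` S)" by (rule compact_imp_bounded[OF compact_continuous_image[OF assms S_compact]])
  then obtain B where B: "\<forall>y\<in>h ` S. norm y \<le> B" unfolding bounded_iff by blast
  have "norm (indicator S x *\<^sub>R h x) \<le> \<bar>B\<bar>" for x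
  proof (cases "x \<in> S")
    case True
    then have "norm (h x) \<le> B" using B by blast
    then show ?thesis using True by simp
  qed simp
  then show ?thesis unfolding set_integrable_def
    by (intro finite_measure.integrable_const_bound[OF mu_finite, of _ "\<bar>B\<bar>"] AE_I2)
       (use m area_measure_props(1) in \<open>simp_all cong: measurable_cong_sets\<close>)
qed

lemma area_integral_patch:
  assumes P: "C1_patch S V \<phi>" and f: "f \<in> borel_measurable borel"
  shows "(\<integral>x. indicator (\<phi> ` V) x * f x \<partial>\<mu>) = (LINT u:V|lborel. f (\<phi> u) * area_density G \<phi> u)"
proof -
  have V: "V \<in> sets borel" using patch_open[OF P] by simp
  have im: "\<phi> ` V \<in> sets borel" by (rule patch_image_borel[OF P S_closed])
  have im': "\<phi> ` V \<in> sets \<mu>" using im area_measure_props(1) by simp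
  have eq: "density \<mu> (indicator (\<phi> ` V)) = patch_measure G V \<phi>"
  proof (rule measure_eqI)
    show "sets (density \<mu> (indicator (\<phi> ` V))) = sets (patch_measure G V \<phi>)" by (simp add: area_measure_props(1))
    fix E assume "E \<in> sets (density \<mu> (indicator (\<phi> ` V)))"
    then have E: "E \<in> sets borel" "E \<in> sets \<mu>" by (simp_all add: area_measure_props(1))
    have "emeasure (density \<mu> (indicator (\<phi> ` V))) E = emeasure \<mu> (E \<inter> \<phi> ` V)"
      using E(2) im' by (subst emeasure_density) (auto simp: indicator_inter_arith[symmetric] Int_commute)
    also have "\<dots> = emeasure (patch_measure G V \<phi>) E"
      unfolding area_measure_props(3)[OF P E(1)] emeasure_patch_measure[OF P G_cont E(1)] ..
    finally show "emeasure (density \<mu> (indicator (\<phi> ` V))) E = emeasure (patch_measure G V \<phi>) E" .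
  qed
  have fm: "f \<in> borel_measurable \<mu>" using f area_measure_props(1) by (simp cong: measurable_cong_sets)
  have nn: "0 \<le> indicator V u *\<^sub>R area_density G \<phi> u" for u
  proof (cases "u \<in> V")
    case True
    have "0 \<le> det (G (\<phi> u)) * conormal_sq \<phi> u"
      using G_det_pos[OF patch_in_S[OF P True]] conormal_sq_pos[OF P True] by simp
    then show ?thesis by (simp add: area_density_eq[OF P True])
  qed simp
  have m1: "(\<lambda>u. if u \<in> V then \<phi> u else 0) \<in> borel_measurable borel"
    by (rule borel_measurable_continuous_on_if[OF V patch_continuous[OF P]]) simp
  have m2: "(\<lambda>u. indicator V u *\<^sub>R area_density G \<phi> u) \<in> borel_measurable borel"
    by (rule density_on_measurable[OF patch_open[OF P] continuous_on_area_density[OF P G_cont] V order_refl])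
  have ind: "density \<mu> (indicator (\<phi> ` V)) = density \<mu> (\<lambda>x. ennreal (indicator (\<phi> ` V) x))"
    by (rule arg_cong[where f="density \<mu>"]) (auto simp: fun_eq_iff indicator_def)
  have "(\<integral>x. indicator (\<phi> ` V) x * f x \<partial>\<mu>) = (\<integral>x. f x \<partial>density \<mu> (\<lambda>x. ennreal (indicator (\<phi> ` V) x)))"
    by (rule integral_real_density[symmetric]) (use im' fm in auto)
  also have "\<dots> = (\<integral>x. f x \<partial>patch_measure G V \<phi>)" unfolding ind[symmetric] eq ..
  also have "\<dots> = (\<integral>u. f (if u \<in> V then \<phi> u else 0) \<partial>density lborel (\<lambda>u. ennreal (indicator V u *\<^sub>R area_density G \<phi> u)))"
    unfolding patch_measure_def by (rule integral_distr) (use m1 f in simp_all)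
  also have "\<dots> = (\<integral>u. (indicator V u *\<^sub>R area_density G \<phi> u) * f (if u \<in> V then \<phi> u else 0) \<partial>lborel)"
  proof (rule integral_real_density)
    show "(\<lambda>u. f (if u \<in> V then \<phi> u else 0)) \<in> borel_measurable lborel"
      using measurable_compose[OF m1 f] by simp
    show "(\<lambda>u. indicator V u *\<^sub>R area_density G \<phi> u) \<in> borel_measurable lborel" using m2 by simp
    show "AE u in lborel. 0 \<le> indicator V u *\<^sub>R area_density G \<phi> u" using nn by simp
  qed
  also have "\<dots> = (LINT u:V|lborel. f (\<phi> u) * area_density G \<phi> u)"
    unfolding set_lebesgue_integral_def
    by (rule Bochner_Integration.integral_cong[OF refl]) (auto simp: indicator_def)
  finally show ?thesis .
qed

definition flux :: "(real^3 \<Rightarrow> real^3) \<Rightarrow> real" where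
  "flux X = surface_integral G S (flux_density X)"

lemma flux_add:
  assumes "continuous_on S X" "continuous_on S Y"
  shows "flux (\<lambda>x. X x + Y x) = flux X + flux Y"
proof -
  have "flux_density (\<lambda>x. X x + Y x) = (\<lambda>x. flux_density X x + flux_density Y x)"
    by (simp add: fun_eq_iff flux_density_def inner_add_left add_divide_distrib)
  then show ?thesis unfolding flux_def surface_integral_def
    using set_integral_add(2)[OF set_integrable_S[OF flux_density_continuous[OF assms(1)]] set_integrable_S[OF flux_density_continuous[OF assms(2)]]]
    by simp
qed

lemma flux_zero:
  assumes "\<And>x. x \<in> S \<Longrightarrow> X x = 0" shows "flux X = 0"
proof -
  have "(\<lambda>x. indicator S x *\<^sub>R flux_density X x) = (\<lambda>x. 0)"
  proof
    fix x show "indicator S x *\<^sub>R flux_density X x = 0"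
      using assms by (cases "x \<in> S") (simp_all add: flux_density_def)
  qed
  then show ?thesis unfolding flux_def surface_integral_def set_lebesgue_integral_def by (simp only: integral_zero)
qed

text \<open>The area density $\sqrt{\det G}\,\sqrt{N \cdot G^{-1} N}$ cancels against the factors of the
density and of the unit normal. What remains is the Euclidean flux.\<close>

lemma local_flux:
  assumes P: "C1_patch S U \<phi>" and ad: "adapted S U \<phi> u0 n (1/3) r \<epsilon>" and n: "n \<noteq> 0"
    and s: "sided \<phi> u0 n (1/3) r \<epsilon> \<sigma>" and X: "continuous_on S X"
    and sup: "\<And>x. x \<in> S \<Longrightarrow> x \<notin> \<phi> ` ball u0 r \<Longrightarrow> X x = 0"
  shows "flux X = \<sigma> * (LINT u:ball u0 r|lborel. X (\<phi> u) \<bullet> patch_normal \<phi> u)"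
proof -
  let ?B = "ball u0 r"
  have bU: "?B \<subseteq> U" by (rule adaptedD(4)[OF ad])
  have PB: "C1_patch S ?B \<phi>" by (rule C1_patch_restrict[OF P open_ball bU])
  define F where "F x = indicator S x *\<^sub>R flux_density X x" for x
  have F: "F \<in> borel_measurable borel" unfolding F_def[abs_def]
    by (rule borel_measurable_continuous_on_indicator[OF _ flux_density_continuous[OF X]]) (use S_closed in auto)
  have "flux X = (\<integral>x. indicator (\<phi> ` ?B) x * F x \<partial>\<mu>)"
    unfolding flux_def surface_integral_def set_lebesgue_integral_def
  proof (rule Bochner_Integration.integral_cong[OF refl])
    fix x show "indicator S x *\<^sub>R flux_density X x = indicator (\<phi> ` ?B) x * F x"
    proof (cases "x \<in> S \<and> x \<notin> \<phi> ` ?B")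
      case True
      then have "X x = 0" using sup by blast
      then show ?thesis by (simp add: F_def flux_density_def)
    next
      case False
      then show ?thesis by (auto simp: F_def indicator_def)
    qed
  qed
  also have "\<dots> = (LINT u:?B|lborel. F (\<phi> u) * area_density G \<phi> u)" by (rule area_integral_patch[OF PB F])
  also have "\<dots> = (LINT u:?B|lborel. \<sigma> * (X (\<phi> u) \<bullet> patch_normal \<phi> u))"
  proof (rule set_lebesgue_integral_cong, simp, intro allI impI)
    fix u assume u: "u \<in> ?B"
    have uU: "u \<in> U" using bU u by blast
    have x: "\<phi> u \<in> S" by (rule patch_in_S[OF P uU])
    have q: "conormal_sq \<phi> u > 0" by (rule conormal_sq_pos[OF P uU])
    have d: "det (G (\<phi> u)) > 0" by (rule G_det_pos[OF x])
    have "F (\<phi> u) * area_density G \<phi> u = (X (\<phi> u) \<bullet> ((\<sigma> / sqrt (conormal_sq \<phi> u)) *\<^sub>R patch_normal \<phi> u)) / sqrt (det (G (\<phi> u))) * sqrt (det (G (\<phi> u)) * conormal_sq \<phi> u)"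
      using x by (simp add: F_def flux_density_def conormal_eq[OF P uU sided_point_side'[OF P ad n s u]] area_density_eq[OF P uU])
    also have "\<dots> = \<sigma> * (X (\<phi> u) \<bullet> patch_normal \<phi> u)" using q d by (simp add: real_sqrt_mult)
    finally show "F (\<phi> u) * area_density G \<phi> u = \<sigma> * (X (\<phi> u) \<bullet> patch_normal \<phi> u)" .
  qed
  finally show ?thesis by simp
qed

end

section \<open>Cutoff functions and the divergence theorem\<close>

lemma C1_funI:
  assumes "\<And>x. (f has_derivative (\<lambda>h. \<Sum>i\<in>UNIV. h $ i * D i x)) (at x)" "\<And>i. continuous_on UNIV (D i)"
  shows "C1_fun f" "pd i f = D i"
proof -
  have p: "pd i f x = D i x" for i x
    using pd_eqI[OF assms(1)[of x], of i] by (simp add: axis_def if_distrib[of "\<lambda>x. x * _"] cong: if_cong)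
  have e: "pd i f = D i" for i by (rule ext) (rule p)
  show "pd i f = D i" by (rule e)
  show "C1_fun f" unfolding C1_fun_def e using assms by (auto simp: differentiable_def)
qed

lemma C1_fun_has_derivative: "C1_fun f \<Longrightarrow> (f has_derivative (\<lambda>h. \<Sum>i\<in>UNIV. h $ i * pd i f x)) (at x)"
  by (rule has_derivative_pd) (simp add: C1_fun_def)

lemma C1_fun_pd_continuous: "C1_fun f \<Longrightarrow> continuous_on UNIV (pd i f)"
  by (simp add: C1_fun_def)

lemma C1_fun_add: assumes "C1_fun f" "C1_fun g" shows "C1_fun (\<lambda>x. f x + g x)"
proof (rule C1_funI(1)[where D="\<lambda>i x. pd i f x + pd i g x"])
  show "((\<lambda>x. f x + g x) has_derivative (\<lambda>h. \<Sum>i\<in>UNIV. h $ i * (pd i f x + pd i g x))) (at x)" for x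
    using has_derivative_add[OF C1_fun_has_derivative[OF assms(1)] C1_fun_has_derivative[OF assms(2)], of x]
    by (simp add: distrib_left sum.distrib)
qed (intro continuous_on_add C1_fun_pd_continuous assms)

lemma C1_fun_mult: assumes "C1_fun f" "C1_fun g" shows "C1_fun (\<lambda>x. f x * g x)"
proof (rule C1_funI(1)[where D="\<lambda>i x. f x * pd i g x + pd i f x * g x"])
  show "((\<lambda>x. f x * g x) has_derivative (\<lambda>h. \<Sum>i\<in>UNIV. h $ i * (f x * pd i g x + pd i f x * g x))) (at x)" for x
    using has_derivative_mult[OF C1_fun_has_derivative[OF assms(1)] C1_fun_has_derivative[OF assms(2)], of x]
    by (simp add: distrib_left sum.distrib sum_distrib_left sum_distrib_right mult_ac)
qed (intro continuous_on_add continuous_on_mult C1_fun_pd_continuous C1_fun_continuous assms)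

lemma C1_fun_compose:
  assumes f: "C1_fun f" and g: "\<And>x. (g has_real_derivative g' (f x)) (at (f x))" and g': "continuous_on (range f) g'"
  shows "C1_fun (\<lambda>x. g (f x))"
proof (rule C1_funI(1)[where D="\<lambda>i x. pd i f x * g' (f x)"])
  show "((\<lambda>x. g (f x)) has_derivative (\<lambda>h. \<Sum>i\<in>UNIV. h $ i * (pd i f x * g' (f x)))) (at x)" for x
    using DERIV_compose_FDERIV[OF g C1_fun_has_derivative[OF f], of x]
    by (simp add: sum_distrib_right mult.assoc)
  show "continuous_on UNIV (\<lambda>x. pd i f x * g' (f x))" for i
    by (intro continuous_on_mult C1_fun_pd_continuous f continuous_on_compose2[OF g' C1_fun_continuous[OF f]]) auto
qed

lemma C1_fun_cmult: "C1_fun f \<Longrightarrow> C1_fun (\<lambda>x. c * f x)"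
  by (rule C1_fun_mult[OF C1_fun_const])

lemma C1_fun_diff: assumes "C1_fun f" "C1_fun g" shows "C1_fun (\<lambda>x. f x - g x)"
  using C1_fun_add[OF assms(1) C1_fun_cmult[OF assms(2), of "-1"]] by simp

lemma C1_fun_coord: "C1_fun (\<lambda>x. x $ i)"
proof (rule C1_funI(1)[where D="\<lambda>j x. if j = i then 1 else 0"])
  show "((\<lambda>x. x $ i) has_derivative (\<lambda>h. \<Sum>j\<in>UNIV. h $ j * (if j = i then 1 else 0))) (at x)" for x :: "real^3"
    using bounded_linear_imp_has_derivative[OF bounded_linear_vec_nth[of i], of "at x"]
    by (simp add: if_distrib[of "\<lambda>x. _ * x"] cong: if_cong)
qed simp

text \<open>A \<open>C\<^sup>1\<close> function that vanishes exactly on the nonpositive numbers.\<close>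

definition pos_sq :: "real \<Rightarrow> real" where "pos_sq t = (max 0 t)\<^sup>2"

lemma pos_sq_derivative: "(pos_sq has_real_derivative 2 * max 0 t) (at t)"
proof -
  consider "t > 0" | "t < 0" | "t = 0" by linarith
  then show ?thesis
  proof cases
    case 1
    have d: "((\<lambda>t. t\<^sup>2) has_real_derivative 2 * t) (at t)" by (auto intro!: derivative_eq_intros)
    have "(pos_sq has_real_derivative 2 * t) (at t)"
      by (rule has_field_derivative_transform_within_open[OF d open_greaterThan[of 0]]) (use 1 in \<open>auto simp: pos_sq_def\<close>)
    then show ?thesis using 1 by simp
  next
    case 2
    have d: "((\<lambda>t. 0) has_real_derivative 0) (at t)" by (rule DERIV_const)
    have "(pos_sq has_real_derivative 0) (at t)"
      by (rule has_field_derivative_transform_within_open[OF d open_lessThan[of 0]]) (use 2 in \<open>auto simp: pos_sq_def\<close>)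
    then show ?thesis using 2 by simp
  next
    case 3
    have "((\<lambda>h. (pos_sq (0 + h) - pos_sq 0) / h) \<longlongrightarrow> 0) (at 0)"
    proof (rule Lim_null_comparison[where g="\<lambda>h. \<bar>h\<bar>"])
      show "\<forall>\<^sub>F h in at 0. norm ((pos_sq (0 + h) - pos_sq 0) / h) \<le> \<bar>h\<bar>"
        by (rule always_eventually) (auto simp: pos_sq_def max_def power2_eq_square abs_mult)
      show "((\<lambda>h::real. \<bar>h\<bar>) \<longlongrightarrow> 0) (at 0)" using tendsto_rabs[OF tendsto_ident_at[of 0 UNIV]] by simp
    qed
    then show ?thesis using 3 by (simp add: has_field_derivative_iff DERIV_def)
  qed
qed

lemma C1_fun_pos_sq: "C1_fun f \<Longrightarrow> C1_fun (\<lambda>x. pos_sq (f x))"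
  by (rule C1_fun_compose[where g'="\<lambda>t. 2 * max 0 t"])
     (auto intro!: pos_sq_derivative continuous_on_mult continuous_on_max continuous_on_const continuous_on_id)

lemma C1_fun_inverse: assumes "C1_fun f" "\<And>x. f x > 0" shows "C1_fun (\<lambda>x. 1 / f x)"
proof (rule C1_fun_compose[OF assms(1), where g="\<lambda>t. 1 / t" and g'="\<lambda>t. - 1 / t\<^sup>2"])
  show "((\<lambda>t. 1 / t) has_real_derivative - 1 / (f x)\<^sup>2) (at (f x))" for x
    using DERIV_inverse[of "f x"] assms(2)[of x] by (simp add: inverse_eq_divide power2_eq_square divide_simps numeral_2_eq_2)
  have "f x \<noteq> 0" for x using assms(2)[of x] by simp
  then have "\<forall>t\<in>range f. t\<^sup>2 \<noteq> 0" by auto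
  then show "continuous_on (range f) (\<lambda>t. - 1 / t\<^sup>2)"
    by (intro continuous_on_divide continuous_on_const continuous_on_power continuous_on_id)
qed

text \<open>The quotient is one where the second summand of the denominator vanishes, and zero where the
numerator does.\<close>

definition bump :: "real^3 \<Rightarrow> real \<Rightarrow> real \<Rightarrow> real^3 \<Rightarrow> real" where
  "bump p a b x = pos_sq (b - (norm (x - p))\<^sup>2) * (1 / (pos_sq (b - (norm (x - p))\<^sup>2) + pos_sq ((norm (x - p))\<^sup>2 - a)))"

lemma bump_C1: assumes "a < b" shows "C1_fun (bump p a b)"
proof -
  have n: "(norm (x - p))\<^sup>2 = (x $ 1 - p $ 1) * (x $ 1 - p $ 1) + (x $ 2 - p $ 2) * (x $ 2 - p $ 2) + (x $ 3 - p $ 3) * (x $ 3 - p $ 3)" for x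
    by (simp add: power2_norm_eq_inner inner_vec_def sum_3)
  have q: "C1_fun (\<lambda>x. (norm (x - p))\<^sup>2)" unfolding n
    by (intro C1_fun_add C1_fun_mult C1_fun_diff C1_fun_coord C1_fun_const)
  have pos: "pos_sq (b - t) + pos_sq (t - a) > 0" for t
  proof (cases "t < b")
    case True then show ?thesis by (simp add: pos_sq_def add_pos_nonneg)
  next
    case False then show ?thesis using assms by (simp add: pos_sq_def add_nonneg_pos)
  qed
  show ?thesis unfolding bump_def[abs_def]
    by (intro C1_fun_mult C1_fun_inverse C1_fun_add C1_fun_pos_sq C1_fun_diff C1_fun_const q pos)
qed

lemma bump_one: "a < b \<Longrightarrow> (norm (x - p))\<^sup>2 \<le> a \<Longrightarrow> bump p a b x = 1"
  by (simp add: bump_def pos_sq_def)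

lemma bump_zero: "(norm (x - p))\<^sup>2 \<ge> b \<Longrightarrow> bump p a b x = 0"
  by (simp add: bump_def pos_sq_def)

lemma C1_field_scale:
  assumes "C1_fun f" "C1_field X" shows "C1_field (\<lambda>x. f x *\<^sub>R X x)"
  using assms by (auto simp: C1_field_def intro: C1_fun_mult)

lemma C1_field_continuous: assumes "C1_field X" shows "continuous_on A X"
proof -
  have "continuous_on A (\<lambda>x. \<chi> i. X x $ i)"
    by (rule continuous_on_vec_lambda, rule continuous_on_subset[OF C1_fun_continuous])
      (use assms in \<open>auto simp: C1_field_def\<close>)
  then show ?thesis by simp
qed

lemma divergence_add:
  assumes "C1_field X" "C1_field Y"
  shows "divergence (\<lambda>x. X x + Y x) x = divergence X x + divergence Y x"
proof -
  have "pd i (\<lambda>x. X x $ i + Y x $ i) x = pd i (\<lambda>x. X x $ i) x + pd i (\<lambda>x. Y x $ i) x" for i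
    by (rule pd_add) (use assms in \<open>auto simp: C1_field_def C1_fun_def\<close>)
  then show ?thesis by (simp add: divergence_def sum.distrib)
qed

lemma divergence_continuous: assumes "C1_field X" shows "continuous_on UNIV (divergence X)"
  unfolding divergence_def[abs_def]
  by (intro continuous_on_sum C1_fun_pd_continuous) (use assms in \<open>auto simp: C1_field_def\<close>)

lemma divergence_zero_open: "open A \<Longrightarrow> x \<in> A \<Longrightarrow> (\<And>y. y \<in> A \<Longrightarrow> X y = 0) \<Longrightarrow> divergence X x = 0"
  unfolding divergence_def by (intro sum.neutral ballI pd_zero_open[of A]) auto

context smooth_region begin

text \<open>At boundary points both sides equal the same integral over the parameters of a patch. At
interior points there is no flux, and the integral of the divergence of a field with compact support
vanishes.\<close>

lemma local_divergence_theorem: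
  assumes p: "p \<in> \<Omega>"
  shows "\<exists>\<rho>>0. \<forall>X. C1_field X \<longrightarrow> (\<forall>x. dist x p > \<rho> \<longrightarrow> X x = 0) \<longrightarrow> flux X = (LINT x:interior \<Omega>|lborel. divergence X x)"
proof (cases "p \<in> S")
  case True
  from sided_patch_exists[OF True] obtain U \<phi> u0 r \<epsilon> \<sigma> where P: "C1_patch S U \<phi>" and u0: "u0 \<in> U" "p = \<phi> u0"
    and n: "patch_normal \<phi> u0 \<noteq> 0" and ad: "adapted S U \<phi> u0 (patch_normal \<phi> u0) (1/3) r \<epsilon>"
    and s: "sided \<phi> u0 (patch_normal \<phi> u0) (1/3) r \<epsilon> \<sigma>" by (elim exE conjE)
  from local_divergence[OF P ad n s] obtain \<rho>1 where r1: "\<rho>1 > 0" "\<forall>X. C1_field X \<longrightarrow> (\<forall>x. dist x (\<phi> u0) > \<rho>1 \<longrightarrow> X x = 0) \<longrightarrow>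
     (LINT x:interior \<Omega>|lborel. divergence X x) = \<sigma> * (LINT u:ball u0 r|lborel. X (\<phi> u) \<bullet> patch_normal \<phi> u)"
    by (elim exE conjE)
  from patch_nbhd[OF P u0(1) adaptedD(1)[OF ad]] obtain \<rho>2 where r2: "\<rho>2 > 0" "\<forall>x. x \<in> S \<and> dist x (\<phi> u0) < \<rho>2 \<longrightarrow> x \<in> \<phi> ` (U \<inter> ball u0 r)"
    by (elim exE conjE)
  define \<rho> where "\<rho> = min \<rho>1 (\<rho>2 / 2)"
  have \<rho>: "\<rho> > 0" "\<rho> \<le> \<rho>1" "\<rho> < \<rho>2" using r1(1) r2(1) by (auto simp: \<rho>_def)
  have "flux X = (LINT x:interior \<Omega>|lborel. divergence X x)" if X: "C1_field X" and sup: "\<forall>x. dist x p > \<rho> \<longrightarrow> X x = 0" for X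
  proof -
    have "\<forall>x. dist x (\<phi> u0) > \<rho>1 \<longrightarrow> X x = 0" using sup \<rho>(2) unfolding u0(2) by auto
    then have "(LINT x:interior \<Omega>|lborel. divergence X x) = \<sigma> * (LINT u:ball u0 r|lborel. X (\<phi> u) \<bullet> patch_normal \<phi> u)"
      using r1(2)[rule_format, OF X] by blast
    moreover have "flux X = \<sigma> * (LINT u:ball u0 r|lborel. X (\<phi> u) \<bullet> patch_normal \<phi> u)"
    proof (rule local_flux[OF P ad n s C1_field_continuous[OF X]])
      fix x assume x: "x \<in> S" "x \<notin> \<phi> ` ball u0 r"
      have "\<not> dist x (\<phi> u0) < \<rho>2" using r2(2)[rule_format, of x] x by blast
      then show "X x = 0" using sup \<rho>(3) unfolding u0(2) by auto
    qed
    ultimately show ?thesis by simp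
  qed
  then show ?thesis using \<rho>(1) by (intro exI[of _ \<rho>]) simp
next
  case False
  then have "p \<in> interior \<Omega>" using p \<Omega>_cases by blast
  then obtain \<rho> where \<rho>: "\<rho> > 0" "cball p \<rho> \<subseteq> interior \<Omega>" using open_contains_cball[THEN iffD1, OF open_interior] by blast
  have "flux X = (LINT x:interior \<Omega>|lborel. divergence X x)" if X: "C1_field X" and sup: "\<forall>x. dist x p > \<rho> \<longrightarrow> X x = 0" for X
  proof -
    have out: "X x = 0" if "x \<notin> cball p \<rho>" for x using sup that by (auto simp: dist_commute)
    have "flux X = 0" by (rule flux_zero) (use out \<rho>(2) S_interior in blast)
    moreover have "(LINT x:interior \<Omega>|lborel. divergence X x) = 0"
    proof -
      have "(LINT x:interior \<Omega>|lborel. divergence X x) = (LINT x|lborel. divergence X x)"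
        unfolding set_lebesgue_integral_def
      proof (rule Bochner_Integration.integral_cong[OF refl])
        fix x show "indicator (interior \<Omega>) x *\<^sub>R divergence X x = divergence X x"
        proof (cases "x \<in> cball p \<rho>")
          case True then show ?thesis using \<rho>(2) by (auto simp: indicator_def)
        next
          case False
          have "divergence X x = 0" by (rule divergence_zero_open[of "- cball p \<rho>"]) (use False out in auto)
          then show ?thesis by simp
        qed
      qed
      also have "\<dots> = 0"
      proof (rule compact_support_divergence_integral[OF X, of "norm p + \<rho>"])
        fix x :: "real^3" assume "norm x > norm p + \<rho>"
        then have "dist x p > \<rho>" using norm_triangle_ineq2[of x p] by (simp add: dist_norm)
        then show "X x = 0" using sup by blast
      qed (use \<rho>(1) in \<open>simp add: add_nonneg_pos\<close>)
      finally show ?thesis .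
    qed
    ultimately show ?thesis by simp
  qed
  then show ?thesis using \<rho>(1) by (intro exI[of _ \<rho>]) simp
qed

text \<open>Finitely many balls on which the local theorem applies cover the region. Splitting \<open>X\<close> by
the cutoff function of one ball after the other, the field is reduced to zero on the region.\<close>

theorem divergence_theorem:
  assumes X: "C1_field X"
  shows "flux X = (LINT x:interior \<Omega>|lborel. divergence X x)"
proof -
  have "\<forall>p\<in>\<Omega>. \<exists>\<rho>. \<rho> > 0 \<and> (\<forall>X. C1_field X \<longrightarrow> (\<forall>x. dist x p > \<rho> \<longrightarrow> X x = 0) \<longrightarrow> flux X = (LINT x:interior \<Omega>|lborel. divergence X x))"
    using local_divergence_theorem by simp
  from bchoice[OF this] obtain R where R0: "\<forall>p\<in>\<Omega>. R p > 0 \<and> (\<forall>X. C1_field X \<longrightarrow> (\<forall>x. dist x p > R p \<longrightarrow> X x = 0) \<longrightarrow> flux X = (LINT x:interior \<Omega>|lborel. divergence X x))"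
    by (elim exE)
  have Rp: "R p > 0" if "p \<in> \<Omega>" for p using R0 that by simp
  have RX: "flux X = (LINT x:interior \<Omega>|lborel. divergence X x)" if "p \<in> \<Omega>" "C1_field X" "\<forall>x. dist x p > R p \<longrightarrow> X x = 0" for p X
    using bspec[OF R0 that(1)] that(2,3) by simp
  have cov: "\<Omega> \<subseteq> (\<Union>p\<in>\<Omega>. ball p (R p / 2))" using Rp by force
  obtain C where C: "C \<subseteq> \<Omega>" "finite C" "\<Omega> \<subseteq> (\<Union>p\<in>C. ball p (R p / 2))"
    by (rule compactE_image[OF compact_\<Omega> _ cov]) auto
  have ind: "C1_field X \<longrightarrow> (\<forall>x\<in>\<Omega>. (\<forall>p\<in>C. dist p x \<ge> R p / 2) \<longrightarrow> X x = 0) \<longrightarrow> flux X = (LINT x:interior \<Omega>|lborel. divergence X x)"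
    if "finite C" "C \<subseteq> \<Omega>" for C X
    using that
  proof (induction C arbitrary: X rule: finite_induct)
    case empty
    show ?case
    proof (intro impI)
      assume X: "C1_field X" and "\<forall>x\<in>\<Omega>. (\<forall>p\<in>{}. dist p x \<ge> R p / 2) \<longrightarrow> X x = 0"
      then have z: "X x = 0" if "x \<in> \<Omega>" for x using that by simp
      have "flux X = 0" by (rule flux_zero) (use z S_sub in blast)
      moreover have "(\<lambda>x. indicator (interior \<Omega>) x *\<^sub>R divergence X x) = (\<lambda>x. 0)"
      proof
        fix x show "indicator (interior \<Omega>) x *\<^sub>R divergence X x = 0"
        proof (cases "x \<in> interior \<Omega>")
          case True
          have "divergence X x = 0" by (rule divergence_zero_open[OF open_interior True]) (use z interior_subset in blast)
          then show ?thesis by simp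
        qed simp
      qed
      ultimately show "flux X = (LINT x:interior \<Omega>|lborel. divergence X x)"
        unfolding set_lebesgue_integral_def by (simp only: integral_zero)
    qed
  next
    case (insert p C)
    show ?case
    proof (intro impI)
      assume X: "C1_field X" and z: "\<forall>x\<in>\<Omega>. (\<forall>q\<in>insert p C. dist q x \<ge> R q / 2) \<longrightarrow> X x = 0"
      have p: "p \<in> \<Omega>" using insert.prems by simp
      have R: "R p > 0" by (rule Rp[OF p])
      define \<psi> where "\<psi> = bump p ((R p / 2)\<^sup>2) ((R p)\<^sup>2)"
      have ab: "(R p / 2)\<^sup>2 < (R p)\<^sup>2" by (rule power_strict_mono) (use R in auto)
      have \<psi>: "C1_fun \<psi>" unfolding \<psi>_def by (rule bump_C1[OF ab])
      define X1 where "X1 x = \<psi> x *\<^sub>R X x" for x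
      define X2 where "X2 x = (1 - \<psi> x) *\<^sub>R X x" for x
      have X1: "C1_field X1" unfolding X1_def[abs_def] by (rule C1_field_scale[OF \<psi> X])
      have X2: "C1_field X2" unfolding X2_def[abs_def] by (rule C1_field_scale[OF C1_fun_diff[OF C1_fun_const \<psi>] X])
      have "\<forall>x. dist x p > R p \<longrightarrow> X1 x = 0"
      proof (intro allI impI)
        fix x assume "dist x p > R p"
        then have "(norm (x - p))\<^sup>2 \<ge> (R p)\<^sup>2" using R by (intro power_mono) (auto simp: dist_norm)
        then show "X1 x = 0" by (simp add: X1_def \<psi>_def bump_zero)
      qed
      then have f1: "flux X1 = (LINT x:interior \<Omega>|lborel. divergence X1 x)" by (rule RX[OF p X1])
      have z2: "\<forall>x\<in>\<Omega>. (\<forall>q\<in>C. dist q x \<ge> R q / 2) \<longrightarrow> X2 x = 0"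
      proof (intro ballI impI)
        fix x assume x: "x \<in> \<Omega>" and far: "\<forall>q\<in>C. dist q x \<ge> R q / 2"
        show "X2 x = 0"
        proof (cases "dist p x \<ge> R p / 2")
          case True
          then have "X x = 0" using z x far by simp
          then show ?thesis by (simp add: X2_def)
        next
          case False
          then have "(norm (x - p))\<^sup>2 \<le> (R p / 2)\<^sup>2" by (intro power_mono) (auto simp: dist_norm norm_minus_commute)
          then show ?thesis by (simp add: X2_def \<psi>_def bump_one[OF ab])
        qed
      qed
      have "C \<subseteq> \<Omega>" using insert.prems by simp
      from insert.IH[OF this, of X2] X2 z2 have f2: "flux X2 = (LINT x:interior \<Omega>|lborel. divergence X2 x)" by simp
      have sum: "X = (\<lambda>x. X1 x + X2 x)" by (simp add: fun_eq_iff X1_def X2_def algebra_simps)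
      have "flux X = flux X1 + flux X2"
        unfolding sum by (rule flux_add[OF C1_field_continuous[OF X1] C1_field_continuous[OF X2]])
      also have "\<dots> = (LINT x:interior \<Omega>|lborel. divergence X1 x + divergence X2 x)"
        unfolding f1 f2
        by (rule set_integral_add(2)[OF interior_integrable[OF divergence_continuous[OF X1]] interior_integrable[OF divergence_continuous[OF X2]], symmetric])
      also have "(\<lambda>x. divergence X1 x + divergence X2 x) = divergence X"
        unfolding sum by (rule ext) (rule divergence_add[OF X1 X2, symmetric])
      finally show "flux X = (LINT x:interior \<Omega>|lborel. divergence X x)" .
    qed
  qed
  have "\<forall>x\<in>\<Omega>. (\<forall>p\<in>C. dist p x \<ge> R p / 2) \<longrightarrow> X x = 0"
  proof (intro ballI impI)
    fix x assume "x \<in> \<Omega>" and far: "\<forall>p\<in>C. dist p x \<ge> R p / 2"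
    then obtain p where "p \<in> C" "x \<in> ball p (R p / 2)" using C(3) by blast
    then show "X x = 0" using far by force
  qed
  then show ?thesis using ind[OF C(2,1), of X] X by simp
qed

end

section \<open>Regions bounded by surfaces in the asymptotically flat end\<close>

lemma connected_annulus: "connected {x::real^3. a < norm x \<and> norm x < b}"
proof (cases "a \<ge> 0")
  case True
  have "{x::real^3. a < norm x \<and> norm x < b} = (\<lambda>p. snd p *\<^sub>R fst p) ` (sphere 0 1 \<times> {a<..<b})"
  proof (intro equalityI subsetI)
    fix x :: "real^3" assume x: "x \<in> {x. a < norm x \<and> norm x < b}"
    then have "norm x > 0" using True by auto
    then show "x \<in> (\<lambda>p. snd p *\<^sub>R fst p) ` (sphere 0 1 \<times> {a<..<b})"
      using x by (intro image_eqI[of _ _ "((1 / norm x) *\<^sub>R x, norm x)"]) auto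
  next
    fix x :: "real^3" assume "x \<in> (\<lambda>p. snd p *\<^sub>R fst p) ` (sphere 0 1 \<times> {a<..<b})"
    then show "x \<in> {x. a < norm x \<and> norm x < b}" using True by auto
  qed
  moreover have "connected (sphere (0::real^3) 1)" by (rule connected_sphere) simp
  then have "connected ((\<lambda>p. snd p *\<^sub>R fst p) ` (sphere (0::real^3) 1 \<times> {a<..<b}))"
    by (intro connected_continuous_image connected_Times continuous_on_scaleR continuous_on_snd continuous_on_fst continuous_on_id) auto
  ultimately show ?thesis by simp
next
  case False
  then have "{x::real^3. a < norm x \<and> norm x < b} = ball 0 b" using le_less_trans[of a] by (auto simp: not_le intro: less_le_trans[OF _ norm_ge_zero])
  then show ?thesis by (simp add: convex_connected)
qed

lemma connected_exterior: "connected {x::real^3. norm x > R}"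
proof -
  have "connected (- cball (0::real^3) R)" by (rule connected_complement_bounded_convex) auto
  moreover have "- cball 0 R = {x::real^3. norm x > R}" by auto
  ultimately show ?thesis by simp
qed

lemma connected_in_one:
  assumes "connected T" "open A" "open B" "A \<inter> B = {}" "T \<subseteq> A \<union> B"
  shows "T \<subseteq> A \<or> T \<subseteq> B"
proof (rule ccontr)
  assume "\<not> ?thesis"
  then have "A \<inter> T \<noteq> {}" "B \<inter> T \<noteq> {}" using assms(5) by blast+
  moreover have "A \<inter> B \<inter> T = {}" using assms(4) by blast
  ultimately show False using connectedD[OF assms(1,2,3)] assms(5) by blast
qed

lemma UNIV_not_lmeasurable: "(UNIV :: 'a::euclidean_space set) \<notin> lmeasurable"
proof
  assume "(UNIV :: 'a set) \<in> lmeasurable"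
  then have "emeasure lebesgue (UNIV :: 'a set) < \<infinity>" by (simp add: fmeasurable_def)
  then show False by simp
qed

text \<open>The coordinates of the end may be singular near the radius \<open>R0\<close>; beyond \<open>R1\<close> the volume
element is bounded below.\<close>

locale asymptotic_end =
  fixes A :: "'m::{t2_space, second_countable_topology} chart set" and g :: "'m tensor2" and c :: "'m chart" and R0 R1 :: real
  assumes mfd: "smooth_3_manifold A" and metric: "riemannian_metric 3 A g" and endc: "end_chart A c R0"
    and det_far: "\<And>y. norm y > R1 \<Longrightarrow> det (g c y) \<ge> 1/4"
begin

lemma c_in: "c \<in> A" and core_ne: "- cdom c \<noteq> {}" and R0_pos: "R0 > 0"
  and cimg_eq: "cimg c = exterior R0"
  using endc by (simp_all add: end_chart_def exterior_def)

lemma chart_facts: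
  assumes "d \<in> A"
  shows "open (cdom d)" "open (cimg d)" "continuous_on (cdom d) (cmap d)" "continuous_on (cimg d) (cinv d)"
    "inj_on (cmap d) (cdom d)" "homeomorphism (cdom d) (cimg d) (cmap d) (cinv d)"
proof -
  have ch: "is_chart d" using mfd assms by (simp add: smooth_3_manifold_def)
  then show "open (cdom d)" "open (cimg d)" "homeomorphism (cdom d) (cimg d) (cmap d) (cinv d)" by (simp_all add: is_chart_def)
  then have h: "homeomorphism (cdom d) (cimg d) (cmap d) (cinv d)" by simp
  show "continuous_on (cdom d) (cmap d)" "continuous_on (cimg d) (cinv d)" using h by (simp_all add: homeomorphism_def)
  show "inj_on (cmap d) (cdom d)" using h by (intro inj_on_inverseI[of _ "cinv d"]) (simp add: homeomorphism_def)
qed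

lemma cinv_cmap: "d \<in> A \<Longrightarrow> p \<in> cdom d \<Longrightarrow> cinv d (cmap d p) = p"
  by (rule inv_into_f_f[OF chart_facts(5)])

lemma cinv_dom: "y \<in> cimg d \<Longrightarrow> cinv d y \<in> cdom d" by (rule inv_into_into)
lemma cmap_cinv: "y \<in> cimg d \<Longrightarrow> cmap d (cinv d y) = y" by (rule f_inv_into_f)

text \<open>The transformation rule of the metric as a matrix identity, with determinants taken.\<close>

lemma metric_transforms:
  assumes d: "d \<in> A" and y: "y \<in> cmap c ` (cdom c \<inter> cdom d)"
  shows "det (g c y) = (det (matrix (frechet_derivative (transition c d) (at y))))\<^sup>2 * det (g d (transition c d y))"
proof -
  let ?M = "matrix (frechet_derivative (transition c d) (at y)) :: real^3^3"
  let ?G = "g d (transition c d y)"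
  have "tensor_field A g" using metric by (simp add: riemannian_metric_def symmetric_two_tensor_def)
  then have t: "g c y $ i $ j = (\<Sum>k\<in>UNIV. \<Sum>l\<in>UNIV. pd i (transition c d) y $ k * pd j (transition c d) y $ l * ?G $ k $ l)" for i j
    using c_in d y unfolding tensor_field_def by blast
  have M: "?M $ k $ i = pd i (transition c d) y $ k" for k i by (simp add: matrix_def pd_def)
  have "g c y = transpose ?M ** (?G ** ?M)"
    unfolding vec_eq_iff matrix_matrix_mult_def transpose_def vec_lambda_beta t M
    by (simp add: sum_distrib_left mult_ac)
  then show ?thesis by (simp add: det_mul det_transpose power2_eq_square)
qed

text \<open>Inside a compact ball of another chart the metric is bounded, while it is bounded below in the
coordinates of the end. Hence the Jacobian of the transition map is bounded below, and the piece of
the end has finite Euclidean volume since its image in the ball has.\<close>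

lemma chart_piece_measurable:
  assumes d: "d \<in> A" and p: "p \<in> cdom d" and \<epsilon>: "\<epsilon> > 0" "cball (cmap d p) \<epsilon> \<subseteq> cimg d"
  shows "{y \<in> exterior (max R0 R1). cinv c y \<in> cdom d \<and> cmap d (cinv c y) \<in> ball (cmap d p) \<epsilon>} \<in> lmeasurable" (is "?Y \<in> _")
proof -
  let ?T = "transition c d"
  let ?J = "\<lambda>y. frechet_derivative ?T (at y)"
  have Te: "?T y = cmap d (cinv c y)" for y by (simp add: transition_def)
  have R: "exterior (max R0 R1) \<subseteq> cimg c" unfolding cimg_eq by (auto simp: exterior_def)
  have oV: "open (cdom d \<inter> cmap d -` ball (cmap d p) \<epsilon>)"
    using continuous_open_preimage[OF chart_facts(3)[OF d] chart_facts(1)[OF d] open_ball] by (simp add: Int_commute)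
  have "open (cimg c \<inter> cinv c -` (cdom d \<inter> cmap d -` ball (cmap d p) \<epsilon>))"
    using continuous_open_preimage[OF chart_facts(4)[OF c_in] chart_facts(2)[OF c_in] oV] by (simp add: Int_commute)
  then have "open (exterior (max R0 R1) \<inter> (cimg c \<inter> cinv c -` (cdom d \<inter> cmap d -` ball (cmap d p) \<epsilon>)))"
    by (rule open_Int[OF open_exterior])
  moreover have "exterior (max R0 R1) \<inter> (cimg c \<inter> cinv c -` (cdom d \<inter> cmap d -` ball (cmap d p) \<epsilon>)) = ?Y" using R by auto
  ultimately have oY: "open ?Y" by simp
  have YV: "y \<in> cmap c ` (cdom c \<inter> cdom d)" if "y \<in> ?Y" for y
  proof (rule image_eqI[of _ _ "cinv c y"])
    have yc: "y \<in> cimg c" using that R by blast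
    show "y = cmap c (cinv c y)" by (rule cmap_cinv[OF yc, symmetric])
    show "cinv c y \<in> cdom c \<inter> cdom d" using cinv_dom[OF yc] that by simp
  qed
  have sm: "Ck_on 1 ?T (cmap c ` (cdom c \<inter> cdom d))"
  proof -
    have "smooth_on ?T (cmap c ` (cdom c \<inter> cdom d))" using mfd c_in d unfolding smooth_3_manifold_def by blast
    then have "\<forall>n. Ck_on n ?T (cmap c ` (cdom c \<inter> cdom d))" unfolding smooth_on_def .
    then show ?thesis by (rule spec)
  qed
  have df: "\<forall>y \<in> cmap c ` (cdom c \<inter> cdom d). ?T differentiable (at y)"
    by (rule conjunct1[OF sm[unfolded One_nat_def Ck_on.simps]])
  have der: "(?T has_derivative ?J y) (at y)" if "y \<in> ?Y" for y
    by (rule frechet_derivative_works[THEN iffD1, OF bspec[OF df YV[OF that]]])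
  have inj: "inj_on ?T ?Y"
  proof (rule inj_onI)
    fix y z assume y: "y \<in> ?Y" and z: "z \<in> ?Y" and e: "?T y = ?T z"
    have "cinv c y = cinv c z"
      by (rule inj_onD[OF chart_facts(5)[OF d]]) (use e y z in \<open>simp_all add: Te\<close>)
    moreover have "y \<in> cimg c" "z \<in> cimg c" using y z R by blast+
    ultimately show "y = z" using cmap_cinv by metis
  qed
  have cT: "continuous_on ?Y ?T"
    by (rule continuous_at_imp_continuous_on) (use has_derivative_continuous[OF der] in simp)
  have oT: "open (?T ` ?Y)" by (rule invariance_of_domain[OF cT oY inj])
  have TB: "?T ` ?Y \<subseteq> ball (cmap d p) \<epsilon>" by (auto simp: Te)
  have Tm: "?T ` ?Y \<in> lmeasurable"
    by (rule lmeasurable_open[OF bounded_subset[OF bounded_ball TB] oT])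
  have Ys: "?Y \<in> sets lebesgue" using oY by (simp add: sets_completionI_sets)
  have "((\<lambda>y. \<bar>det (matrix (?J y))\<bar>) has_integral measure lebesgue (?T ` ?Y)) ?Y"
    using has_measure_differentiable_image[OF Ys has_derivative_at_withinI[OF der] inj, of "measure lebesgue (?T ` ?Y)"] Tm by simp
  then have "(\<lambda>y. \<bar>det (matrix (?J y))\<bar>) integrable_on ?Y" by (rule has_integral_integrable)
  then have J: "(\<lambda>y. \<bar>det (matrix (?J y))\<bar>) absolutely_integrable_on ?Y"
    by (rule nonnegative_absolutely_integrable_1) simp
  have Gd: "continuous_on (cimg d) (g d)"
    using metric d by (auto simp: riemannian_metric_def symmetric_two_tensor_def intro: Ck_on_continuous)
  have "continuous_on (cball (cmap d p) \<epsilon>) (\<lambda>x. det (g d x))"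
    unfolding det_3 by (intro continuous_on_add continuous_on_diff continuous_on_mult continuous_on_component continuous_on_subset[OF Gd \<epsilon>(2)])
  then have "bounded ((\<lambda>x. det (g d x)) ` cball (cmap d p) \<epsilon>)"
    by (intro compact_imp_bounded compact_continuous_image compact_cball)
  then obtain B0 where B0: "\<forall>z\<in>(\<lambda>x. det (g d x)) ` cball (cmap d p) \<epsilon>. norm z \<le> B0" unfolding bounded_iff by blast
  define B where "B = \<bar>B0\<bar> + 1"
  have B: "B > 0" by (simp add: B_def)
  define \<kappa> where "\<kappa> = sqrt (1 / (4 * B))"
  have \<kappa>: "\<kappa> > 0" using B by (simp add: \<kappa>_def)
  have low: "\<kappa> \<le> \<bar>det (matrix (?J y))\<bar>" if y: "y \<in> ?Y" for y
  proof -
    have "?T y \<in> cball (cmap d p) \<epsilon>" using y by (simp add: Te)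
    then have "norm (det (g d (?T y))) \<le> B0" using B0 by blast
    then have le: "det (g d (?T y)) \<le> B" unfolding B_def by simp
    have "1/4 \<le> det (g c y)" by (rule det_far) (use y in \<open>simp add: exterior_def\<close>)
    also have "\<dots> = (det (matrix (?J y)))\<^sup>2 * det (g d (?T y))" by (rule metric_transforms[OF d YV[OF y]])
    also have "\<dots> \<le> (det (matrix (?J y)))\<^sup>2 * B" using le by (intro mult_left_mono) auto
    finally have "1 / (4 * B) \<le> (det (matrix (?J y)))\<^sup>2" using B by (simp add: field_simps)
    then have "sqrt (1 / (4 * B)) \<le> sqrt ((det (matrix (?J y)))\<^sup>2)" by (rule real_sqrt_le_mono)
    then show ?thesis by (simp add: \<kappa>_def)
  qed
  have "(\<lambda>y. \<kappa>) absolutely_integrable_on ?Y"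
  proof (rule set_integrable_bound[OF J])
    show "set_borel_measurable lebesgue ?Y (\<lambda>y. \<kappa>)" unfolding set_borel_measurable_def using Ys by simp
    show "AE y in lebesgue. y \<in> ?Y \<longrightarrow> norm \<kappa> \<le> norm \<bar>det (matrix (?J y))\<bar>"
      using low \<kappa> by (intro AE_I2) auto
  qed
  then have "(\<lambda>y. (1 / \<kappa>) * \<kappa>) integrable_on ?Y"
    by (intro integrable_on_mult_right set_lebesgue_integral_eq_integral(1))
  then have "(\<lambda>y. 1::real) integrable_on ?Y" using \<kappa> by simp
  then show ?thesis by (simp only: lmeasurable_iff_integrable_on)
qed

text \<open>A compact set is covered by finitely many chart balls, so that by \<open>chart_piece_measurable\<close>
the part of it in the end has finite volume. It cannot contain a neighborhood of infinity.\<close>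

lemma infinite_volume:
  assumes D: "compact D" and sub: "exterior R2 \<subseteq> cmap c ` (D \<inter> cdom c)"
  shows False
proof -
  define Y where "Y q = {y \<in> exterior (max R0 R1). cinv c y \<in> cdom (fst q) \<and> cmap (fst q) (cinv c y) \<in> ball (cmap (fst q) (fst (snd q))) (snd (snd q))}"
    for q :: "'m chart \<times> 'm \<times> real"
  define N where "N q = cdom (fst q) \<inter> cmap (fst q) -` ball (cmap (fst q) (fst (snd q))) (snd (snd q))" for q :: "'m chart \<times> 'm \<times> real"
  have "\<forall>p\<in>D. \<exists>q. fst q \<in> A \<and> fst (snd q) \<in> cdom (fst q) \<and> snd (snd q) > 0 \<and> cball (cmap (fst q) (fst (snd q))) (snd (snd q)) \<subseteq> cimg (fst q) \<and> p \<in> N q"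
  proof
    fix p assume "p \<in> D"
    have "(\<Union>c\<in>A. cdom c) = UNIV" using mfd by (simp add: smooth_3_manifold_def)
    then obtain d where d: "d \<in> A" "p \<in> cdom d" by blast
    have "cmap d p \<in> cimg d" using d(2) by blast
    then obtain \<epsilon> where "\<epsilon> > 0" "cball (cmap d p) \<epsilon> \<subseteq> cimg d"
      using open_contains_cball[THEN iffD1, OF chart_facts(2)[OF d(1)]] by blast
    then show "\<exists>q. fst q \<in> A \<and> fst (snd q) \<in> cdom (fst q) \<and> snd (snd q) > 0 \<and> cball (cmap (fst q) (fst (snd q))) (snd (snd q)) \<subseteq> cimg (fst q) \<and> p \<in> N q"
      using d by (intro exI[of _ "(d, p, \<epsilon>)"]) (simp add: N_def)
  qed
  from bchoice[OF this] obtain q where q: "\<forall>p\<in>D. fst (q p) \<in> A \<and> fst (snd (q p)) \<in> cdom (fst (q p)) \<and> snd (snd (q p)) > 0 \<and> cball (cmap (fst (q p)) (fst (snd (q p)))) (snd (snd (q p))) \<subseteq> cimg (fst (q p)) \<and> p \<in> N (q p)"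
    by (elim exE)
  have oN: "open (N (q p))" if "p \<in> D" for p
  proof -
    have a: "fst (q p) \<in> A" using q that by blast
    show ?thesis unfolding N_def
      using continuous_open_preimage[OF chart_facts(3)[OF a] chart_facts(1)[OF a] open_ball] by (simp add: Int_commute)
  qed
  have Ym: "Y (q p) \<in> lmeasurable" if "p \<in> D" for p
    unfolding Y_def by (rule chart_piece_measurable) (use q that in blast)+
  have "D \<subseteq> (\<Union>p\<in>D. N (q p))" using q by blast
  then obtain C where C: "C \<subseteq> D" "finite C" "D \<subseteq> (\<Union>p\<in>C. N (q p))"
    using compactE_image[OF D, of D "\<lambda>p. N (q p)"] oN by blast
  let ?R = "max R2 (max R0 R1)"
  have "exterior ?R \<subseteq> (\<Union>p\<in>C. Y (q p))"
  proof
    fix y assume y: "y \<in> exterior ?R"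
    then have y2: "y \<in> exterior R2" "y \<in> exterior (max R0 R1)" by (auto simp: exterior_def)
    then obtain p where p: "p \<in> D" "p \<in> cdom c" "y = cmap c p" using sub by blast
    have cy: "cinv c y = p" unfolding p(3) by (rule cinv_cmap[OF c_in p(2)])
    obtain p' where "p' \<in> C" "p \<in> N (q p')" using C(3) p(1) by blast
    then show "y \<in> (\<Union>p\<in>C. Y (q p))" using y2(2) by (auto simp: Y_def N_def cy)
  qed
  moreover have Um: "(\<Union>p\<in>C. Y (q p)) \<in> lmeasurable"
    using C(1) Ym by (intro fmeasurable.finite_UN C(2)) auto
  moreover have "(UNIV :: (real^3) set) = cball 0 ?R \<union> exterior ?R" by (auto simp: exterior_def)
  ultimately have "(UNIV :: (real^3) set) = cball 0 ?R \<union> (\<Union>p\<in>C. Y (q p))" by blast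
  moreover have "cball 0 ?R \<union> (\<Union>p\<in>C. Y (q p)) \<in> lmeasurable"
    by (rule fmeasurable.Un) (use Um in auto)
  ultimately show False using UNIV_not_lmeasurable by metis
qed

text \<open>The exterior of \<open>S\<close> in the end consists of the open images of the interior and of the
complement of \<open>D\<close>. A neighborhood of infinity is connected, hence on one side, and by
\<open>infinite_volume\<close> this is the outside. The annulus between the core and \<open>S\<close> is on one side, too. It
is inside: otherwise the core would be open and closed in the connected manifold.\<close>

lemma region_structure:
  assumes D: "compact D" and fr: "frontier D \<subseteq> cdom c" and core: "- cdom c \<subseteq> D"
    and r: "r > R0" "\<forall>x\<in>coord_boundary c D. norm x \<ge> r"
  defines "\<Omega> \<equiv> coord_region c D \<union> cball 0 R0" and "S \<equiv> coord_boundary c D"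
  shows "compact \<Omega>" "frontier \<Omega> = S" "ball 0 r \<subseteq> \<Omega>" "coord_region c D = \<Omega> \<inter> exterior R0" "S \<subseteq> exterior R0"
proof -
  let ?f = "cmap c"
  define W where "W = ?f ` (D \<inter> cdom c)"
  define Wc where "Wc = ?f ` (cdom c - D)"
  define Wi where "Wi = ?f ` (cdom c \<inter> interior D)"
  have clD: "closed D" using D by (rule compact_imp_closed)
  have om: "open (?f ` V)" if "open V" "V \<subseteq> cdom c" for V
  proof -
    have "openin (top_of_set (cimg c)) (?f ` V)"
      by (rule homeomorphism_imp_open_map[OF chart_facts(6)[OF c_in]]) (use that open_subset in blast)
    then show ?thesis using chart_facts(2)[OF c_in] openin_open_eq by blast
  qed
  have oWc: "open Wc" unfolding Wc_def by (rule om) (use chart_facts(1)[OF c_in] clD in auto)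
  have oWi: "open Wi" unfolding Wi_def by (rule om) (use chart_facts(1)[OF c_in] in auto)
  have Sf: "S = ?f ` frontier D" by (simp add: S_def coord_boundary_def)
  have frD: "frontier D = D - interior D" using clD by (simp add: frontier_def)
  have cover: "exterior R0 = Wc \<union> Wi \<union> S"
  proof -
    have "cdom c = (cdom c - D) \<union> (cdom c \<inter> interior D) \<union> frontier D"
      using fr frD interior_subset[of D] by blast
    then have "?f ` cdom c = ?f ` ((cdom c - D) \<union> (cdom c \<inter> interior D) \<union> frontier D)" by (rule arg_cong)
    then show ?thesis unfolding Wc_def Wi_def Sf cimg_eq[symmetric] image_Un .
  qed
  have Weq: "W = Wi \<union> S"
  proof -
    have "D \<inter> cdom c = (cdom c \<inter> interior D) \<union> frontier D" using fr frD interior_subset[of D] by blast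
    then show ?thesis unfolding W_def Wi_def Sf by (simp only: image_Un)
  qed
  have disj: "?f ` X \<inter> ?f ` Y = {}" if "X \<subseteq> cdom c" "Y \<subseteq> cdom c" "X \<inter> Y = {}" for X Y
    using inj_on_image_Int[OF chart_facts(5)[OF c_in] that(1,2)] that(3) by simp
  have WcW: "Wc \<inter> W = {}" unfolding Wc_def W_def by (rule disj) auto
  have WcWi: "Wc \<inter> Wi = {}" using WcW Weq by blast
  have WiS: "Wi \<inter> S = {}" unfolding Wi_def Sf by (rule disj) (use fr frD in auto)
  have Wr: "coord_region c D = W" by (simp add: coord_region_def W_def)
  have Oeq: "\<Omega> = W \<union> cball 0 R0" by (simp add: \<Omega>_def Wr)
  show Sext: "S \<subseteq> exterior R0" using cover by blast
  have Wext: "W \<subseteq> exterior R0" using cover Weq by blast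
  have e0: "exterior R0 \<inter> cball 0 R0 = {}" by (auto simp: exterior_def)
  show "coord_region c D = \<Omega> \<inter> exterior R0" unfolding Wr Oeq using Wext e0 by blast
  have "- \<Omega> = Wc"
  proof -
    have "- \<Omega> = exterior R0 - W" unfolding Oeq by (auto simp: exterior_def)
    also have "\<dots> = Wc" using cover Weq WcW by blast
    finally show ?thesis .
  qed
  then have clO: "closed \<Omega>" using oWc by (simp add: closed_def)
  have Scomp: "compact S" unfolding Sf
  proof (rule compact_continuous_image[OF continuous_on_subset[OF chart_facts(3)[OF c_in] fr]])
    have "compact (D \<inter> frontier D)" by (rule compact_Int_closed[OF D frontier_closed])
    moreover have "D \<inter> frontier D = frontier D" using frD by blast
    ultimately show "compact (frontier D)" by simp
  qed
  obtain L where L: "\<forall>x\<in>S. norm x \<le> L" using compact_imp_bounded[OF Scomp] unfolding bounded_iff by blast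
  \<comment> \<open>Beyond this radius there are no points of \<open>S\<close>.\<close>
  define L' where "L' = max L R0"
  have "exterior L' \<subseteq> Wc \<union> Wi"
  proof
    fix x assume x: "x \<in> exterior L'"
    then have "x \<in> exterior R0" "x \<notin> S" using L by (auto simp: exterior_def L'_def)
    then show "x \<in> Wc \<union> Wi" using cover by blast
  qed
  moreover have "connected (exterior L')" unfolding exterior_def by (rule connected_exterior)
  ultimately have "exterior L' \<subseteq> Wc \<or> exterior L' \<subseteq> Wi" using oWc oWi WcWi by (intro connected_in_one) auto
  moreover have "\<not> exterior L' \<subseteq> Wi"
  proof
    assume "exterior L' \<subseteq> Wi"
    then have "exterior L' \<subseteq> ?f ` (D \<inter> cdom c)" using Weq unfolding W_def by blast
    then show False by (rule infinite_volume[OF D])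
  qed
  ultimately have far: "exterior L' \<subseteq> Wc" by blast
  have WL: "W \<subseteq> cball 0 L'"
  proof
    fix x assume "x \<in> W"
    then have "x \<notin> exterior L'" using far WcW by blast
    then show "x \<in> cball 0 L'" by (simp add: exterior_def)
  qed
  have "bounded W" by (rule bounded_subset[OF bounded_cball WL])
  then have "bounded \<Omega>" unfolding Oeq by simp
  then show Ocomp: "compact \<Omega>" using clO by (simp add: compact_eq_bounded_closed)
  let ?An = "{x::real^3. R0 < norm x \<and> norm x < r}"
  have "?An \<subseteq> Wc \<union> Wi"
  proof
    fix x assume x: "x \<in> ?An"
    then have "x \<in> exterior R0" "x \<notin> S" using r(2) by (auto simp: exterior_def S_def)
    then show "x \<in> Wc \<union> Wi" using cover by blast
  qed
  then have "?An \<subseteq> Wc \<or> ?An \<subseteq> Wi" using oWc oWi WcWi connected_annulus by (intro connected_in_one) auto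
  moreover have "\<not> ?An \<subseteq> Wc"
  proof
    assume An: "?An \<subseteq> Wc"
    \<comment> \<open>If the annulus is outside, the coordinate part of \<open>D\<close> is compact. Then it is closed in the manifold, and the core is the difference of the open interior of \<open>D\<close> and a closed set.\<close>
    have "W = \<Omega> \<inter> {x. norm x \<ge> r}"
    proof
      show "W \<subseteq> \<Omega> \<inter> {x. norm x \<ge> r}"
      proof
        fix x assume x: "x \<in> W"
        then have "norm x > R0" using Wext by (auto simp: exterior_def)
        moreover have "x \<notin> ?An" using An WcW x by blast
        ultimately show "x \<in> \<Omega> \<inter> {x. norm x \<ge> r}" using x Oeq by auto
      qed
      show "\<Omega> \<inter> {x. norm x \<ge> r} \<subseteq> W" unfolding Oeq using r(1) by auto
    qed
    moreover have "closed {x::real^3. norm x \<ge> r}" by (intro closed_Collect_le continuous_on_const continuous_on_norm continuous_on_id)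
    ultimately have "compact W" using compact_Int_closed[OF Ocomp] by simp
    then have "compact (cinv c ` W)"
      by (rule compact_continuous_image[rotated]) (rule continuous_on_subset[OF chart_facts(4)[OF c_in]], auto simp: W_def)
    moreover have "cinv c ` W = D \<inter> cdom c"
      unfolding W_def image_image using cinv_cmap[OF c_in] by (auto simp: image_iff)
    ultimately have cl: "closed (D \<inter> cdom c)" by (simp add: compact_imp_closed)
    have "- cdom c = interior D - (D \<inter> cdom c)" using core fr frD interior_subset[of D] by blast
    then have "open (- cdom c)" using cl by (simp add: open_Diff)
    moreover have "closed (- cdom c)" using chart_facts(1)[OF c_in] by (simp add: closed_Compl)
    moreover have "connected (UNIV :: 'm set)" using mfd by (simp add: smooth_3_manifold_def)
    ultimately have "- cdom c = {} \<or> - cdom c = UNIV" by (auto simp: connected_clopen)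
    then have "cdom c = {}" using core_ne by blast
    then have "exterior R0 = {}" using cimg_eq by simp
    moreover have "((\<bar>R0\<bar> + 1) *\<^sub>R axis 1 1 :: real^3) \<in> exterior R0" by (simp add: exterior_def norm_axis_1)
    ultimately show False by blast
  qed
  ultimately have An: "?An \<subseteq> Wi" by blast
  show ball: "ball 0 r \<subseteq> \<Omega>"
  proof
    fix x :: "real^3" assume "x \<in> ball 0 r"
    then have "x \<in> cball 0 R0 \<or> x \<in> ?An" by auto
    then show "x \<in> \<Omega>" using An Weq Oeq by blast
  qed
  have int1: "Wi \<union> ball 0 r \<subseteq> interior \<Omega>"
    by (rule interior_maximal) (use ball Weq Oeq oWi in auto)
  have int2: "S \<inter> interior \<Omega> = {}"
  proof (rule ccontr)
    assume "S \<inter> interior \<Omega> \<noteq> {}"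
    then obtain p where p: "p \<in> frontier D" "?f p \<in> interior \<Omega>" unfolding Sf by blast
    have op: "open (cdom c \<inter> ?f -` interior \<Omega>)"
      using continuous_open_preimage[OF chart_facts(3)[OF c_in] chart_facts(1)[OF c_in] open_interior] by (simp add: Int_commute)
    have "p \<in> cdom c \<inter> ?f -` interior \<Omega>" using p fr by blast
    moreover have "p \<in> closure (- D)" using p(1) by (simp add: frontier_closures)
    ultimately have "(cdom c \<inter> ?f -` interior \<Omega>) \<inter> (- D) \<noteq> {}"
      using open_Int_closure_eq_empty[OF op, of "- D"] by blast
    then obtain q where q: "q \<in> cdom c" "?f q \<in> interior \<Omega>" "q \<notin> D" by blast
    then have "?f q \<in> Wc" unfolding Wc_def by blast
    then have "?f q \<notin> \<Omega>" using \<open>- \<Omega> = Wc\<close> by blast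
    then show False using q(2) interior_subset by blast
  qed
  have "\<Omega> \<subseteq> S \<union> (Wi \<union> ball 0 r)"
  proof
    fix x assume "x \<in> \<Omega>"
    then have "x \<in> W \<or> x \<in> cball 0 R0" using Oeq by blast
    moreover have "cball (0::real^3) R0 \<subseteq> ball 0 r" using r(1) by auto
    ultimately show "x \<in> S \<union> (Wi \<union> ball 0 r)" using Weq by blast
  qed
  moreover have "S \<subseteq> \<Omega>" using Weq Oeq by blast
  ultimately have "\<Omega> - interior \<Omega> = S" using int1 int2 by blast
  then show "frontier \<Omega> = S" using clO by (simp add: frontier_def)
qed

end

section \<open>Limits along almost symmetric exhaustions\<close>

lemma lborel_reflect: "distr lborel borel uminus = (lborel :: 'a::euclidean_space measure)"
proof -
  have "(lborel :: 'a measure) = density (distr lborel borel (\<lambda>x. 0 + (-1::real) *\<^sub>R x)) (\<lambda>_. \<bar>-1::real\<bar> ^ DIM('a))"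
    by (rule lborel_affine) simp
  then show ?thesis by (simp add: density_1)
qed

lemma integrable_reflect:
  fixes f :: "'a::euclidean_space \<Rightarrow> real"
  assumes "integrable lborel f"
  shows "integrable lborel (\<lambda>x. f (- x))" "(LINT x|lborel. f (- x)) = (LINT x|lborel. f x)"
proof -
  have m: "f \<in> borel_measurable borel" using borel_measurable_integrable[OF assms] by simp
  have "integrable (distr lborel borel uminus) f" unfolding lborel_reflect by (rule assms)
  then show "integrable lborel (\<lambda>x. f (- x))" by (subst (asm) integrable_distr_eq) (use m in auto)
  have "integral\<^sup>L (distr lborel borel uminus) f = (LINT x|lborel. f (- x))"
    by (rule integral_distr) (use m in auto)
  then show "(LINT x|lborel. f (- x)) = (LINT x|lborel. f x)" unfolding lborel_reflect by simp
qed

text \<open>Comparison with a geometric series over the dyadic balls of radius $2^{n+1}$; its ratio is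
$2^{3-p}$.\<close>

lemma integrable_of_decay:
  fixes h :: "real^3 \<Rightarrow> real"
  assumes cont: "continuous_on UNIV h" and p: "p > 3" and h: "\<And>x. norm x \<ge> \<rho> \<Longrightarrow> \<bar>h x\<bar> \<le> C * norm x powr (- p)"
  shows "integrable lborel h"
proof -
  define r where "r = max 1 \<rho>"
  have r: "r \<ge> 1" "r \<ge> \<rho>" by (simp_all add: r_def)
  have "compact (h ` cball 0 r)" by (rule compact_continuous_image[OF continuous_on_subset[OF cont] compact_cball]) simp
  then have "bounded (h ` cball 0 r)" by (rule compact_imp_bounded)
  then obtain M where M: "\<forall>y\<in>h ` cball 0 r. norm y \<le> M" unfolding bounded_iff by blast
  \<comment> \<open>One constant for both the bounded part and the tail, so that the decay estimate holds from radius one on.\<close>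
  define B where "B = \<bar>C\<bar> + \<bar>M\<bar> * r powr p"
  have rp: "1 \<le> r powr p" using r p by (simp add: ge_one_powr_ge_zero)
  have B: "B \<ge> 0" by (simp add: B_def)
  have near: "\<bar>h x\<bar> \<le> B" if "norm x \<le> 1" for x
  proof -
    have "\<bar>h x\<bar> \<le> M" using M that r by auto
    also have "\<dots> \<le> \<bar>M\<bar> * 1" by simp
    also have "\<dots> \<le> \<bar>M\<bar> * r powr p" by (rule mult_left_mono[OF rp]) simp
    finally show ?thesis unfolding B_def by simp
  qed
  have far: "\<bar>h x\<bar> \<le> B * norm x powr (- p)" if x: "norm x \<ge> 1" for x
  proof (cases "norm x \<ge> r")
    case True
    have "\<bar>h x\<bar> \<le> C * norm x powr (- p)" by (rule h) (use True r in linarith)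
    also have "\<dots> \<le> B * norm x powr (- p)" by (rule mult_right_mono) (auto simp: B_def intro: order_trans[OF abs_ge_self])
    finally show ?thesis .
  next
    case False
    have "\<bar>h x\<bar> \<le> M" using M False by auto
    also have "\<dots> \<le> \<bar>M\<bar> * (r powr p * r powr (- p))" using r by (simp flip: powr_add)
    also have "\<dots> \<le> \<bar>M\<bar> * (r powr p * norm x powr (- p))"
      by (intro mult_left_mono powr_mono2') (use False x p in auto)
    also have "\<dots> \<le> B * norm x powr (- p)" unfolding B_def by (simp add: algebra_simps)
    finally show ?thesis .
  qed
  define t where "t = (2::real) powr (3 - p)"
  have t: "0 < t" "t < 1" using p by (simp_all add: t_def powr_less_one)
  define v where "v = measure lborel (ball (0::real^3) 1)"
  define a where "a n = B * (2 ^ n) powr (- p)" for n :: nat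
  have a: "a n \<ge> 0" for n by (simp add: a_def B)
  have ball_vol: "emeasure lborel (ball (0::real^3) s) = ennreal (s ^ 3 * v)" if "s \<ge> 0" for s
  proof -
    have "emeasure lborel (ball (0::real^3) s) = ennreal (measure lborel (ball (0::real^3) s))"
      by (rule emeasure_eq_ennreal_measure) (use emeasure_lborel_ball_finite[of "0::real^3" s] in \<open>simp add: top.not_eq_extremum\<close>)
    then show ?thesis using content_ball_conv_unit_ball[OF that, of "0::real^3"] by (simp add: v_def)
  qed
  have ps: "(2 ^ n) powr (- p) * (2 ^ n) ^ 3 = t ^ n" for n :: nat
  proof -
    have "((2::real) ^ n) powr (- p) * (2 ^ n) ^ 3 = 2 powr (real n * (- p)) * 2 powr (real n * 3)"
      by (simp add: powr_realpow[symmetric] powr_powr flip: power_mult powr_realpow)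
    also have "\<dots> = (2 powr (3 - p)) powr real n" by (simp add: powr_powr algebra_simps flip: powr_add)
    also have "\<dots> = t ^ n" using t by (simp add: t_def powr_realpow)
    finally show ?thesis .
  qed
  have dom: "ennreal (norm (h x)) \<le> (\<Sum>n. ennreal (a n) * indicator (ball 0 (2 ^ Suc n)) x)" for x
  proof -
    have "\<exists>n. norm x < 2 ^ Suc n \<and> \<bar>h x\<bar> \<le> a n"
    proof (cases "norm x < 1")
      case True
      then show ?thesis using near[of x] by (intro exI[of _ 0]) (simp add: a_def)
    next
      case False
      obtain m :: nat where "norm x < 2 ^ m" using real_arch_pow[of 2 "norm x"] by auto
      then have ex: "\<exists>m. norm x < 2 ^ m" by blast
      define k where "k = (LEAST m. norm x < 2 ^ m)"
      have k: "norm x < 2 ^ k" unfolding k_def by (rule LeastI_ex[OF ex])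
      have "k \<noteq> 0" using k False by (intro notI) simp
      then obtain n where n: "k = Suc n" by (cases k) auto
      have "\<not> norm x < 2 ^ n" by (rule not_less_Least[of n "\<lambda>m. norm x < 2 ^ m", folded k_def]) (simp add: n)
      then have n2: "norm x \<ge> 2 ^ n" by simp
      have "\<bar>h x\<bar> \<le> B * norm x powr (- p)" by (rule far) (use False in simp)
      also have "\<dots> \<le> a n" unfolding a_def using n2 p by (intro mult_left_mono[OF _ B] powr_mono2') auto
      finally show ?thesis using k n by blast
    qed
    then obtain n where n: "norm x < 2 ^ Suc n" "\<bar>h x\<bar> \<le> a n" by blast
    define F where "F k = ennreal (a k) * indicator (ball 0 (2 ^ Suc k)) x" for k
    have "ennreal (norm (h x)) \<le> F n" using n by (simp add: F_def ennreal_leI)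
    also have "F n = sum F {n}" by simp
    also have "\<dots> \<le> suminf F" by (rule sum_le_suminf) auto
    finally show ?thesis unfolding F_def[abs_def] .
  qed
  have hm: "h \<in> borel_measurable borel" by (rule borel_measurable_continuous_onI[OF cont])
  have "(\<integral>\<^sup>+x. ennreal (norm (h x)) \<partial>lborel) \<le> (\<integral>\<^sup>+x. (\<Sum>n. ennreal (a n) * indicator (ball 0 (2 ^ Suc n)) x) \<partial>(lborel :: (real^3) measure))"
    by (rule nn_integral_mono) (rule dom)
  also have "\<dots> = (\<Sum>n. \<integral>\<^sup>+x. ennreal (a n) * indicator (ball 0 (2 ^ Suc n)) x \<partial>(lborel :: (real^3) measure))"
    by (rule nn_integral_suminf, intro borel_measurable_times_ennreal borel_measurable_const borel_measurable_indicator)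
       (simp only: sets_lborel borel_open open_ball)
  also have "\<dots> = (\<Sum>n. ennreal (8 * B * v * t ^ n))"
  proof (intro arg_cong[where f=suminf] ext)
    fix n :: nat
    have "(\<integral>\<^sup>+x. ennreal (a n) * indicator (ball 0 (2 ^ Suc n)) x \<partial>(lborel :: (real^3) measure)) = ennreal (a n) * ennreal ((2 ^ Suc n) ^ 3 * v)"
      by (subst nn_integral_cmult_indicator) (simp_all only: ball_vol[of "2 ^ Suc n"] zero_le_power zero_le_numeral sets_lborel borel_open open_ball)
    also have "\<dots> = ennreal (a n * ((2 ^ Suc n) ^ 3 * v))" by (rule ennreal_mult[symmetric]) (simp_all add: a v_def)
    also have "a n * ((2 ^ Suc n) ^ 3 * v) = 8 * B * v * ((2 ^ n) powr (- p) * (2 ^ n) ^ 3)"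
      by (simp add: a_def power_mult_distrib)
    finally show "(\<integral>\<^sup>+x. ennreal (a n) * indicator (ball 0 (2 ^ Suc n)) x \<partial>(lborel :: (real^3) measure)) = ennreal (8 * B * v * t ^ n)"
      unfolding ps .
  qed
  also have "\<dots> < \<infinity>"
  proof -
    have "summable (\<lambda>n. 8 * B * v * t ^ n)" using t by (intro summable_mult summable_geometric) simp
    then have "(\<Sum>n. ennreal (8 * B * v * t ^ n)) \<noteq> top"
      using t B by (intro ennreal_suminf_neq_top) (auto simp: v_def)
    then show ?thesis by (simp add: top.not_eq_extremum)
  qed
  finally show ?thesis using hm by (simp add: integrable_iff_bounded)
qed

lemma C1_surface_negligible:
  assumes "C1_surface S" shows "negligible S"
proof (rule locally_negligible_alt[THEN iffD2], rule ballI)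
  fix x assume "x \<in> S"
  then obtain U \<phi> where P: "C1_patch S U \<phi>" "x \<in> \<phi> ` U" using assms unfolding C1_surface_def by blast
  have d: "\<phi> differentiable_on U"
  proof -
    have "\<forall>u\<in>U. \<phi> differentiable (at u)" using P(1) by (simp add: C1_patch_def)
    then show ?thesis unfolding differentiable_on_def by (blast intro: differentiable_at_withinI)
  qed
  have "negligible (\<phi> ` U)" by (rule negligible_differentiable_image_lowdim[OF _ d]) simp
  then show "\<exists>V. openin (top_of_set S) V \<and> x \<in> V \<and> negligible V" using P unfolding C1_patch_def by blast
qed

text \<open>Reflection invariance turns the integral over the symmetric part into the integral of the
even part of \<open>f\<close>, to which dominated convergence applies. The rest of \<open>U k\<close> avoids the ball of radius
\<open>r k\<close>, so that its contribution is at most the decay of \<open>f\<close> at this radius times its volume.\<close>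

lemma symmetric_exhaustion_limit:
  fixes f :: "real^3 \<Rightarrow> real" and U :: "nat \<Rightarrow> (real^3) set" and r :: "nat \<Rightarrow> real"
  assumes cont: "continuous_on UNIV f" and \<beta>: "\<beta> > 2"
    and f1: "\<And>x. norm x \<ge> \<rho> \<Longrightarrow> \<bar>f x\<bar> \<le> C1 * norm x powr (- \<beta>)"
    and f2: "\<And>x. norm x \<ge> \<rho> \<Longrightarrow> \<bar>f x + f (- x)\<bar> \<le> C2 * norm x powr (- (\<beta> + 1))"
    and r: "filterlim r at_top sequentially"
    and U: "\<forall>\<^sub>F k in sequentially. open (U k) \<and> bounded (U k) \<and> ball 0 (r k) \<subseteq> U k"
    and vol: "(\<lambda>k. measure lborel (U k - uminus ` U k)) \<in> O(\<lambda>k. r k powr q)" and q: "q < \<beta>"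
  shows "(\<lambda>k. LINT x:U k|lborel. f x) \<longlonglongrightarrow> 1/2 * (LINT x|lborel. f x + f (- x))"
proof -
  let ?h = "\<lambda>x. f x + f (- x)"
  define V where "V k = U k \<inter> uminus ` U k" for k
  define T where "T k = U k - uminus ` U k" for k
  have cm: "continuous_on UNIV (\<lambda>x. f (- x))"
    by (rule continuous_on_compose2[OF cont continuous_on_minus[OF continuous_on_id]]) simp
  have hi: "integrable lborel ?h"
    by (rule integrable_of_decay[OF continuous_on_add[OF cont cm] _ f2]) (use \<beta> in auto)
  have neg_in: "x \<in> uminus ` A \<longleftrightarrow> - x \<in> A" for x :: "real^3" and A
    by (metis image_iff minus_minus)
  have Vsym: "- x \<in> V k \<longleftrightarrow> x \<in> V k" for x k unfolding V_def Int_iff neg_in by auto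
  have good: "\<forall>\<^sub>F k in sequentially. open (U k) \<and> bounded (U k) \<and> ball 0 (r k) \<subseteq> U k \<and> r k \<ge> max 1 \<rho>"
    using U filterlim_at_top[THEN iffD1, OF r, rule_format, of "max 1 \<rho>"] by eventually_elim auto
  have fU: "set_integrable lborel (U k) f" if "open (U k)" "bounded (U k)" for k
    by (rule set_integrable_bounded_open[of "closure (U k)"]) (use that in \<open>auto intro: continuous_on_subset[OF cont] closure_subset[THEN subsetD]\<close>)
  have VS: "V k \<in> sets lborel" "T k \<in> sets lborel" if "open (U k)" for k
  proof -
    have "open (uminus ` U k)" using that by (rule open_negations)
    then show "V k \<in> sets lborel" "T k \<in> sets lborel" using that by (auto simp: V_def T_def)
  qed
  have split: "\<forall>\<^sub>F k in sequentially. (LINT x:U k|lborel. f x) = 1/2 * (LINT x|lborel. indicator (V k) x * ?h x) + (LINT x:T k|lborel. f x)"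
    using good
  proof eventually_elim
    case (elim k)
    have iV: "set_integrable lborel (V k) f" and iT: "set_integrable lborel (T k) f"
      using elim VS by (auto intro!: set_integrable_subset[OF fU] simp: V_def T_def)
    have "U k = V k \<union> T k" "V k \<inter> T k = {}" by (auto simp: V_def T_def)
    then have 1: "(LINT x:U k|lborel. f x) = (LINT x:V k|lborel. f x) + (LINT x:T k|lborel. f x)"
      using set_integral_Un[OF _ iV iT] by simp
    have iV': "integrable lborel (\<lambda>x. indicator (V k) x * f x)" using iV by (simp add: set_integrable_def)
    have sw: "indicator (V k) (- x) * f (- x) = indicator (V k) x * f (- x)" for x by (simp add: indicator_def Vsym)
    note rf = integrable_reflect[OF iV', unfolded sw]
    have "(LINT x|lborel. indicator (V k) x * ?h x) = (LINT x|lborel. indicator (V k) x * f x + indicator (V k) x * f (- x))"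
      by (simp add: distrib_left)
    also have "\<dots> = (LINT x|lborel. indicator (V k) x * f x) + (LINT x|lborel. indicator (V k) x * f x)"
      by (subst Bochner_Integration.integral_add[OF iV' rf(1)]) (simp only: rf(2))
    finally have "(LINT x|lborel. indicator (V k) x * ?h x) = 2 * (LINT x:V k|lborel. f x)"
      by (simp add: set_lebesgue_integral_def)
    then show ?case using 1 by simp
  qed
  have lim1: "(\<lambda>k. LINT x|lborel. indicator (V k) x * ?h x) \<longlonglongrightarrow> (LINT x|lborel. ?h x)"
  proof -
    from good obtain N where N: "\<And>k. k \<ge> N \<Longrightarrow> open (U k) \<and> bounded (U k) \<and> ball 0 (r k) \<subseteq> U k \<and> r k \<ge> max 1 \<rho>"
      unfolding eventually_sequentially by (elim exE) blast
    have "(\<lambda>k. LINT x|lborel. indicator (V (k + N)) x * ?h x) \<longlonglongrightarrow> (LINT x|lborel. ?h x)"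
    proof (rule integral_dominated_convergence[where w="\<lambda>x. \<bar>?h x\<bar>"])
      show "?h \<in> borel_measurable lborel" using hi by (rule borel_measurable_integrable)
      show "(\<lambda>x. indicator (V (k + N)) x * ?h x) \<in> borel_measurable lborel" for k
        using VS(1)[of "k + N"] N[of "k + N"] borel_measurable_integrable[OF hi] by (intro borel_measurable_times borel_measurable_indicator) auto
      show "integrable lborel (\<lambda>x. \<bar>?h x\<bar>)" using hi by (rule integrable_abs)
      show "AE x in lborel. norm (indicator (V (k + N)) x * ?h x) \<le> \<bar>?h x\<bar>" for k by (rule AE_I2) (simp add: indicator_def)
      show "AE x in lborel. (\<lambda>k. indicator (V (k + N)) x * ?h x) \<longlonglongrightarrow> ?h x"
      proof (rule AE_I2)
        fix x :: "real^3"
        have "filterlim (\<lambda>k. r (k + N)) at_top sequentially" by (rule filterlim_compose[OF r filterlim_add_const_nat_at_top])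
        then have "\<forall>\<^sub>F k in sequentially. r (k + N) \<ge> norm x + 1" by (simp add: filterlim_at_top)
        then have "\<forall>\<^sub>F k in sequentially. indicator (V (k + N)) x * ?h x = ?h x"
        proof eventually_elim
          case (elim k)
          have "x \<in> ball 0 (r (k + N))" "- x \<in> ball 0 (r (k + N))" using elim by auto
          then have "x \<in> V (k + N)" unfolding V_def Int_iff neg_in using N[of "k + N"] by auto
          then show ?case by simp
        qed
        then show "(\<lambda>k. indicator (V (k + N)) x * ?h x) \<longlonglongrightarrow> ?h x" by (rule tendsto_eventually)
      qed
    qed
    then show ?thesis by (rule LIMSEQ_offset)
  qed
  have lim2: "(\<lambda>k. LINT x:T k|lborel. f x) \<longlonglongrightarrow> 0"
  proof -
    obtain c where c: "c > 0" "\<forall>\<^sub>F k in sequentially. norm (measure lborel (T k)) \<le> c * norm (r k powr q)"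
      using landau_o.bigE[OF vol] unfolding T_def by blast
    have "\<forall>\<^sub>F k in sequentially. norm (LINT x:T k|lborel. f x) \<le> \<bar>C1\<bar> * c * r k powr (q - \<beta>)"
      using good c(2)
    proof eventually_elim
      case (elim k)
      then have rk: "r k \<ge> 1" "r k \<ge> \<rho>" and o: "open (U k)" "bounded (U k)" "ball 0 (r k) \<subseteq> U k" by auto
      have Tf: "emeasure lborel (T k) < \<infinity>"
      proof -
        have "bounded (T k)" by (rule bounded_subset[OF o(2)]) (auto simp: T_def)
        then show ?thesis by (rule emeasure_bounded_finite)
      qed
      have pt: "\<bar>f x\<bar> \<le> \<bar>C1\<bar> * r k powr (- \<beta>)" if x: "x \<in> T k" for x
      proof -
        have "\<not> norm x < r k"
        proof
          assume "norm x < r k"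
          then have "- x \<in> U k" using o(3) by (intro subsetD[OF o(3)]) simp
          then show False using x unfolding T_def Diff_iff neg_in by blast
        qed
        then have n: "norm x \<ge> r k" by simp
        have "\<bar>f x\<bar> \<le> C1 * norm x powr (- \<beta>)" by (rule f1) (use n rk in linarith)
        also have "\<dots> \<le> \<bar>C1\<bar> * norm x powr (- \<beta>)" by (rule mult_right_mono) auto
        also have "\<dots> \<le> \<bar>C1\<bar> * r k powr (- \<beta>)" by (intro mult_left_mono powr_mono2') (use n rk \<beta> in auto)
        finally show ?thesis .
      qed
      have iT: "set_integrable lborel (T k) f"
        by (rule set_integrable_subset[OF fU[OF o(1,2)] VS(2)[OF o(1)]]) (auto simp: T_def)
      have ci: "set_integrable lborel (T k) (\<lambda>x. \<bar>C1\<bar> * r k powr (- \<beta>))"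
        unfolding set_integrable_def using VS(2)[OF o(1)] Tf by simp
      have "norm (LINT x:T k|lborel. f x) \<le> (LINT x:T k|lborel. norm (f x))"
        by (rule set_integral_norm_bound[OF iT])
      also have "\<dots> \<le> (LINT x:T k|lborel. \<bar>C1\<bar> * r k powr (- \<beta>))"
        by (rule set_integral_mono[OF set_integrable_norm[OF iT] ci]) (use pt in simp)
      also have "\<dots> = \<bar>C1\<bar> * r k powr (- \<beta>) * measure lborel (T k)"
        using set_integral_const[OF VS(2)[OF o(1)], of "\<bar>C1\<bar> * r k powr (- \<beta>)"] Tf by (simp add: top.not_eq_extremum mult.commute)
      also have "\<dots> \<le> \<bar>C1\<bar> * r k powr (- \<beta>) * (c * r k powr q)"
        by (rule mult_left_mono) (use elim in auto)
      also have "\<dots> = \<bar>C1\<bar> * c * r k powr (q - \<beta>)" by (simp add: powr_diff powr_minus divide_inverse mult_ac)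
      finally show ?case .
    qed
    moreover have "(\<lambda>k. \<bar>C1\<bar> * c * r k powr (q - \<beta>)) \<longlonglongrightarrow> 0"
      by (rule tendsto_mult_right_zero[OF tendsto_neg_powr[OF _ r]]) (use q in simp)
    ultimately show ?thesis by (rule Lim_null_comparison)
  qed
  have "(\<lambda>k. 1/2 * (LINT x|lborel. indicator (V k) x * ?h x) + (LINT x:T k|lborel. f x)) \<longlonglongrightarrow> 1/2 * (LINT x|lborel. ?h x) + 0"
    by (intro tendsto_add tendsto_mult_left lim1 lim2)
  then have "(\<lambda>k. 1/2 * (LINT x|lborel. indicator (V k) x * ?h x) + (LINT x:T k|lborel. f x)) \<longlonglongrightarrow> 1/2 * (LINT x|lborel. ?h x)" by simp
  then show ?thesis by (rule tendsto_cong[OF split, THEN iffD2])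
qed

section \<open>From initial data to a flux field on Euclidean space\<close>

text \<open>The parity conditions see only differences, so that subtracting the flat metric from \<open>g\<close> is
harmless there.\<close>

lemma vacuum_data_asymptotic:
  assumes v: "vacuum_initial_data A g K" and a: "AF_RT A c R0 \<delta> g K"
  shows "asymptotic_data (g c) (K c) R0 \<delta>"
proof -
  have af: "end_chart A c R0" "1/2 < \<delta>" "AF_decay \<delta> (g c) (K c)" "RT_decay \<delta> (g c) (K c)"
    using a unfolding AF_RT_def AF_def by blast+
  have cA: "c \<in> A" and img: "cimg c = exterior R0" using af(1) by (simp_all add: end_chart_def exterior_def)
  have gm: "riemannian_metric 3 A g" and Km: "symmetric_two_tensor 2 A K" using v unfolding vacuum_initial_data_def by blast+
  have gs: "symmetric_two_tensor 3 A g" using gm unfolding riemannian_metric_def by blast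
  have gC: "Ck_on 3 (g c) (exterior R0)" and gT: "\<forall>x\<in>exterior R0. transpose (g c x) = g c x"
    using gs cA unfolding symmetric_two_tensor_def img[symmetric] by blast+
  have KC: "Ck_on 2 (K c) (exterior R0)" using Km cA unfolding symmetric_two_tensor_def img[symmetric] by blast
  have bl: "bounded_linear (\<lambda>M::real^3^3. M $ i $ j)" for i j
    using bounded_linear_compose[OF bounded_linear_vec_nth bounded_linear_vec_nth, of i j] by simp
  have gCij: "Ck_on 3 (\<lambda>x. g c x $ i $ j) (exterior R0)" for i j by (rule Ck_on_linear[OF open_exterior bl gC])
  have KCij: "Ck_on 0 (\<lambda>x. K c x $ i $ j) (exterior R0)" for i j
    using Ck_on_continuous[OF Ck_on_linear[OF open_exterior bl KC]] by simp
  have shift: "Ck_on n (\<lambda>x. f x - k) (exterior R0)" if "Ck_on n f (exterior R0)" for n k and f :: "real^3 \<Rightarrow> real"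
  proof (cases n)
    case 0
    then show ?thesis using that by (simp add: continuous_on_diff)
  next
    case (Suc m)
    have df: "\<forall>x\<in>exterior R0. f differentiable (at x)" using that Suc by simp
    have fe: "frechet_derivative (\<lambda>x. f x - k) (at x) = frechet_derivative f (at x)" if "x \<in> exterior R0" for x
    proof (rule frechet_derivative_at[symmetric])
      have "(f has_derivative frechet_derivative f (at x)) (at x)" using df that by (simp add: frechet_derivative_works)
      then show "((\<lambda>x. f x - k) has_derivative frechet_derivative f (at x)) (at x)"
        using has_derivative_diff[OF _ has_derivative_const] by force
    qed
    have "Ck_on m (\<lambda>x. frechet_derivative (\<lambda>x. f x - k) (at x) v) (exterior R0)" if "v \<in> Basis" for v
    proof (rule Ck_on_cong_open[OF open_exterior, THEN iffD1])
      show "Ck_on m (\<lambda>x. frechet_derivative f (at x) v) (exterior R0)" using \<open>Ck_on n f (exterior R0)\<close> Suc that by simp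
    qed (simp add: fe)
    then show ?thesis using df Suc by simp
  qed
  show ?thesis
  proof
    show "\<delta> > 1/2" by (rule af(2))
    fix i j :: 3
    show "near R0 3 \<delta> (if i = j then 1 else 0) (\<lambda>x. g c x $ i $ j)"
      unfolding near_def
    proof (rule decay_from_pds)
      let ?c = "if i = j then 1 else 0 :: real"
      show "Ck_on 3 (\<lambda>x. g c x $ i $ j - ?c) (exterior R0)" by (rule shift[OF gCij])
      fix l :: "3 list" assume l: "length l \<le> 3"
      have "pds l (\<lambda>x. g c x $ i $ j - ?c) \<in> O[at_infinity](\<lambda>x. norm x powr (- \<delta> - real (length l)))"
        using af(3) l unfolding AF_decay_def by blast
      then show "bounded_order (\<delta> + length l) (pds l (\<lambda>x. g c x $ i $ j - ?c))" by (simp add: bounded_order_def)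
      have "pds l (odd_part (\<lambda>x. g c x $ i $ j)) \<in> O[at_infinity](\<lambda>x. norm x powr (- 1 - \<delta> - real (length l)))"
        using af(4) l unfolding RT_decay_def by blast
      moreover have "odd_part (\<lambda>x. g c x $ i $ j) = (\<lambda>x. (g c x $ i $ j - ?c) - 1 * (g c (- x) $ i $ j - ?c))"
        by (rule ext) (simp add: odd_part_def)
      moreover have "- (\<delta> + 1 + real (length l)) = - 1 - \<delta> - real (length l)" by simp
      ultimately show "bounded_order (\<delta> + 1 + length l) (pds l (\<lambda>x. (g c x $ i $ j - ?c) - 1 * (g c (- x) $ i $ j - ?c)))"
        unfolding bounded_order_def by (simp only:)
    qed
    show "decay R0 0 (1 + \<delta>) (- 1) (\<lambda>x. K c x $ i $ j)"
    proof (rule decay_from_pds[OF KCij])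
      fix l :: "3 list" assume "length l \<le> 0"
      then have l: "length l \<le> 2" by simp
      have "pds l (\<lambda>x. K c x $ i $ j) \<in> O[at_infinity](\<lambda>x. norm x powr (- 1 - \<delta> - real (length l)))"
        using af(3) l unfolding AF_decay_def by blast
      then show "bounded_order (1 + \<delta> + length l) (pds l (\<lambda>x. K c x $ i $ j))" by (simp add: bounded_order_def)
      have "pds l (even_part (\<lambda>x. K c x $ i $ j)) \<in> O[at_infinity](\<lambda>x. norm x powr (- 2 - \<delta> - real (length l)))"
        using af(4) l unfolding RT_decay_def by blast
      moreover have "even_part (\<lambda>x. K c x $ i $ j) = (\<lambda>x. K c x $ i $ j - - 1 * K c (- x) $ i $ j)"
        by (rule ext) (simp add: even_part_def)
      moreover have "- (1 + \<delta> + 1 + real (length l)) = - 2 - \<delta> - real (length l)" by simp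
      ultimately show "bounded_order (1 + \<delta> + 1 + length l) (pds l (\<lambda>x. K c x $ i $ j - - 1 * K c (- x) $ i $ j))"
        unfolding bounded_order_def by simp
    qed
    fix x assume x: "x \<in> exterior R0"
    have "transpose (g c x) $ i $ j = g c x $ i $ j" using gT x by simp
    then show "g c x $ i $ j = g c x $ j $ i" by (simp add: transpose_def)
    show "scalar_curvature (g c) x - normsq_wrt (g c) (K c) x + (trace_wrt (g c) (K c) x)\<^sup>2 = 0"
      using v cA x unfolding vacuum_initial_data_def img[symmetric] by blast
  next
    fix x v assume "x \<in> exterior R0" "v \<noteq> (0 :: real^3)"
    then show "v \<bullet> (g c x *v v) > 0" using gm cA unfolding riemannian_metric_def img[symmetric] by blast
  qed
qed

lemma C1_fun_vanishing_on_overlap: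
  fixes f :: "real^3 \<Rightarrow> real"
  assumes "open A" "open B" "A \<union> B = UNIV" and z: "\<And>x. x \<in> A \<Longrightarrow> f x = 0"
    and d: "\<And>x. x \<in> B \<Longrightarrow> f differentiable (at x)" and c: "\<And>i. continuous_on B (pd i f)"
  shows "C1_fun f"
  unfolding C1_fun_def
proof (intro conjI allI)
  fix x
  have "x \<in> A \<or> x \<in> B" using assms(3) by blast
  then show "f differentiable at x"
    using d differentiable_cong_open[OF assms(1), of x f "\<lambda>_. 0"] z by auto
next
  fix i
  have "continuous_on A (pd i f)"
    using continuous_on_cong[of A A "pd i f" "\<lambda>_. 0"] pd_zero_open[OF assms(1) _ z] by auto
  then show "continuous_on UNIV (pd i f)" using continuous_on_open_Un[OF assms(1,2) _ c] assms(3) by simp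
qed

context asymptotic_data begin

text \<open>A field on all of Euclidean space is needed, because the region is completed by the ball that
replaces the core.\<close>

lemma flux_field_cutoff:
  assumes R: "R > 0"
  obtains X \<rho> where "C1_field X" "\<rho> > R" "\<And>x. norm x > \<rho> \<Longrightarrow> X x = flux_field \<alpha> x"
    "\<And>x. norm x > \<rho> \<Longrightarrow> divergence X x = flux_div \<alpha> x"
proof -
  define \<zeta> where "\<zeta> = (\<lambda>x. 1 - bump 0 ((R + 1)\<^sup>2) ((R + 2)\<^sup>2) x)"
  have sq: "(R + 1)\<^sup>2 < (R + 2)\<^sup>2" by (rule power_strict_mono) (use R in auto)
  have C: "C1_fun \<zeta>" unfolding \<zeta>_def by (rule C1_fun_diff[OF C1_fun_const bump_C1[OF sq]])
  have c0: "\<zeta> x = 0" if "norm x < R + 1" for x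
    unfolding \<zeta>_def using bump_one[OF sq, of x 0] power_mono[of "norm x" "R + 1" 2] that by simp
  have c1: "\<zeta> x = 1" if "norm x > R + 2" for x
    unfolding \<zeta>_def using bump_zero[of "(R+2)\<^sup>2" x 0] power_mono[of "R + 2" "norm x" 2] that R by simp
  define X where "X x = (if norm x > R then \<zeta> x *\<^sub>R flux_field \<alpha> x else 0)" for x
  have "C1_fun (\<lambda>x. X x $ i)" for i
  proof (rule C1_fun_vanishing_on_overlap)
    let ?Z = "\<lambda>x. flux_field \<alpha> x $ i"
    show "open (ball (0::real^3) (R + 1))" "open (exterior R)" by (simp_all add: open_exterior)
    show "ball (0::real^3) (R + 1) \<union> exterior R = UNIV" by (auto simp: exterior_def)
    show "X x $ i = 0" if "x \<in> ball 0 (R + 1)" for x using that c0[of x] by (simp add: X_def)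
    have e: "X x $ i = \<zeta> x * ?Z x" if "x \<in> exterior R" for x using that by (simp add: X_def exterior_def)
    have Zd: "?Z differentiable (at x)" if "x \<in> exterior R" for x
      using decay_differentiable[of R 0] flux_field_decay[of \<alpha> i] that by simp
    have Zc: "continuous_on (exterior R) (pd j ?Z)" for j
    proof -
      have "decay R 0 (\<delta> + 1) (- 1) (pd j ?Z)" using decay_pd[of R 0 \<delta> 1] flux_field_decay[of \<alpha> i] by simp
      then show ?thesis unfolding decay_0_iff by blast
    qed
    have cd: "\<zeta> differentiable (at x)" for x using C by (simp add: C1_fun_def)
    show "(\<lambda>x. X x $ i) differentiable (at x)" if "x \<in> exterior R" for x
      using differentiable_cong_open[OF open_exterior that, of "\<lambda>x. X x $ i" "\<lambda>x. \<zeta> x * ?Z x"] e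
        differentiable_mult[OF cd Zd[OF that]] by simp
    fix j
    have "pd j (\<lambda>x. X x $ i) x = \<zeta> x * pd j ?Z x + pd j \<zeta> x * ?Z x" if x: "x \<in> exterior R" for x
      using pd_cong_open[OF open_exterior x, of "\<lambda>x. X x $ i" "\<lambda>x. \<zeta> x * ?Z x" j] e pd_mult[OF cd Zd[OF x]] by simp
    moreover have "continuous_on (exterior R) (\<lambda>x. \<zeta> x * pd j ?Z x + pd j \<zeta> x * ?Z x)"
      by (intro continuous_on_add continuous_on_mult Zc continuous_on_subset[OF C1_fun_continuous[OF C]]
          continuous_on_subset[OF C1_fun_pd_continuous[OF C]] continuous_at_imp_continuous_on ballI
          differentiable_imp_continuous_within Zd) auto
    ultimately show "continuous_on (exterior R) (pd j (\<lambda>x. X x $ i))"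
      using continuous_on_cong[of "exterior R" "exterior R"] by simp
  qed
  then have XC: "C1_field X" by (simp add: C1_field_def)
  have XZ: "X x = flux_field \<alpha> x" if "norm x > R + 2" for x using that c1[of x] by (simp add: X_def)
  have "divergence X x = flux_div \<alpha> x" if x: "norm x > R + 2" for x
  proof -
    have "pd i (\<lambda>y. X y $ i) x = pd i (\<lambda>y. flux_field \<alpha> y $ i) x" for i
      by (rule pd_cong_open[OF open_exterior[of "R + 2"]]) (use x XZ in \<open>auto simp: exterior_def\<close>)
    then show ?thesis by (simp add: divergence_def flux_div_def)
  qed
  then show ?thesis using that[OF XC, of "R + 2"] XZ by simp
qed

text \<open>Raising the index of $E(Y,\cdot)$ and pairing with the conormal gives back $E(Y,\nu)$, and
$\sqrt{\det g}$ is compensated in \<open>flux_density\<close>.\<close>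

lemma center_flux_eq_flux:
  assumes reg: "smooth_region \<Omega> S W G" and S: "S \<subseteq> exterior R" and X: "\<And>x. x \<in> S \<Longrightarrow> X x = flux_field \<alpha> x"
  shows "center_flux G W S \<alpha> = smooth_region.flux S W G X"
proof -
  interpret smooth_region \<Omega> S W G by (rule reg)
  have "(\<Sum>i\<in>UNIV. \<Sum>j\<in>UNIV. (ricci G i j x - 1/2 * scalar_curvature G x * G x $ i $ j) * Y_field \<alpha> x $ i * outward_normal G W S x $ j) = flux_density X x"
    if x: "x \<in> S" for x
  proof -
    define V :: "real^3" where "V = (\<chi> k. \<Sum>i\<in>UNIV. einstein i k x * Y_field \<alpha> x $ i)"
    let ?w = "sqrt (det (G x))"
    have w: "?w > 0" using G_det_pos[OF x] by simp
    have "X x = ?w *\<^sub>R (matrix_inv (G x) *v V)"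
      unfolding X[OF x] flux_field_def V_def vec_eq_iff matrix_vector_mult_def ginv_def by simp
    then have "X x \<bullet> conormal x = ?w * ((matrix_inv (G x) *v V) \<bullet> (G x *v \<nu> x))" by (simp add: conormal_def)
    also have "(matrix_inv (G x) *v V) \<bullet> (G x *v \<nu> x) = V \<bullet> \<nu> x"
      unfolding inner_sym_matrix[OF G_symm[OF x], symmetric] G_mult_inverse(1)[OF x] ..
    finally have "flux_density X x = V \<bullet> \<nu> x" using w by (simp add: flux_density_def)
    also have "\<dots> = (\<Sum>j\<in>UNIV. \<Sum>i\<in>UNIV. einstein i j x * Y_field \<alpha> x $ i * outward_normal G W S x $ j)"
      by (simp add: V_def \<nu>_def inner_vec_def sum_distrib_right)
    also have "\<dots> = (\<Sum>i\<in>UNIV. \<Sum>j\<in>UNIV. einstein i j x * Y_field \<alpha> x $ i * outward_normal G W S x $ j)" by (rule sum.swap)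
    finally show ?thesis by (simp add: einstein_def)
  qed
  then show ?thesis
    unfolding center_flux_def flux_def surface_integral_def set_lebesgue_integral_def
    by (intro Bochner_Integration.integral_cong refl) (simp add: indicator_def)
qed

lemma flux_div_bounds:
  obtains \<rho> C1 C2 where "\<And>x. norm x \<ge> \<rho> \<Longrightarrow> \<bar>flux_div \<alpha> x\<bar> \<le> C1 * norm x powr (- (1 + 2 * \<delta>))"
    "\<And>x. norm x \<ge> \<rho> \<Longrightarrow> \<bar>flux_div \<alpha> x + flux_div \<alpha> (- x)\<bar> \<le> C2 * norm x powr (- (1 + 2 * \<delta> + 1))"
proof -
  have "bounded_order (1 + 2 * \<delta>) (flux_div \<alpha>)" "bounded_order (1 + 2 * \<delta> + 1) (\<lambda>x. flux_div \<alpha> x - - 1 * flux_div \<alpha> (- x))"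
    using flux_div_decay[of \<alpha>] unfolding decay_0_iff by blast+
  then have O: "flux_div \<alpha> \<in> O[at_infinity](\<lambda>x. norm x powr (- (1 + 2 * \<delta>)))"
    "(\<lambda>x. flux_div \<alpha> x + flux_div \<alpha> (- x)) \<in> O[at_infinity](\<lambda>x. norm x powr (- (1 + 2 * \<delta> + 1)))"
    unfolding bounded_order_def by simp_all
  obtain C1 where "\<forall>\<^sub>F x in at_infinity. norm (flux_div \<alpha> x) \<le> C1 * norm (norm x powr (- (1 + 2 * \<delta>)))"
    using landau_o.bigE[OF O(1)] by blast
  then obtain b1 where b1: "\<forall>x. norm x \<ge> b1 \<longrightarrow> norm (flux_div \<alpha> x) \<le> C1 * norm (norm x powr (- (1 + 2 * \<delta>)))"
    unfolding eventually_at_infinity by blast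
  obtain C2 where "\<forall>\<^sub>F x in at_infinity. norm (flux_div \<alpha> x + flux_div \<alpha> (- x)) \<le> C2 * norm (norm x powr (- (1 + 2 * \<delta> + 1)))"
    using landau_o.bigE[OF O(2)] by blast
  then obtain b2 where b2: "\<forall>x. norm x \<ge> b2 \<longrightarrow> norm (flux_div \<alpha> x + flux_div \<alpha> (- x)) \<le> C2 * norm (norm x powr (- (1 + 2 * \<delta> + 1)))"
    unfolding eventually_at_infinity by blast
  show ?thesis
    by (rule that[of "max b1 b2" C1 C2]) (use b1 b2 in auto)
qed

end

section \<open>The center of mass\<close>

context asymptotic_end begin

lemma metric_chart_facts:
  "continuous_on (exterior R0) (g c)" "x \<in> exterior R0 \<Longrightarrow> transpose (g c x) = g c x"
  "x \<in> exterior R0 \<Longrightarrow> v \<noteq> 0 \<Longrightarrow> v \<bullet> (g c x *v v) > 0"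
proof -
  have s: "symmetric_two_tensor 3 A g" using metric unfolding riemannian_metric_def by blast
  then have "Ck_on 3 (g c) (cimg c)" using c_in unfolding symmetric_two_tensor_def by blast
  then show "continuous_on (exterior R0) (g c)" unfolding cimg_eq by (rule Ck_on_continuous)
  show "transpose (g c x) = g c x" if "x \<in> exterior R0"
    using s c_in that unfolding symmetric_two_tensor_def cimg_eq[symmetric] by blast
  show "v \<bullet> (g c x *v v) > 0" if "x \<in> exterior R0" "v \<noteq> 0"
    using metric c_in that unfolding riemannian_metric_def cimg_eq[symmetric] by blast
qed

lemma boundary_smooth_region:
  assumes D: "compact D" "frontier D \<subseteq> cdom c" "- cdom c \<subseteq> D"
    and r: "r > R0" "\<forall>x\<in>coord_boundary c D. norm x \<ge> r"
    and con: "connected (frontier D)" and C1: "C1_surface (coord_boundary c D)"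
  shows "smooth_region (coord_region c D \<union> cball 0 R0) (coord_boundary c D) (coord_region c D) (g c)"
proof -
  note reg = region_structure[OF D r]
  show ?thesis
  proof
    show "compact (coord_region c D \<union> cball 0 R0)" by (rule reg(1))
    show "coord_boundary c D = frontier (coord_region c D \<union> cball 0 R0)" by (rule reg(2)[symmetric])
    show "connected (coord_boundary c D)" unfolding coord_boundary_def
      by (rule connected_continuous_image[OF continuous_on_subset[OF chart_facts(3)[OF c_in] D(2)] con])
    show "C1_surface (coord_boundary c D)" by (rule C1)
    have "(0::real^3) \<in> ball 0 r" using r(1) R0_pos by simp
    then show "interior (coord_region c D \<union> cball 0 R0) \<noteq> {}" using interior_maximal[OF reg(3) open_ball] by blast
    show "\<exists>T. open T \<and> coord_boundary c D \<subseteq> T \<and> (coord_region c D \<union> cball 0 R0) \<inter> T \<subseteq> coord_region c D"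
      using reg(4,5) open_exterior by blast
    show "continuous_on (coord_boundary c D) (g c)" by (rule continuous_on_subset[OF metric_chart_facts(1) reg(5)])
  qed (use metric_chart_facts(2,3) reg(5) in blast)+
qed

text \<open>A point of the interior of \<open>\<Omega>\<close> whose antipode is not in the interior is counted by
\<open>end_volume\<close>, unless its antipode lies on the surface, which is a null set. The factor \<open>2\<close> bounds the
Euclidean by the Riemannian volume.\<close>

lemma asymmetry_volume_le:
  assumes D: "compact D" "frontier D \<subseteq> cdom c" "- cdom c \<subseteq> D"
    and r: "r > R0" "\<forall>x\<in>coord_boundary c D. norm x \<ge> r" and r1: "r > R1"
    and C1: "C1_surface (coord_boundary c D)"
  defines "\<Omega> \<equiv> coord_region c D \<union> cball 0 R0"
  shows "measure lborel (interior \<Omega> - uminus ` interior \<Omega>) \<le> 2 * end_volume c (g c) (D - (D \<inter> antipodal_image c D))"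
proof -
  note reg = region_structure[OF D r, folded \<Omega>_def]
  define W where "W = coord_region c D"
  define S where "S = coord_boundary c D"
  define T where "T = {x \<in> W. - x \<notin> W}"
  have neg_in: "x \<in> uminus ` A \<longleftrightarrow> - x \<in> A" for x :: "real^3" and A by (metis image_iff minus_minus)
  have T: "cmap c ` ((D - (D \<inter> antipodal_image c D)) \<inter> cdom c) = T"
  proof (intro equalityI subsetI)
    fix x assume "x \<in> cmap c ` ((D - (D \<inter> antipodal_image c D)) \<inter> cdom c)"
    then obtain p where p: "x = cmap c p" "p \<in> D" "p \<in> cdom c" "p \<notin> antipodal_image c D" by blast
    have "x \<in> W" using p unfolding W_def coord_region_def by blast
    moreover have "- x \<notin> W"
    proof
      assume "- x \<in> W"
      then obtain q where q: "- x = cmap c q" "q \<in> D \<inter> cdom c" unfolding W_def coord_region_def by blast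
      have "cmap c p = - cmap c q" unfolding q(1)[symmetric] p(1) by simp
      then have "p \<in> antipodal_image c D" using p(3) q(2) unfolding antipodal_image_def by blast
      then show False using p(4) by blast
    qed
    ultimately show "x \<in> T" by (simp add: T_def)
  next
    fix x assume "x \<in> T"
    then have x: "x \<in> W" "- x \<notin> W" by (simp_all add: T_def)
    then obtain p where p: "x = cmap c p" "p \<in> D" "p \<in> cdom c" unfolding W_def coord_region_def by blast
    have "p \<notin> antipodal_image c D"
    proof
      assume "p \<in> antipodal_image c D"
      then obtain q where q: "q \<in> D \<inter> cdom c" "cmap c p = - cmap c q" using p(3) unfolding antipodal_image_def by blast
      have "- x = cmap c q" using q(2) p(1) by simp
      then show False using x(2) q(1) unfolding W_def coord_region_def by blast
    qed
    then show "x \<in> cmap c ` ((D - (D \<inter> antipodal_image c D)) \<inter> cdom c)" using p by blast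
  qed
  have WO: "W = \<Omega> \<inter> exterior R0" unfolding W_def by (rule reg(4))
  have clO: "closed \<Omega>" by (rule compact_imp_closed[OF reg(1)])
  have Wb: "W \<in> sets borel" unfolding WO by (intro sets.Int borel_closed borel_open clO open_exterior)
  have Wm: "uminus ` W \<in> sets borel"
  proof -
    have "uminus ` W = uminus ` \<Omega> \<inter> exterior R0"
      unfolding WO set_eq_iff Int_iff neg_in by simp
    then show ?thesis by (simp only:) (intro sets.Int borel_closed borel_open closed_negations clO open_exterior)
  qed
  have Tb: "T \<in> sets borel"
  proof -
    have "T = W - uminus ` W" unfolding T_def by (auto simp: neg_in)
    then show ?thesis using Wb Wm by simp
  qed
  have Tfar: "norm x \<ge> r" if x: "x \<in> T" for x
  proof (rule ccontr)
    assume "\<not> norm x \<ge> r"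
    then have "- x \<in> \<Omega>" by (intro subsetD[OF reg(3)]) simp
    moreover have "- x \<in> exterior R0" using x WO unfolding T_def by simp
    ultimately show False using x WO unfolding T_def by blast
  qed
  \<comment> \<open>A compact subset of the end, on which the volume element is bounded.\<close>
  define Q where "Q = \<Omega> \<inter> {x. norm x \<ge> r}"
  have Q: "compact Q" unfolding Q_def
    by (intro compact_Int_closed reg(1) closed_Collect_le continuous_on_const continuous_on_norm continuous_on_id)
  have TQ: "T \<subseteq> Q" using Tfar WO unfolding T_def Q_def by blast
  have Qext: "Q \<subseteq> exterior R0" using r(1) by (auto simp: Q_def exterior_def)
  have "continuous_on Q (\<lambda>x. det (g c x))"
    unfolding det_3 by (intro continuous_on_add continuous_on_diff continuous_on_mult continuous_on_component continuous_on_subset[OF metric_chart_facts(1) Qext])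
  then have cQ: "continuous_on Q (\<lambda>x. sqrt (det (g c x)))" by (rule continuous_on_real_sqrt)
  have iT: "set_integrable lborel T (\<lambda>x. sqrt (det (g c x)))"
    by (rule set_integrable_bounded_open[OF Q cQ TQ Tb])
  have Tf: "emeasure lborel T < \<infinity>" by (rule emeasure_bounded_finite[OF bounded_subset[OF compact_imp_bounded[OF Q] TQ]])
  have ic: "set_integrable lborel T (\<lambda>x. 1/2 :: real)" unfolding set_integrable_def using Tb Tf by simp
  have half: "1/2 \<le> sqrt (det (g c x))" if "x \<in> T" for x
  proof (rule real_le_rsqrt)
    have "det (g c x) \<ge> 1/4" by (rule det_far) (use Tfar[OF that] r1 in linarith)
    then show "(1/2)\<^sup>2 \<le> det (g c x)" by (simp add: power2_eq_square)
  qed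
  have "1/2 * measure lborel T = (LINT x:T|lborel. 1/2)"
    using set_integral_const[of T lborel "1/2::real"] Tb Tf by (simp add: top.not_eq_extremum mult.commute)
  also have "\<dots> \<le> (LINT x:T|lborel. sqrt (det (g c x)))" by (rule set_integral_mono[OF ic iT half])
  also have "\<dots> = end_volume c (g c) (D - (D \<inter> antipodal_image c D))" unfolding end_volume_def T ..
  finally have volT: "measure lborel T \<le> 2 * end_volume c (g c) (D - (D \<inter> antipodal_image c D))" by simp
  let ?N = "uminus ` S"
  have neg: "negligible (uminus ` S)"
    unfolding S_def by (rule negligible_differentiable_image_negligible[OF _ C1_surface_negligible[OF C1]])
      (auto intro: linear_imp_differentiable_on[OF linear_uminus])
  have Sc: "closed S" unfolding S_def reg(2)[symmetric] by (rule frontier_closed)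
  then have Nb: "?N \<in> sets borel" by (intro borel_closed closed_negations)
  have N0: "?N \<in> null_sets lborel"
    using neg null_sets_completion_iff[of ?N lborel] Nb by (simp add: negligible_iff_null_sets)
  have sub: "interior \<Omega> - uminus ` interior \<Omega> \<subseteq> T \<union> ?N"
  proof
    fix x assume "x \<in> interior \<Omega> - uminus ` interior \<Omega>"
    then have x: "x \<in> interior \<Omega>" "- x \<notin> interior \<Omega>" unfolding Diff_iff neg_in by blast+
    have xO: "x \<in> \<Omega>" using x(1) interior_subset by blast
    have "x \<in> exterior R0"
    proof (rule ccontr)
      assume "x \<notin> exterior R0"
      then have "- x \<in> ball 0 r" using r(1) by (simp add: exterior_def)
      then show False using x(2) interior_maximal[OF reg(3) open_ball] by blast
    qed
    then have xW: "x \<in> W" using xO WO by blast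
    show "x \<in> T \<union> ?N"
    proof (cases "- x \<in> \<Omega>")
      case True
      then have "- x \<in> frontier \<Omega>" using x(2) clO by (simp add: frontier_def)
      then show ?thesis unfolding Un_iff neg_in S_def reg(2) by blast
    next
      case False
      then show ?thesis using xW WO by (simp add: T_def)
    qed
  qed
  have "measure lborel (interior \<Omega> - uminus ` interior \<Omega>) \<le> measure lborel (T \<union> ?N)"
  proof (rule measure_mono_fmeasurable[OF sub])
    show "interior \<Omega> - uminus ` interior \<Omega> \<in> sets lborel" using open_negations[OF open_interior[of \<Omega>]] by auto
    show "T \<union> ?N \<in> fmeasurable lborel"
      by (rule fmeasurable.Un[OF fmeasurableI[OF _ Tf] fmeasurableI_null_sets[OF N0]]) (use Tb in simp)
  qed
  also have "\<dots> = measure lborel T" by (rule measure_Un_null_set) (use Tb N0 in auto)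
  finally show ?thesis using volT by simp
qed

text \<open>The limit is half of the integral of $f(x) + f(-x)$, where \<open>f\<close> is the divergence of the
cut-off flux field; it does not involve the sequence.\<close>

lemma center_flux_limit:
  assumes data: "asymptotic_data (g c) P R0 \<delta>"
  shows "\<exists>L. \<forall>D. admissible_sequence c \<delta> (g c) D \<longrightarrow>
    (\<lambda>k. center_flux (g c) (coord_region c (D k)) (coord_boundary c (D k)) \<alpha>) \<longlonglongrightarrow> L"
proof -
  interpret asymptotic_data "g c" P R0 \<delta> by (rule data)
  obtain X \<rho>1 where X: "C1_field X" "\<rho>1 > R0" "\<And>x. norm x > \<rho>1 \<Longrightarrow> X x = flux_field \<alpha> x"
    "\<And>x. norm x > \<rho>1 \<Longrightarrow> divergence X x = flux_div \<alpha> x"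
    by (rule flux_field_cutoff[OF R0_pos, of \<alpha>]) (rule that)
  obtain \<rho>2 C1 C2 where est: "\<And>x. norm x \<ge> \<rho>2 \<Longrightarrow> \<bar>flux_div \<alpha> x\<bar> \<le> C1 * norm x powr (- (1 + 2 * \<delta>))"
    "\<And>x. norm x \<ge> \<rho>2 \<Longrightarrow> \<bar>flux_div \<alpha> x + flux_div \<alpha> (- x)\<bar> \<le> C2 * norm x powr (- (1 + 2 * \<delta> + 1))"
    by (rule flux_div_bounds[of \<alpha>]) (rule that)
  define f where "f = divergence X"
  define \<rho> where "\<rho> = max \<rho>2 (\<rho>1 + 1)"
  have fc: "continuous_on UNIV f" unfolding f_def by (rule divergence_continuous[OF X(1)])
  have f1: "\<bar>f x\<bar> \<le> C1 * norm x powr (- (1 + 2 * \<delta>))" if "norm x \<ge> \<rho>" for x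
    using est(1)[of x] X(4)[of x] that by (simp add: f_def \<rho>_def)
  have f2: "\<bar>f x + f (- x)\<bar> \<le> C2 * norm x powr (- (1 + 2 * \<delta> + 1))" if "norm x \<ge> \<rho>" for x
    using est(2)[of x] X(4)[of x] X(4)[of "- x"] that by (simp add: f_def \<rho>_def)
  show ?thesis
  proof (intro exI allI impI)
    fix D assume adm: "admissible_sequence c \<delta> (g c) D"
    define \<Omega> where "\<Omega> k = coord_region c (D k) \<union> cball 0 R0" for k
    define r where "r k = inner_radius c (D k)" for k
    from adm have Dk: "compact (D k)" "frontier (D k) \<subseteq> cdom c" "connected (frontier (D k))" "C1_surface (coord_boundary c (D k))" for k
      unfolding admissible_sequence_def by blast+
    have core: "\<forall>\<^sub>F k in sequentially. - cdom c \<subseteq> D k" and r: "filterlim r at_top sequentially"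
      using adm unfolding admissible_sequence_def r_def[abs_def] by blast+
    from adm obtain q where q: "q < 1 + 2 * \<delta>"
      "(\<lambda>k. end_volume c (g c) (D k - (D k \<inter> antipodal_image c (D k)))) \<in> O(\<lambda>k. r k powr q)"
      unfolding admissible_sequence_def r_def by blast
    have rn: "\<forall>x\<in>coord_boundary c (D k). norm x \<ge> r k" for k
      unfolding r_def inner_radius_def by (intro ballI cINF_lower) (auto intro: bdd_belowI[of _ 0])
    have "\<forall>\<^sub>F k in sequentially. r k \<ge> max (\<rho>1 + 1) (R1 + 1)" using r by (simp only: filterlim_at_top)
    then have good: "\<forall>\<^sub>F k in sequentially. - cdom c \<subseteq> D k \<and> r k > R0 \<and> r k > R1 \<and> r k > \<rho>1"
      using core by eventually_elim (use X(2) in auto)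
    have lim: "(\<lambda>k. LINT x:interior (\<Omega> k)|lborel. f x) \<longlonglongrightarrow> 1/2 * (LINT x|lborel. f x + f (- x))"
    proof (rule symmetric_exhaustion_limit[OF fc _ f1 f2 r _ _ q(1)])
      show "1 + 2 * \<delta> > 2" using delta by simp
      show "\<forall>\<^sub>F k in sequentially. open (interior (\<Omega> k)) \<and> bounded (interior (\<Omega> k)) \<and> ball 0 (r k) \<subseteq> interior (\<Omega> k)"
        using good
      proof eventually_elim
        case (elim k)
        then have e: "- cdom c \<subseteq> D k" "r k > R0" by blast+
        note reg = region_structure[OF Dk(1,2) e rn, folded \<Omega>_def]
        show ?case using bounded_subset[OF compact_imp_bounded[OF reg(1)] interior_subset] interior_maximal[OF reg(3) open_ball] by simp
      qed
      have "\<forall>\<^sub>F k in sequentially. norm (measure lborel (interior (\<Omega> k) - uminus ` interior (\<Omega> k)))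
          \<le> 2 * norm (end_volume c (g c) (D k - (D k \<inter> antipodal_image c (D k))))"
        using good
      proof eventually_elim
        case (elim k)
        then have e: "- cdom c \<subseteq> D k" "r k > R0" "r k > R1" by blast+
        show ?case using asymmetry_volume_le[OF Dk(1,2) e(1,2) rn e(3) Dk(4), folded \<Omega>_def]
          by (simp add: order_trans[OF _ mult_left_mono[OF abs_ge_self]])
      qed
      then show "(\<lambda>k. measure lborel (interior (\<Omega> k) - uminus ` interior (\<Omega> k))) \<in> O(\<lambda>k. r k powr q)"
        by (rule landau_o.big_trans[OF bigoI q(2)])
    qed
    have ev: "\<forall>\<^sub>F k in sequentially. center_flux (g c) (coord_region c (D k)) (coord_boundary c (D k)) \<alpha> = (LINT x:interior (\<Omega> k)|lborel. f x)"
      using good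
    proof eventually_elim
      case (elim k)
      then have e: "- cdom c \<subseteq> D k" "r k > R0" "r k > \<rho>1" by blast+
      have reg: "smooth_region (\<Omega> k) (coord_boundary c (D k)) (coord_region c (D k)) (g c)"
        unfolding \<Omega>_def by (rule boundary_smooth_region[OF Dk(1,2) e(1,2) rn Dk(3,4)])
      have S: "coord_boundary c (D k) \<subseteq> exterior R0" by (rule region_structure(5)[OF Dk(1,2) e(1,2) rn])
      have "X x = flux_field \<alpha> x" if "x \<in> coord_boundary c (D k)" for x
        by (rule X(3)) (use bspec[OF rn that] e(3) in linarith)
      then show ?case unfolding f_def center_flux_eq_flux[OF reg S, of X \<alpha>]
        using center_flux_eq_flux[OF reg S, of X \<alpha>] smooth_region.divergence_theorem[OF reg X(1)] by simp
    qed
    show "(\<lambda>k. center_flux (g c) (coord_region c (D k)) (coord_boundary c (D k)) \<alpha>) \<longlonglongrightarrow> 1/2 * (LINT x|lborel. f x + f (- x))"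
      by (rule tendsto_cong[OF ev, THEN iffD2]) (rule lim)
  qed
qed

end

theorem proposition3p1:
  fixes A :: "'m::{t2_space, second_countable_topology} chart set"
    and g K :: "'m tensor2"
    and c :: "'m chart"
    and R0 \<delta> m :: real
  assumes "vacuum_initial_data A g K"
    and "AF_RT A c R0 \<delta> g K"
    and "m = adm_mass (g c)" and "m \<noteq> 0"
  shows "\<exists>C :: real^3. \<forall>D :: nat \<Rightarrow> 'm set. admissible_sequence c \<delta> (g c) D \<longrightarrow>
    (\<forall>\<alpha>. (\<lambda>k. 1 / (16 * pi * m) *
        center_flux (g c) (coord_region c (D k)) (coord_boundary c (D k)) \<alpha>)
      \<longlonglongrightarrow> C $ \<alpha>)"
proof -
  have data: "asymptotic_data (g c) (K c) R0 \<delta>" by (rule vacuum_data_asymptotic[OF assms(1,2)])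
  then interpret asymptotic_data "g c" "K c" R0 \<delta> .
  have "((\<lambda>x. det (g c x)) \<longlongrightarrow> 1) at_infinity" by (rule near_tendsto[OF det_near]) (use delta in simp)
  then have "\<forall>\<^sub>F x in at_infinity. det (g c x) > 1/4" by (rule order_tendstoD) simp
  then obtain b where b: "\<And>x. norm x \<ge> b \<Longrightarrow> det (g c x) > 1/4" unfolding eventually_at_infinity by blast
  have end_data: "asymptotic_end A g c R0 b"
  proof
    show "smooth_3_manifold A" "riemannian_metric 3 A g" using assms(1) unfolding vacuum_initial_data_def by blast+
    show "end_chart A c R0" using assms(2) unfolding AF_RT_def AF_def by blast
    show "1/4 \<le> det (g c y)" if "norm y > b" for y using b[of y] that by simp
  qed
  define Q where "Q \<alpha> L \<longleftrightarrow> (\<forall>D. admissible_sequence c \<delta> (g c) D \<longrightarrow>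
    (\<lambda>k. center_flux (g c) (coord_region c (D k)) (coord_boundary c (D k)) \<alpha>) \<longlonglongrightarrow> L)" for \<alpha> L
  have "\<exists>L. Q \<alpha> L" for \<alpha>
    unfolding Q_def by (rule asymptotic_end.center_flux_limit[OF end_data data])
  then have "\<forall>\<alpha>. \<exists>L. Q \<alpha> L" by (rule allI)
  from choice[OF this] obtain L where L: "\<forall>\<alpha>. Q \<alpha> (L \<alpha>)" by (elim exE)
  show ?thesis
  proof (intro exI[of _ "\<chi> \<alpha>. 1 / (16 * pi * m) * L \<alpha>"] allI impI)
    fix D \<alpha> assume "admissible_sequence c \<delta> (g c) D"
    from L[THEN spec, unfolded Q_def, THEN spec, THEN mp, OF this] show "(\<lambda>k. 1 / (16 * pi * m) * center_flux (g c) (coord_region c (D k)) (coord_boundary c (D k)) \<alpha>)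
        \<longlonglongrightarrow> (\<chi> \<alpha>. 1 / (16 * pi * m) * L \<alpha>) $ \<alpha>"
      unfolding vec_lambda_beta by (rule tendsto_mult_left)
  qed
qed

end
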